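(* There exists $\alpha_0<2/3$ such that for all $\alpha>0$ with $\alpha>\alpha_0$ the system of eigenfunctions of the operator $\mathscr{L}_{i,\alpha}=-d^2/dx^2+ix^\alpha$ is complete in $L_2(\mathbb{R}_+)$.
   Context: For $\alpha>0$ and $c\in\mathbb{C}\setminus\{0\}$ with $|\arg c|<\pi$, $\mathscr{L}_{c,\alpha}$ is the operator in $L_2(\mathbb{R}_+)$ with Dirichlet boundary condition, acting as $l_{c,\alpha}(y)=-y''+cx^\alpha y$ on the domain $$\{y\in L_2(\mathbb{R}_+)\ :\ y\in W^2_{2,\mathrm{loc}}(\mathbb{R}_+),\ l_{c,\alpha}(y)\in L_2(\mathbb{R}_+),\ y(0)=0\}.$$ It is known that this operator has compact inverse, discrete spectrum, and one-dimensional root subspaces. Here $c=i$ (the imaginary unit). Completeness of the system of eigenfunctions means that its linear span is dense in $L_2(\mathbb{R}_+)$. *)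

theory Defs
  imports "HOL-Analysis.Analysis"
begin

section \<open>The space L2 over the half-line\<close>

text \<open>Elements of \<open>L\<^sub>2\<close> are represented by functions, not by classes modulo almost everywhere
  equality; hence \<open>L2_norm\<close> is a seminorm, and equality in \<open>L\<^sub>2\<close> is equality
  almost everywhere. Values at negative arguments play no role.\<close>

abbreviation half_line :: "real measure" where
  "half_line \<equiv> lebesgue_on {0..}"

definition L2 :: "real measure \<Rightarrow> (real \<Rightarrow> complex) set" where
  "L2 M = {f. f \<in> borel_measurable M \<and> integrable M (\<lambda>x. (norm (f x))\<^sup>2)}"

definition L2_norm :: "real measure \<Rightarrow> (real \<Rightarrow> complex) \<Rightarrow> real" where
  "L2_norm M f = sqrt (\<integral>x. (norm (f x))\<^sup>2 \<partial>M)"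

definition complex_span :: "(real \<Rightarrow> complex) set \<Rightarrow> (real \<Rightarrow> complex) set" where
  "complex_span E = {\<lambda>x. \<Sum>g\<in>F. a g * g x | F a. finite F \<and> F \<subseteq> E}"

definition complete_system_in_L2 :: "real measure \<Rightarrow> (real \<Rightarrow> complex) set \<Rightarrow> bool" where
  "complete_system_in_L2 M E \<longleftrightarrow>
     E \<subseteq> L2 M \<and>
     (\<forall>f\<in>L2 M. \<forall>\<epsilon>>0. \<exists>g\<in>complex_span E. L2_norm M (\<lambda>x. f x - g x) < \<epsilon>)"

section \<open>The local Sobolev space\<close>

definition absolutely_continuous_between ::
    "real \<Rightarrow> real \<Rightarrow> (real \<Rightarrow> complex) \<Rightarrow> bool" where
  "absolutely_continuous_between r s f \<longleftrightarrow>
     (\<forall>\<epsilon>>0. \<exists>\<delta>>0. \<forall>(n::nat) a b.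
        (\<forall>i<n. r \<le> a i \<and> a i \<le> b i \<and> b i \<le> s) \<longrightarrow>
        (\<forall>i<n. \<forall>j<n. i \<noteq> j \<longrightarrow> {a i<..<b i} \<inter> {a j<..<b j} = {}) \<longrightarrow>
        (\<Sum>i<n. b i - a i) < \<delta> \<longrightarrow>
        (\<Sum>i<n. norm (f (b i) - f (a i))) < \<epsilon>)"

text \<open>The derivative is one-sided at \<open>0\<close>.\<close>

definition D :: "(real \<Rightarrow> complex) \<Rightarrow> real \<Rightarrow> complex" where
  "D y x = vector_derivative y (at x within {0..})"

text \<open>In one dimension, \<open>W\<^sup>2\<^sub>2\<close> on a bounded interval consists of the functions \<open>y\<close> (taken in
  their continuously differentiable representative) for which \<open>y'\<close> is absolutely continuous and
  \<open>y''\<close>, which then exists almost everywhere and is the weak second derivative, is square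
  integrable. Local means on every \<open>[0, R]\<close>, so that \<open>y(0)\<close> is meaningful.\<close>

definition W22_loc :: "(real \<Rightarrow> complex) set" where
  "W22_loc = {y.
     (\<forall>x\<ge>0. y differentiable (at x within {0..})) \<and>
     (\<forall>R>0. absolutely_continuous_between 0 R (D y) \<and> D (D y) \<in> L2 (lebesgue_on {0..R}))}"

section \<open>The operator\<close>

text \<open>For \<open>y \<in> W22_loc\<close> the function \<open>diff_expr c \<alpha> y\<close> is meaningful only up to null sets, since
  \<open>D (D y)\<close> is arbitrary at the points where the second derivative does not exist.\<close>

definition diff_expr :: "complex \<Rightarrow> real \<Rightarrow> (real \<Rightarrow> complex) \<Rightarrow> real \<Rightarrow> complex" where
  "diff_expr c \<alpha> y x = - D (D y) x + c * complex_of_real (x powr \<alpha>) * y x"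

definition op_domain :: "complex \<Rightarrow> real \<Rightarrow> (real \<Rightarrow> complex) set" where
  "op_domain c \<alpha> =
     {y \<in> L2 half_line. y \<in> W22_loc \<and> diff_expr c \<alpha> y \<in> L2 half_line \<and> y 0 = 0}"

definition eigenfunctions :: "complex \<Rightarrow> real \<Rightarrow> (real \<Rightarrow> complex) set" where
  "eigenfunctions c \<alpha> =
     {y \<in> op_domain c \<alpha>.
        \<not> (AE x in half_line. y x = 0) \<and>
        (\<exists>\<mu>::complex. AE x in half_line. diff_expr c \<alpha> y x = \<mu> * y x)}"

end

theory Submission
  imports
    Defs
    "HOL-Complex_Analysis.Complex_Analysis"
    "HOL-Computational_Algebra.Fundamental_Theorem_Algebra"
begin

text \<open>Let \<open>f\<close> annihilate all eigenfunctions, and let \<open>u(\<sqdot>, \<mu>)\<close> be the solution of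
  \<open>-u'' + i x\<^sup>\<alpha> u = \<mu> u\<close> that decays at infinity, normalized by \<open>u(0, \<mu>) = 1\<close>. It is meromorphic in
  \<open>\<mu>\<close> with simple poles at the eigenvalues and eigenfunctions as residues, so \<open>\<integral> f u(\<sqdot>, \<mu>)\<close> is entire.
  Its order is at most \<open>1/2 + 1/\<alpha>\<close>, and it is bounded on the rays outside the numerical range, the first quadrant.
  For \<open>\<alpha> > 2/3\<close> the order is less than 2, and the Phragmen-Lindeloef principle in the quadrant makes it
  vanish. For \<open>\<alpha>\<close> slightly below \<open>2/3\<close> one needs a slightly smaller sector: although the resolvent is
  exponentially large inside the quadrant, \<open>u(\<sqdot>, \<mu>)\<close> is still polynomially bounded on the ray
  through \<open>1/256 + i\<close>.

  The solutions \<open>u(\<sqdot>, \<mu>)\<close> in turn are complete: with \<open>S\<close> the solution vanishing at \<open>0\<close> and \<open>G\<close> the Green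
  function, the Cauchy kernel equals \<open>S(x) u(t) - G(x, t)\<close>. If \<open>f\<close> annihilates \<open>u\<close>, its integral against the
  Cauchy kernel, which is entire of order \<open>1/2\<close> in \<open>\<mu>\<close>, is as small as \<open>G\<close> outside the quadrant, hence
  zero; the Cauchy kernel being of Volterra type, \<open>f = 0\<close>.\<close>

text \<open>Every estimate rests on one identity instead of asymptotic expansions: for a constant
  multiplier \<omega>, the flux Re(cnj \<omega> v' cnj v) of a solution of v'' = q v has derivative
  Re \<omega> |v'|^2 + Re(cnj \<omega> q) |v|^2. Where both coefficients are nonnegative the flux
  increases, and a suitable \<omega> for each region yields existence, uniqueness, decay and size of
  solutions. Turning the half-line by half the angle of the eigenvalue ray makes the potential real,
  so the slope of u at 0 is bounded by a polynomial over the distance to the line of that ray; this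
  bound gives the simple poles and controls growth across the ray. At \<alpha> = 2/3 the order times
  the opening of the quadrant is exactly pi, so any gain in angle moves the threshold. The gain here
  is half the angle between the inner ray and the imaginary axis. Points of the inner ray lie in the
  numerical range, so no single multiplier serves the whole half-line; several are joined near the
  turning point. All pairings are bilinear, without conjugation, which keeps them holomorphic in
  \<mu>.\<close>

section \<open>Holomorphy of pointwise limits and of parameter integrals\<close>

text \<open>By Montel a subsequence converges to a holomorphic function, and pointwise convergence
  identifies that function with \<open>g\<close>. A uniform bound thus replaces any proof of locally
  uniform convergence.\<close>

lemma holomorphic_pointwise_limit:
  fixes f :: "nat \<Rightarrow> complex \<Rightarrow> complex"
  assumes U: "open U" and hol: "\<And>n. f n holomorphic_on U"
    and bnd: "\<And>n z. z \<in> U \<Longrightarrow> norm (f n z) \<le> B"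
    and lim: "\<And>z. z \<in> U \<Longrightarrow> (\<lambda>n. f n z) \<longlonglongrightarrow> g z"
  shows "g holomorphic_on U"
proof -
  obtain h r where h: "h holomorphic_on U" "strict_mono (r :: nat \<Rightarrow> nat)"
    and hl: "\<And>x. x \<in> U \<Longrightarrow> (\<lambda>n. f (r n) x) \<longlonglongrightarrow> h x"
  proof (rule Montel[of U "range f" f])
    show "\<exists>B. \<forall>h\<in>range f. \<forall>z\<in>K. cmod (h z) \<le> B" if "compact K" "K \<subseteq> U" for K
      using bnd that by blast
  qed (use U hol in auto)
  have "h z = g z" if "z \<in> U" for z
    using LIMSEQ_unique[OF hl[OF that]] LIMSEQ_subseq_LIMSEQ[OF lim[OF that] h(2)]
    by (auto simp: o_def)
  then show ?thesis using h(1) holomorphic_transform by blast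
qed

text \<open>The Cauchy estimate on discs of radius r/2 bounds the derivative of \<open>K t\<close>
  near w by 2 g(t)/r, so the difference quotients have an integrable majorant and dominated
  convergence produces the complex derivative.\<close>

lemma holomorphic_on_integral:
  fixes K :: "'a \<Rightarrow> complex \<Rightarrow> complex"
  assumes U: "open U"
    and meas: "\<And>z. z \<in> U \<Longrightarrow> (\<lambda>t. K t z) \<in> borel_measurable M"
    and hol: "\<And>t. t \<in> space M \<Longrightarrow> K t holomorphic_on U"
    and g: "integrable M g"
    and bnd: "\<And>t z. t \<in> space M \<Longrightarrow> z \<in> U \<Longrightarrow> norm (K t z) \<le> g t"
  shows "(\<lambda>z. \<integral>t. K t z \<partial>M) holomorphic_on U"
proof -
  have "\<exists>D. ((\<lambda>z. \<integral>t. K t z \<partial>M) has_field_derivative D) (at w)" if w: "w \<in> U" for w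
  proof -
    obtain r where r: "r > 0" "cball w r \<subseteq> U" using U w open_contains_cball by blast
    define Q where "Q z t = (K t z - K t w) / (z - w)" for z t
    have lip: "norm (K t z - K t w) \<le> (2 * g t / r) * norm (z - w)"
      if t: "t \<in> space M" and z: "z \<in> cball w (r/2)" for t z
    proof (rule field_differentiable_bound[of "cball w (r/2)"])
      show "convex (cball w (r/2))" by simp
      fix x assume x: "x \<in> cball w (r/2)"
      have xU: "cball x (r/2) \<subseteq> U"
      proof -
        have "dist w x \<le> r/2" using x by (simp add: dist_commute)
        then have "cball x (r/2) \<subseteq> cball w r"
          by (smt (verit) dist_triangle field_sum_of_halves mem_cball subsetI)
        then show ?thesis using r by blast
      qed
      then have "x \<in> U" using r(1) by auto
      then show "(K t has_field_derivative deriv (K t) x) (at x within cball w (r/2))"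
        using hol[OF t] U holomorphic_derivI by blast
      have "norm ((deriv ^^ 1) (K t) x) \<le> (fact 1) * g t / (r/2) ^ 1"
      proof (rule Cauchy_inequality)
        show "K t holomorphic_on ball x (r/2)"
          using hol[OF t] xU ball_subset_cball holomorphic_on_subset by (metis subset_trans)
        show "continuous_on (cball x (r/2)) (K t)"
          using hol[OF t] xU holomorphic_on_imp_continuous_on continuous_on_subset by blast
        show "cmod (K t y) \<le> g t" if "cmod (x - y) = r / 2" for y
          using bnd[OF t] xU that by (auto simp: dist_norm)
      qed (use r in auto)
      then show "cmod (deriv (K t) x) \<le> 2 * g t / r" by (simp add: field_simps)
    qed (use z r in auto)
    have "((\<lambda>z. \<integral>t. Q z t \<partial>M) \<longlongrightarrow> (\<integral>t. deriv (K t) w \<partial>M)) (at w)"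
    proof (subst tendsto_at_iff_sequentially, intro allI impI)
      fix X :: "nat \<Rightarrow> complex" assume X: "\<forall>i. X i \<in> UNIV - {w}" "X \<longlonglongrightarrow> w"
      have ev: "\<forall>\<^sub>F n in sequentially. X n \<in> ball w (r/2)"
        by (rule topological_tendstoD[OF X(2)]) (use r in auto)
      then obtain N where N: "\<And>n. n \<ge> N \<Longrightarrow> X n \<in> ball w (r/2)"
        by (auto simp: eventually_sequentially)
      \<comment> \<open>The shift by \<open>N\<close> drops the finitely many terms outside the disc
        on which the Lipschitz bound holds.\<close>
      have "(\<lambda>n. \<integral>t. Q (X (n + N)) t \<partial>M) \<longlonglongrightarrow> (\<integral>t. deriv (K t) w \<partial>M)"
      proof (rule integral_dominated_convergence[where w = "\<lambda>t. 2 * g t / r"])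
        have lm: "(\<lambda>n. Q (X (n + N)) t) \<longlonglongrightarrow> deriv (K t) w" if t: "t \<in> space M" for t
        proof -
          have "(K t has_field_derivative deriv (K t) w) (at w)"
            using hol[OF t] U w holomorphic_derivI by blast
          then have "((\<lambda>z. Q z t) \<longlongrightarrow> deriv (K t) w) (at w)"
            by (simp add: has_field_derivative_iff Q_def)
          then have "((\<lambda>z. Q z t) \<circ> X) \<longlonglongrightarrow> deriv (K t) w"
            using X by (subst (asm) tendsto_at_iff_sequentially) auto
          then show ?thesis by (auto simp: o_def intro: LIMSEQ_ignore_initial_segment)
        qed
        have ms: "Q (X (n + N)) \<in> borel_measurable M" for n
        proof -
          have "X (n+N) \<in> cball w r" using N[of "n+N"] r by (auto simp: dist_norm)
          then have "X (n+N) \<in> U" using r by blast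
          then show ?thesis unfolding Q_def using meas w by (intro borel_measurable_divide borel_measurable_diff) auto
        qed
        show "Q (X (n + N)) \<in> borel_measurable M" for n by (rule ms)
        show "(\<lambda>t. deriv (K t) w) \<in> borel_measurable M"
          by (rule borel_measurable_LIMSEQ_metric[OF ms lm])
        show "AE t in M. (\<lambda>n. Q (X (n + N)) t) \<longlonglongrightarrow> deriv (K t) w"
          using lm by (intro AE_I2)
        show "integrable M (\<lambda>t. 2 * g t / r)" using g by simp
        show "AE t in M. norm (Q (X (n + N)) t) \<le> 2 * g t / r" for n
        proof (intro AE_I2)
          fix t assume t: "t \<in> space M"
          have nz: "norm (X (n+N) - w) > 0" using X(1) by simp
          have "norm (K t (X (n+N)) - K t w) \<le> (2 * g t / r) * norm (X (n+N) - w)"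
            using lip[OF t] N[of "n+N"] by (simp add: less_imp_le)
          then show "norm (Q (X (n + N)) t) \<le> 2 * g t / r"
            unfolding Q_def norm_divide using nz by (simp add: pos_divide_le_eq)
        qed
      qed
      then show "((\<lambda>z. \<integral>t. Q z t \<partial>M) \<circ> X) \<longlonglongrightarrow> (\<integral>t. deriv (K t) w \<partial>M)"
        by (simp add: o_def LIMSEQ_offset)
    qed
    moreover have "\<forall>\<^sub>F z in at w. (\<integral>t. Q z t \<partial>M) = ((\<integral>t. K t z \<partial>M) - (\<integral>t. K t w \<partial>M)) / (z - w)"
    proof -
      have int: "integrable M (\<lambda>t. K t z)" if "z \<in> U" for z
        by (rule Bochner_Integration.integrable_bound[OF g meas[OF that]])
           (use bnd[OF _ that] in \<open>auto intro!: AE_I2 order_trans[OF _ abs_ge_self]\<close>)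
      have "\<forall>\<^sub>F z in at w. z \<in> U" using U w eventually_at_in_open' by blast
      then show ?thesis
        by eventually_elim (simp add: Q_def int w Bochner_Integration.integral_diff)
    qed
    ultimately have "((\<lambda>z. ((\<integral>t. K t z \<partial>M) - (\<integral>t. K t w \<partial>M)) / (z - w)) \<longlongrightarrow> (\<integral>t. deriv (K t) w \<partial>M)) (at w)"
      using tendsto_cong by force
    then show ?thesis by (auto simp: has_field_derivative_iff)
  qed
  then show ?thesis using U by (auto simp: holomorphic_on_open field_differentiable_def)
qed

section \<open>Phragmen-Lindelof in a sector and growth across the real line\<close>

lemma exp_minus_exp_bound:
  fixes C p \<epsilon> q :: real
  assumes "p < q" "\<epsilon> > 0"
  shows "\<exists>L0. \<forall>L\<ge>L0. C * exp (p * L) - \<epsilon> * exp (q * L) \<le> 0"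
proof -
  have "filterlim (\<lambda>L. exp ((q - p) * L)) at_top at_top"
    using assms by (intro filterlim_compose[OF exp_at_top] filterlim_tendsto_pos_mult_at_top[OF tendsto_const] filterlim_ident) auto
  then have "\<forall>\<^sub>F L in at_top. exp ((q - p) * L) \<ge> C / \<epsilon>"
    by (simp add: filterlim_at_top)
  then obtain L0 where "\<And>L. L \<ge> L0 \<Longrightarrow> exp ((q - p) * L) \<ge> C / \<epsilon>"
    by (auto simp: eventually_at_top_linorder)
  then have "C * exp (p * L) \<le> \<epsilon> * exp (q * L)" if "L \<ge> L0" for L
  proof -
    have "C \<le> \<epsilon> * exp ((q - p) * L)" using \<open>\<And>L. L \<ge> L0 \<Longrightarrow> _\<close>[OF that] assms by (simp add: field_simps)
    then have "C * exp (p * L) \<le> \<epsilon> * exp ((q - p) * L) * exp (p * L)" by simp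
    also have "\<dots> = \<epsilon> * exp (q * L)" by (simp add: mult_exp_exp algebra_simps)
    finally show ?thesis .
  qed
  then show ?thesis by (intro exI[of _ L0]) auto
qed

text \<open>In the logarithmic variable, z = e exp w, the sector becomes the half strip |Im w| \<le>
  \<psi>, Re w \<ge> 0. The factor exp(-\<epsilon> exp(q w)) damps the growth, exp(-n w) absorbs the
  power r^n, the maximum modulus principle runs on a long rectangle, and finally \<epsilon> tends to
  0.\<close>

lemma phragmen_lindelof_sector:
  fixes G :: "complex \<Rightarrow> complex" and e :: complex
  assumes hol: "G holomorphic_on UNIV" and e: "norm e = 1"
    and \<psi>: "0 < \<psi>" "\<psi> < pi / 2" and p: "0 < p" "p * \<psi> < pi / 2" and C: "C \<ge> 0"
    and gr: "\<And>z. norm z \<ge> 1 \<Longrightarrow> norm (G z) \<le> K * exp (C * norm z powr p)"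
    and up: "\<And>r. r \<ge> 1 \<Longrightarrow> norm (G (of_real r * (e * cis \<psi>))) \<le> B * r ^ n"
    and lo: "\<And>r. r \<ge> 1 \<Longrightarrow> norm (G (of_real r * (e * cis (-\<psi>)))) \<le> B * r ^ n"
  obtains B' where "\<And>r \<theta>. r \<ge> 1 \<Longrightarrow> \<bar>\<theta>\<bar> \<le> \<psi> \<Longrightarrow> norm (G (of_real r * (e * cis \<theta>))) \<le> B' * r ^ n"
proof -
  \<comment> \<open>Midpoint between p and the critical exponent pi/(2 \<psi>): q > p lets the
    damping win, and q \<psi> < pi/2 keeps the real part of exp(q w) positive in the strip.\<close>
  define q where "q = (p + pi / (2 * \<psi>)) / 2"
  have pq: "p < pi / (2 * \<psi>)" using p \<psi> by (simp add: field_simps)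
  have q: "p < q" "q * \<psi> < pi / 2"
  proof -
    show "p < q" using pq by (simp add: q_def)
    have "q < pi / (2 * \<psi>)" using pq by (simp add: q_def)
    then show "q * \<psi> < pi / 2" using \<psi> by (simp add: field_simps)
  qed
  define \<kappa> where "\<kappa> = cos (q * \<psi>)"
  have q0: "0 \<le> q * \<psi>" using q p \<psi> by simp
  have \<kappa>: "\<kappa> > 0" unfolding \<kappa>_def using q q0 pi_gt_zero by (intro cos_gt_zero_pi) linarith+
  define B' where "B' = max B (max K (K * exp C))"
  have bound: "norm (G (e * exp w)) \<le> B' * exp (real n * Re w) * exp (\<epsilon> * exp (q * Re w))"
    if w: "Re w \<ge> 0" "\<bar>Im w\<bar> \<le> \<psi>" and \<epsilon>: "\<epsilon> > 0" for w \<epsilon>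
  proof -
    obtain L0 where L0: "\<And>L. L \<ge> L0 \<Longrightarrow> C * exp (p * L) - (\<epsilon> * \<kappa>) * exp (q * L) \<le> 0"
      using exp_minus_exp_bound[OF q(1), of "\<epsilon> * \<kappa>" C] \<epsilon> \<kappa> by auto
    \<comment> \<open>Far enough to the right that on the edge Re z = L the damping dominates exp(C
      exp(p L)), and beyond w.\<close>
    define L where "L = max L0 (Re w + 1)"
    define S where "S = cbox (Complex 0 (-\<psi>)) (Complex L \<psi>)"
    define H where "H z = G (e * exp z) * exp (- of_real \<epsilon> * exp (of_real q * z)) * exp (- of_nat n * z)" for z
    have nH: "norm (H z) = norm (G (e * exp z)) * exp (- \<epsilon> * (exp (q * Re z) * cos (q * Im z))) * exp (- (real n * Re z))" for z
      by (simp add: H_def norm_mult Re_exp)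
    have cosb: "cos (q * y) \<ge> \<kappa>" if "\<bar>y\<bar> \<le> \<psi>" for y
    proof -
      have "cos (q * y) = cos (q * \<bar>y\<bar>)" by (cases "y \<ge> 0") (auto simp: abs_if)
      also have "\<dots> \<ge> \<kappa>" unfolding \<kappa>_def
      proof (rule cos_monotone_0_pi_le)
        show "0 \<le> q * \<bar>y\<bar>" using q p by simp
        show "q * \<bar>y\<bar> \<le> q * \<psi>" using that q p by (intro mult_left_mono) auto
        show "q * \<psi> \<le> pi" using q pi_gt_zero by linarith
      qed
      finally show ?thesis .
    qed
    have nG: "norm (G (e * exp z)) \<le> K * exp (C * exp (p * Re z))" if "Re z \<ge> 0" for z
      using gr[of "e * exp z"] that e by (simp add: norm_mult powr_def mult.commute)
    have K0: "K \<ge> 0"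
    proof -
      have "0 \<le> K * exp (C * norm (1::complex) powr p)" using gr[of 1] order_trans[OF norm_ge_zero] by simp
      then show ?thesis by (simp add: zero_le_mult_iff)
    qed
    have B0: "B' \<ge> 0" using K0 by (simp add: B'_def)
    have holH: "H holomorphic_on UNIV"
    proof -
      have "(\<lambda>z. e * exp z) holomorphic_on UNIV" by (intro holomorphic_intros)
      then have "G \<circ> (\<lambda>z. e * exp z) holomorphic_on UNIV"
        using hol by (rule holomorphic_on_compose_gen) auto
      then have "(\<lambda>z. G (e * exp z)) holomorphic_on UNIV" by (simp add: o_def)
      then show ?thesis unfolding H_def by (intro holomorphic_intros)
    qed
    have "norm (H w) \<le> B'"
    proof (rule maximum_modulus_frontier[of H S])
      show "H holomorphic_on interior S" using holH holomorphic_on_subset by blast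
      show "continuous_on (closure S) H" using holH holomorphic_on_imp_continuous_on continuous_on_subset by blast
      show "bounded S" by (simp add: S_def)
      show "w \<in> S" using w by (auto simp: S_def in_cbox_complex_iff L_def)
      fix z assume "z \<in> frontier S"
      then have z: "Re z \<ge> 0" "Re z \<le> L" "\<bar>Im z\<bar> \<le> \<psi>" and zz: "Re z = 0 \<or> Re z = L \<or> Im z = \<psi> \<or> Im z = -\<psi>"
        by (auto simp: S_def frontier_def in_cbox_complex_iff in_box_complex_iff)
      have small: "exp (- \<epsilon> * (exp (q * Re z) * cos (q * Im z))) \<le> exp (- (\<epsilon> * \<kappa>) * exp (q * Re z))"
      proof -
        have "\<kappa> * exp (q * Re z) \<le> cos (q * Im z) * exp (q * Re z)" using cosb[OF z(3)] by simp
        then show ?thesis using \<epsilon> by (simp add: mult.commute mult.left_commute)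
      qed
      have small1: "exp (- \<epsilon> * (exp (q * Re z) * cos (q * Im z))) \<le> 1"
      proof -
        have "0 \<le> (\<epsilon> * \<kappa>) * exp (q * Re z)" using \<epsilon> \<kappa> by simp
        then have "exp (- (\<epsilon> * \<kappa>) * exp (q * Re z)) \<le> 1" by simp
        then show ?thesis using small by linarith
      qed
      consider "Re z = 0" | "Re z = L" | "Im z = \<psi> \<or> Im z = -\<psi>" using zz by blast
      then show "norm (H z) \<le> B'"
      proof cases
        case 1
        have "norm (H z) \<le> norm (G (e * exp z)) * 1 * 1"
          unfolding nH using small1 1 by (intro mult_mono) auto
        also have "\<dots> \<le> K * exp C" using nG[of z] 1 by simp
        finally show ?thesis by (simp add: B'_def)
      next
        case 2
        have "norm (H z) \<le> (K * exp (C * exp (p * L))) * exp (- (\<epsilon> * \<kappa>) * exp (q * L)) * 1"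
          unfolding nH using small nG[of z] z 2 K0 by (intro mult_mono) auto
        also have "\<dots> = K * exp (C * exp (p * L) - (\<epsilon> * \<kappa>) * exp (q * L))"
          by (simp add: mult_exp_exp)
        also have "\<dots> \<le> K * 1" using L0[of L] K0 by (intro mult_left_mono) (auto simp: L_def)
        finally show ?thesis by (simp add: B'_def)
      next
        case 3
        have ez: "exp z = of_real (exp (Re z)) * cis (Im z)" by (simp add: exp_eq_polar)
        have "norm (G (e * exp z)) \<le> B * exp (Re z) ^ n"
          using 3 up[of "exp (Re z)"] lo[of "exp (Re z)"] z by (auto simp: ez mult.left_commute)
        then have "norm (H z) \<le> (B * exp (Re z) ^ n) * 1 * exp (- (real n * Re z))"
          unfolding nH using small1 by (intro mult_mono) (auto intro: order_trans[OF norm_ge_zero])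
        also have "\<dots> = B" by (simp add: exp_of_nat_mult[symmetric] mult_exp_exp)
        finally show ?thesis by (simp add: B'_def)
      qed
    qed
    then have "norm (G (e * exp w)) * exp (- (real n * Re w)) * exp (- \<epsilon> * (exp (q * Re w) * cos (q * Im w))) \<le> B'"
      unfolding nH by (simp only: mult_ac)
    then have "norm (G (e * exp w)) \<le> B' * exp (real n * Re w) * exp (\<epsilon> * (exp (q * Re w) * cos (q * Im w)))"
      by (simp add: exp_minus field_simps)
    also have "\<dots> \<le> B' * exp (real n * Re w) * exp (\<epsilon> * exp (q * Re w))"
      using B0 \<epsilon> by (intro mult_left_mono) (auto simp: mult_le_cancel_left1)
    finally show ?thesis .
  qed
  have "norm (G (of_real r * (e * cis \<theta>))) \<le> B' * r ^ n" if r: "r \<ge> 1" and \<theta>: "\<bar>\<theta>\<bar> \<le> \<psi>" for r \<theta>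
  proof -
    define w where "w = Complex (ln r) \<theta>"
    have ew: "exp w = of_real r * cis \<theta>" using r by (simp add: w_def exp_eq_polar)
    have lim: "((\<lambda>\<epsilon>. B' * exp (real n * Re w) * exp (\<epsilon> * exp (q * Re w))) \<longlongrightarrow> B' * exp (real n * Re w) * exp (0 * exp (q * Re w))) (at_right 0)"
      by (intro tendsto_intros)
    have ev: "\<forall>\<^sub>F \<epsilon> in at_right 0. norm (G (e * exp w)) \<le> B' * exp (real n * Re w) * exp (\<epsilon> * exp (q * Re w))"
    proof -
      have "Re w \<ge> 0" "\<bar>Im w\<bar> \<le> \<psi>" using r \<theta> by (auto simp: w_def)
      then show ?thesis using bound[of w] by (intro eventually_at_rightI[of 0 1]) auto
    qed
    have "norm (G (e * exp w)) \<le> B' * exp (real n * Re w) * exp (0 * exp (q * Re w))"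
      by (rule tendsto_lowerbound[OF lim ev]) simp
    moreover have e1: "of_real r * (e * cis \<theta>) = e * exp w" unfolding ew by (simp only: mult_ac)
    moreover have "exp (real n * Re w) = r ^ n" using r by (simp add: w_def exp_of_nat_mult)
    ultimately show ?thesis unfolding e1 by simp
  qed
  then show thesis by (rule that)
qed

text \<open>For w on the unit circle about a real x, |(w - x)^2 - 1| = 2 |Im w|, so multiplication
  by this polynomial cancels the singular factor 1/|Im w|. At a point z with Re z = x its modulus is
  1 + (Im z)^2 \<ge> 1, and the maximum principle gives the bound at z.\<close>

lemma entire_growth_across_real_line:
  fixes G :: "complex \<Rightarrow> complex"
  assumes hol: "G holomorphic_on UNIV" and p: "p > 0" and C: "C \<ge> 0" and K: "K \<ge> 0"
    and gr: "\<And>z. norm z \<ge> 1 \<Longrightarrow> Im z \<noteq> 0 \<Longrightarrow> norm (G z) \<le> K * exp (C * norm z powr p) * (1 + 1 / \<bar>Im z\<bar>)"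
  obtains K' C' where "K' \<ge> 0" "C' \<ge> 0" "\<And>z. norm z \<ge> 1 \<Longrightarrow> norm (G z) \<le> K' * exp (C' * norm z powr p)"
proof -
  obtain K1 where K1: "\<And>z. norm z \<le> 3 \<Longrightarrow> norm (G z) \<le> K1"
  proof -
    have "compact (G ` cball 0 3)"
      by (intro compact_continuous_image) (use hol holomorphic_on_imp_continuous_on continuous_on_subset in blast, simp)
    then obtain b where b: "\<forall>y\<in>G ` cball 0 3. norm y \<le> b" using compact_imp_bounded bounded_iff by metis
    show ?thesis
    proof (rule that)
      fix z :: complex assume "norm z \<le> 3"
      then have "G z \<in> G ` cball 0 3" by simp
      then show "norm (G z) \<le> b" using b by blast
    qed
  qed
  have K10: "K1 \<ge> 0" using K1[of 0] order_trans[OF norm_ge_zero] by auto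
  \<comment> \<open>Points of the comparison circle have modulus at most 2 |z|, whence the factor 2
    powr p.\<close>
  define C' where "C' = C * 2 powr p"
  have C': "C' \<ge> 0" "C \<le> C'" using C p by (auto simp: C'_def mult_le_cancel_left1 ge_one_powr_ge_zero)
  have main: "norm (G z) \<le> (4 * K + K1) * exp (C' * norm z powr p)" if z1: "norm z \<ge> 1" for z
  proof -
    have e1: "1 \<le> exp (C' * norm z powr p)" using C' by auto
    consider "norm z \<le> 3" | "norm z > 3" "\<bar>Im z\<bar> \<ge> 1/2" | "norm z > 3" "\<bar>Im z\<bar> < 1/2" by linarith
    then show ?thesis
    proof cases
      case 1
      have "K1 * 1 \<le> (4 * K + K1) * exp (C' * norm z powr p)" using e1 K K10 by (intro mult_mono) auto
      then show ?thesis using K1[OF 1] by simp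
    next
      case 2
      then have "1 / \<bar>Im z\<bar> \<le> 2" by (simp add: field_simps)
      have "norm (G z) \<le> K * exp (C * norm z powr p) * (1 + 1 / \<bar>Im z\<bar>)" using gr[OF z1] 2 by auto
      also have "\<dots> \<le> K * exp (C' * norm z powr p) * 4"
        using \<open>1 / \<bar>Im z\<bar> \<le> 2\<close> K C' by (intro mult_mono) (auto intro!: mult_right_mono)
      also have "\<dots> \<le> (4 * K + K1) * exp (C' * norm z powr p)" using K10 by (simp add: algebra_simps)
      finally show ?thesis .
    next
      case 3
      define x where "x = Re z"
      have "norm z \<le> \<bar>x\<bar> + \<bar>Im z\<bar>" unfolding x_def by (rule cmod_le)
      then have x2: "\<bar>x\<bar> > 2" using 3 by linarith
      have xz: "\<bar>x\<bar> \<le> norm z" unfolding x_def by (rule abs_Re_le_cmod)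
      define H where "H w = G w * ((w - of_real x)^2 - 1)" for w
      have zx: "z - of_real x = \<i> * of_real (Im z)" by (simp add: complex_eq_iff x_def)
      have "norm (H z) \<le> 4 * K * exp (C' * norm z powr p)"
      proof (rule maximum_modulus_frontier[of H "cball (of_real x) 1"])
        have holH: "H holomorphic_on UNIV" unfolding H_def using hol by (intro holomorphic_intros)
        show "H holomorphic_on interior (cball (of_real x) 1)" using holH holomorphic_on_subset by blast
        show "continuous_on (closure (cball (of_real x) 1)) H"
          using holH holomorphic_on_imp_continuous_on continuous_on_subset by blast
        show "z \<in> cball (of_real x) 1" using 3 by (simp add: dist_commute dist_norm zx norm_mult)
        fix w assume "w \<in> frontier (cball (complex_of_real x) 1)"
        then have w: "norm (w - of_real x) = 1" by (simp add: dist_norm norm_minus_commute)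
        define \<eta> where "\<eta> = w - of_real x"
        have \<eta>: "norm \<eta> = 1" "w = of_real x + \<eta>" using w by (auto simp: \<eta>_def)
        have imw: "Im w = Im \<eta>" by (simp add: \<eta>(2))
        have "\<eta> * cnj \<eta> = 1" using complex_norm_square[of \<eta>] \<eta> by simp
        then have "\<eta>^2 - 1 = \<eta> * (\<eta> - cnj \<eta>)" by (simp add: power2_eq_square algebra_simps)
        then have n2: "norm (\<eta>^2 - 1) = 2 * \<bar>Im \<eta>\<bar>" using \<eta> by (simp add: norm_mult complex_diff_cnj)
        have w1: "norm w \<ge> 1" using x2 \<eta> norm_triangle_ineq2[of "of_real x" "-\<eta>"] by simp
        have w2: "norm w \<le> 2 * norm z" using \<eta> norm_triangle_ineq[of "of_real x" \<eta>] xz 3 by simp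
        show "norm (H w) \<le> 4 * K * exp (C' * norm z powr p)"
        proof (cases "Im \<eta> = 0")
          case True
          then show ?thesis using n2 K by (simp add: H_def norm_mult \<eta>_def)
        next
          case False
          have "norm (H w) \<le> (K * exp (C * norm w powr p) * (1 + 1 / \<bar>Im \<eta>\<bar>)) * (2 * \<bar>Im \<eta>\<bar>)"
            unfolding H_def norm_mult using gr[OF w1] False n2 K by (intro mult_mono) (auto simp: imw \<eta>_def[symmetric])
          also have "\<dots> = (K * exp (C * norm w powr p)) * (2 * \<bar>Im \<eta>\<bar> + 2)" using False by (simp add: field_simps)
          also have "\<dots> \<le> (K * exp (C' * norm z powr p)) * 4"
          proof (intro mult_mono)
            have "norm w powr p \<le> (2 * norm z) powr p" using w2 p by (intro powr_mono2) auto
            then have "C * norm w powr p \<le> C' * norm z powr p"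
              using C by (simp add: C'_def powr_mult mult.assoc mult_left_mono)
            then show "exp (C * norm w powr p) \<le> exp (C' * norm z powr p)" by simp
            show "2 * \<bar>Im \<eta>\<bar> + 2 \<le> 4" using abs_Im_le_cmod[of \<eta>] \<eta> by simp
          qed (use K in auto)
          finally show ?thesis by simp
        qed
      qed auto
      moreover have "norm (H z) \<ge> norm (G z)"
      proof -
        have "(z - of_real x)^2 - 1 = - of_real ((Im z)^2 + 1)" by (simp add: zx power_mult_distrib)
        then have "norm ((z - of_real x)^2 - 1) = \<bar>(Im z)^2 + 1\<bar>"
          by (simp only: norm_minus_cancel norm_of_real)
        then show ?thesis unfolding H_def norm_mult by (simp add: mult_le_cancel_left1)
      qed
      ultimately have "norm (G z) \<le> 4 * K * exp (C' * norm z powr p)" by simp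
      also have "\<dots> \<le> (4 * K + K1) * exp (C' * norm z powr p)" using K10 by (simp add: algebra_simps)
      finally show ?thesis .
    qed
  qed
  show thesis by (rule that[OF _ C'(1) main]) (use K K10 in auto)
qed

section \<open>The equation v'' = q v as a first order system\<close>

text \<open>Carrying w = v' as a second function makes all identities first order; derivatives
  within the half-line include the end point 0.\<close>

definition is_sol :: "(real \<Rightarrow> complex) \<Rightarrow> (real \<Rightarrow> complex) \<Rightarrow> (real \<Rightarrow> complex) \<Rightarrow> bool" where
  "is_sol q v w \<longleftrightarrow> (\<forall>s\<ge>0. (v has_vector_derivative w s) (at s within {0..}) \<and>
     (w has_vector_derivative q s * v s) (at s within {0..}))"

lemma is_solD:
  assumes "is_sol q v w" "s \<ge> 0"
  shows "(v has_vector_derivative w s) (at s within {0..})"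
    "(w has_vector_derivative q s * v s) (at s within {0..})"
  using assms by (auto simp: is_sol_def)

lemma is_sol_continuous:
  assumes "is_sol q v w"
  shows "continuous_on {0..} v" "continuous_on {0..} w"
  by (auto simp: continuous_on_eq_continuous_within
      intro!: has_vector_derivative_continuous is_solD(1)[OF assms],
      auto intro!: has_vector_derivative_continuous is_solD(2)[OF assms])

lemma is_sol_lincomb:
  assumes "is_sol q v w" "is_sol q v' w'"
  shows "is_sol q (\<lambda>s. c * v s + d * v' s) (\<lambda>s. c * w s + d * w' s)"
  unfolding is_sol_def
proof (intro allI impI conjI)
  fix s :: real assume s: "s \<ge> 0"
  note d = is_solD[OF assms(1) s] is_solD[OF assms(2) s]
  show "((\<lambda>s. c * v s + d * v' s) has_vector_derivative c * w s + d * w' s) (at s within {0..})"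
    by (intro has_vector_derivative_add has_vector_derivative_mult_right d)
  have "((\<lambda>s. c * w s + d * w' s) has_vector_derivative c * (q s * v s) + d * (q s * v' s)) (at s within {0..})"
    by (intro has_vector_derivative_add has_vector_derivative_mult_right d)
  then show "((\<lambda>s. c * w s + d * w' s) has_vector_derivative q s * (c * v s + d * v' s)) (at s within {0..})"
    by (simp add: algebra_simps)
qed

lemma has_vector_derivative_affine_half_line:
  fixes v :: "real \<Rightarrow> complex"
  assumes "(v has_vector_derivative v') (at (x0 + z * s) within {0..})" "x0 \<ge> 0" "z \<ge> 0" "s \<ge> 0"
  shows "((\<lambda>s. v (x0 + z * s)) has_vector_derivative of_real z * v') (at s within {0..})"
proof -
  have "((\<lambda>s. x0 + z * s) has_vector_derivative z) (at s within {0..})"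
    by (auto intro!: derivative_eq_intros simp: has_real_derivative_iff_has_vector_derivative[symmetric])
  moreover have "(v has_vector_derivative v') (at (x0 + z * s) within (\<lambda>s. x0 + z * s) ` {0..})"
    using assms by (intro has_vector_derivative_within_subset[OF assms(1)]) auto
  ultimately have "((v \<circ> (\<lambda>s. x0 + z * s)) has_vector_derivative (z *\<^sub>R v')) (at s within {0..})"
    by (rule vector_diff_chain_within)
  then show ?thesis by (simp add: o_def scaleR_conv_of_real)
qed

lemma is_sol_affine:
  assumes "is_sol q v w" "x0 \<ge> 0" "z \<ge> (0::real)"
  shows "is_sol (\<lambda>s. of_real (z^2) * q (x0 + z * s)) (\<lambda>s. v (x0 + z * s)) (\<lambda>s. of_real z * w (x0 + z * s))"
  unfolding is_sol_def
proof (intro allI impI conjI)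
  fix s :: real assume s: "s \<ge> 0"
  then have p: "x0 + z * s \<ge> 0" using assms by simp
  note d = is_solD[OF assms(1) p]
  show "((\<lambda>s. v (x0 + z * s)) has_vector_derivative of_real z * w (x0 + z * s)) (at s within {0..})"
    by (rule has_vector_derivative_affine_half_line[OF d(1)]) (use assms s in auto)
  have "((\<lambda>s. of_real z * w (x0 + z * s)) has_vector_derivative of_real z * (of_real z * (q (x0 + z * s) * v (x0 + z * s)))) (at s within {0..})"
    by (intro has_vector_derivative_mult_right has_vector_derivative_affine_half_line[OF d(2)]) (use assms s in auto)
  then show "((\<lambda>s. of_real z * w (x0 + z * s)) has_vector_derivative of_real (z^2) * q (x0 + z * s) * v (x0 + z * s)) (at s within {0..})"
    by (simp add: power2_eq_square mult.assoc)
qed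

lemma is_sol_shift:
  assumes "is_sol q v w" "x0 \<ge> 0"
  shows "is_sol (\<lambda>s. q (x0 + s)) (\<lambda>s. v (x0 + s)) (\<lambda>s. w (x0 + s))"
  using is_sol_affine[OF assms, of 1] by simp

subsection \<open>Monotonicity and growth\<close>

lemma nondecreasing_on_half_line:
  fixes f :: "real \<Rightarrow> real"
  assumes d: "\<And>s. s \<ge> 0 \<Longrightarrow> (f has_real_derivative f' s) (at s within {0..})"
    and ab: "0 \<le> a" "a \<le> b" and nn: "\<And>s. a \<le> s \<Longrightarrow> s \<le> b \<Longrightarrow> f' s \<ge> 0"
  shows "f a \<le> f b"
proof (rule DERIV_nonneg_imp_increasing_open[OF ab(2)])
  fix x assume x: "a < x" "x < b"
  then have "at x within {0..} = at x" using ab by (intro at_within_interior) auto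
  then show "\<exists>y. DERIV f x :> y \<and> 0 \<le> y" using d[of x] nn[of x] x ab by (metis less_eq_real_def order_trans)
next
  have "continuous_on {0..} f" by (auto simp: continuous_on_eq_continuous_within intro!: DERIV_continuous d)
  then show "continuous_on {a..b} f" using ab continuous_on_subset by fastforce
qed

lemma Re_mult_cnj_has_derivative:
  fixes v w :: "real \<Rightarrow> complex"
  assumes "(v has_vector_derivative v') (at s within A)" "(w has_vector_derivative w') (at s within A)"
  shows "((\<lambda>s. Re (c * v s * cnj (w s))) has_real_derivative Re (c * v' * cnj (w s)) + Re (c * v s * cnj w')) (at s within A)"
proof -
  have "((\<lambda>s. c * v s * cnj (w s)) has_vector_derivative (c * v s * cnj w' + c * v' * cnj (w s))) (at s within A)"
    by (intro has_vector_derivative_mult has_vector_derivative_mult_right has_vector_derivative_cnj assms)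
  from bounded_linear.has_vector_derivative[OF bounded_linear_Re this]
  show ?thesis by (simp add: has_real_derivative_iff_has_vector_derivative add.commute)
qed

lemma Re_self_mult_cnj: "Re (z * cnj z) = (norm z)\<^sup>2"
  by (simp add: complex_norm_square[symmetric])

lemma norm_square_has_derivative:
  fixes v :: "real \<Rightarrow> complex"
  assumes "(v has_vector_derivative v') (at s within A)"
  shows "((\<lambda>s. (norm (v s))\<^sup>2) has_real_derivative 2 * Re (v' * cnj (v s))) (at s within A)"
proof -
  have "Re (v s * cnj v') = Re (v' * cnj (v s))" by simp
  then show ?thesis
    using Re_mult_cnj_has_derivative[OF assms assms, of 1] by (simp only: mult_1_left Re_self_mult_cnj mult_2)
qed

lemma two_mult_le_weighted: "2 * (a * b) \<le> (a\<^sup>2 + k\<^sup>2 * b\<^sup>2) / k" if "k > 0" for a b k :: real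
proof -
  have "0 \<le> (a - k * b)^2" by simp
  then have "2 * (a * b) * k \<le> a^2 + k^2 * b^2" by (simp add: power2_eq_square algebra_simps)
  then show ?thesis using that by (simp add: field_simps)
qed

text \<open>The energy E = |w|^2 + k^2 |v|^2 satisfies E' \<le> ((k^2 + Q)/k) E. The weight k is
  left free: for k^2 = Q the rate takes its least value 2k, and this square root of the potential is
  what later determines the order of growth in \<mu>.\<close>

lemma is_sol_growth:
  assumes sol: "is_sol q v w" and x: "0 \<le> x0" "x0 \<le> x" and k: "k > 0"
    and q: "\<And>s. x0 \<le> s \<Longrightarrow> s \<le> x \<Longrightarrow> norm (q s) \<le> Q"
  shows "(norm (w x))\<^sup>2 + k\<^sup>2 * (norm (v x))\<^sup>2 \<le>
    ((norm (w x0))\<^sup>2 + k\<^sup>2 * (norm (v x0))\<^sup>2) * exp ((k\<^sup>2 + Q) / k * (x - x0))"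
proof -
  define E where "E s = (norm (w s))\<^sup>2 + k\<^sup>2 * (norm (v s))\<^sup>2" for s
  define E' where "E' s = 2 * Re (q s * v s * cnj (w s)) + k\<^sup>2 * (2 * Re (w s * cnj (v s)))" for s
  define c where "c = (k\<^sup>2 + Q) / k"
  have dE: "(E has_real_derivative E' s) (at s within {0..})" if "s \<ge> 0" for s
    unfolding E_def E'_def
    by (intro DERIV_add DERIV_cmult norm_square_has_derivative is_solD[OF sol that])
  have "- (E x0 * exp (- c * x0)) \<le> - (E x * exp (- c * x))"
  proof (rule nondecreasing_on_half_line[of "\<lambda>s. - (E s * exp (- c * s))" "\<lambda>s. (c * E s - E' s) * exp (- c * s)"])
    show "((\<lambda>s. - (E s * exp (- c * s))) has_real_derivative (c * E s - E' s) * exp (- c * s)) (at s within {0..})"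
      if "s \<ge> 0" for s
      using dE[OF that] by (auto intro!: derivative_eq_intros simp: algebra_simps)
    fix s assume s: "x0 \<le> s" "s \<le> x"
    have Q: "norm (q s) \<le> Q" using q[OF s] .
    have Q0: "0 \<le> Q" using Q norm_ge_zero order_trans by blast
    have "E' s \<le> 2 * (norm (q s) * norm (v s) * norm (w s)) + k\<^sup>2 * (2 * (norm (w s) * norm (v s)))"
      unfolding E'_def
      by (intro add_mono mult_left_mono order_trans[OF complex_Re_le_cmod]) (auto simp: norm_mult)
    also have "\<dots> \<le> (k\<^sup>2 + Q) * (2 * (norm (w s) * norm (v s)))"
      using mult_right_mono[OF Q, of "norm (v s) * norm (w s)"] by (simp add: algebra_simps)
    also have "\<dots> \<le> (k\<^sup>2 + Q) * (E s / k)"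
      unfolding E_def using Q0 k by (intro mult_left_mono two_mult_le_weighted) auto
    finally show "0 \<le> (c * E s - E' s) * exp (- c * s)" by (simp add: c_def)
  qed (use x in auto)
  then have "E x * exp (- c * x) \<le> E x0 * exp (- c * x0)" by simp
  then have "E x * exp (- c * x) * exp (c * x) \<le> E x0 * exp (- c * x0) * exp (c * x)"
    by (rule mult_right_mono) simp
  moreover have "exp (- c * x) * exp (c * x) = 1" by (simp add: mult_exp_exp)
  moreover have "exp (- c * x0) * exp (c * x) = exp (c * (x - x0))" by (simp add: mult_exp_exp algebra_simps)
  ultimately have "E x \<le> E x0 * exp (c * (x - x0))" by (simp only: mult.assoc mult_1_right)
  then show ?thesis unfolding E_def c_def .
qed

lemma is_sol_zero:
  assumes sol: "is_sol q v w" and q: "continuous_on {0..} q" and z: "v 0 = 0" "w 0 = 0" and s: "s \<ge> 0"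
  shows "v s = 0" "w s = 0"
proof -
  have "compact (q ` {0..s})"
    using q by (intro compact_continuous_image continuous_on_subset[OF q]) auto
  then obtain Q where "\<And>t. 0 \<le> t \<Longrightarrow> t \<le> s \<Longrightarrow> norm (q t) \<le> Q"
    using compact_imp_bounded bounded_iff by (metis atLeastAtMost_iff image_eqI)
  from is_sol_growth[OF sol order_refl s zero_less_one this] z
  have "(norm (w s))\<^sup>2 + (norm (v s))\<^sup>2 \<le> 0" by simp
  then show "v s = 0" "w s = 0" by (auto simp: add_nonneg_eq_0_iff dest: antisym)
qed

lemma is_sol_unique:
  assumes "is_sol q v w" "is_sol q v' w'" "continuous_on {0..} q" "v 0 = v' 0" "w 0 = w' 0" "s \<ge> 0"
  shows "v s = v' s" "w s = w' s"
  using is_sol_zero[OF is_sol_lincomb[OF assms(1,2), of 1 "-1"] assms(3)] assms(4-) by auto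

subsection \<open>The initial value problem\<close>

lemma has_vector_derivative_indefinite_integral:
  fixes g :: "real \<Rightarrow> complex"
  assumes g: "continuous_on {0..} g" and s: "s \<ge> 0"
  shows "((\<lambda>x. integral {0..x} g) has_vector_derivative g s) (at s within {0..})"
proof -
  have "((\<lambda>x. integral {0..x} g) has_vector_derivative g s) (at s within {0..s+1})"
    by (rule integral_has_vector_derivative) (use s in \<open>auto intro: continuous_on_subset[OF g]\<close>)
  moreover have "at s within {0..s+1} = at s within {0..}"
    by (rule at_within_nhd[of s "{..<s+1}"]) auto
  ultimately show ?thesis by simp
qed

lemma continuous_integrable_half_line:
  fixes g :: "real \<Rightarrow> 'a::banach"
  assumes "continuous_on {0..} g" "a \<ge> 0"
  shows "g integrable_on {a..b}"
  using assms by (intro integrable_continuous_real continuous_on_subset[OF assms(1)]) auto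

lemma has_vector_derivative_iterated_integral:
  fixes g :: "real \<Rightarrow> complex"
  assumes g: "continuous_on {0..} g" and s: "s \<ge> 0"
  shows "((\<lambda>x. integral {0..x} (\<lambda>t. of_real (x - t) * g t)) has_vector_derivative integral {0..s} g) (at s within {0..})"
proof -
  have tg: "continuous_on {0..} (\<lambda>t. of_real t * g t)" by (intro continuous_intros g)
  have eq: "integral {0..x} (\<lambda>t. of_real (x - t) * g t) =
     of_real x * integral {0..x} g - integral {0..x} (\<lambda>t. of_real t * g t)" for x
    by (simp add: left_diff_distrib of_real_diff Henstock_Kurzweil_Integration.integral_diff
        continuous_integrable_half_line[OF g] continuous_integrable_half_line[OF tg] integrable_on_mult_right)
  have "((\<lambda>x. of_real x * integral {0..x} g - integral {0..x} (\<lambda>t. of_real t * g t)) has_vector_derivative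
      (of_real s * g s + 1 * integral {0..s} g) - of_real s * g s) (at s within {0..})"
    by (intro has_vector_derivative_diff has_vector_derivative_mult
        has_vector_derivative_indefinite_integral[OF g s] has_vector_derivative_indefinite_integral[OF tg s])
       (auto intro!: derivative_eq_intros)
  then show ?thesis unfolding eq by simp
qed

lemma norm_of_real_diff_le: "0 \<le> t \<Longrightarrow> t \<le> s \<Longrightarrow> norm (complex_of_real s - complex_of_real t) \<le> s"
  by (metis abs_of_nonneg diff_ge_0_iff_ge diff_le_eq le_add_same_cancel1 norm_of_real of_real_diff)

text \<open>The terms, not the partial sums, of the Neumann series of the Volterra form of the
  initial value problem: y(s) equals a + b s plus the integral of (s - t) q(t) y(t) over [0, s]. The
  sum is \<open>sol\<close>.\<close>

primrec picard :: "(real \<Rightarrow> complex) \<Rightarrow> complex \<Rightarrow> complex \<Rightarrow> nat \<Rightarrow> real \<Rightarrow> complex" where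
  "picard q a b 0 = (\<lambda>s. a + b * of_real s)"
| "picard q a b (Suc n) = (\<lambda>s. integral {0..s} (\<lambda>t. of_real (s - t) * (q t * picard q a b n t)))"

definition sol :: "(real \<Rightarrow> complex) \<Rightarrow> complex \<Rightarrow> complex \<Rightarrow> real \<Rightarrow> complex" where
  "sol q a b s = (\<Sum>n. picard q a b n s)"

definition dsol :: "(real \<Rightarrow> complex) \<Rightarrow> complex \<Rightarrow> complex \<Rightarrow> real \<Rightarrow> complex" where
  "dsol q a b s = b + integral {0..s} (\<lambda>t. q t * sol q a b t)"

lemma continuous_on_picard:
  assumes "continuous_on {0..} q"
  shows "continuous_on {0..} (picard q a b n)"
proof (induction n)
  case 0 show ?case by (auto intro!: continuous_intros)
next
  case (Suc n)
  have "continuous_on {0..} (\<lambda>t. q t * picard q a b n t)" by (intro continuous_intros assms Suc)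
  from has_vector_derivative_iterated_integral[OF this] show ?case
    by (auto simp: continuous_on_eq_continuous_within intro!: has_vector_derivative_continuous)
qed

text \<open>The kernel factor s - t is bounded crudely by N, so each step integrates a power of t
  once and contributes one factor of the factorial.\<close>

lemma norm_picard_le:
  assumes q: "continuous_on {0..} q" and Q: "\<And>s. 0 \<le> s \<Longrightarrow> s \<le> N \<Longrightarrow> norm (q s) \<le> Q"
    and s: "0 \<le> s" "s \<le> N"
  shows "norm (picard q a b n s) \<le> (norm a + norm b * N) * ((Q * N * s) ^ n / fact n)"
  using s
proof (induction n arbitrary: s)
  case 0
  have "norm (a + b * of_real s) \<le> norm a + norm b * s"
    using 0 by (metis abs_of_nonneg norm_mult norm_of_real norm_triangle_ineq)
  also have "\<dots> \<le> norm a + norm b * N" using 0 by (simp add: mult_left_mono)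
  finally show ?case by simp
next
  case (Suc n)
  define A where "A = norm a + norm b * N"
  have Q0: "Q \<ge> 0" "N \<ge> 0" "A \<ge> 0" using Q[of 0] Suc.prems order_trans[OF norm_ge_zero] by (auto simp: A_def)
  define F where "F t = A * ((Q * N * t) ^ Suc n / fact (Suc n))" for t
  have F: "((\<lambda>t. N * (Q * (A * ((Q * N * t) ^ n / fact n)))) has_integral F s - F 0) {0..s}"
  proof (rule fundamental_theorem_of_calculus)
    fix t :: real
    have "((\<lambda>t. (Q * N * t) ^ Suc n) has_real_derivative real (Suc n) * (Q * N * t) ^ n * (Q * N)) (at t within {0..s})"
      using DERIV_power_Suc[OF DERIV_cmult_Id[of "Q * N" t "{0..s}"], of n]
      by (simp only: of_nat_Suc mult_ac)
    then have "(F has_real_derivative A * ((real (Suc n) * (Q * N * t) ^ n * (Q * N)) / fact (Suc n))) (at t within {0..s})"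
      unfolding F_def by (intro DERIV_cmult DERIV_cdivide)
    moreover have "(real (Suc n) * (Q * N * t) ^ n * (Q * N)) / fact (Suc n) = N * (Q * ((Q * N * t) ^ n / fact n))"
      by (simp add: fact_Suc del: of_nat_Suc)
    ultimately show "(F has_vector_derivative N * (Q * (A * ((Q * N * t) ^ n / fact n)))) (at t within {0..s})"
      by (simp add: has_real_derivative_iff_has_vector_derivative mult_ac)
  qed (use Suc in auto)
  have "norm (picard q a b (Suc n) s) \<le> integral {0..s} (\<lambda>t. N * (Q * (A * ((Q * N * t) ^ n / fact n))))"
    unfolding picard.simps
  proof (rule integral_norm_bound_integral)
    show "(\<lambda>t. of_real (s - t) * (q t * picard q a b n t)) integrable_on {0..s}"
      by (intro continuous_integrable_half_line continuous_intros q continuous_on_picard) auto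
    show "norm (of_real (s - t) * (q t * picard q a b n t)) \<le> N * (Q * (A * ((Q * N * t) ^ n / fact n)))"
      if "t \<in> {0..s}" for t
      unfolding norm_mult using that Suc Q Q0
      by (intro mult_mono) (auto simp: A_def[symmetric] intro!: mult_nonneg_nonneg intro: order_trans[OF norm_of_real_diff_le])
  qed (use F in blast)
  also have "\<dots> = F s" using integral_unique[OF F] by (simp only:) (simp add: F_def)
  finally show ?case by (simp add: F_def A_def)
qed

lemma sol_majorant:
  assumes q: "continuous_on {0..} q" and Q: "\<And>s. 0 \<le> s \<Longrightarrow> s \<le> N \<Longrightarrow> norm (q s) \<le> Q"
    and s: "0 \<le> s" "s \<le> N"
  shows "norm (picard q a b n s) \<le> (norm a + norm b * N) * ((Q * N * N) ^ n / fact n)"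
    "summable (\<lambda>n. (norm a + norm b * N) * ((Q * N * N) ^ n / fact n))"
proof -
  have Q0: "Q \<ge> 0" "N \<ge> 0" using Q[of 0] s order_trans[OF norm_ge_zero] by auto
  have "norm (picard q a b n s) \<le> (norm a + norm b * N) * ((Q * N * s) ^ n / fact n)"
    by (rule norm_picard_le[OF q Q s])
  also have "\<dots> \<le> (norm a + norm b * N) * ((Q * N * N) ^ n / fact n)"
    using s Q0 by (intro mult_left_mono divide_right_mono power_mono) auto
  finally show "norm (picard q a b n s) \<le> (norm a + norm b * N) * ((Q * N * N) ^ n / fact n)" .
  show "summable (\<lambda>n. (norm a + norm b * N) * ((Q * N * N) ^ n / fact n))"
    using summable_exp[of "Q * N * N"] by (intro summable_mult) (simp add: divide_inverse mult.commute)
qed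

lemma picard_bounded_on:
  fixes q :: "real \<Rightarrow> complex"
  assumes q: "continuous_on {0..} q"
  obtains Q where "\<And>s. 0 \<le> s \<Longrightarrow> s \<le> N \<Longrightarrow> norm (q s) \<le> Q"
proof -
  have "compact (q ` {0..N})"
    using q by (intro compact_continuous_image continuous_on_subset[OF q] compact_Icc) auto
  then obtain Q where "\<And>t. 0 \<le> t \<Longrightarrow> t \<le> N \<Longrightarrow> norm (q t) \<le> Q"
    using compact_imp_bounded bounded_iff by (metis atLeastAtMost_iff image_eqI)
  then show thesis by (rule that)
qed

lemma picard_sums_sol:
  assumes q: "continuous_on {0..} q" and s: "0 \<le> s"
  shows "(\<lambda>n. picard q a b n s) sums sol q a b s"
proof -
  obtain Q where Q: "\<And>t. 0 \<le> t \<Longrightarrow> t \<le> s \<Longrightarrow> norm (q t) \<le> Q" using picard_bounded_on[OF q] by blast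
  have "summable (\<lambda>n. picard q a b n s)"
    by (rule summable_comparison_test'[OF sol_majorant(2)[OF q Q s order_refl]])
       (use sol_majorant(1)[OF q Q s order_refl] in auto)
  then show ?thesis unfolding sol_def by (rule summable_sums)
qed

lemma continuous_on_sol:
  assumes q: "continuous_on {0..} q"
  shows "continuous_on {0..} (sol q a b)"
proof -
  have "continuous_on {0..N} (sol q a b)" if N: "N \<ge> 0" for N
  proof -
    obtain Q where Q: "\<And>t. 0 \<le> t \<Longrightarrow> t \<le> N \<Longrightarrow> norm (q t) \<le> Q" using picard_bounded_on[OF q] by blast
    have "uniform_limit {0..N} (\<lambda>n s. \<Sum>i<n. picard q a b i s) (\<lambda>s. suminf (\<lambda>i. picard q a b i s)) sequentially"
      by (rule Weierstrass_m_test[OF _ sol_majorant(2)[OF q Q N order_refl]])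
         (use sol_majorant(1)[OF q Q] in auto)
    then have "continuous_on {0..N} (\<lambda>s. suminf (\<lambda>i. picard q a b i s))"
      by (rule uniform_limit_theorem[rotated])
         (auto intro!: always_eventually continuous_intros continuous_on_subset[OF continuous_on_picard[OF q]])
    then show ?thesis by (simp add: sol_def[abs_def])
  qed
  then have "continuous (at s within {0..}) (sol q a b)" if "s \<ge> 0" for s
  proof -
    have "continuous (at s within {0..s+1}) (sol q a b)"
      using \<open>\<And>N. N \<ge> 0 \<Longrightarrow> continuous_on {0..N} (sol q a b)\<close>[of "s+1"] that
      by (auto simp: continuous_on_eq_continuous_within)
    moreover have "at s within {0..s+1} = at s within {0..}"
      by (rule at_within_nhd[of s "{..<s+1}"]) auto
    ultimately show ?thesis by simp
  qed
  then show ?thesis by (auto simp: continuous_on_eq_continuous_within)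
qed

lemma sol_integral_equation:
  assumes q: "continuous_on {0..} q" and s: "0 \<le> s"
  shows "sol q a b s = a + b * of_real s + integral {0..s} (\<lambda>t. of_real (s - t) * (q t * sol q a b t))"
proof -
  obtain Q where Q: "\<And>t. 0 \<le> t \<Longrightarrow> t \<le> s \<Longrightarrow> norm (q t) \<le> Q" using picard_bounded_on[OF q] by blast
  have Q0: "Q \<ge> 0" using Q[of 0] s order_trans[OF norm_ge_zero] by auto
  define P where "P k t = (\<Sum>i<k. picard q a b i t)" for k t
  define B where "B = (\<Sum>n. (norm a + norm b * s) * ((Q * s * s) ^ n / fact n))"
  have contP: "continuous_on {0..} (P k)" for k
    unfolding P_def by (intro continuous_intros continuous_on_picard q)
  have PB: "norm (P k t) \<le> B" if "t \<in> {0..s}" for k t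
  proof -
    have "norm (P k t) \<le> (\<Sum>i<k. norm (picard q a b i t))" unfolding P_def by (rule norm_sum)
    also have "\<dots> \<le> (\<Sum>i<k. (norm a + norm b * s) * ((Q * s * s) ^ i / fact i))"
      by (intro sum_mono sol_majorant(1)[OF q Q]) (use that in auto)
    also have "\<dots> \<le> B" unfolding B_def
      by (intro sum_le_suminf sol_majorant(2)[OF q Q s order_refl]) (use s Q0 in auto)
    finally show ?thesis .
  qed
  have Plim: "(\<lambda>k. P k t) \<longlonglongrightarrow> sol q a b t" if "t \<ge> 0" for t
    using picard_sums_sol[OF q that] by (simp add: sums_def P_def)
  have step: "integral {0..s} (\<lambda>t. of_real (s - t) * (q t * P k t)) = P (Suc k) s - (a + b * of_real s)" for k
  proof -
    have "integral {0..s} (\<lambda>t. of_real (s - t) * (q t * P k t)) =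
      integral {0..s} (\<lambda>t. \<Sum>i<k. of_real (s - t) * (q t * picard q a b i t))"
      by (simp add: P_def sum_distrib_left)
    also have "\<dots> = (\<Sum>i<k. integral {0..s} (\<lambda>t. of_real (s - t) * (q t * picard q a b i t)))"
      by (intro Henstock_Kurzweil_Integration.integral_sum continuous_integrable_half_line continuous_intros q continuous_on_picard) auto
    also have "\<dots> = (\<Sum>i<k. picard q a b (Suc i) s)" by simp
    also have "\<dots> = P (Suc k) s - (a + b * of_real s)"
      unfolding P_def by (subst sum.lessThan_Suc_shift) simp
    finally show ?thesis .
  qed
  have "(\<lambda>k. integral {0..s} (\<lambda>t. of_real (s - t) * (q t * P k t))) \<longlonglongrightarrow>
     integral {0..s} (\<lambda>t. of_real (s - t) * (q t * sol q a b t))"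
  proof (rule dominated_convergence(2)[where h = "\<lambda>t. s * (Q * B)"])
    show "(\<lambda>t. of_real (s - t) * (q t * P k t)) integrable_on {0..s}" for k
      by (intro continuous_integrable_half_line continuous_intros q contP) auto
    show "norm (of_real (s - t) * (q t * P k t)) \<le> s * (Q * B)" if "t \<in> {0..s}" for k t
      unfolding norm_mult using that PB[OF that] Q Q0
      by (intro mult_mono) (auto simp: norm_of_real_diff_le intro!: mult_nonneg_nonneg)
    show "(\<lambda>k. of_real (s - t) * (q t * P k t)) \<longlonglongrightarrow> of_real (s - t) * (q t * sol q a b t)" if "t \<in> {0..s}" for t
      by (intro tendsto_intros Plim) (use that in auto)
  qed auto
  moreover have "(\<lambda>k. P (Suc k) s - (a + b * of_real s)) \<longlonglongrightarrow> sol q a b s - (a + b * of_real s)"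
    by (intro tendsto_intros LIMSEQ_Suc Plim s)
  ultimately have "integral {0..s} (\<lambda>t. of_real (s - t) * (q t * sol q a b t)) = sol q a b s - (a + b * of_real s)"
    unfolding step using LIMSEQ_unique by blast
  then show ?thesis by simp
qed

lemma is_sol_sol:
  assumes q: "continuous_on {0..} q"
  shows "is_sol q (sol q a b) (dsol q a b)"
  unfolding is_sol_def
proof (intro allI impI conjI)
  fix s :: real assume s: "s \<ge> 0"
  have c: "continuous_on {0..} (\<lambda>t. q t * sol q a b t)" by (intro continuous_intros q continuous_on_sol)
  have "((\<lambda>s. a + b * of_real s + integral {0..s} (\<lambda>t. of_real (s - t) * (q t * sol q a b t)))
     has_vector_derivative (0 + b * 1 + integral {0..s} (\<lambda>t. q t * sol q a b t))) (at s within {0..})"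
    by (intro has_vector_derivative_add has_vector_derivative_iterated_integral[OF c s] has_vector_derivative_mult_right)
       (auto intro!: derivative_eq_intros)
  then have "((\<lambda>s. a + b * of_real s + integral {0..s} (\<lambda>t. of_real (s - t) * (q t * sol q a b t)))
     has_vector_derivative dsol q a b s) (at s within {0..})" by (simp add: dsol_def)
  then show "(sol q a b has_vector_derivative dsol q a b s) (at s within {0..})"
    by (rule has_vector_derivative_transform[rotated 2]) (use s sol_integral_equation[OF q] in auto)
  have "((\<lambda>s. b + integral {0..s} (\<lambda>t. q t * sol q a b t)) has_vector_derivative 0 + q s * sol q a b s) (at s within {0..})"
    by (intro has_vector_derivative_add has_vector_derivative_indefinite_integral[OF c s]) auto
  then show "(dsol q a b has_vector_derivative q s * sol q a b s) (at s within {0..})"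
    by (simp add: dsol_def[abs_def])
qed

lemma sol_0 [simp]: "dsol q a b 0 = b"
  and sol_0': "continuous_on {0..} q \<Longrightarrow> sol q a b 0 = a"
  using sol_integral_equation[of q 0 a b] by (auto simp: dsol_def)

lemma is_sol_eq_sol:
  assumes "is_sol q v w" "continuous_on {0..} q" "s \<ge> 0"
  shows "v s = sol q (v 0) (w 0) s" "w s = dsol q (v 0) (w 0) s"
  using is_sol_unique[OF assms(1) is_sol_sol[OF assms(2)] assms(2) _ _ assms(3)]
  by (auto simp: sol_0' assms(2))

lemma sol_lincomb:
  assumes "continuous_on {0..} q" "s \<ge> 0"
  shows "sol q a b s = a * sol q 1 0 s + b * sol q 0 1 s"
    "dsol q a b s = a * dsol q 1 0 s + b * dsol q 0 1 s"
proof -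
  note S = is_sol_sol[OF assms(1)]
  note u = is_sol_unique[OF S[of a b] is_sol_lincomb[OF S[of 1 0] S[of 0 1], of a b] assms(1) _ _ assms(2)]
  show "sol q a b s = a * sol q 1 0 s + b * sol q 0 1 s"
    "dsol q a b s = a * dsol q 1 0 s + b * dsol q 0 1 s"
    by (rule u; simp add: sol_0'[OF assms(1)])+
qed

subsection \<open>Holomorphic dependence on a parameter\<close>

lemma continuous_borel_measurable_segment:
  fixes g :: "real \<Rightarrow> complex"
  assumes "continuous_on {0..} g"
  shows "g \<in> borel_measurable (lebesgue_on {0..s})"
  using assms by (intro continuous_imp_measurable_on_sets_lebesgue continuous_on_subset[OF assms]) auto

lemma holomorphic_on_integral_segment:
  fixes K :: "real \<Rightarrow> complex \<Rightarrow> complex"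
  assumes U: "open U"
    and cont: "\<And>z. z \<in> U \<Longrightarrow> continuous_on {0..} (\<lambda>t. K t z)"
    and hol: "\<And>t. t \<ge> 0 \<Longrightarrow> K t holomorphic_on U"
    and bnd: "\<And>t z. 0 \<le> t \<Longrightarrow> t \<le> s \<Longrightarrow> z \<in> U \<Longrightarrow> norm (K t z) \<le> B"
  shows "(\<lambda>z. integral {0..s} (\<lambda>t. K t z)) holomorphic_on U"
proof -
  have gi: "integrable (lebesgue_on {0..s}) (\<lambda>t. B)"
    by (intro finite_measure.integrable_const finite_measure_lebesgue_on) auto
  have "(\<lambda>z. \<integral>t. K t z \<partial>lebesgue_on {0..s}) holomorphic_on U"
    by (rule holomorphic_on_integral[OF U _ _ gi])
       (use cont hol bnd in \<open>auto simp: continuous_borel_measurable_segment\<close>)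
  moreover have "(\<integral>t. K t z \<partial>lebesgue_on {0..s}) = integral {0..s} (\<lambda>t. K t z)" if z: "z \<in> U" for z
  proof (rule lebesgue_integral_eq_integral)
    show "integrable (lebesgue_on {0..s}) (\<lambda>t. K t z)"
      by (rule Bochner_Integration.integrable_bound[OF gi continuous_borel_measurable_segment[OF cont[OF z]]])
         (use bnd z in \<open>auto intro!: AE_I2 order_trans[OF _ abs_ge_self]\<close>)
  qed auto
  ultimately show ?thesis using holomorphic_transform by (metis (no_types, lifting))
qed

text \<open>Each Neumann term is holomorphic as a parameter integral, and the majorants of
  \<open>sol_majorant\<close> bound the partial sums uniformly in \<mu>, so
  \<open>holomorphic_pointwise_limit\<close> applies. The third conclusion, a bound uniform in
  \<mu>, serves as a majorant in later parameter integrals.\<close>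

lemma sol_holomorphic:
  fixes q :: "complex \<Rightarrow> real \<Rightarrow> complex"
  assumes U: "open U"
    and cont: "\<And>\<mu>. \<mu> \<in> U \<Longrightarrow> continuous_on {0..} (q \<mu>)"
    and hol: "\<And>s. s \<ge> 0 \<Longrightarrow> (\<lambda>\<mu>. q \<mu> s) holomorphic_on U"
    and bnd: "\<And>N. \<exists>Q. \<forall>\<mu>\<in>U. \<forall>s. 0 \<le> s \<longrightarrow> s \<le> N \<longrightarrow> norm (q \<mu> s) \<le> Q"
    and s: "s \<ge> 0"
  shows "(\<lambda>\<mu>. sol (q \<mu>) a b s) holomorphic_on U"
    "(\<lambda>\<mu>. dsol (q \<mu>) a b s) holomorphic_on U"
    "\<exists>B. \<forall>\<mu>\<in>U. \<forall>t. 0 \<le> t \<longrightarrow> t \<le> s \<longrightarrow> norm (sol (q \<mu>) a b t) \<le> B"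
proof -
  have solB: "\<exists>B. \<forall>\<mu>\<in>U. \<forall>t. 0 \<le> t \<longrightarrow> t \<le> s \<longrightarrow> norm (sol (q \<mu>) a b t) \<le> B \<and>
      (\<forall>k. norm (\<Sum>i<k. picard (q \<mu>) a b i t) \<le> B \<and> norm (picard (q \<mu>) a b k t) \<le> B)" if s: "s \<ge> 0" for s
  proof -
    obtain Q where Q: "\<And>\<mu> t. \<mu> \<in> U \<Longrightarrow> 0 \<le> t \<Longrightarrow> t \<le> s \<Longrightarrow> norm (q \<mu> t) \<le> Q" using bnd[of s] by blast
    define m where "m n = (norm a + norm b * s) * ((Q * s * s) ^ n / fact n)" for n
    have "norm (sol (q \<mu>) a b t) \<le> suminf m \<and> (\<forall>k. norm (\<Sum>i<k. picard (q \<mu>) a b i t) \<le> suminf m \<and> norm (picard (q \<mu>) a b k t) \<le> suminf m)"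
      if \<mu>: "\<mu> \<in> U" and t: "0 \<le> t" "t \<le> s" for \<mu> t
    proof -
      have Q0: "Q \<ge> 0" using Q[OF \<mu> t] norm_ge_zero order_trans by blast
      note maj = sol_majorant[OF cont[OF \<mu>] Q[OF \<mu>] t, of a b, folded m_def]
      have m0: "m n \<ge> 0" for n using Q0 s by (simp add: m_def)
      have P: "norm (\<Sum>i<k. picard (q \<mu>) a b i t) \<le> suminf m" for k
      proof -
        have "norm (\<Sum>i<k. picard (q \<mu>) a b i t) \<le> (\<Sum>i<k. m i)" by (intro sum_norm_le maj)
        also have "\<dots> \<le> suminf m" by (intro sum_le_suminf maj(2)) (use m0 in auto)
        finally show ?thesis .
      qed
      have "norm (picard (q \<mu>) a b k t) \<le> suminf m" for k
      proof -
        have "m k = sum m {k}" by simp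
        also have "\<dots> \<le> suminf m" by (intro sum_le_suminf maj(2)) (use m0 in auto)
        finally show ?thesis using maj(1)[of k] by linarith
      qed
      moreover have "norm (sol (q \<mu>) a b t) \<le> suminf m"
      proof (rule LIMSEQ_le_const2)
        show "(\<lambda>k. norm (\<Sum>i<k. picard (q \<mu>) a b i t)) \<longlonglongrightarrow> norm (sol (q \<mu>) a b t)"
          using picard_sums_sol[OF cont[OF \<mu>] t(1), of a b] by (intro tendsto_norm) (simp add: sums_def)
      qed (use P in auto)
      ultimately show ?thesis using P by blast
    qed
    then show ?thesis by blast
  qed
  show "\<exists>B. \<forall>\<mu>\<in>U. \<forall>t. 0 \<le> t \<longrightarrow> t \<le> s \<longrightarrow> norm (sol (q \<mu>) a b t) \<le> B" using solB[OF s] by blast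
  have pic: "(\<lambda>\<mu>. picard (q \<mu>) a b n s) holomorphic_on U" if "s \<ge> 0" for n s
    using that
  proof (induction n arbitrary: s)
    case 0 show ?case by (simp add: holomorphic_intros)
  next
    case (Suc n)
    obtain Q where Q: "\<And>\<mu> t. \<mu> \<in> U \<Longrightarrow> 0 \<le> t \<Longrightarrow> t \<le> s \<Longrightarrow> norm (q \<mu> t) \<le> Q" using bnd[of s] by blast
    obtain B where B: "\<And>\<mu> t. \<mu> \<in> U \<Longrightarrow> 0 \<le> t \<Longrightarrow> t \<le> s \<Longrightarrow> norm (picard (q \<mu>) a b n t) \<le> B"
      using solB[OF Suc.prems] by blast
    show ?case unfolding picard.simps
    proof (rule holomorphic_on_integral_segment[OF U])
      show "continuous_on {0..} (\<lambda>t. of_real (s - t) * (q \<mu> t * picard (q \<mu>) a b n t))" if "\<mu> \<in> U" for \<mu>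
        using that by (intro continuous_intros cont continuous_on_picard)
      show "(\<lambda>\<mu>. of_real (s - t) * (q \<mu> t * picard (q \<mu>) a b n t)) holomorphic_on U" if "t \<ge> 0" for t
        using that by (intro holomorphic_intros hol Suc.IH)
      show "norm (of_real (s - t) * (q \<mu> t * picard (q \<mu>) a b n t)) \<le> s * (Q * B)"
        if "0 \<le> t" "t \<le> s" "\<mu> \<in> U" for t \<mu>
        unfolding norm_mult using that Q[OF that(3,1,2)] B[OF that(3,1,2)]
        by (intro mult_mono) (auto simp: norm_of_real_diff_le intro!: mult_nonneg_nonneg intro: order_trans[OF norm_ge_zero])
    qed
  qed
  have hs: "(\<lambda>\<mu>. sol (q \<mu>) a b s) holomorphic_on U" if s: "s \<ge> 0" for s
  proof -
    obtain B where B: "\<And>\<mu> k. \<mu> \<in> U \<Longrightarrow> norm (\<Sum>i<k. picard (q \<mu>) a b i s) \<le> B"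
      using solB[OF s] s by blast
    show ?thesis
    proof (rule holomorphic_pointwise_limit[OF U, where f = "\<lambda>k \<mu>. \<Sum>i<k. picard (q \<mu>) a b i s"])
      show "(\<lambda>\<mu>. \<Sum>i<k. picard (q \<mu>) a b i s) holomorphic_on U" for k by (intro holomorphic_intros pic s)
      show "(\<lambda>k. \<Sum>i<k. picard (q \<mu>) a b i s) \<longlonglongrightarrow> sol (q \<mu>) a b s" if "\<mu> \<in> U" for \<mu>
        using picard_sums_sol[OF cont[OF that] s] by (simp add: sums_def)
    qed (rule B)
  qed
  show "(\<lambda>\<mu>. sol (q \<mu>) a b s) holomorphic_on U" by (rule hs[OF s])
  obtain Q where Q: "\<And>\<mu> t. \<mu> \<in> U \<Longrightarrow> 0 \<le> t \<Longrightarrow> t \<le> s \<Longrightarrow> norm (q \<mu> t) \<le> Q" using bnd[of s] by blast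
  obtain B where B: "\<And>\<mu> t. \<mu> \<in> U \<Longrightarrow> 0 \<le> t \<Longrightarrow> t \<le> s \<Longrightarrow> norm (sol (q \<mu>) a b t) \<le> B"
    using solB[OF s] by blast
  have "(\<lambda>\<mu>. integral {0..s} (\<lambda>t. q \<mu> t * sol (q \<mu>) a b t)) holomorphic_on U"
  proof (rule holomorphic_on_integral_segment[OF U])
    show "norm (q \<mu> t * sol (q \<mu>) a b t) \<le> Q * B" if "0 \<le> t" "t \<le> s" "\<mu> \<in> U" for t \<mu>
      unfolding norm_mult using Q[OF that(3,1,2)] B[OF that(3,1,2)]
      by (intro mult_mono) (auto intro: order_trans[OF norm_ge_zero])
  qed (auto intro!: holomorphic_intros continuous_intros hol hs cont continuous_on_sol)
  then show "(\<lambda>\<mu>. dsol (q \<mu>) a b s) holomorphic_on U"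
    unfolding dsol_def by (intro holomorphic_intros)
qed

subsection \<open>Energy identities\<close>

text \<open>The boundary term left by multiplying v'' = q v by cnj \<omega> cnj v and integrating by
  parts. Turning \<omega> trades the kinetic term Re \<omega> |w|^2 against the potential term
  Re(cnj \<omega> q) |v|^2.\<close>

definition energy_flux :: "complex \<Rightarrow> (real \<Rightarrow> complex) \<Rightarrow> (real \<Rightarrow> complex) \<Rightarrow> real \<Rightarrow> real" where
  "energy_flux \<omega> v w s = Re (cnj \<omega> * w s * cnj (v s))"

definition decaying :: "(real \<Rightarrow> complex) \<Rightarrow> (real \<Rightarrow> complex) \<Rightarrow> bool" where
  "decaying v w \<longleftrightarrow> integrable half_line (\<lambda>s. (norm (v s))\<^sup>2 + (norm (w s))\<^sup>2)"

lemma integrable_half_lineI: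
  fixes h :: "real \<Rightarrow> real"
  assumes cont: "continuous_on {0..} h" and nn: "\<And>s. s \<ge> 0 \<Longrightarrow> h s \<ge> 0"
    and bnd: "\<And>N. N \<ge> 0 \<Longrightarrow> integral {0..N} h \<le> B"
  shows "integrable half_line h" "(\<integral>s. h s \<partial>half_line) \<le> B"
proof -
  define f where "f k x = (if x \<in> {0..real k} then h x else 0)" for k x
  have fint: "f k integrable_on {0..}" and fval: "integral {0..} (f k) = integral {0..real k} h" for k
  proof -
    have h: "h integrable_on {0..real k}" by (rule continuous_integrable_half_line[OF cont]) simp
    have "f k integrable_on UNIV" unfolding f_def using h by (subst integrable_restrict_UNIV)
    have eq: "(\<lambda>x. if x \<in> {0..} then f k x else 0) = f k" by (auto simp: f_def)
    show "f k integrable_on {0..}" using \<open>f k integrable_on UNIV\<close> eq by (subst integrable_restrict_UNIV[symmetric]) simp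
    have "integral {0..} (f k) = integral UNIV (\<lambda>x. if x \<in> {0..} then f k x else 0)" by (rule integral_restrict_UNIV[symmetric])
    also have "\<dots> = integral {0..real k} h" unfolding eq unfolding f_def by (rule integral_restrict_UNIV)
    finally show "integral {0..} (f k) = integral {0..real k} h" .
  qed
  have mono: "f k x \<le> f (Suc k) x" if "x \<in> {0..}" for k x using nn that by (auto simp: f_def)
  have lim: "(\<lambda>k. f k x) \<longlonglongrightarrow> h x" if "x \<in> {0..}" for x
  proof -
    obtain n where "x \<le> real n" using real_arch_simple by blast
    then have "\<forall>k\<ge>n. f k x = h x" using that by (auto simp: f_def)
    then show ?thesis by (intro tendsto_eventually) (auto simp: eventually_sequentially)
  qed
  have bd: "bounded (range (\<lambda>k. integral {0..} (f k)))"
  proof (rule boundedI)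
    fix y assume "y \<in> range (\<lambda>k. integral {0..} (f k))"
    then obtain k where k: "y = integral {0..real k} h" using fval by auto
    have "0 \<le> integral {0..real k} h"
      by (intro integral_nonneg continuous_integrable_half_line[OF cont]) (use nn in auto)
    then show "norm y \<le> B" using bnd[of "real k"] k by auto
  qed
  note mc = monotone_convergence_increasing[OF fint mono lim bd]
  have "h absolutely_integrable_on {0..}"
    by (rule nonnegative_absolutely_integrable_1) (use mc nn in auto)
  then show int: "integrable half_line h"
    by (simp add: integrable_restrict_space set_integrable_def)
  have "(\<integral>s. h s \<partial>half_line) = integral {0..} h"
    by (rule lebesgue_integral_eq_integral[OF int]) simp
  also have "\<dots> \<le> B"
    by (rule LIMSEQ_le_const2[OF conjunct2[OF mc]]) (use fval bnd in auto)
  finally show "(\<integral>s. h s \<partial>half_line) \<le> B" .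
qed

lemma integral_segment_le_half_line:
  fixes h :: "real \<Rightarrow> real"
  assumes cont: "continuous_on {0..} h" and nn: "\<And>s. s \<ge> 0 \<Longrightarrow> h s \<ge> 0"
    and int: "integrable half_line h" and a: "a \<ge> 0"
  shows "integral {a..b} h \<le> (\<integral>s. h s \<partial>half_line)"
proof -
  have "h absolutely_integrable_on {0..}"
    using int by (simp add: integrable_restrict_space set_integrable_def)
  then have "h integrable_on {0..}" by (simp add: absolutely_integrable_on_def)
  then have "integral {a..b} h \<le> integral {0..} h"
    by (intro integral_subset_le continuous_integrable_half_line[OF cont]) (use a nn in auto)
  also have "\<dots> = (\<integral>s. h s \<partial>half_line)"
    by (rule lebesgue_integral_eq_integral[OF int, symmetric]) simp
  finally show ?thesis .
qed

lemma Re_times_of_real: "Re (z * of_real r) = Re z * r"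
  by simp

lemma energy_flux_has_derivative:
  assumes "is_sol q v w" "s \<ge> 0"
  shows "(energy_flux \<omega> v w has_real_derivative
    Re \<omega> * (norm (w s))\<^sup>2 + Re (cnj \<omega> * q s) * (norm (v s))\<^sup>2) (at s within {0..})"
proof -
  have 1: "Re (cnj \<omega> * (q s * v s) * cnj (v s)) = Re (cnj \<omega> * q s) * (norm (v s))\<^sup>2"
  proof -
    have "cnj \<omega> * (q s * v s) * cnj (v s) = (cnj \<omega> * q s) * of_real ((norm (v s))\<^sup>2)"
      by (simp only: complex_norm_square mult.assoc)
    then show ?thesis by (simp only: Re_times_of_real)
  qed
  have 2: "Re (cnj \<omega> * w s * cnj (w s)) = Re \<omega> * (norm (w s))\<^sup>2"
  proof -
    have "cnj \<omega> * w s * cnj (w s) = cnj \<omega> * of_real ((norm (w s))\<^sup>2)"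
      by (simp only: complex_norm_square mult.assoc)
    then show ?thesis by (simp only: Re_times_of_real complex_cnj_cancel_iff cnj.simps)
  qed
  show ?thesis
    using Re_mult_cnj_has_derivative[OF is_solD(2,1)[OF assms], of "cnj \<omega>"] unfolding 1 2
    by (simp add: energy_flux_def[abs_def] add.commute)
qed

lemma abs_energy_flux_le: "\<bar>energy_flux \<omega> v w s\<bar> \<le> norm \<omega> * norm (v s) * norm (w s)"
  unfolding energy_flux_def by (rule order_trans[OF abs_Re_le_cmod]) (simp add: norm_mult)

lemma abs_energy_flux_le': "\<bar>energy_flux \<omega> v w s\<bar> \<le> norm \<omega> * ((norm (v s))\<^sup>2 + (norm (w s))\<^sup>2) / 2"
proof -
  have "2 * (norm (v s) * norm (w s)) \<le> (norm (v s))\<^sup>2 + (norm (w s))\<^sup>2"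
    using sum_squares_bound[of "norm (v s)" "norm (w s)"] by simp
  then have "norm \<omega> * (2 * (norm (v s) * norm (w s))) \<le> norm \<omega> * ((norm (v s))\<^sup>2 + (norm (w s))\<^sup>2)"
    by (rule mult_left_mono) simp
  then show ?thesis using abs_energy_flux_le[of \<omega> v w s] by linarith
qed

lemma energy_flux_mono:
  assumes "is_sol q v w" "Re \<omega> \<ge> 0" "0 \<le> a" "a \<le> b"
    and "\<And>s. a \<le> s \<Longrightarrow> s \<le> b \<Longrightarrow> Re (cnj \<omega> * q s) \<ge> 0"
  shows "energy_flux \<omega> v w a \<le> energy_flux \<omega> v w b"
  by (rule nondecreasing_on_half_line[OF energy_flux_has_derivative[OF assms(1)] assms(3,4)])
     (use assms in auto)

lemma weighted_energy_continuous:
  assumes "is_sol q v w"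
  shows "continuous_on {0..} (\<lambda>s. c1 * (norm (w s))\<^sup>2 + c2 * (norm (v s))\<^sup>2 :: real)"
  by (intro continuous_intros is_sol_continuous[OF assms(1)])

lemma energy_balance:
  assumes "is_sol q v w" "0 \<le> a" "a \<le> b"
  shows "((\<lambda>s. Re \<omega> * (norm (w s))\<^sup>2 + Re (cnj \<omega> * q s) * (norm (v s))\<^sup>2) has_integral
    energy_flux \<omega> v w b - energy_flux \<omega> v w a) {a..b}"
proof (rule fundamental_theorem_of_calculus)
  fix s assume "s \<in> {a..b}"
  then show "(energy_flux \<omega> v w has_vector_derivative
      Re \<omega> * (norm (w s))\<^sup>2 + Re (cnj \<omega> * q s) * (norm (v s))\<^sup>2) (at s within {a..b})"
    using energy_flux_has_derivative[OF assms(1), of s \<omega>] assms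
    by (auto simp: has_real_derivative_iff_has_vector_derivative[symmetric] intro: DERIV_subset)
qed (use assms in auto)

lemma energy_inequality:
  assumes sol: "is_sol q v w" and ab: "0 \<le> a" "a \<le> b"
    and c1: "c1 \<le> Re \<omega>" and c2: "\<And>s. a \<le> s \<Longrightarrow> s \<le> b \<Longrightarrow> c2 \<le> Re (cnj \<omega> * q s)"
  shows "integral {a..b} (\<lambda>s. c1 * (norm (w s))\<^sup>2 + c2 * (norm (v s))\<^sup>2)
    \<le> energy_flux \<omega> v w b - energy_flux \<omega> v w a"
proof (rule has_integral_le[OF integrable_integral energy_balance[OF sol ab]])
  show "(\<lambda>s. c1 * (norm (w s))\<^sup>2 + c2 * (norm (v s))\<^sup>2) integrable_on {a..b}"
    by (rule continuous_integrable_half_line[OF weighted_energy_continuous[OF sol] ab(1)])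
  show "c1 * (norm (w s))\<^sup>2 + c2 * (norm (v s))\<^sup>2
      \<le> Re \<omega> * (norm (w s))\<^sup>2 + Re (cnj \<omega> * q s) * (norm (v s))\<^sup>2" if "s \<in> {a..b}" for s
    using that c1 c2 by (intro add_mono mult_right_mono) auto
qed

text \<open>A positive flux at s could only increase, which would keep |v|^2 + |w|^2 above a
  positive constant on all of [s, \<infinity>) and contradict integrability.\<close>

lemma decaying_flux_nonpos:
  assumes sol: "is_sol q v w" and dec: "decaying v w" and \<omega>: "Re \<omega> \<ge> 0"
    and good: "\<And>s. s \<ge> s0 \<Longrightarrow> Re (cnj \<omega> * q s) \<ge> 0" and s0: "0 \<le> s0" and s: "s0 \<le> s"
  shows "energy_flux \<omega> v w s \<le> 0"
proof (rule ccontr)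
  define \<eta> where "\<eta> = energy_flux \<omega> v w s"
  assume "\<not> energy_flux \<omega> v w s \<le> 0"
  then have \<eta>: "\<eta> > 0" by (simp add: \<eta>_def)
  have n\<omega>: "norm \<omega> > 0" using \<eta> abs_energy_flux_le[of \<omega> v w s] by (cases "\<omega> = 0") (auto simp: \<eta>_def)
  define h where "h s = (norm (v s))\<^sup>2 + (norm (w s))\<^sup>2" for s
  define d where "d = 2 * \<eta> / norm \<omega>"
  have d: "d > 0" using \<eta> n\<omega> by (simp add: d_def)
  have hd: "h t \<ge> d" if t: "t \<ge> s" for t
  proof -
    have "\<eta> \<le> energy_flux \<omega> v w t"
      unfolding \<eta>_def by (rule energy_flux_mono[OF sol \<omega>]) (use s0 s t good in auto)
    also have "\<dots> \<le> norm \<omega> * h t / 2" using abs_energy_flux_le'[of \<omega> v w t] by (simp add: h_def)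
    finally show ?thesis using n\<omega> by (simp add: d_def field_simps)
  qed
  have cont: "continuous_on {0..} h" unfolding h_def by (intro continuous_intros is_sol_continuous[OF sol])
  have int: "integrable half_line h" using dec unfolding decaying_def h_def .
  define I where "I = (\<integral>s. h s \<partial>half_line)"
  \<comment> \<open>Length chosen so that d (b - s) = |I| + 1 exceeds the total energy I.\<close>
  define b where "b = s + (\<bar>I\<bar> + 1) / d"
  have "b \<ge> s" using d by (simp add: b_def)
  have "d * (b - s) = integral {s..b} (\<lambda>_. d)" using \<open>b \<ge> s\<close> by simp
  also have "\<dots> \<le> integral {s..b} h"
    by (intro integral_le continuous_integrable_half_line[OF cont]) (use hd s s0 in auto)
  also have "\<dots> \<le> I" unfolding I_def
    by (rule integral_segment_le_half_line[OF cont _ int]) (use s s0 in \<open>auto simp: h_def\<close>)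
  finally show False using d by (simp add: b_def)
qed

lemma decaying_energy_bound:
  assumes sol: "is_sol q v w" and dec: "decaying v w"
    and c1: "0 \<le> c1" "c1 \<le> Re \<omega>" and c2: "0 \<le> c2" "\<And>s. s \<ge> s0 \<Longrightarrow> c2 \<le> Re (cnj \<omega> * q s)"
    and s0: "0 \<le> s0" "s0 \<le> b"
  shows "integral {s0..b} (\<lambda>s. c1 * (norm (w s))\<^sup>2 + c2 * (norm (v s))\<^sup>2) \<le> - energy_flux \<omega> v w s0"
proof -
  have "energy_flux \<omega> v w b \<le> 0"
    by (rule decaying_flux_nonpos[OF sol dec _ _ s0]) (use c1 c2 in \<open>auto intro: order_trans\<close>)
  then show ?thesis
    using energy_inequality[OF sol s0 c1(2), of c2] c2 by auto
qed

text \<open>Converse of \<open>decaying_flux_nonpos\<close>: the flux grows at least c times as fast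
  as energy accumulates and never becomes positive, so the energy beyond s0 is at most -flux(s0)/c.
  Decay can thus be checked by the sign of a flux, and this sign survives scaling, shifts and
  limits.\<close>

lemma decayingI:
  assumes sol: "is_sol q v w" and s0: "s0 \<ge> 0" and c: "c > 0" "c \<le> Re \<omega>" "\<And>s. s \<ge> s0 \<Longrightarrow> c \<le> Re (cnj \<omega> * q s)"
    and flux: "\<And>s. s \<ge> s0 \<Longrightarrow> energy_flux \<omega> v w s \<le> 0"
  shows "decaying v w"
proof -
  define h where "h s = (norm (v s))\<^sup>2 + (norm (w s))\<^sup>2" for s
  have cont: "continuous_on {0..} h" unfolding h_def by (intro continuous_intros is_sol_continuous[OF sol])
  have h0: "h s \<ge> 0" for s by (simp add: h_def)
  define B where "B = integral {0..s0} h + - energy_flux \<omega> v w s0 / c"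
  have "integral {0..N} h \<le> B" if N: "N \<ge> 0" for N
  proof -
    define b where "b = max N s0"
    have b: "s0 \<le> b" by (simp add: b_def)
    have "integral {0..N} h \<le> integral {0..b} h"
      by (intro integral_subset_le continuous_integrable_half_line[OF cont]) (auto simp: h0 b_def)
    also have "\<dots> = integral {0..s0} h + integral {s0..b} h"
      by (rule Henstock_Kurzweil_Integration.integral_combine[symmetric])
         (use s0 b in \<open>auto intro: continuous_integrable_half_line[OF cont]\<close>)
    also have "integral {s0..b} h \<le> - energy_flux \<omega> v w s0 / c"
    proof -
      have "c * integral {s0..b} h = integral {s0..b} (\<lambda>s. c * (norm (w s))\<^sup>2 + c * (norm (v s))\<^sup>2)"
        by (simp add: h_def[abs_def] algebra_simps flip: integral_mult_right)
      also have "\<dots> \<le> energy_flux \<omega> v w b - energy_flux \<omega> v w s0"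
        by (rule energy_inequality[OF sol s0 b c(2)]) (use c in auto)
      also have "\<dots> \<le> - energy_flux \<omega> v w s0" using flux[OF b] by simp
      finally show ?thesis using c by (simp add: field_simps)
    qed
    finally show ?thesis by (simp add: B_def)
  qed
  from integrable_half_lineI(1)[OF cont h0 this] show ?thesis unfolding decaying_def h_def .
qed

lemma decaying_lincomb:
  assumes "is_sol q v w" "is_sol q' v' w'" "decaying v w" "decaying v' w'"
  shows "decaying (\<lambda>s. c * v s + d * v' s) (\<lambda>s. c * w s + d * w' s)"
  unfolding decaying_def
proof (rule Bochner_Integration.integrable_bound)
  show "integrable half_line (\<lambda>s. 2 * (norm c)\<^sup>2 * ((norm (v s))\<^sup>2 + (norm (w s))\<^sup>2)
      + 2 * (norm d)\<^sup>2 * ((norm (v' s))\<^sup>2 + (norm (w' s))\<^sup>2))"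
  proof (rule Bochner_Integration.integrable_add)
    show "integrable half_line (\<lambda>s. 2 * (norm c)\<^sup>2 * ((norm (v s))\<^sup>2 + (norm (w s))\<^sup>2))"
      by (rule integrable_mult_right) (rule assms(3)[unfolded decaying_def])
    show "integrable half_line (\<lambda>s. 2 * (norm d)\<^sup>2 * ((norm (v' s))\<^sup>2 + (norm (w' s))\<^sup>2))"
      by (rule integrable_mult_right) (rule assms(4)[unfolded decaying_def])
  qed
  have "continuous_on {0..} (\<lambda>s. (norm (c * v s + d * v' s))\<^sup>2 + (norm (c * w s + d * w' s))\<^sup>2)"
    by (intro continuous_intros is_sol_continuous[OF assms(1)] is_sol_continuous[OF assms(2)])
  then show "(\<lambda>s. (norm (c * v s + d * v' s))\<^sup>2 + (norm (c * w s + d * w' s))\<^sup>2) \<in> borel_measurable half_line"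
    by (intro continuous_imp_measurable_on_sets_lebesgue) auto
  have *: "(norm (c * x + d * y))\<^sup>2 \<le> 2 * (norm c)\<^sup>2 * (norm x)\<^sup>2 + 2 * (norm d)\<^sup>2 * (norm y)\<^sup>2" for x y
  proof -
    have "norm (c * x + d * y) \<le> norm c * norm x + norm d * norm y"
      by (metis norm_mult norm_triangle_ineq)
    then have "(norm (c * x + d * y))\<^sup>2 \<le> (norm c * norm x + norm d * norm y)\<^sup>2" by (intro power_mono) auto
    also have "\<dots> \<le> 2 * (norm c * norm x)\<^sup>2 + 2 * (norm d * norm y)\<^sup>2"
      using sum_squares_bound[of "norm c * norm x" "norm d * norm y"] by (simp add: power2_sum)
    finally show ?thesis by (simp add: power_mult_distrib)
  qed
  show "AE s in half_line. norm ((norm (c * v s + d * v' s))\<^sup>2 + (norm (c * w s + d * w' s))\<^sup>2)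
    \<le> norm (2 * (norm c)\<^sup>2 * ((norm (v s))\<^sup>2 + (norm (w s))\<^sup>2) + 2 * (norm d)\<^sup>2 * ((norm (v' s))\<^sup>2 + (norm (w' s))\<^sup>2))"
  proof (intro AE_I2)
    fix s
    have "(norm (c * v s + d * v' s))\<^sup>2 + (norm (c * w s + d * w' s))\<^sup>2
      \<le> 2 * (norm c)\<^sup>2 * ((norm (v s))\<^sup>2 + (norm (w s))\<^sup>2) + 2 * (norm d)\<^sup>2 * ((norm (v' s))\<^sup>2 + (norm (w' s))\<^sup>2)"
      using *[of "v s" "v' s"] *[of "w s" "w' s"] by (simp only: distrib_left)
    moreover have "0 \<le> (norm (c * v s + d * v' s))\<^sup>2 + (norm (c * w s + d * w' s))\<^sup>2" by simp
    ultimately show "norm ((norm (c * v s + d * v' s))\<^sup>2 + (norm (c * w s + d * w' s))\<^sup>2)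
      \<le> norm (2 * (norm c)\<^sup>2 * ((norm (v s))\<^sup>2 + (norm (w s))\<^sup>2) + 2 * (norm d)\<^sup>2 * ((norm (v' s))\<^sup>2 + (norm (w' s))\<^sup>2))"
      unfolding real_norm_def by linarith
  qed
qed

lemma wronskian_constant:
  assumes "is_sol q v w" "is_sol q v' w'" "s \<ge> 0"
  shows "v s * w' s - w s * v' s = v 0 * w' 0 - w 0 * v' 0"
proof -
  define f where "f s = v s * w' s - w s * v' s" for s
  have d: "(f has_vector_derivative 0) (at s within {0..})" if "s \<in> {0..}" for s
  proof -
    have s: "s \<ge> 0" using that by simp
    have "(f has_vector_derivative (v s * (q s * v' s) + w s * w' s) - (w s * w' s + q s * v s * v' s)) (at s within {0..})"
      unfolding f_def
      by (intro has_vector_derivative_diff has_vector_derivative_mult is_solD[OF assms(1) s] is_solD[OF assms(2) s])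
    then show ?thesis by (simp add: algebra_simps)
  qed
  have "\<exists>c. \<forall>x\<in>{0..}. f x = c"
  proof (rule has_vector_derivative_zero_constant[of "{0..}" f])
    show "(f has_vector_derivative 0) (at x within {0..})" if "x \<in> {0..}" for x by (rule d[OF that])
  qed (auto)
  then show ?thesis using assms(3) by (force simp: f_def)
qed

text \<open>A decaying solution vanishing at \<open>R\<close> has zero flux beyond \<open>R\<close>, hence vanishes.\<close>

lemma decaying_unique:
  assumes sol: "is_sol q v w" "is_sol q v' w'" and dec: "decaying v w" "decaying v' w'"
    and q: "continuous_on {0..} q" and R: "R \<ge> 0" and \<omega>: "Re \<omega> > 0"
    and good: "\<And>s. s \<ge> R \<Longrightarrow> Re (cnj \<omega> * q s) \<ge> 0"
  shows "v 0 * w' 0 = w 0 * v' 0"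
proof -
  define d where "d s = v' R * v s + (- v R) * v' s" for s
  define e where "e s = v' R * w s + (- v R) * w' s" for s
  have de: "is_sol q d e" unfolding d_def e_def by (rule is_sol_lincomb[OF sol])
  have dd: "decaying d e" unfolding d_def e_def by (rule decaying_lincomb[OF sol dec])
  have "energy_flux \<omega> d e R = 0" by (simp add: energy_flux_def d_def)
  moreover have "energy_flux \<omega> d e (R+1) \<le> 0"
    by (rule decaying_flux_nonpos[OF de dd _ good R]) (use \<omega> in auto)
  moreover have "integral {R..R+1} (\<lambda>s. Re \<omega> * (norm (e s))\<^sup>2) \<le> energy_flux \<omega> d e (R+1) - energy_flux \<omega> d e R"
    using energy_inequality[OF de R, of "R+1" "Re \<omega>" \<omega> 0] good by simp
  moreover have "integral {R..R+1} (\<lambda>s. Re \<omega> * (norm (e s))\<^sup>2) \<ge> 0"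
    by (rule integral_nonneg) (use \<omega> R in \<open>auto intro!: continuous_integrable_half_line continuous_intros is_sol_continuous[OF de]\<close>)
  ultimately have "integral {R..R+1} (\<lambda>s. Re \<omega> * (norm (e s))\<^sup>2) = 0" by linarith
  moreover have "continuous_on {R..R+1} (\<lambda>s. Re \<omega> * (norm (e s))\<^sup>2)"
    using R by (intro continuous_intros continuous_on_subset[OF is_sol_continuous(2)[OF de]]) auto
  ultimately have "\<forall>x\<in>{R..R+1}. Re \<omega> * (norm (e x))\<^sup>2 = 0"
    using \<omega> by (subst (asm) integral_eq_0_iff) auto
  then have "Re \<omega> * (norm (e R))\<^sup>2 = 0" by auto
  then have "e R = 0" using \<omega> by simp
  then have "v R * w' R - w R * v' R = 0" by (simp add: e_def mult.commute)
  then show ?thesis using wronskian_constant[OF sol R] by simp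
qed

text \<open>Testing the equation against the hat function \<open>1 - s / \<ell>\<close>.\<close>

lemma initial_slope_le:
  assumes sol: "is_sol q v w" and q: "continuous_on {0..} q" and l: "l > 0"
    and Q: "\<And>s. 0 \<le> s \<Longrightarrow> s \<le> l \<Longrightarrow> norm (q s) \<le> Q"
  shows "norm (w 0) \<le> integral {0..l} (\<lambda>s. norm (w s) / l + Q * norm (v s))"
proof -
  define F where "F s = of_real (1 - s / l) * w s" for s
  have F: "((\<lambda>s. of_real (1 - s / l) * (q s * v s) - of_real (1 / l) * w s) has_integral F l - F 0) {0..l}"
  proof (rule fundamental_theorem_of_calculus)
    fix s assume s: "s \<in> {0..l}"
    have "((\<lambda>s. of_real (1 - s / l) :: complex) has_vector_derivative of_real (- (1 / l))) (at s within {0..})"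
      using l by (intro has_vector_derivative_of_real) (auto intro!: derivative_eq_intros simp: has_real_derivative_iff_has_vector_derivative[symmetric])
    then have "(F has_vector_derivative of_real (1 - s / l) * (q s * v s) + of_real (- (1 / l)) * w s) (at s within {0..})"
      unfolding F_def using s by (intro has_vector_derivative_mult is_solD[OF sol]) auto
    then show "(F has_vector_derivative of_real (1 - s / l) * (q s * v s) - of_real (1 / l) * w s) (at s within {0..l})"
      by (auto intro: has_vector_derivative_within_subset)
  qed (use l in auto)
  have "norm (w 0) = norm (F l - F 0)" using l by (simp add: F_def)
  also have "\<dots> = norm (integral {0..l} (\<lambda>s. of_real (1 - s / l) * (q s * v s) - of_real (1 / l) * w s))"
    using F by (simp add: integral_unique)
  also have "\<dots> \<le> integral {0..l} (\<lambda>s. norm (w s) / l + Q * norm (v s))"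
  proof (rule integral_norm_bound_integral)
    show "(\<lambda>s. of_real (1 - s / l) * (q s * v s) - of_real (1 / l) * w s) integrable_on {0..l}" using F by blast
    show "(\<lambda>s. norm (w s) / l + Q * norm (v s)) integrable_on {0..l}"
      by (intro continuous_integrable_half_line continuous_intros is_sol_continuous[OF sol]) (use l in auto)
    fix s assume s: "s \<in> {0..l}"
    have "norm (of_real (1 - s / l) * (q s * v s) - of_real (1 / l) * w s)
        \<le> norm (of_real (1 - s / l) * (q s * v s)) + norm (of_real (1 / l) * w s)" by (rule norm_triangle_ineq4)
    also have "norm (of_real (1 - s / l) * (q s * v s)) \<le> 1 * (Q * norm (v s))"
      unfolding norm_mult norm_of_real using s l Q[of s] by (intro mult_mono) (auto intro: order_trans[OF norm_ge_zero])
    also have "norm (of_real (1 / l) * w s) = norm (w s) / l" using l by (simp add: norm_mult norm_divide)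
    finally show "norm (of_real (1 - s / l) * (q s * v s) - of_real (1 / l) * w s) \<le> norm (w s) / l + Q * norm (v s)" by simp
  qed
  finally show ?thesis .
qed

lemma le_weighted_square: "x \<le> (\<epsilon> * x\<^sup>2 + 1 / \<epsilon>) / 2" if "\<epsilon> > 0" for x \<epsilon> :: real
proof -
  have "0 \<le> (\<epsilon> * x - 1)\<^sup>2" by simp
  then have "2 * x * \<epsilon> \<le> \<epsilon>\<^sup>2 * x\<^sup>2 + 1" by (simp add: power2_eq_square algebra_simps)
  then show ?thesis using that by (simp add: field_simps power2_eq_square)
qed

text \<open>The slope is at most the integral of |w| + Q |v| over [0, 1], hence of the size of the
  square root of the energy, while the energy is at most linear in the slope; so the slope bounds
  itself.\<close>

lemma initial_slope_bound:
  assumes sol: "is_sol q v w" and q: "continuous_on {0..} q"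
    and Q: "\<And>s. 0 \<le> s \<Longrightarrow> s \<le> 1 \<Longrightarrow> norm (q s) \<le> Q"
    and A: "A > 0" and en: "integral {0..1} (\<lambda>s. (norm (w s))\<^sup>2 + (norm (v s))\<^sup>2) \<le> A * norm (w 0)"
  shows "norm (w 0) \<le> 2 * (1 + Q)\<^sup>2 * A"
proof -
  have Q0: "Q \<ge> 0" using Q[of 0] order_trans[OF norm_ge_zero] by auto
  \<comment> \<open>Young's inequality with this weight leaves exactly half of |w 0| on the right,
    where it can be absorbed.\<close>
  define \<epsilon> where "\<epsilon> = 1 / ((1 + Q) * A)"
  have \<epsilon>: "\<epsilon> > 0" using Q0 A by (simp add: \<epsilon>_def)
  define h where "h s = (norm (w s))\<^sup>2 + (norm (v s))\<^sup>2" for s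
  have ci: "h integrable_on {0..1}" unfolding h_def
    by (intro continuous_integrable_half_line continuous_intros is_sol_continuous[OF sol]) simp
  have "norm (w 0) \<le> integral {0..1} (\<lambda>s. norm (w s) / 1 + Q * norm (v s))"
    by (rule initial_slope_le[OF sol q _ Q]) auto
  also have "\<dots> \<le> integral {0..1} (\<lambda>s. (1 + Q) * (\<epsilon> / 2 * h s + 1 / \<epsilon>))"
  proof (rule integral_le)
    show "(\<lambda>s. norm (w s) / 1 + Q * norm (v s)) integrable_on {0..1}"
      by (intro continuous_integrable_half_line continuous_intros is_sol_continuous[OF sol]) auto
    show "(\<lambda>s. (1 + Q) * (\<epsilon> / 2 * h s + 1 / \<epsilon>)) integrable_on {0..1}"
      unfolding h_def by (intro continuous_integrable_half_line continuous_intros is_sol_continuous[OF sol]) auto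
    fix s :: real
    have "norm (w s) / 1 + Q * norm (v s) \<le> (1 + Q) * (norm (w s) + norm (v s))"
      using Q0 by (simp add: algebra_simps mult_nonneg_nonneg)
    also have "\<dots> \<le> (1 + Q) * (\<epsilon> / 2 * h s + 1 / \<epsilon>)"
    proof (rule mult_left_mono)
      show "norm (w s) + norm (v s) \<le> \<epsilon> / 2 * h s + 1 / \<epsilon>"
        using add_mono[OF le_weighted_square[OF \<epsilon>, of "norm (w s)"] le_weighted_square[OF \<epsilon>, of "norm (v s)"]]
        by (simp add: h_def add_divide_distrib distrib_left)
    qed (use Q0 in simp)
    finally show "norm (w s) / 1 + Q * norm (v s) \<le> (1 + Q) * (\<epsilon> / 2 * h s + 1 / \<epsilon>)" .
  qed
  also have "\<dots> = (1 + Q) * (\<epsilon> / 2 * integral {0..1} h + 1 / \<epsilon>)"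
  proof -
    have "integral {0..1} (\<lambda>s. \<epsilon> / 2 * h s + 1 / \<epsilon>) = integral {0..1} (\<lambda>s. \<epsilon> / 2 * h s) + integral {0..1} (\<lambda>s::real. 1 / \<epsilon>)"
      by (intro Henstock_Kurzweil_Integration.integral_add integrable_on_mult_right ci integrable_const_ivl)
    moreover have "integral {0..1} (\<lambda>s. \<epsilon> / 2 * h s) = \<epsilon> / 2 * integral {0..1} h"
      by (rule integral_mult_right)
    moreover have "integral {0..1} (\<lambda>s::real. 1 / \<epsilon>) = 1 / \<epsilon>" by simp
    ultimately show ?thesis by (simp only: integral_mult_right)
  qed
  also have "\<dots> \<le> (1 + Q) * (\<epsilon> / 2 * (A * norm (w 0)) + 1 / \<epsilon>)"
    using en \<epsilon> Q0 by (intro mult_left_mono add_right_mono) (auto simp: h_def[abs_def])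
  also have "\<dots> = norm (w 0) / 2 + (1 + Q)\<^sup>2 * A"
  proof -
    have e1: "(1 + Q) * A * \<epsilon> = 1" "1 / \<epsilon> = (1 + Q) * A" using Q0 A by (auto simp: \<epsilon>_def add_nonneg_eq_0_iff)
    have "(1 + Q) * (\<epsilon> / 2 * (A * norm (w 0)) + 1 / \<epsilon>) = ((1 + Q) * A * \<epsilon>) * norm (w 0) / 2 + (1 + Q) * (1 / \<epsilon>)"
      by (simp add: algebra_simps)
    also have "\<dots> = norm (w 0) / 2 + (1 + Q)\<^sup>2 * A" unfolding e1 by (simp add: power2_eq_square)
    finally show ?thesis .
  qed
  finally show ?thesis by simp
qed

subsection \<open>Weyl solutions\<close>

text \<open>The Weyl coefficient is the limit of the coefficients of the solutions vanishing at \<open>n\<close>.\<close>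

definition weyl_approx :: "(real \<Rightarrow> complex) \<Rightarrow> nat \<Rightarrow> complex" where
  "weyl_approx q n = - (sol q 1 0 (real (Suc n)) / sol q 0 1 (real (Suc n)))"

text \<open>One multiplier gives both coefficients of the flux derivative the lower bound c on the
  whole half-line. This is the limit point situation, in which the truncated boundary problems
  converge.\<close>

locale accretive_potential =
  fixes q :: "real \<Rightarrow> complex" and \<omega> :: complex and c Q :: real
  assumes q: "continuous_on {0..} q" and c: "c > 0" "c \<le> Re \<omega>"
    and good: "\<And>s. s \<ge> 0 \<Longrightarrow> c \<le> Re (cnj \<omega> * q s)"
    and Q: "\<And>s. 0 \<le> s \<Longrightarrow> s \<le> 1 \<Longrightarrow> norm (q s) \<le> Q"
begin

abbreviation "C \<equiv> sol q 1 0"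
abbreviation "C' \<equiv> dsol q 1 0"
abbreviation "S \<equiv> sol q 0 1"
abbreviation "S' \<equiv> dsol q 0 1"

lemma flux_mono: "is_sol q v w \<Longrightarrow> 0 \<le> a \<Longrightarrow> a \<le> b \<Longrightarrow> energy_flux \<omega> v w a \<le> energy_flux \<omega> v w b"
  using c good by (intro energy_flux_mono[of q]) (auto intro: order_trans[of 0 c])

lemma norm_omega: "norm \<omega> \<ge> c" "norm \<omega> > 0"
  using c complex_Re_le_cmod[of \<omega>] by auto

lemma flux_bounds_energy:
  assumes "is_sol q v w" "0 \<le> a" "a \<le> b"
  shows "c * integral {a..b} (\<lambda>s. (norm (w s))\<^sup>2 + (norm (v s))\<^sup>2) \<le> energy_flux \<omega> v w b - energy_flux \<omega> v w a"
proof -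
  have "c * integral {a..b} (\<lambda>s. (norm (w s))\<^sup>2 + (norm (v s))\<^sup>2)
      = integral {a..b} (\<lambda>s. c * (norm (w s))\<^sup>2 + c * (norm (v s))\<^sup>2)"
    by (simp only: integral_mult_right[symmetric] distrib_left)
  also have "\<dots> \<le> energy_flux \<omega> v w b - energy_flux \<omega> v w a"
    by (rule energy_inequality[OF assms c(2)]) (use good assms in auto)
  finally show ?thesis .
qed

text \<open>The flux is zero at 0, where S vanishes, and gains the energy of S on [0, 1], which is
  positive because S'(0) = 1. Positive flux persists, so S has no zero beyond 1 and the denominators
  in \<open>weyl_approx\<close> are nonzero.\<close>

lemma S_flux_pos: "energy_flux \<omega> S S' 1 > 0"
proof -
  note sS = is_sol_sol[OF q, of 0 1]
  have "energy_flux \<omega> S S' 0 = 0" by (simp add: energy_flux_def sol_0'[OF q])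
  then have le: "c * integral {0..1} (\<lambda>s. (norm (S' s))\<^sup>2 + (norm (S s))\<^sup>2) \<le> energy_flux \<omega> S S' 1"
    using flux_bounds_energy[OF sS, of 0 1] by simp
  define h where "h s = (norm (S' s))\<^sup>2 + (norm (S s))\<^sup>2" for s
  have cont: "continuous_on {0..1} h" unfolding h_def
    by (intro continuous_intros continuous_on_subset[OF is_sol_continuous(1)[OF sS]] continuous_on_subset[OF is_sol_continuous(2)[OF sS]]) auto
  have nn: "h s \<ge> 0" for s by (simp add: h_def)
  have "integral {0..1} h \<noteq> 0"
  proof
    assume "integral {0..1} h = 0"
    then have "\<forall>x\<in>{0..1}. h x = 0" using cont nn by (subst (asm) integral_eq_0_iff) auto
    then have "h 0 = 0" by simp
    then show False by (simp add: h_def sol_0'[OF q])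
  qed
  moreover have "integral {0..1} h \<ge> 0"
    by (intro integral_nonneg integrable_continuous_real cont) (simp add: nn)
  ultimately have "0 < c * integral {0..1} h" using c by simp
  then show ?thesis using le unfolding h_def by linarith
qed

lemma S_nonzero: "s \<ge> 1 \<Longrightarrow> S s \<noteq> 0"
  using flux_mono[OF is_sol_sol[OF q, of 0 1], of 1 s] S_flux_pos by (auto simp: energy_flux_def)

definition "m n = weyl_approx q n"
definition "u n s = C s + m n * S s"
definition "u' n s = C' s + m n * S' s"

lemma is_sol_u: "is_sol q (u n) (u' n)"
  using is_sol_lincomb[OF is_sol_sol[OF q, of 1 0] is_sol_sol[OF q, of 0 1], of 1 "m n"]
  by (simp add: u_def[abs_def] u'_def[abs_def])

lemma u_initial: "u n 0 = 1" "u' n 0 = m n"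
  by (simp_all add: u_def u'_def sol_0'[OF q])

lemma u_flux_nonpos:
  assumes "0 \<le> s" "s \<le> real (Suc n)"
  shows "energy_flux \<omega> (u n) (u' n) s \<le> 0"
proof -
  have "u n (real (Suc n)) = 0"
    using S_nonzero[of "real (Suc n)"] by (simp add: u_def m_def weyl_approx_def)
  then have "energy_flux \<omega> (u n) (u' n) (real (Suc n)) = 0" by (simp add: energy_flux_def)
  then show ?thesis using flux_mono[OF is_sol_u[of n] assms] by linarith
qed

lemma u_energy:
  assumes "0 \<le> s" "s \<le> real (Suc n)"
  shows "integral {0..s} (\<lambda>s. (norm (u' n s))\<^sup>2 + (norm (u n s))\<^sup>2) \<le> norm \<omega> / c * norm (m n)"
proof -
  have "c * integral {0..s} (\<lambda>s. (norm (u' n s))\<^sup>2 + (norm (u n s))\<^sup>2)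
      \<le> energy_flux \<omega> (u n) (u' n) s - energy_flux \<omega> (u n) (u' n) 0"
    by (rule flux_bounds_energy[OF is_sol_u _ assms(1)]) simp
  also have "\<dots> \<le> norm \<omega> * norm (m n)"
    using u_flux_nonpos[OF assms] abs_energy_flux_le[of \<omega> "u n" "u' n" 0] by (simp add: u_initial)
  finally show ?thesis using c by (simp add: field_simps)
qed

lemma m_bound: "norm (m n) \<le> 2 * (1 + Q)\<^sup>2 * (norm \<omega> / c)"
  using initial_slope_bound[OF is_sol_u q Q, of "norm \<omega> / c" n] u_energy[of 1 n] c norm_omega
  by (simp add: u_initial)

lemma S_energy_lower:
  assumes "b \<ge> 1"
  shows "2 * energy_flux \<omega> S S' 1 / norm \<omega> * (b - 1) \<le> integral {0..b} (\<lambda>s. (norm (S' s))\<^sup>2 + (norm (S s))\<^sup>2)"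
proof -
  note sS = is_sol_sol[OF q, of 0 1]
  define d where "d = 2 * energy_flux \<omega> S S' 1 / norm \<omega>"
  have cont: "continuous_on {0..} (\<lambda>s. (norm (S' s))\<^sup>2 + (norm (S s))\<^sup>2)"
    by (intro continuous_intros is_sol_continuous[OF sS])
  have "d * (b - 1) = integral {1..b} (\<lambda>_. d)" using assms by simp
  also have "\<dots> \<le> integral {1..b} (\<lambda>s. (norm (S' s))\<^sup>2 + (norm (S s))\<^sup>2)"
  proof (rule integral_le)
    show "(\<lambda>s. (norm (S' s))\<^sup>2 + (norm (S s))\<^sup>2) integrable_on {1..b}"
      by (rule continuous_integrable_half_line[OF cont]) simp
    fix s :: real assume "s \<in> {1..b}"
    then have "energy_flux \<omega> S S' 1 \<le> energy_flux \<omega> S S' s" by (intro flux_mono[OF sS]) auto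
    also have "\<dots> \<le> norm \<omega> * ((norm (S s))\<^sup>2 + (norm (S' s))\<^sup>2) / 2"
      using abs_energy_flux_le'[of \<omega> S S' s] by simp
    finally show "d \<le> (norm (S' s))\<^sup>2 + (norm (S s))\<^sup>2" using norm_omega by (simp add: d_def field_simps)
  qed auto
  also have "\<dots> \<le> integral {0..b} (\<lambda>s. (norm (S' s))\<^sup>2 + (norm (S s))\<^sup>2)"
    by (intro integral_subset_le continuous_integrable_half_line[OF cont]) auto
  finally show ?thesis by (simp add: d_def)
qed

lemma norm_square_diff_le: "(norm (x - y :: complex))\<^sup>2 \<le> 2 * (norm x)\<^sup>2 + 2 * (norm y)\<^sup>2"
proof -
  have "(norm (x - y))\<^sup>2 \<le> (norm x + norm y)\<^sup>2" by (intro power_mono norm_triangle_ineq4) auto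
  also have "\<dots> \<le> 2 * (norm x)\<^sup>2 + 2 * (norm y)\<^sup>2"
    using sum_squares_bound[of "norm x" "norm y"] by (simp add: power2_sum)
  finally show ?thesis .
qed

text \<open>The difference of \<open>u n\<close> and \<open>u n'\<close> is (m n - m n') S. Its
  energy on [0, n + 1] is bounded by those of the two approximants, whereas the energy of S grows
  linearly because its flux stays above a positive constant.\<close>

lemma m_Cauchy:
  obtains K where "\<And>n n'. 1 \<le> n \<Longrightarrow> n \<le> n' \<Longrightarrow> (norm (m n - m n'))\<^sup>2 * real n \<le> K"
proof -
  define A where "A = norm \<omega> / c * (2 * (1 + Q)\<^sup>2 * (norm \<omega> / c))"
  define d where "d = 2 * energy_flux \<omega> S S' 1 / norm \<omega>"
  have d: "d > 0" using S_flux_pos norm_omega by (simp add: d_def)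
  have A: "integral {0..s} (\<lambda>s. (norm (u' n s))\<^sup>2 + (norm (u n s))\<^sup>2) \<le> A" if "0 \<le> s" "s \<le> real (Suc n)" for s n
    using u_energy[OF that] mult_left_mono[OF m_bound[of n], of "norm \<omega> / c"] c by (simp add: A_def)
  have "(norm (m n - m n'))\<^sup>2 * real n \<le> 4 * A / d" if n: "1 \<le> n" "n \<le> n'" for n n'
  proof -
    define b where "b = real (Suc n)"
    have b: "0 \<le> b" "b \<le> real (Suc n)" "b \<le> real (Suc n')" "b \<ge> 1" using n by (auto simp: b_def)
    have ci: "(\<lambda>s. (norm (u' k s))\<^sup>2 + (norm (u k s))\<^sup>2) integrable_on {0..b}" for k
      by (intro continuous_integrable_half_line continuous_intros is_sol_continuous[OF is_sol_u]) simp
    have cS: "(\<lambda>s. (norm (S' s))\<^sup>2 + (norm (S s))\<^sup>2) integrable_on {0..b}"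
      by (intro continuous_integrable_half_line continuous_intros is_sol_continuous[OF is_sol_sol[OF q]]) simp
    have "(norm (m n - m n'))\<^sup>2 * (d * (b - 1)) \<le> (norm (m n - m n'))\<^sup>2 * integral {0..b} (\<lambda>s. (norm (S' s))\<^sup>2 + (norm (S s))\<^sup>2)"
      using S_energy_lower[OF b(4)] by (intro mult_left_mono) (auto simp: d_def)
    also have "\<dots> = integral {0..b} (\<lambda>s. (norm (m n - m n'))\<^sup>2 * ((norm (S' s))\<^sup>2 + (norm (S s))\<^sup>2))"
      by (rule integral_mult_right[symmetric])
    also have "\<dots> \<le> integral {0..b} (\<lambda>s. 2 * ((norm (u' n s))\<^sup>2 + (norm (u n s))\<^sup>2) + 2 * ((norm (u' n' s))\<^sup>2 + (norm (u n' s))\<^sup>2))"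
    proof (rule integral_le)
      show "(\<lambda>s. (norm (m n - m n'))\<^sup>2 * ((norm (S' s))\<^sup>2 + (norm (S s))\<^sup>2)) integrable_on {0..b}"
        by (rule integrable_on_mult_right[OF cS])
      show "(\<lambda>s. 2 * ((norm (u' n s))\<^sup>2 + (norm (u n s))\<^sup>2) + 2 * ((norm (u' n' s))\<^sup>2 + (norm (u n' s))\<^sup>2)) integrable_on {0..b}"
        by (intro integrable_add integrable_on_mult_right ci)
      fix s
      have 1: "(m n - m n') * S s = u n s - u n' s" "(m n - m n') * S' s = u' n s - u' n' s"
        by (simp_all add: u_def u'_def algebra_simps)
      have "(norm (m n - m n'))\<^sup>2 * ((norm (S' s))\<^sup>2 + (norm (S s))\<^sup>2)
          = (norm (u' n s - u' n' s))\<^sup>2 + (norm (u n s - u n' s))\<^sup>2"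
        unfolding 1[symmetric] norm_mult power_mult_distrib by (simp add: distrib_left)
      also have "\<dots> \<le> 2 * ((norm (u' n s))\<^sup>2 + (norm (u n s))\<^sup>2) + 2 * ((norm (u' n' s))\<^sup>2 + (norm (u n' s))\<^sup>2)"
        using add_mono[OF norm_square_diff_le[of "u' n s" "u' n' s"] norm_square_diff_le[of "u n s" "u n' s"]]
        by (simp add: distrib_left add_ac)
      finally show "(norm (m n - m n'))\<^sup>2 * ((norm (S' s))\<^sup>2 + (norm (S s))\<^sup>2)
          \<le> 2 * ((norm (u' n s))\<^sup>2 + (norm (u n s))\<^sup>2) + 2 * ((norm (u' n' s))\<^sup>2 + (norm (u n' s))\<^sup>2)" .
    qed
    also have "\<dots> = 2 * integral {0..b} (\<lambda>s. (norm (u' n s))\<^sup>2 + (norm (u n s))\<^sup>2)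
        + 2 * integral {0..b} (\<lambda>s. (norm (u' n' s))\<^sup>2 + (norm (u n' s))\<^sup>2)"
      by (simp only: Henstock_Kurzweil_Integration.integral_add[OF integrable_on_mult_right[OF ci] integrable_on_mult_right[OF ci]] integral_mult_right)
    also have "\<dots> \<le> 4 * A" using A[OF b(1,2)] A[OF b(1,3)] by linarith
    finally have "(norm (m n - m n'))\<^sup>2 * real n * d \<le> 4 * A" by (simp add: b_def mult_ac)
    then show ?thesis using d by (simp add: field_simps)
  qed
  then show thesis by (rule that)
qed

lemma m_convergent: "convergent m"
proof -
  obtain K where K: "\<And>n n'. 1 \<le> n \<Longrightarrow> n \<le> n' \<Longrightarrow> (norm (m n - m n'))\<^sup>2 * real n \<le> K" using m_Cauchy by blast
  have "Cauchy m"
  proof (rule metric_CauchyI)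
    fix e :: real assume e: "e > 0"
    obtain M0 where M0: "K / e\<^sup>2 < real M0" using reals_Archimedean2 by blast
    define M where "M = max 1 M0"
    have M: "real M > K / e\<^sup>2" "M \<ge> 1" using M0 by (auto simp: M_def)
    have lt: "norm (m n - m n') < e" if "M \<le> n" "n \<le> n'" for n n'
    proof (rule ccontr)
      assume "\<not> norm (m n - m n') < e"
      then have "e\<^sup>2 \<le> (norm (m n - m n'))\<^sup>2" using e by (intro power_mono) auto
      then have "e\<^sup>2 * real M \<le> (norm (m n - m n'))\<^sup>2 * real n" using that by (intro mult_mono) auto
      also have "\<dots> \<le> K" using K[of n n'] that M by simp
      finally show False using M e by (simp add: field_simps)
    qed
    show "\<exists>M. \<forall>n\<ge>M. \<forall>n'\<ge>M. dist (m n) (m n') < e"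
    proof (intro exI[of _ M] allI impI)
      fix n n' assume "M \<le> n" "M \<le> n'"
      then show "dist (m n) (m n') < e"
        using lt[of n n'] lt[of n' n] by (cases "n \<le> n'") (auto simp: dist_norm norm_minus_commute)
    qed
  qed
  then show ?thesis by (rule Cauchy_convergent)
qed

text \<open>Nonpositivity of the flux of \<open>u n\<close> on [0, n + 1] passes to the limit at
  each fixed s, and \<open>decayingI\<close> turns it into decay.\<close>

lemma weyl_decaying: "decaying (sol q 1 (lim m)) (dsol q 1 (lim m))"
proof (rule decayingI[OF is_sol_sol[OF q] order_refl c])
  show "c \<le> Re (cnj \<omega> * q s)" if "0 \<le> s" for s using good that .
  fix s :: real assume s: "s \<ge> 0"
  have m: "m \<longlonglongrightarrow> lim m" using m_convergent by (simp add: convergent_LIMSEQ_iff)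
  have lm: "(\<lambda>n. energy_flux \<omega> (u n) (u' n) s) \<longlonglongrightarrow> Re (cnj \<omega> * (C' s + lim m * S' s) * cnj (C s + lim m * S s))"
    unfolding energy_flux_def u_def u'_def by (intro tendsto_intros m)
  have eq: "Re (cnj \<omega> * (C' s + lim m * S' s) * cnj (C s + lim m * S s)) = energy_flux \<omega> (sol q 1 (lim m)) (dsol q 1 (lim m)) s"
    using sol_lincomb[OF q s, of 1 "lim m"] by (simp add: energy_flux_def)
  have ex: "\<exists>N. \<forall>n\<ge>N. energy_flux \<omega> (u n) (u' n) s \<le> 0"
  proof -
    obtain N where "s \<le> real N" using real_arch_simple by blast
    then show ?thesis by (intro exI[of _ N]) (auto intro!: u_flux_nonpos s)
  qed
  show "energy_flux \<omega> (sol q 1 (lim m)) (dsol q 1 (lim m)) s \<le> 0"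
    using LIMSEQ_le_const2[OF lm ex] unfolding eq .
qed

end

text \<open>The bound \<open>m_bound\<close> depends on \<mu> only through constants common to all
  of U, so the pointwise limit of the holomorphic approximants is holomorphic.\<close>

lemma weyl_coefficient_holomorphic:
  fixes q :: "complex \<Rightarrow> real \<Rightarrow> complex"
  assumes U: "open U"
    and cont: "\<And>\<mu>. \<mu> \<in> U \<Longrightarrow> continuous_on {0..} (q \<mu>)"
    and hol: "\<And>s. s \<ge> 0 \<Longrightarrow> (\<lambda>\<mu>. q \<mu> s) holomorphic_on U"
    and bnd: "\<And>N. \<exists>Q. \<forall>\<mu>\<in>U. \<forall>s. 0 \<le> s \<longrightarrow> s \<le> N \<longrightarrow> norm (q \<mu> s) \<le> Q"
    and c: "c > 0" "c \<le> Re \<omega>" and good: "\<And>\<mu> s. \<mu> \<in> U \<Longrightarrow> s \<ge> 0 \<Longrightarrow> c \<le> Re (cnj \<omega> * q \<mu> s)"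
  obtains m where "m holomorphic_on U" "\<And>\<mu>. \<mu> \<in> U \<Longrightarrow> decaying (sol (q \<mu>) 1 (m \<mu>)) (dsol (q \<mu>) 1 (m \<mu>))"
proof -
  obtain Q where Q: "\<And>\<mu> s. \<mu> \<in> U \<Longrightarrow> 0 \<le> s \<Longrightarrow> s \<le> 1 \<Longrightarrow> norm (q \<mu> s) \<le> Q" using bnd[of 1] by blast
  have loc: "accretive_potential (q \<mu>) \<omega> c Q" if "\<mu> \<in> U" for \<mu>
    using that cont c good Q by unfold_locales auto
  define m where "m \<mu> = lim (\<lambda>n. weyl_approx (q \<mu>) n)" for \<mu>
  have "m holomorphic_on U"
  proof (rule holomorphic_pointwise_limit[OF U, where f = "\<lambda>n \<mu>. weyl_approx (q \<mu>) n"])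
    show "(\<lambda>\<mu>. weyl_approx (q \<mu>) n) holomorphic_on U" for n
      unfolding weyl_approx_def
    proof (intro holomorphic_intros sol_holomorphic(1)[OF U cont hol bnd])
      show "sol (q \<mu>) 0 1 (real (Suc n)) \<noteq> 0" if "\<mu> \<in> U" for \<mu>
        using accretive_potential.S_nonzero[OF loc[OF that]] by simp
    qed auto
    show "norm (weyl_approx (q \<mu>) n) \<le> 2 * (1 + Q)\<^sup>2 * (norm \<omega> / c)" if "\<mu> \<in> U" for \<mu> n
      using accretive_potential.m_bound[OF loc[OF that], of n]
      by (simp add: accretive_potential.m_def[OF loc[OF that]])
    show "(\<lambda>n. weyl_approx (q \<mu>) n) \<longlonglongrightarrow> m \<mu>" if "\<mu> \<in> U" for \<mu>
      using accretive_potential.m_convergent[OF loc[OF that]]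
      by (simp add: accretive_potential.m_def[OF loc[OF that], abs_def] m_def convergent_LIMSEQ_iff)
  qed
  moreover have "decaying (sol (q \<mu>) 1 (m \<mu>)) (dsol (q \<mu>) 1 (m \<mu>))" if "\<mu> \<in> U" for \<mu>
    using accretive_potential.weyl_decaying[OF loc[OF that]]
    by (simp add: accretive_potential.m_def[OF loc[OF that], abs_def] m_def)
  ultimately show thesis by (rule that)
qed

text \<open>Decaying solutions exist as soon as the potential is accretive from some \<open>R\<close> on: the Weyl
  solution on \<open>[R, \<infinity>)\<close> is continued to \<open>0\<close> by inverting the fundamental matrix at \<open>R\<close>.\<close>

lemma decaying_data_holomorphic:
  fixes q :: "complex \<Rightarrow> real \<Rightarrow> complex"
  assumes U: "open U"
    and cont: "\<And>\<mu>. \<mu> \<in> U \<Longrightarrow> continuous_on {0..} (q \<mu>)"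
    and hol: "\<And>s. s \<ge> 0 \<Longrightarrow> (\<lambda>\<mu>. q \<mu> s) holomorphic_on U"
    and bnd: "\<And>N. \<exists>Q. \<forall>\<mu>\<in>U. \<forall>s. 0 \<le> s \<longrightarrow> s \<le> N \<longrightarrow> norm (q \<mu> s) \<le> Q"
    and c: "c > 0" "c \<le> Re \<omega>" and R: "R \<ge> 0"
    and good: "\<And>\<mu> s. \<mu> \<in> U \<Longrightarrow> s \<ge> R \<Longrightarrow> c \<le> Re (cnj \<omega> * q \<mu> s)"
  obtains y0 y1 where "y0 holomorphic_on U" "y1 holomorphic_on U"
    "\<And>\<mu>. \<mu> \<in> U \<Longrightarrow> y0 \<mu> \<noteq> 0 \<or> y1 \<mu> \<noteq> 0"
    "\<And>\<mu>. \<mu> \<in> U \<Longrightarrow> decaying (sol (q \<mu>) (y0 \<mu>) (y1 \<mu>)) (dsol (q \<mu>) (y0 \<mu>) (y1 \<mu>))"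
    "\<And>\<mu>. \<mu> \<in> U \<Longrightarrow> sol (q \<mu>) (y0 \<mu>) (y1 \<mu>) R = 1"
    "(\<lambda>\<mu>. dsol (q \<mu>) (y0 \<mu>) (y1 \<mu>) R) holomorphic_on U"
proof -
  define p where "p \<mu> s = q \<mu> (R + s)" for \<mu> s
  have contp: "continuous_on {0..} (p \<mu>)" if "\<mu> \<in> U" for \<mu>
    unfolding p_def using R by (intro continuous_on_compose2[OF cont[OF that]] continuous_intros) auto
  obtain m where m: "m holomorphic_on U" "\<And>\<mu>. \<mu> \<in> U \<Longrightarrow> decaying (sol (p \<mu>) 1 (m \<mu>)) (dsol (p \<mu>) 1 (m \<mu>))"
  proof (rule weyl_coefficient_holomorphic[OF U contp _ _ c])
    show "(\<lambda>\<mu>. p \<mu> s) holomorphic_on U" if "s \<ge> 0" for s unfolding p_def using hol[of "R + s"] that R by simp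
    show "\<exists>Q. \<forall>\<mu>\<in>U. \<forall>s. 0 \<le> s \<longrightarrow> s \<le> N \<longrightarrow> norm (p \<mu> s) \<le> Q" for N
      unfolding p_def using bnd[of "R + N"] R by (meson add_left_mono add_nonneg_nonneg)
    show "c \<le> Re (cnj \<omega> * p \<mu> s)" if "\<mu> \<in> U" "0 \<le> s" for \<mu> s unfolding p_def using good that by simp
  qed auto
  define y0 where "y0 \<mu> = dsol (q \<mu>) 0 1 R - sol (q \<mu>) 0 1 R * m \<mu>" for \<mu>
  define y1 where "y1 \<mu> = sol (q \<mu>) 1 0 R * m \<mu> - dsol (q \<mu>) 1 0 R" for \<mu>
  have at_R: "sol (q \<mu>) (y0 \<mu>) (y1 \<mu>) R = 1" "dsol (q \<mu>) (y0 \<mu>) (y1 \<mu>) R = m \<mu>" if \<mu>: "\<mu> \<in> U" for \<mu>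
  proof -
    have W: "sol (q \<mu>) 1 0 R * dsol (q \<mu>) 0 1 R - dsol (q \<mu>) 1 0 R * sol (q \<mu>) 0 1 R = 1"
      using wronskian_constant[OF is_sol_sol[OF cont[OF \<mu>]] is_sol_sol[OF cont[OF \<mu>]] R, of 1 0 0 1]
      by (simp add: sol_0'[OF cont[OF \<mu>]])
    have "sol (q \<mu>) (y0 \<mu>) (y1 \<mu>) R = sol (q \<mu>) 1 0 R * dsol (q \<mu>) 0 1 R - dsol (q \<mu>) 1 0 R * sol (q \<mu>) 0 1 R"
      unfolding sol_lincomb(1)[OF cont[OF \<mu>] R, of "y0 \<mu>" "y1 \<mu>"] by (simp add: y0_def y1_def algebra_simps)
    then show "sol (q \<mu>) (y0 \<mu>) (y1 \<mu>) R = 1" using W by simp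
    have "dsol (q \<mu>) (y0 \<mu>) (y1 \<mu>) R = m \<mu> * (sol (q \<mu>) 1 0 R * dsol (q \<mu>) 0 1 R - dsol (q \<mu>) 1 0 R * sol (q \<mu>) 0 1 R)"
      unfolding sol_lincomb(2)[OF cont[OF \<mu>] R, of "y0 \<mu>" "y1 \<mu>"] by (simp add: y0_def y1_def algebra_simps)
    then show "dsol (q \<mu>) (y0 \<mu>) (y1 \<mu>) R = m \<mu>" using W by simp
  qed
  show thesis
  proof (rule that[of y0 y1])
    note sh = sol_holomorphic(1,2)[OF U cont hol bnd R]
    show "y0 holomorphic_on U" unfolding y0_def by (intro holomorphic_intros sh m)
    show "y1 holomorphic_on U" unfolding y1_def by (intro holomorphic_intros sh m)
    fix \<mu> assume \<mu>: "\<mu> \<in> U"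
    note sy = is_sol_sol[OF cont[OF \<mu>], of "y0 \<mu>" "y1 \<mu>"]
    show "sol (q \<mu>) (y0 \<mu>) (y1 \<mu>) R = 1" by (rule at_R(1)[OF \<mu>])
    show "y0 \<mu> \<noteq> 0 \<or> y1 \<mu> \<noteq> 0"
      using at_R(1)[OF \<mu>] sol_lincomb(1)[OF cont[OF \<mu>] R, of "y0 \<mu>" "y1 \<mu>"] by auto
    show "decaying (sol (q \<mu>) (y0 \<mu>) (y1 \<mu>)) (dsol (q \<mu>) (y0 \<mu>) (y1 \<mu>))"
    proof (rule decayingI[OF sy R c good[OF \<mu>]])
      fix s assume s: "R \<le> s"
      note sh = is_sol_shift[OF sy R]
      have eq: "sol (q \<mu>) (y0 \<mu>) (y1 \<mu>) (R + t) = sol (p \<mu>) 1 (m \<mu>) t"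
        "dsol (q \<mu>) (y0 \<mu>) (y1 \<mu>) (R + t) = dsol (p \<mu>) 1 (m \<mu>) t" if "t \<ge> 0" for t
        using is_sol_eq_sol[OF sh contp[OF \<mu>, unfolded p_def[abs_def]] that] at_R[OF \<mu>]
        by (auto simp: p_def[abs_def])
      have "energy_flux \<omega> (sol (p \<mu>) 1 (m \<mu>)) (dsol (p \<mu>) 1 (m \<mu>)) (s - R) \<le> 0"
        by (rule decaying_flux_nonpos[OF is_sol_sol[OF contp[OF \<mu>]] m(2)[OF \<mu>], where ?s0.0 = 0])
           (use c good[OF \<mu>] s R in \<open>auto simp: p_def intro: order_trans[of 0 c]\<close>)
      then show "energy_flux \<omega> (sol (q \<mu>) (y0 \<mu>) (y1 \<mu>)) (dsol (q \<mu>) (y0 \<mu>) (y1 \<mu>)) s \<le> 0"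
        using eq[of "s - R"] s by (simp add: energy_flux_def)
    qed
  next
    have "m holomorphic_on U" by (rule m(1))
    then show "(\<lambda>\<mu>. dsol (q \<mu>) (y0 \<mu>) (y1 \<mu>) R) holomorphic_on U"
      by (rule holomorphic_transform) (simp add: at_R)
  qed
qed

section \<open>The rotated potentials\<close>

lemma norm_powr_of_real:
  fixes w :: complex
  assumes "\<alpha> > (0::real)"
  shows "norm (w powr of_real \<alpha>) = norm w powr \<alpha>"
  by (cases "w = 0") (auto simp: powr_def norm_exp_eq_Re Re_Ln)

text \<open>Adding a nonnegative real number turns t cis \<phi> towards the positive axis: the signs
  of Im w and of Im(w cis(-\<phi>)) place the argument between 0 and \<phi>, and projecting w onto
  the direction cis \<phi> gives |w| \<ge> t.\<close>

lemma Arg_of_shifted_ray: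
  fixes x t :: real
  assumes x: "x \<ge> 0" and t: "t > 0" and \<phi>: "\<bar>\<phi>\<bar> < pi / 2"
  defines "w \<equiv> of_real x + of_real t * cis \<phi>"
  shows "Re w > 0" "norm w \<ge> t" "0 \<le> \<phi> \<Longrightarrow> 0 \<le> Im (Ln w) \<and> Im (Ln w) \<le> \<phi>"
    "\<phi> \<le> 0 \<Longrightarrow> \<phi> \<le> Im (Ln w) \<and> Im (Ln w) \<le> 0"
proof -
  have cp: "cos \<phi> > 0" using \<phi> by (intro cos_gt_zero_pi) auto
  show Re: "Re w > 0" using x t cp by (simp add: w_def add_nonneg_pos)
  then have nz: "w \<noteq> 0" by auto
  have "w * cis (- \<phi>) = of_real x * cis (- \<phi>) + of_real t"
    by (simp add: w_def distrib_right cis_mult mult.assoc)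
  then have "Re (w * cis (- \<phi>)) = x * cos \<phi> + t" by simp
  then have "x * cos \<phi> + t \<le> norm (w * cis (- \<phi>))" using complex_Re_le_cmod by metis
  then have "x * cos \<phi> + t \<le> norm w" by (simp add: norm_mult)
  moreover have "x * cos \<phi> \<ge> 0" using x cp by simp
  ultimately show "norm w \<ge> t" by linarith
  define \<theta> where "\<theta> = Im (Ln w)"
  have \<theta>: "\<bar>\<theta>\<bar> < pi / 2" using Re Re_Ln_pos_lt[OF nz] by (simp add: \<theta>_def)
  define r where "r = exp (Re (Ln w))"
  have w: "w = of_real r * cis \<theta>" using exp_Ln[OF nz] by (simp add: r_def \<theta>_def exp_eq_polar)
  have r: "r > 0" by (simp add: r_def)
  have im: "r * sin \<theta> = t * sin \<phi>" using arg_cong[OF w, of Im] by (simp add: w_def)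
  have re: "r * cos \<theta> = x + t * cos \<phi>" using arg_cong[OF w, of Re] by (simp add: w_def)
  have "r * sin (\<theta> - \<phi>) = (r * sin \<theta>) * cos \<phi> - (r * cos \<theta>) * sin \<phi>"
    by (simp add: sin_diff algebra_simps)
  then have dif: "r * sin (\<theta> - \<phi>) = - x * sin \<phi>" unfolding im re by (simp add: algebra_simps)
  show "0 \<le> Im (Ln w) \<and> Im (Ln w) \<le> \<phi>" if "0 \<le> \<phi>"
  proof -
    have s: "sin \<phi> \<ge> 0" using that \<phi> by (intro sin_ge_zero) auto
    have "\<theta> \<ge> 0"
    proof (rule ccontr)
      assume "\<not> \<theta> \<ge> 0"
      then have "sin \<theta> < 0" using \<theta> sin_gt_zero[of "- \<theta>"] by auto
      then have "r * sin \<theta> < 0" using r by (simp add: mult_pos_neg)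
      moreover have "t * sin \<phi> \<ge> 0" using t s by simp
      ultimately show False using im by linarith
    qed
    moreover have "\<theta> \<le> \<phi>"
    proof (rule ccontr)
      assume "\<not> \<theta> \<le> \<phi>"
      then have "sin (\<theta> - \<phi>) > 0" using \<theta> \<phi> that by (intro sin_gt_zero) auto
      then have "r * sin (\<theta> - \<phi>) > 0" using r by simp
      moreover have "- x * sin \<phi> \<le> 0" using x s by simp
      ultimately show False using dif by linarith
    qed
    ultimately show ?thesis by (simp add: \<theta>_def)
  qed
  show "\<phi> \<le> Im (Ln w) \<and> Im (Ln w) \<le> 0" if "\<phi> \<le> 0"
  proof -
    have s: "sin \<phi> \<le> 0" using that \<phi> sin_ge_zero[of "-\<phi>"] by auto
    have "\<theta> \<le> 0"
    proof (rule ccontr)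
      assume "\<not> \<theta> \<le> 0"
      then have "sin \<theta> > 0" using \<theta> by (intro sin_gt_zero) auto
      then have "r * sin \<theta> > 0" using r by simp
      moreover have "t * sin \<phi> \<le> 0" using t s by (simp add: mult_nonneg_nonpos)
      ultimately show False using im by linarith
    qed
    moreover have "\<phi> \<le> \<theta>"
    proof (rule ccontr)
      assume "\<not> \<phi> \<le> \<theta>"
      then have "sin (\<phi> - \<theta>) > 0" using \<theta> \<phi> that by (intro sin_gt_zero) auto
      then have "r * sin (\<phi> - \<theta>) > 0" using r by simp
      moreover have "r * sin (\<phi> - \<theta>) = x * sin \<phi>" using dif sin_minus[of "\<theta> - \<phi>"] by simp
      moreover have "x * sin \<phi> \<le> 0" using x s by (simp add: mult_nonneg_nonpos)
      ultimately show False by linarith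
    qed
    ultimately show ?thesis by (simp add: \<theta>_def)
  qed
qed

text \<open>The potential of the equation \<open>-y'' + (\<i> x\<^sup>\<alpha> - \<mu>) y = 0\<close> along the ray \<open>x = x\<^sub>1 + e\<^sup>\<zeta> s\<close>, \<open>s \<ge> 0\<close>.\<close>

definition pot :: "real \<Rightarrow> real \<Rightarrow> complex \<Rightarrow> complex \<Rightarrow> real \<Rightarrow> complex" where
  "pot \<alpha> x\<^sub>1 \<mu> \<zeta> s =
     exp \<zeta> ^ 2 * (\<i> * (of_real x\<^sub>1 + exp \<zeta> * of_real s) powr (of_real \<alpha>) - \<mu>)"

text \<open>On this strip the leading term of the potential stays in the half plane in which
  \<open>\<omega> = 1 + \<i>\<close> detects decay.\<close>

definition strip :: "real \<Rightarrow> complex set" where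
  "strip \<alpha> = {\<zeta>. - 3 * pi / 4 < (2 + \<alpha>) * Im \<zeta> \<and> (2 + \<alpha>) * Im \<zeta> < pi / 4}"

lemma exp_polar_real: "exp \<zeta> = of_real (exp (Re \<zeta>)) * cis (Im \<zeta>)"
  by (simp add: exp_eq_polar)

context
  fixes \<alpha> :: real
  assumes \<alpha>: "\<alpha> > 0"
begin

lemma strip_imp: assumes "\<zeta> \<in> strip \<alpha>" shows "\<bar>Im \<zeta>\<bar> < pi / 2"
proof -
  have "(2 + \<alpha>) * \<bar>Im \<zeta>\<bar> < 3 * pi / 4" using assms \<alpha> by (auto simp: strip_def abs_if)
  moreover have "2 * \<bar>Im \<zeta>\<bar> \<le> (2 + \<alpha>) * \<bar>Im \<zeta>\<bar>" using \<alpha> by (intro mult_right_mono) auto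
  ultimately show ?thesis using pi_gt_zero by linarith
qed

lemma zero_in_strip: "of_real r \<in> strip \<alpha>"
  by (simp add: strip_def)

lemma convex_strip: "convex (strip \<alpha>)"
proof -
  have "strip \<alpha> = {\<zeta>. - 3 * pi / 4 / (2 + \<alpha>) < Im \<zeta>} \<inter> {\<zeta>. Im \<zeta> < pi / 4 / (2 + \<alpha>)}"
    using \<alpha> by (auto simp: strip_def field_simps)
  then show ?thesis by (simp add: convex_Int convex_halfspace_Im_gt convex_halfspace_Im_lt)
qed

lemma ray_Re_nonneg:
  assumes "x\<^sub>1 \<ge> 0" "\<bar>Im \<zeta>\<bar> < pi / 2" "s \<ge> 0"
  shows "Re (of_real x\<^sub>1 + exp \<zeta> * of_real s) \<ge> 0" "s > 0 \<Longrightarrow> Re (of_real x\<^sub>1 + exp \<zeta> * of_real s) > 0"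
    "x\<^sub>1 > 0 \<Longrightarrow> Re (of_real x\<^sub>1 + exp \<zeta> * of_real s) > 0"
proof -
  have cp: "cos (Im \<zeta>) > 0" using assms by (intro cos_gt_zero_pi) auto
  have 1: "Re (of_real x\<^sub>1 + exp \<zeta> * of_real s) = x\<^sub>1 + exp (Re \<zeta>) * cos (Im \<zeta>) * s"
    by (simp add: Re_exp)
  show "Re (of_real x\<^sub>1 + exp \<zeta> * of_real s) \<ge> 0" "s > 0 \<Longrightarrow> Re (of_real x\<^sub>1 + exp \<zeta> * of_real s) > 0"
    "x\<^sub>1 > 0 \<Longrightarrow> Re (of_real x\<^sub>1 + exp \<zeta> * of_real s) > 0"
    unfolding 1 using assms cp by (auto intro: add_nonneg_nonneg add_nonneg_pos add_pos_nonneg)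
qed

lemma pot_continuous:
  assumes "x\<^sub>1 \<ge> 0" "\<bar>Im \<zeta>\<bar> < pi / 2"
  shows "continuous_on {0..} (pot \<alpha> x\<^sub>1 \<mu> \<zeta>)"
proof -
  have "continuous_on {0..} (\<lambda>s. (of_real x\<^sub>1 + exp \<zeta> * of_real s) powr (of_real \<alpha> :: complex))"
  proof (rule continuous_on_powr_complex)
    show "{0..} \<subseteq> {s. Re (of_real x\<^sub>1 + exp \<zeta> * of_real s) \<ge> 0 \<or> Im (of_real x\<^sub>1 + exp \<zeta> * of_real s) \<noteq> 0}"
      using ray_Re_nonneg(1)[OF assms] by blast
  qed (use \<alpha> in \<open>auto intro!: continuous_intros\<close>)
  from continuous_on_mult[OF continuous_on_const continuous_on_diff[OF continuous_on_mult[OF continuous_on_const this] continuous_on_const]]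
  show ?thesis unfolding pot_def .
qed

lemma pot_holomorphic:
  assumes "x\<^sub>1 \<ge> 0" "s \<ge> 0"
  shows "(\<lambda>\<zeta>. pot \<alpha> x\<^sub>1 \<mu> \<zeta> s) holomorphic_on {\<zeta>. \<bar>Im \<zeta>\<bar> < pi / 2}"
    "(\<lambda>\<mu>. pot \<alpha> x\<^sub>1 \<mu> \<zeta> s) holomorphic_on A"
proof -
  show "(\<lambda>\<mu>. pot \<alpha> x\<^sub>1 \<mu> \<zeta> s) holomorphic_on A" unfolding pot_def by (intro holomorphic_intros)
  show "(\<lambda>\<zeta>. pot \<alpha> x\<^sub>1 \<mu> \<zeta> s) holomorphic_on {\<zeta>. \<bar>Im \<zeta>\<bar> < pi / 2}"
  proof (cases "x\<^sub>1 = 0 \<and> s = 0")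
    case True
    then show ?thesis unfolding pot_def by (auto intro!: holomorphic_intros)
  next
    case False
    have "of_real x\<^sub>1 + exp \<zeta> * of_real s \<notin> \<real>\<^sub>\<le>\<^sub>0" if "\<bar>Im \<zeta>\<bar> < pi / 2" for \<zeta>
      using ray_Re_nonneg(2,3)[OF assms(1) that assms(2)] False assms by (auto simp: complex_nonpos_Reals_iff)
    then show ?thesis unfolding pot_def by (intro holomorphic_intros) auto
  qed
qed

lemma norm_pot_le:
  assumes "x\<^sub>1 \<ge> 0" "s \<ge> 0"
  shows "norm (pot \<alpha> x\<^sub>1 \<mu> \<zeta> s) \<le> exp (Re \<zeta>) ^ 2 * ((x\<^sub>1 + exp (Re \<zeta>) * s) powr \<alpha> + norm \<mu>)"
proof -
  have "norm (of_real x\<^sub>1 + exp \<zeta> * of_real s) \<le> x\<^sub>1 + exp (Re \<zeta>) * s"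
    using norm_triangle_ineq[of "of_real x\<^sub>1" "exp \<zeta> * of_real s"] assms by (simp add: norm_mult norm_exp_eq_Re)
  then have "norm ((of_real x\<^sub>1 + exp \<zeta> * of_real s) powr (of_real \<alpha>)) \<le> (x\<^sub>1 + exp (Re \<zeta>) * s) powr \<alpha>"
    using \<alpha> by (simp add: norm_powr_of_real powr_mono2)
  then have "norm (\<i> * (of_real x\<^sub>1 + exp \<zeta> * of_real s) powr (of_real \<alpha>) - \<mu>) \<le> (x\<^sub>1 + exp (Re \<zeta>) * s) powr \<alpha> + norm \<mu>"
    by (intro order_trans[OF norm_triangle_ineq4]) (simp add: norm_mult)
  then show ?thesis unfolding pot_def norm_mult norm_power norm_exp_eq_Re by (intro mult_left_mono) auto
qed

text \<open>Let \<theta> be the argument of the point x1 + exp \<zeta> s and \<phi> = Im \<zeta>.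
  The leading term of cnj(1 + \<i>) times the potential has argument pi/4 + 2 \<phi> + \<alpha>
  \<theta>. Since \<theta> lies between 0 and \<phi>, this lies between pi/4 + 2 \<phi> and pi/4 +
  (2 + \<alpha>) \<phi>, and the bounds defining \<open>strip\<close> are those that keep the latter
  inside (-pi/2, pi/2). The term with \<mu> is dominated once s is large.\<close>

lemma pot_good:
  assumes x: "x\<^sub>1 \<ge> 0" and \<delta>: "0 < \<delta>" "\<delta> \<le> pi / 4"
    and \<zeta>: "- 3 * pi / 4 + \<delta> \<le> (2 + \<alpha>) * Im \<zeta>" "(2 + \<alpha>) * Im \<zeta> \<le> pi / 4 - \<delta>"
    and r0: "r0 \<le> Re \<zeta>" and L: "norm \<mu> \<le> L" and s: "s > 0" "sin \<delta> * (exp r0 * s) powr \<alpha> \<ge> L + 1"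
  shows "exp r0 ^ 2 \<le> Re (cnj (1 + \<i>) * pot \<alpha> x\<^sub>1 \<mu> \<zeta> s)"
proof -
  define \<phi> where "\<phi> = Im \<zeta>"
  define t where "t = exp (Re \<zeta>) * s"
  define w where "w = of_real x\<^sub>1 + of_real t * cis \<phi>"
  have "\<zeta> \<in> strip \<alpha>" using \<zeta> \<delta> by (auto simp: strip_def)
  then have \<phi>: "\<bar>\<phi>\<bar> < pi / 2" using strip_imp by (simp add: \<phi>_def)
  have t: "t > 0" using s by (simp add: t_def)
  note A = Arg_of_shifted_ray[OF x t \<phi>, folded w_def]
  have weq: "of_real x\<^sub>1 + exp \<zeta> * of_real s = w" by (simp add: w_def t_def \<phi>_def exp_polar_real[of \<zeta>] mult_ac)
  have wnz: "w \<noteq> 0" using A(1) by auto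
  define \<theta> where "\<theta> = Im (Ln w)"
  define \<beta> where "\<beta> = pi / 4 + 2 * \<phi> + \<alpha> * \<theta>"
  have sd: "sin \<delta> > 0" using \<delta> by (intro sin_gt_zero) auto
  have \<beta>: "\<bar>\<beta>\<bar> \<le> pi / 2 - \<delta>"
  proof (cases "\<phi> \<ge> 0")
    case True
    then have "0 \<le> \<alpha> * \<theta>" "\<alpha> * \<theta> \<le> \<alpha> * \<phi>" using A(3) \<alpha> by (auto simp: \<theta>_def)
    moreover have "(2 + \<alpha>) * \<phi> \<le> pi / 4 - \<delta>" using \<zeta> by (simp add: \<phi>_def)
    ultimately show ?thesis using True \<delta> pi_gt_zero unfolding \<beta>_def abs_le_iff distrib_right by linarith
  next
    case False
    then have "\<alpha> * \<theta> \<le> 0" "\<alpha> * \<phi> \<le> \<alpha> * \<theta>" using A(4) \<alpha> by (auto simp: \<theta>_def mult_nonneg_nonpos)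
    moreover have "(2 + \<alpha>) * \<phi> \<ge> - 3 * pi / 4 + \<delta>" using \<zeta> by (simp add: \<phi>_def)
    ultimately show ?thesis using False \<delta> pi_gt_zero unfolding \<beta>_def abs_le_iff distrib_right by linarith
  qed
  have cb: "cos \<beta> \<ge> sin \<delta>"
  proof -
    have "sin \<delta> = cos (pi / 2 - \<delta>)" by (simp add: cos_diff)
    also have "\<dots> \<le> cos \<bar>\<beta>\<bar>" by (rule cos_monotone_0_pi_le) (use \<beta> \<delta> in auto)
    finally show ?thesis by simp
  qed
  define N where "N = norm w powr \<alpha>"
  have wp: "w powr of_real \<alpha> = of_real N * cis (\<alpha> * \<theta>)"
  proof -
    have "w powr of_real \<alpha> = exp (of_real \<alpha> * Ln w)" using wnz by (simp add: powr_def)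
    also have "\<dots> = of_real (exp (\<alpha> * Re (Ln w))) * cis (\<alpha> * \<theta>)" by (simp add: exp_eq_polar \<theta>_def)
    also have "exp (\<alpha> * Re (Ln w)) = N" using wnz by (simp add: N_def powr_def Re_Ln)
    finally show ?thesis .
  qed
  define E where "E = exp (Re \<zeta>) ^ 2"
  have e2: "exp \<zeta> ^ 2 = of_real E * cis (2 * \<phi>)"
    unfolding exp_polar_real[of \<zeta>] power_mult_distrib by (simp add: E_def \<phi>_def power2_eq_square cis_mult)
  have oi: "cnj (1 + \<i>) * \<i> = of_real (sqrt 2) * cis (pi / 4)"
    by (simp add: complex_eq_iff cos_45 sin_45)
  have "cnj (1 + \<i>) * pot \<alpha> x\<^sub>1 \<mu> \<zeta> s = (cnj (1 + \<i>) * \<i>) * (exp \<zeta> ^ 2 * w powr of_real \<alpha>) - cnj (1 + \<i>) * (exp \<zeta> ^ 2 * \<mu>)"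
    unfolding pot_def weq by (simp add: algebra_simps)
  also have "(cnj (1 + \<i>) * \<i>) * (exp \<zeta> ^ 2 * w powr of_real \<alpha>) = of_real (sqrt 2 * E * N) * (cis (pi / 4) * cis (2 * \<phi>) * cis (\<alpha> * \<theta>))"
    unfolding oi e2 wp by (simp only: of_real_mult mult_ac)
  also have "cis (pi / 4) * cis (2 * \<phi>) * cis (\<alpha> * \<theta>) = cis \<beta>" by (simp add: cis_mult \<beta>_def)
  finally have eq: "Re (cnj (1 + \<i>) * pot \<alpha> x\<^sub>1 \<mu> \<zeta> s) = sqrt 2 * E * N * cos \<beta> - Re (cnj (1 + \<i>) * (exp \<zeta> ^ 2 * \<mu>))"
    by simp
  have "Re (cnj (1 + \<i>) * (exp \<zeta> ^ 2 * \<mu>)) \<le> norm (cnj (1 + \<i>) * (exp \<zeta> ^ 2 * \<mu>))" by (rule complex_Re_le_cmod)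
  also have "\<dots> = sqrt 2 * E * norm \<mu>"
  proof -
    have "norm (cnj (1 + \<i>)) = sqrt 2" by (simp add: cmod_def)
    then show ?thesis by (simp only: norm_mult norm_power norm_exp_eq_Re E_def mult.assoc)
  qed
  finally have b2: "Re (cnj (1 + \<i>) * (exp \<zeta> ^ 2 * \<mu>)) \<le> sqrt 2 * E * norm \<mu>" .
  have E0: "E > 0" by (simp add: E_def)
  have "L + 1 \<le> sin \<delta> * (exp r0 * s) powr \<alpha>" by (rule s(2))
  also have "\<dots> \<le> cos \<beta> * N"
  proof (rule mult_mono[OF cb])
    have "exp r0 * s \<le> norm w" using A(2) r0 s unfolding t_def
      by (meson exp_le_cancel_iff less_imp_le mult_right_mono order_trans)
    then show "(exp r0 * s) powr \<alpha> \<le> N" unfolding N_def using \<alpha> s by (intro powr_mono2) auto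
  qed (use sd cb in auto)
  finally have "1 \<le> N * cos \<beta> - norm \<mu>" using L by (simp add: mult.commute)
  then have "sqrt 2 * E * 1 \<le> sqrt 2 * E * (N * cos \<beta> - norm \<mu>)" using E0 by (intro mult_left_mono) auto
  also have "\<dots> \<le> Re (cnj (1 + \<i>) * pot \<alpha> x\<^sub>1 \<mu> \<zeta> s)" using eq b2 by (simp add: algebra_simps)
  finally have "sqrt 2 * E \<le> Re (cnj (1 + \<i>) * pot \<alpha> x\<^sub>1 \<mu> \<zeta> s)" by simp
  moreover have "exp r0 ^ 2 \<le> E" unfolding E_def using r0 by (intro power_mono) auto
  moreover have "1 * E \<le> sqrt 2 * E" using E0 by (intro mult_right_mono) auto
  ultimately show ?thesis by linarith
qed

lemma pot_good_eventually:
  assumes x: "x\<^sub>1 \<ge> 0" and \<delta>: "0 < \<delta>" "\<delta> \<le> pi / 4"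
  obtains R c where "R \<ge> 0" "c > 0" "c \<le> 1"
    "\<And>\<zeta> \<mu> s. - 3 * pi / 4 + \<delta> \<le> (2 + \<alpha>) * Im \<zeta> \<Longrightarrow> (2 + \<alpha>) * Im \<zeta> \<le> pi / 4 - \<delta> \<Longrightarrow> r0 \<le> Re \<zeta> \<Longrightarrow>
      norm \<mu> \<le> L \<Longrightarrow> s \<ge> R \<Longrightarrow> c \<le> Re (cnj (1 + \<i>) * pot \<alpha> x\<^sub>1 \<mu> \<zeta> s)"
proof -
  have sd: "sin \<delta> > 0" using \<delta> by (intro sin_gt_zero) auto
  define R where "R = exp (- r0) * max 1 (((\<bar>L\<bar> + 1) / sin \<delta>) powr (1 / \<alpha>))"
  define c where "c = min 1 (exp r0 ^ 2)"
  have big: "sin \<delta> * (exp r0 * s) powr \<alpha> \<ge> L + 1" "s > 0" if "s \<ge> R" for s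
  proof -
    have R: "R > 0" by (simp add: R_def)
    then show "s > 0" using that by simp
    have "((\<bar>L\<bar> + 1) / sin \<delta>) powr (1 / \<alpha>) \<le> exp r0 * R" by (simp add: R_def mult_exp_exp flip: mult.assoc)
    also have "\<dots> \<le> exp r0 * s" using that by simp
    finally have "(((\<bar>L\<bar> + 1) / sin \<delta>) powr (1 / \<alpha>)) powr \<alpha> \<le> (exp r0 * s) powr \<alpha>"
      using \<alpha> by (intro powr_mono2) auto
    then have "(\<bar>L\<bar> + 1) / sin \<delta> \<le> (exp r0 * s) powr \<alpha>" using \<alpha> sd by (simp add: powr_powr)
    then show "sin \<delta> * (exp r0 * s) powr \<alpha> \<ge> L + 1" using sd by (simp add: field_simps)
  qed
  show thesis
  proof (rule that[of R c])
    fix \<zeta> \<mu> :: complex and s :: real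
    assume "- 3 * pi / 4 + \<delta> \<le> (2 + \<alpha>) * Im \<zeta>" "(2 + \<alpha>) * Im \<zeta> \<le> pi / 4 - \<delta>" "r0 \<le> Re \<zeta>" "norm \<mu> \<le> L" "R \<le> s"
    from pot_good[OF x \<delta> this(1-4) big(2)[OF this(5)] big(1)[OF this(5)]]
    show "c \<le> Re (cnj (1 + \<i>) * pot \<alpha> x\<^sub>1 \<mu> \<zeta> s)" by (simp add: c_def)
  qed (auto simp: R_def c_def)
qed

text \<open>The data are the value and the slope with respect to the parameter s. The slope with
  respect to x is b / exp \<zeta>, which explains the factor exp \<zeta> whenever a ray is
  turned.\<close>

definition dec_data :: "real \<Rightarrow> complex \<Rightarrow> complex \<Rightarrow> complex \<Rightarrow> complex \<Rightarrow> bool" where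
  "dec_data x\<^sub>1 \<mu> \<zeta> a b \<longleftrightarrow> decaying (sol (pot \<alpha> x\<^sub>1 \<mu> \<zeta>) a b) (dsol (pot \<alpha> x\<^sub>1 \<mu> \<zeta>) a b)"

lemma strip_good:
  assumes x: "x\<^sub>1 \<ge> 0" and \<zeta>: "\<zeta> \<in> strip \<alpha>"
  obtains R c where "R \<ge> 0" "c > 0" "c \<le> 1" "\<And>s. s \<ge> R \<Longrightarrow> c \<le> Re (cnj (1 + \<i>) * pot \<alpha> x\<^sub>1 \<mu> \<zeta> s)"
proof -
  define \<delta> where "\<delta> = min (pi / 4) (min ((2 + \<alpha>) * Im \<zeta> + 3 * pi / 4) (pi / 4 - (2 + \<alpha>) * Im \<zeta>))"
  have \<delta>: "0 < \<delta>" "\<delta> \<le> pi / 4" "- 3 * pi / 4 + \<delta> \<le> (2 + \<alpha>) * Im \<zeta>" "(2 + \<alpha>) * Im \<zeta> \<le> pi / 4 - \<delta>"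
  proof -
    have "\<delta> \<le> (2 + \<alpha>) * Im \<zeta> + 3 * pi / 4" "\<delta> \<le> pi / 4 - (2 + \<alpha>) * Im \<zeta>" "\<delta> \<le> pi / 4"
      unfolding \<delta>_def by (meson min.cobounded1 min.cobounded2 order_trans)+
    then show "\<delta> \<le> pi / 4" "- 3 * pi / 4 + \<delta> \<le> (2 + \<alpha>) * Im \<zeta>" "(2 + \<alpha>) * Im \<zeta> \<le> pi / 4 - \<delta>" by linarith+
    show "0 < \<delta>" using \<zeta> pi_gt_zero unfolding \<delta>_def strip_def min_less_iff_conj by auto
  qed
  from pot_good_eventually[OF x \<delta>(1,2), of "Re \<zeta>" "norm \<mu>"] \<delta>(3,4) that show thesis
    by (metis order_refl)
qed

lemma dec_data_unique:
  assumes x: "x\<^sub>1 \<ge> 0" and \<zeta>: "\<zeta> \<in> strip \<alpha>" and d: "dec_data x\<^sub>1 \<mu> \<zeta> a b" "dec_data x\<^sub>1 \<mu> \<zeta> a' b'"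
  shows "a * b' = b * a'"
proof -
  note q = pot_continuous[OF x strip_imp[OF \<zeta>], of \<mu>]
  obtain R c where R: "R \<ge> 0" "c > 0" "\<And>s. s \<ge> R \<Longrightarrow> c \<le> Re (cnj (1 + \<i>) * pot \<alpha> x\<^sub>1 \<mu> \<zeta> s)"
    using strip_good[OF x \<zeta>] by metis
  have "0 \<le> Re (cnj (1 + \<i>) * pot \<alpha> x\<^sub>1 \<mu> \<zeta> s)" if "s \<ge> R" for s using R(3)[OF that] R(2) by linarith
  from decaying_unique[OF is_sol_sol[OF q] is_sol_sol[OF q] d[unfolded dec_data_def] q R(1) _ this]
  show ?thesis by (simp add: sol_0'[OF q])
qed

lemma dec_data_scale:
  assumes x: "x\<^sub>1 \<ge> 0" and \<zeta>: "\<zeta> \<in> strip \<alpha>" and d: "dec_data x\<^sub>1 \<mu> \<zeta> a b"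
  shows "dec_data x\<^sub>1 \<mu> \<zeta> (k * a) (k * b)"
proof -
  note q = pot_continuous[OF x strip_imp[OF \<zeta>], of \<mu>]
  note S = is_sol_sol[OF q]
  have dec: "decaying (\<lambda>s. k * sol (pot \<alpha> x\<^sub>1 \<mu> \<zeta>) a b s + 0 * sol (pot \<alpha> x\<^sub>1 \<mu> \<zeta>) a b s)
    (\<lambda>s. k * dsol (pot \<alpha> x\<^sub>1 \<mu> \<zeta>) a b s + 0 * dsol (pot \<alpha> x\<^sub>1 \<mu> \<zeta>) a b s)"
    by (rule decaying_lincomb[OF S S]) (use d in \<open>simp_all add: dec_data_def\<close>)
  have "sol (pot \<alpha> x\<^sub>1 \<mu> \<zeta>) (k * a) (k * b) s = k * sol (pot \<alpha> x\<^sub>1 \<mu> \<zeta>) a b s"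
    "dsol (pot \<alpha> x\<^sub>1 \<mu> \<zeta>) (k * a) (k * b) s = k * dsol (pot \<alpha> x\<^sub>1 \<mu> \<zeta>) a b s" if "s \<ge> 0" for s
    unfolding sol_lincomb[OF q that, of "k * a" "k * b"] sol_lincomb[OF q that, of a b] by (simp_all add: algebra_simps)
  then have "integrable half_line (\<lambda>s. (norm (sol (pot \<alpha> x\<^sub>1 \<mu> \<zeta>) (k * a) (k * b) s))\<^sup>2 + (norm (dsol (pot \<alpha> x\<^sub>1 \<mu> \<zeta>) (k * a) (k * b) s))\<^sup>2)
    \<longleftrightarrow> integrable half_line (\<lambda>s. (norm (k * sol (pot \<alpha> x\<^sub>1 \<mu> \<zeta>) a b s))\<^sup>2 + (norm (k * dsol (pot \<alpha> x\<^sub>1 \<mu> \<zeta>) a b s))\<^sup>2)"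
    by (intro Bochner_Integration.integrable_cong) auto
  then show ?thesis using dec by (simp add: dec_data_def decaying_def)
qed

lemma dec_data_prop:
  assumes x: "x\<^sub>1 \<ge> 0" and \<zeta>: "\<zeta> \<in> strip \<alpha>" and d: "dec_data x\<^sub>1 \<mu> \<zeta> a b"
    and nz: "a \<noteq> 0 \<or> b \<noteq> 0" and eq: "a * b' = b * a'"
  shows "dec_data x\<^sub>1 \<mu> \<zeta> a' b'"
proof (cases "a = 0")
  case True
  then have "b \<noteq> 0" "a' = 0" using nz eq by auto
  then show ?thesis using dec_data_scale[OF x \<zeta> d, of "b' / b"] True by simp
next
  case False
  then have "b' = a' / a * b" using eq by (simp add: field_simps)
  then show ?thesis using dec_data_scale[OF x \<zeta> d, of "a' / a"] False by simp
qed

text \<open>A nowhere vanishing holomorphic choice of decaying data near \<zeta>: the point beyond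
  which the potential is accretive can be fixed uniformly on a small ball inside the strip.\<close>

lemma dec_data_near_zeta:
  assumes x: "x\<^sub>1 \<ge> 0" and \<zeta>0: "\<zeta>\<^sub>0 \<in> strip \<alpha>"
  obtains r y0 y1 where "r > 0" "ball \<zeta>\<^sub>0 r \<subseteq> strip \<alpha>" "y0 holomorphic_on ball \<zeta>\<^sub>0 r" "y1 holomorphic_on ball \<zeta>\<^sub>0 r"
    "\<And>\<zeta>. \<zeta> \<in> ball \<zeta>\<^sub>0 r \<Longrightarrow> y0 \<zeta> \<noteq> 0 \<or> y1 \<zeta> \<noteq> 0"
    "\<And>\<zeta>. \<zeta> \<in> ball \<zeta>\<^sub>0 r \<Longrightarrow> dec_data x\<^sub>1 \<mu> \<zeta> (y0 \<zeta>) (y1 \<zeta>)"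
proof -
  \<comment> \<open>Half the margin of the centre inside the strip (capped at pi/8), so that every
    point of the ball keeps a margin of at least \<delta>.\<close>
  define \<delta> where "\<delta> = min (pi / 4) (min ((2 + \<alpha>) * Im \<zeta>\<^sub>0 + 3 * pi / 4) (pi / 4 - (2 + \<alpha>) * Im \<zeta>\<^sub>0)) / 2"
  have \<delta>: "0 < \<delta>" "\<delta> \<le> pi / 4" "- 3 * pi / 4 + 2 * \<delta> \<le> (2 + \<alpha>) * Im \<zeta>\<^sub>0" "(2 + \<alpha>) * Im \<zeta>\<^sub>0 \<le> pi / 4 - 2 * \<delta>"
  proof -
    have "2 * \<delta> \<le> (2 + \<alpha>) * Im \<zeta>\<^sub>0 + 3 * pi / 4" "2 * \<delta> \<le> pi / 4 - (2 + \<alpha>) * Im \<zeta>\<^sub>0" "2 * \<delta> \<le> pi / 4"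
    proof -
      have "2 * \<delta> = min (pi / 4) (min ((2 + \<alpha>) * Im \<zeta>\<^sub>0 + 3 * pi / 4) (pi / 4 - (2 + \<alpha>) * Im \<zeta>\<^sub>0))"
        by (simp add: \<delta>_def)
      then show "2 * \<delta> \<le> (2 + \<alpha>) * Im \<zeta>\<^sub>0 + 3 * pi / 4" "2 * \<delta> \<le> pi / 4 - (2 + \<alpha>) * Im \<zeta>\<^sub>0" "2 * \<delta> \<le> pi / 4"
        by (simp_all only: min.cobounded1 min.cobounded2 min.coboundedI2)
    qed
    then show "\<delta> \<le> pi / 4" "- 3 * pi / 4 + 2 * \<delta> \<le> (2 + \<alpha>) * Im \<zeta>\<^sub>0" "(2 + \<alpha>) * Im \<zeta>\<^sub>0 \<le> pi / 4 - 2 * \<delta>"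
      using pi_gt_zero by linarith+
    show "0 < \<delta>" using \<zeta>0 pi_gt_zero unfolding \<delta>_def strip_def by auto
  qed
  define r where "r = min 1 (\<delta> / (2 + \<alpha>))"
  have r: "r > 0" using \<delta> \<alpha> by (simp add: r_def)
  have near: "- 3 * pi / 4 + \<delta> \<le> (2 + \<alpha>) * Im \<zeta>" "(2 + \<alpha>) * Im \<zeta> \<le> pi / 4 - \<delta>" "Re \<zeta>\<^sub>0 - 1 \<le> Re \<zeta>" "Re \<zeta> \<le> Re \<zeta>\<^sub>0 + 1"
    if "\<zeta> \<in> ball \<zeta>\<^sub>0 r" for \<zeta>
  proof -
    have d: "norm (\<zeta>\<^sub>0 - \<zeta>) < r" using that by (simp add: dist_norm)
    have "\<bar>Im \<zeta>\<^sub>0 - Im \<zeta>\<bar> \<le> \<delta> / (2 + \<alpha>)" using abs_Im_le_cmod[of "\<zeta>\<^sub>0 - \<zeta>"] d by (simp add: r_def)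
    then have "(2 + \<alpha>) * \<bar>Im \<zeta>\<^sub>0 - Im \<zeta>\<bar> \<le> \<delta>" using \<alpha> by (simp add: field_simps)
    then have "\<bar>(2 + \<alpha>) * (Im \<zeta>\<^sub>0 - Im \<zeta>)\<bar> \<le> \<delta>" using \<alpha> by (simp add: abs_mult)
    then show "- 3 * pi / 4 + \<delta> \<le> (2 + \<alpha>) * Im \<zeta>" "(2 + \<alpha>) * Im \<zeta> \<le> pi / 4 - \<delta>"
      using \<delta>(3,4) by (auto simp: right_diff_distrib abs_le_iff)
    show "Re \<zeta>\<^sub>0 - 1 \<le> Re \<zeta>" "Re \<zeta> \<le> Re \<zeta>\<^sub>0 + 1"
      using abs_Re_le_cmod[of "\<zeta>\<^sub>0 - \<zeta>"] d by (auto simp: r_def)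
  qed
  have sub: "ball \<zeta>\<^sub>0 r \<subseteq> strip \<alpha>" using near(1,2) \<delta>(1) by (fastforce simp: strip_def)
  obtain R c where R: "R \<ge> 0" "c > 0" "c \<le> 1" and good: "\<And>\<zeta> l s. - 3 * pi / 4 + \<delta> \<le> (2 + \<alpha>) * Im \<zeta> \<Longrightarrow> (2 + \<alpha>) * Im \<zeta> \<le> pi / 4 - \<delta> \<Longrightarrow> Re \<zeta>\<^sub>0 - 1 \<le> Re \<zeta> \<Longrightarrow>
      norm l \<le> norm \<mu> \<Longrightarrow> s \<ge> R \<Longrightarrow> c \<le> Re (cnj (1 + \<i>) * pot \<alpha> x\<^sub>1 l \<zeta> s)"
    using pot_good_eventually[OF x \<delta>(1,2), of "Re \<zeta>\<^sub>0 - 1" "norm \<mu>"] by blast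
  show thesis
  proof (rule decaying_data_holomorphic[OF open_ball, of \<zeta>\<^sub>0 r "\<lambda>\<zeta>. pot \<alpha> x\<^sub>1 \<mu> \<zeta>" c "1 + \<i>" R])
    show "continuous_on {0..} (pot \<alpha> x\<^sub>1 \<mu> \<zeta>)" if "\<zeta> \<in> ball \<zeta>\<^sub>0 r" for \<zeta>
      by (rule pot_continuous[OF x strip_imp]) (use sub that in blast)
    show "(\<lambda>\<zeta>. pot \<alpha> x\<^sub>1 \<mu> \<zeta> s) holomorphic_on ball \<zeta>\<^sub>0 r" if "s \<ge> 0" for s
      by (rule holomorphic_on_subset[OF pot_holomorphic(1)[OF x that]]) (use sub strip_imp in auto)
    show "\<exists>Q. \<forall>\<zeta>\<in>ball \<zeta>\<^sub>0 r. \<forall>s. 0 \<le> s \<longrightarrow> s \<le> N \<longrightarrow> norm (pot \<alpha> x\<^sub>1 \<mu> \<zeta> s) \<le> Q" for N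
    proof (intro exI ballI allI impI)
      fix \<zeta> s assume z: "\<zeta> \<in> ball \<zeta>\<^sub>0 r" and s: "0 \<le> s" "s \<le> N"
      define E where "E = exp (Re \<zeta>\<^sub>0 + 1)"
      have E: "exp (Re \<zeta>) \<le> E" using near(4)[OF z] by (simp add: E_def)
      have "norm (pot \<alpha> x\<^sub>1 \<mu> \<zeta> s) \<le> exp (Re \<zeta>) ^ 2 * ((x\<^sub>1 + exp (Re \<zeta>) * s) powr \<alpha> + norm \<mu>)"
        by (rule norm_pot_le[OF x s(1)])
      also have "\<dots> \<le> E ^ 2 * ((x\<^sub>1 + E * N) powr \<alpha> + norm \<mu>)"
        using E s x \<alpha> by (intro mult_mono power_mono add_mono powr_mono2) (auto simp: E_def intro!: add_nonneg_nonneg)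
      finally show "norm (pot \<alpha> x\<^sub>1 \<mu> \<zeta> s) \<le> (exp (Re \<zeta>\<^sub>0 + 1)) ^ 2 * ((x\<^sub>1 + exp (Re \<zeta>\<^sub>0 + 1) * N) powr \<alpha> + norm \<mu>)"
        by (simp add: E_def)
    qed
    show "c \<le> Re (cnj (1 + \<i>) * pot \<alpha> x\<^sub>1 \<mu> \<zeta> s)" if "\<zeta> \<in> ball \<zeta>\<^sub>0 r" "R \<le> s" for \<zeta> s
      using good[OF near(1-3)[OF that(1)] order_refl that(2)] .
    fix y0 y1
    assume "y0 holomorphic_on ball \<zeta>\<^sub>0 r" "y1 holomorphic_on ball \<zeta>\<^sub>0 r"
      "\<And>\<zeta>. \<zeta> \<in> ball \<zeta>\<^sub>0 r \<Longrightarrow> y0 \<zeta> \<noteq> 0 \<or> y1 \<zeta> \<noteq> 0"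
      "\<And>\<zeta>. \<zeta> \<in> ball \<zeta>\<^sub>0 r \<Longrightarrow> decaying (sol (pot \<alpha> x\<^sub>1 \<mu> \<zeta>) (y0 \<zeta>) (y1 \<zeta>)) (dsol (pot \<alpha> x\<^sub>1 \<mu> \<zeta>) (y0 \<zeta>) (y1 \<zeta>))"
    then show thesis using that[of r y0 y1] r sub by (simp add: dec_data_def)
  qed (use R in auto)
qed

subsection \<open>Rotation of the ray\<close>

lemma pot_real: "pot \<alpha> x\<^sub>1 \<mu> (of_real r) s = of_real (exp r ^ 2) * pot \<alpha> x\<^sub>1 \<mu> 0 (exp r * s)"
  by (simp add: pot_def exp_of_real)

text \<open>For real \<zeta> = r the ray is only rescaled. Decay is carried over by the sign of the
  flux, which is multiplied by exp r; this replaces a change of variables in the integral.\<close>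

lemma dec_data_real_scaling:
  assumes x: "x\<^sub>1 \<ge> 0" and d: "dec_data x\<^sub>1 \<mu> 0 a b"
  shows "dec_data x\<^sub>1 \<mu> (of_real r) a (exp (of_real r) * b)"
proof -
  define u where "u = sol (pot \<alpha> x\<^sub>1 \<mu> 0) a b"
  define u' where "u' = dsol (pot \<alpha> x\<^sub>1 \<mu> 0) a b"
  have z0: "0 \<in> strip \<alpha>" using zero_in_strip[of 0] by simp
  note q0 = pot_continuous[OF x strip_imp[OF z0], of \<mu>]
  note q = pot_continuous[OF x strip_imp[OF zero_in_strip], of \<mu> r]
  have su: "is_sol (pot \<alpha> x\<^sub>1 \<mu> 0) u u'" unfolding u_def u'_def by (rule is_sol_sol[OF q0])
  define v where "v s = u (exp r * s)" for s
  define v' where "v' s = of_real (exp r) * u' (exp r * s)" for s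
  have sv: "is_sol (pot \<alpha> x\<^sub>1 \<mu> (of_real r)) v v'"
    using is_sol_affine[OF su order_refl, of "exp r"] by (simp add: v_def[abs_def] v'_def[abs_def] pot_real[abs_def])
  obtain R c where R: "R \<ge> 0" "c > 0" "c \<le> 1" "\<And>s. s \<ge> R \<Longrightarrow> c \<le> Re (cnj (1 + \<i>) * pot \<alpha> x\<^sub>1 \<mu> (of_real r) s)"
    using strip_good[OF x zero_in_strip] by metis
  obtain R0 c0 where R0: "R0 \<ge> 0" "c0 > 0" "\<And>s. s \<ge> R0 \<Longrightarrow> c0 \<le> Re (cnj (1 + \<i>) * pot \<alpha> x\<^sub>1 \<mu> 0 s)"
    using strip_good[OF x z0] by metis
  have fl: "energy_flux (1 + \<i>) u u' s \<le> 0" if "s \<ge> R0" for s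
    by (rule decaying_flux_nonpos[OF su, where ?s0.0 = R0])
       (use d R0 that in \<open>auto simp: dec_data_def u_def u'_def intro: order_trans[OF less_imp_le]\<close>)
  have "decaying v v'"
  proof (rule decayingI[OF sv, of "max R (exp (-r) * R0)" c "1 + \<i>"])
    fix s assume s: "s \<ge> max R (exp (-r) * R0)"
    then show "c \<le> Re (cnj (1 + \<i>) * pot \<alpha> x\<^sub>1 \<mu> (of_real r) s)" using R by simp
    have "R0 \<le> exp r * s"
    proof -
      have "exp r * (exp (-r) * R0) \<le> exp r * s" using s by (intro mult_left_mono) auto
      then show ?thesis by (simp add: mult_exp_exp flip: mult.assoc)
    qed
    then have "energy_flux (1 + \<i>) u u' (exp r * s) \<le> 0" by (rule fl)
    moreover have "energy_flux (1 + \<i>) v v' s = exp r * energy_flux (1 + \<i>) u u' (exp r * s)"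
    proof -
      have "cnj (1 + \<i>) * v' s * cnj (v s) = of_real (exp r) * (cnj (1 + \<i>) * u' (exp r * s) * cnj (u (exp r * s)))"
        by (simp only: v_def v'_def mult_ac)
      then show ?thesis unfolding energy_flux_def by (simp only: Re_complex_of_real times_complex.simps Im_complex_of_real)
    qed
    ultimately show "energy_flux (1 + \<i>) v v' s \<le> 0" by (simp add: mult_nonneg_nonpos)
  qed (use R in auto)
  moreover have "v s = sol (pot \<alpha> x\<^sub>1 \<mu> (of_real r)) a (exp (of_real r) * b) s"
    "v' s = dsol (pot \<alpha> x\<^sub>1 \<mu> (of_real r)) a (exp (of_real r) * b) s" if "s \<ge> 0" for s
    using is_sol_eq_sol[OF sv q that] by (simp_all add: v_def v'_def u_def u'_def sol_0'[OF q0] exp_of_real)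
  then have "integrable half_line (\<lambda>s. (norm (v s))\<^sup>2 + (norm (v' s))\<^sup>2) \<longleftrightarrow> integrable half_line
    (\<lambda>s. (norm (sol (pot \<alpha> x\<^sub>1 \<mu> (of_real r)) a (exp (of_real r) * b) s))\<^sup>2 + (norm (dsol (pot \<alpha> x\<^sub>1 \<mu> (of_real r)) a (exp (of_real r) * b) s))\<^sup>2)"
    by (intro Bochner_Integration.integrable_cong) auto
  ultimately show ?thesis by (simp add: dec_data_def decaying_def)
qed

text \<open>Restarting the solution at x allows the ray to be turned about a point other than 0, as
  is done next to the turning point.\<close>

lemma dec_data_shift:
  assumes x: "x \<ge> 0" and d: "dec_data 0 \<mu> 0 a b"
  shows "dec_data x \<mu> 0 (sol (pot \<alpha> 0 \<mu> 0) a b x) (dsol (pot \<alpha> 0 \<mu> 0) a b x)"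
proof -
  define u where "u = sol (pot \<alpha> 0 \<mu> 0) a b"
  define u' where "u' = dsol (pot \<alpha> 0 \<mu> 0) a b"
  have z0: "0 \<in> strip \<alpha>" using zero_in_strip[of 0] by simp
  note q0 = pot_continuous[OF order_refl strip_imp[OF z0], of \<mu>]
  note q = pot_continuous[OF x strip_imp[OF z0], of \<mu>]
  have su: "is_sol (pot \<alpha> 0 \<mu> 0) u u'" unfolding u_def u'_def by (rule is_sol_sol[OF q0])
  have peq: "(\<lambda>s. pot \<alpha> 0 \<mu> 0 (x + s)) = pot \<alpha> x \<mu> 0" by (auto simp: pot_def)
  note sv = is_sol_shift[OF su x, unfolded peq]
  obtain R c where R: "R \<ge> 0" "c > 0" "c \<le> 1" "\<And>s. s \<ge> R \<Longrightarrow> c \<le> Re (cnj (1 + \<i>) * pot \<alpha> x \<mu> 0 s)"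
    using strip_good[OF x z0] by metis
  obtain R0 c0 where R0: "R0 \<ge> 0" "c0 > 0" "\<And>s. s \<ge> R0 \<Longrightarrow> c0 \<le> Re (cnj (1 + \<i>) * pot \<alpha> 0 \<mu> 0 s)"
    using strip_good[OF order_refl z0] by metis
  have fl: "energy_flux (1 + \<i>) u u' s \<le> 0" if "s \<ge> R0" for s
    by (rule decaying_flux_nonpos[OF su, where ?s0.0 = R0])
       (use d R0 that in \<open>auto simp: dec_data_def u_def u'_def intro: order_trans[OF less_imp_le]\<close>)
  have "decaying (\<lambda>s. u (x + s)) (\<lambda>s. u' (x + s))"
  proof (rule decayingI[OF sv, of "max R R0" c "1 + \<i>"])
    fix s assume s: "s \<ge> max R R0"
    then show "c \<le> Re (cnj (1 + \<i>) * pot \<alpha> x \<mu> 0 s)" using R by simp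
    show "energy_flux (1 + \<i>) (\<lambda>s. u (x + s)) (\<lambda>s. u' (x + s)) s \<le> 0"
      using fl[of "x + s"] s x by (simp add: energy_flux_def)
  qed (use R in auto)
  moreover have "u (x + s) = sol (pot \<alpha> x \<mu> 0) (u x) (u' x) s"
    "u' (x + s) = dsol (pot \<alpha> x \<mu> 0) (u x) (u' x) s" if "s \<ge> 0" for s
    using is_sol_eq_sol[OF sv q that] by simp_all
  then have "integrable half_line (\<lambda>s. (norm (u (x + s)))\<^sup>2 + (norm (u' (x + s)))\<^sup>2) \<longleftrightarrow> integrable half_line
    (\<lambda>s. (norm (sol (pot \<alpha> x \<mu> 0) (u x) (u' x) s))\<^sup>2 + (norm (dsol (pot \<alpha> x \<mu> 0) (u x) (u' x) s))\<^sup>2)"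
    by (intro Bochner_Integration.integrable_cong) auto
  ultimately show ?thesis by (simp add: dec_data_def decaying_def u_def u'_def)
qed

text \<open>For real \<open>\<zeta>\<close> the claim is a rescaling of the half-line; the identity theorem extends it to
  the strip.\<close>

theorem dec_data_rotate:
  assumes x: "x\<^sub>1 \<ge> 0" and \<zeta>: "\<zeta> \<in> strip \<alpha>" and d: "dec_data x\<^sub>1 \<mu> 0 a b"
  shows "dec_data x\<^sub>1 \<mu> \<zeta> a (exp \<zeta> * b)"
proof -
  define T where "T = {\<zeta> \<in> strip \<alpha>. dec_data x\<^sub>1 \<mu> \<zeta> a (exp \<zeta> * b)}"
  have local: "\<exists>r>0. ball z r \<subseteq> strip \<alpha> \<and> (\<forall>w\<in>ball z r. w islimpt T \<longrightarrow> ball z r \<subseteq> T)"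
    if z: "z \<in> strip \<alpha>" for z
  proof -
    obtain r y0 y1 where r: "r > 0" "ball z r \<subseteq> strip \<alpha>" and hol: "y0 holomorphic_on ball z r" "y1 holomorphic_on ball z r"
      and nz: "\<And>\<zeta>. \<zeta> \<in> ball z r \<Longrightarrow> y0 \<zeta> \<noteq> 0 \<or> y1 \<zeta> \<noteq> 0"
      and dd: "\<And>\<zeta>. \<zeta> \<in> ball z r \<Longrightarrow> dec_data x\<^sub>1 \<mu> \<zeta> (y0 \<zeta>) (y1 \<zeta>)"
      using dec_data_near_zeta[OF x z] by metis
    \<comment> \<open>The determinant of the local decaying data and the proposed data. It vanishes
      exactly where the proposed solution decays, and by the identity theorem everywhere on the ball
      as soon as its zeros accumulate there.\<close>
    define h where "h \<zeta> = y0 \<zeta> * (exp \<zeta> * b) - y1 \<zeta> * a" for \<zeta>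
    have holh: "h holomorphic_on ball z r" unfolding h_def by (intro holomorphic_intros hol)
    have T: "\<zeta> \<in> T \<longleftrightarrow> h \<zeta> = 0" if "\<zeta> \<in> ball z r" for \<zeta>
    proof -
      have \<zeta>: "\<zeta> \<in> strip \<alpha>" using that r by blast
      show ?thesis
        using dec_data_unique[OF x \<zeta> dd[OF that], of a "exp \<zeta> * b"]
          dec_data_prop[OF x \<zeta> dd[OF that] nz[OF that], of "exp \<zeta> * b" a] \<zeta>
        by (auto simp: T_def h_def)
    qed
    have "ball z r \<subseteq> T" if w: "w \<in> ball z r" "w islimpt T" for w
    proof -
      have lp: "w islimpt (T \<inter> ball z r)"
        using w by (metis Int_commute islimpt_Int_eventually eventually_at_in_open' open_ball inf_commute eventually_at_topological centre_in_ball)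
      have "h \<zeta> = 0" if "\<zeta> \<in> ball z r" for \<zeta>
        by (rule analytic_continuation[OF holh open_ball connected_ball _ w(1) lp _ that]) (use T in auto)
      then show ?thesis using T by blast
    qed
    then show ?thesis using r by blast
  qed
  \<comment> \<open>The accumulation points of T in the strip form a set that is open with open
    complement in the connected strip; the real axis, where the claim is a rescaling, puts 0 into
    it.\<close>
  define A where "A = {z \<in> strip \<alpha>. z islimpt T}"
  have openA: "open A"
    unfolding open_contains_ball
  proof
    fix z assume "z \<in> A"
    then have z: "z \<in> strip \<alpha>" "z islimpt T" by (auto simp: A_def)
    obtain r where r: "r > 0" "ball z r \<subseteq> strip \<alpha>" "ball z r \<subseteq> T"
      using local[OF z(1)] z(2) centre_in_ball by metis
    have "w islimpt T" if "w \<in> ball z r" for w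
      using islimpt_subset[OF interior_limit_point[of w "ball z r"] r(3)] that by simp
    then show "\<exists>e>0. ball z e \<subseteq> A" using r by (auto simp: A_def)
  qed
  have openB: "open (strip \<alpha> - A)"
    unfolding open_contains_ball
  proof
    fix z assume "z \<in> strip \<alpha> - A"
    then have z: "z \<in> strip \<alpha>" "\<not> z islimpt T" by (auto simp: A_def)
    obtain r where r: "r > 0" "ball z r \<subseteq> strip \<alpha>" "\<forall>w\<in>ball z r. w islimpt T \<longrightarrow> ball z r \<subseteq> T"
      using local[OF z(1)] by metis
    have "\<not> w islimpt T" if "w \<in> ball z r" for w
      using r(3) that z(2) islimpt_subset[OF interior_limit_point[of z "ball z r"], of T] r(1) by auto
    then show "\<exists>e>0. ball z e \<subseteq> strip \<alpha> - A" using r by (auto simp: A_def)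
  qed
  have "0 \<in> A"
  proof -
    have T: "of_real r \<in> T" for r
      using dec_data_real_scaling[OF x d] zero_in_strip by (simp add: T_def)
    have "\<exists>w\<in>T. w \<noteq> 0 \<and> dist w 0 < e" if "e > 0" for e
      by (rule bexI[OF _ T[of "e / 2"]]) (use that in \<open>simp add: norm_divide\<close>)
    then show ?thesis using zero_in_strip[of 0] by (auto simp: A_def islimpt_approachable)
  qed
  moreover have "A \<inter> strip \<alpha> = {} \<or> (strip \<alpha> - A) \<inter> strip \<alpha> = {}"
    by (rule connectedD[OF convex_connected[OF convex_strip] openA openB]) auto
  moreover have "A \<subseteq> strip \<alpha>" by (auto simp: A_def)
  ultimately have "\<zeta> \<in> A" using \<zeta> by blast
  then have "\<zeta> islimpt T" by (simp add: A_def)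
  then have "\<zeta> \<in> T" using local[OF \<zeta>] centre_in_ball by blast
  then show ?thesis by (simp add: T_def)
qed

end

section \<open>The normalized decaying solution\<close>

text \<open>The ray carrying the eigenvalues has argument \<open>\<pi> / (2 + \<alpha>)\<close>; \<open>unrotate\<close> turns it to the real axis.\<close>

definition unrotate :: "real \<Rightarrow> complex \<Rightarrow> complex" where
  "unrotate \<alpha> \<mu> = \<mu> * cis (- (pi / (2 + \<alpha>)))"

text \<open>The Weyl-Titchmarsh coefficient u'(0)/u(0); an unspecified value where
  \<open>regular\<close> fails.\<close>

definition weyl_m :: "real \<Rightarrow> complex \<Rightarrow> complex" where
  "weyl_m \<alpha> \<mu> = (SOME m. dec_data \<alpha> 0 \<mu> 0 1 m)"

text \<open>Fails exactly where the decaying solutions vanish at 0, that is, at the Dirichlet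
  eigenvalues.\<close>

definition regular :: "real \<Rightarrow> complex \<Rightarrow> bool" where
  "regular \<alpha> \<mu> \<longleftrightarrow> (\<exists>m. dec_data \<alpha> 0 \<mu> 0 1 m)"

definition weyl_u :: "real \<Rightarrow> complex \<Rightarrow> real \<Rightarrow> complex" where
  "weyl_u \<alpha> \<mu> = sol (pot \<alpha> 0 \<mu> 0) 1 (weyl_m \<alpha> \<mu>)"

definition weyl_u' :: "real \<Rightarrow> complex \<Rightarrow> real \<Rightarrow> complex" where
  "weyl_u' \<alpha> \<mu> = dsol (pot \<alpha> 0 \<mu> 0) 1 (weyl_m \<alpha> \<mu>)"

definition weyl_norm2 :: "real \<Rightarrow> complex \<Rightarrow> real" where
  "weyl_norm2 \<alpha> \<mu> = (\<integral>s. (norm (weyl_u \<alpha> \<mu> s))\<^sup>2 \<partial>half_line)"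

lemma norm_unrotate [simp]: "norm (unrotate \<alpha> \<mu>) = norm \<mu>"
  by (simp add: unrotate_def norm_mult)

text \<open>The flux at 0 dominates the energy on [0, 1], which is the input of
  \<open>initial_slope_bound\<close>. If v vanishes at 0, so does this flux, and nothing is left for
  the slope.\<close>

lemma decaying_slope_bound:
  assumes sol: "is_sol q v w" and dec: "decaying v w" and q: "continuous_on {0..} q"
    and c: "c > 0" "c \<le> Re \<omega>" "\<And>s. s \<ge> 0 \<Longrightarrow> c \<le> Re (cnj \<omega> * q s)"
    and Q: "\<And>s. 0 \<le> s \<Longrightarrow> s \<le> 1 \<Longrightarrow> norm (q s) \<le> Q"
  shows "norm (v 0) = 1 \<Longrightarrow> norm (w 0) \<le> 2 * (1 + Q)\<^sup>2 * (norm \<omega> / c)"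
    and "v 0 = 0 \<Longrightarrow> w 0 = 0"
proof -
  have n\<omega>: "norm \<omega> > 0" using c by auto
  have "integral {0..1} (\<lambda>s. c * (norm (w s))\<^sup>2 + c * (norm (v s))\<^sup>2) \<le> - energy_flux \<omega> v w 0"
    by (rule decaying_energy_bound[OF sol dec]) (use c in auto)
  also have "\<dots> \<le> norm \<omega> * norm (v 0) * norm (w 0)" using abs_energy_flux_le[of \<omega> v w 0] by linarith
  finally have "c * integral {0..1} (\<lambda>s. (norm (w s))\<^sup>2 + (norm (v s))\<^sup>2) \<le> norm \<omega> * norm (v 0) * norm (w 0)"
    by (simp only: integral_mult_right[symmetric] distrib_left)
  then have en: "integral {0..1} (\<lambda>s. (norm (w s))\<^sup>2 + (norm (v s))\<^sup>2) \<le> norm \<omega> / c * norm (v 0) * norm (w 0)"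
    using c by (simp add: field_simps)
  show "norm (w 0) \<le> 2 * (1 + Q)\<^sup>2 * (norm \<omega> / c)" if "norm (v 0) = 1"
    by (rule initial_slope_bound[OF sol q Q]) (use en that n\<omega> c in auto)
  show "w 0 = 0" if "v 0 = 0"
  proof (rule ccontr)
    assume w: "w 0 \<noteq> 0"
    have Q0: "Q \<ge> 0" using Q[of 0] order_trans[OF norm_ge_zero] by auto
    \<comment> \<open>The energy is at most 0, so every positive A is admissible; this one turns the
      slope bound into |w 0| \<le> |w 0|/2.\<close>
    define A where "A = norm (w 0) / (4 * (1 + Q)\<^sup>2)"
    have A: "A > 0" using w Q0 by (simp add: A_def)
    have "0 \<le> A * norm (w 0)" using A by simp
    then have "integral {0..1} (\<lambda>s. (norm (w s))\<^sup>2 + (norm (v s))\<^sup>2) \<le> A * norm (w 0)"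
      using en that by simp
    from initial_slope_bound[OF sol q Q A this] have "norm (w 0) \<le> 2 * (1 + Q)\<^sup>2 * A" by simp
    also have "\<dots> = norm (w 0) / 2" using Q0 by (simp add: A_def add_nonneg_eq_0_iff)
    finally show False using w by simp
  qed
qed

context
  fixes \<alpha> :: real
  assumes \<alpha>: "\<alpha> > 0"
begin

lemma zero_strip: "0 \<in> strip \<alpha>"
  using zero_in_strip[OF \<alpha>, of 0] by simp

lemma pot_zero_continuous: "x \<ge> 0 \<Longrightarrow> continuous_on {0..} (pot \<alpha> x \<mu> 0)"
  by (rule pot_continuous[OF \<alpha>]) simp_all

lemma pot_zero: "s \<ge> 0 \<Longrightarrow> pot \<alpha> 0 \<mu> 0 s = \<i> * of_real (s powr \<alpha>) - \<mu>"
  by (simp add: pot_def powr_of_real)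

lemma norm_pot_zero_le: "s \<ge> 0 \<Longrightarrow> norm (pot \<alpha> 0 \<mu> 0 s) \<le> s powr \<alpha> + norm \<mu>"
  using norm_pot_le[OF \<alpha> order_refl, of s \<mu> 0] by simp

text \<open>Here exp((2 + \<alpha>) \<zeta>) = -\<i> cancels the factor \<i>: along this ray the
  equation reads -v'' + s^\<alpha> v = \<nu> v with \<nu> = \<open>unrotate \<alpha> \<mu>\<close>,
  a self-adjoint problem with real potential.\<close>

lemma pot_selfadjoint:
  assumes "s \<ge> 0"
  shows "pot \<alpha> 0 \<mu> (- \<i> * of_real (pi / (2 * (2 + \<alpha>)))) s = of_real (s powr \<alpha>) - unrotate \<alpha> \<mu>"
proof -
  define t where "t = pi / (2 * (2 + \<alpha>))"
  define \<zeta> where "\<zeta> = - \<i> * of_real t"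
  have t: "(2 + \<alpha>) * t = pi / 2" "0 < t" "t < pi" using \<alpha> by (auto simp: t_def field_simps add_pos_pos)
  have Lnz: "Ln (exp \<zeta>) = \<zeta>" using t by (intro Ln_exp) (auto simp: \<zeta>_def)
  have p1: "(exp \<zeta> * of_real s) powr of_real \<alpha> = of_real (s powr \<alpha>) * exp (of_real \<alpha> * \<zeta>)"
  proof -
    have "(of_real s * exp \<zeta>) powr of_real \<alpha> = of_real s powr of_real \<alpha> * exp \<zeta> powr (of_real \<alpha> :: complex)"
      using assms by (intro powr_times_real_left) auto
    also have "exp \<zeta> powr (of_real \<alpha>) = exp (of_real \<alpha> * \<zeta>)" by (simp add: powr_def Lnz)
    finally show ?thesis unfolding powr_of_real[OF assms] by (simp only: mult.commute[of "exp \<zeta>" "of_real s"])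
  qed
  have e2: "exp \<zeta> ^ 2 = exp (2 * \<zeta>)" by (simp add: exp_double)
  have e3: "exp (2 * \<zeta>) * exp (of_real \<alpha> * \<zeta>) = - \<i>"
  proof -
    have "exp (2 * \<zeta>) * exp (of_real \<alpha> * \<zeta>) = exp (- \<i> * of_real ((2 + \<alpha>) * t))"
      by (simp add: mult_exp_exp \<zeta>_def algebra_simps)
    also have "\<dots> = cis (- (pi / 2))" unfolding t(1) by (simp add: cis_conv_exp)
    finally show ?thesis by simp
  qed
  have e4: "exp (2 * \<zeta>) = cis (- (pi / (2 + \<alpha>)))"
  proof -
    have "2 * t = pi / (2 + \<alpha>)" using \<alpha> by (simp add: t_def field_simps)
    moreover have "2 * \<zeta> = \<i> * of_real (- (2 * t))" by (simp add: \<zeta>_def)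
    ultimately show ?thesis by (simp only: cis_conv_exp)
  qed
  have "pot \<alpha> 0 \<mu> \<zeta> s = \<i> * of_real (s powr \<alpha>) * (exp (2 * \<zeta>) * exp (of_real \<alpha> * \<zeta>)) - \<mu> * exp (2 * \<zeta>)"
    unfolding pot_def of_real_0 add_0 p1 e2 by (simp add: algebra_simps)
  also have "\<dots> = of_real (s powr \<alpha>) - unrotate \<alpha> \<mu>" unfolding e3 unfolding unrotate_def e4 by (simp add: complex_eq_iff)
  finally show ?thesis by (simp add: \<zeta>_def t_def)
qed

text \<open>After the rotation to the self-adjoint problem, a non-real spectral parameter gives
  accretivity through its imaginary part. The first power of 1/|Im| is essential: it makes the zeros
  of the decaying data simple and allows growth bounds to be continued across the eigenvalue
  ray.\<close>

lemma dec_data_bound: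
  assumes Im: "Im (unrotate \<alpha> \<mu>) \<noteq> 0" and d: "dec_data \<alpha> 0 \<mu> 0 a b"
  shows "norm a = 1 \<Longrightarrow> norm b \<le> 32 * (1 + norm \<mu>) ^ 3 / \<bar>Im (unrotate \<alpha> \<mu>)\<bar>"
    and "a = 0 \<Longrightarrow> b = 0"
proof -
  define \<zeta> where "\<zeta> = - \<i> * complex_of_real (pi / (2 * (2 + \<alpha>)))"
  have \<zeta>: "\<zeta> \<in> strip \<alpha>"
  proof -
    have "(2 + \<alpha>) * Im \<zeta> = - (pi / 2)" using \<alpha> by (simp add: \<zeta>_def field_simps)
    then show ?thesis using pi_gt_zero by (simp add: strip_def)
  qed
  have n\<zeta>: "norm (exp \<zeta>) = 1" by (simp add: \<zeta>_def norm_exp_eq_Re)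
  define p where "p = pot \<alpha> 0 \<mu> \<zeta>"
  define v where "v = sol p a (exp \<zeta> * b)"
  define w where "w = dsol p a (exp \<zeta> * b)"
  have q: "continuous_on {0..} p" unfolding p_def by (rule pot_continuous[OF \<alpha> order_refl strip_imp[OF \<alpha> \<zeta>]])
  have sol: "is_sol p v w" unfolding v_def w_def by (rule is_sol_sol[OF q])
  have dec: "decaying v w" using dec_data_rotate[OF \<alpha> order_refl \<zeta> d]
    by (simp add: dec_data_def[OF \<alpha>] v_def w_def p_def)
  define y where "y = Im (unrotate \<alpha> \<mu>)"
  \<comment> \<open>Weight of the kinetic term, so small that t |\<mu>| and t itself are each at
    most |y|/2; the contribution |y| of the imaginary part then pays for both.\<close>
  define t where "t = \<bar>y\<bar> / (2 * (1 + norm \<mu>))"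
  have ymu: "\<bar>y\<bar> \<le> norm \<mu>" using abs_Im_le_cmod[of "unrotate \<alpha> \<mu>"] by (simp add: y_def)
  have y0: "\<bar>y\<bar> > 0" using Im by (simp add: y_def)
  have m1: "1 + norm \<mu> > 0" by (simp add: add_pos_nonneg)
  have t: "t > 0" using y0 m1 by (simp add: t_def)
  have t1: "t \<le> \<bar>y\<bar> / 2"
  proof -
    have "\<bar>y\<bar> * 1 \<le> \<bar>y\<bar> * (1 + norm \<mu>)" by (intro mult_left_mono) auto
    then show ?thesis using m1 by (simp add: t_def field_simps)
  qed
  have tmu: "t * norm \<mu> \<le> \<bar>y\<bar> / 2"
  proof -
    have "\<bar>y\<bar> * norm \<mu> \<le> \<bar>y\<bar> * (1 + norm \<mu>)" by (intro mult_left_mono) auto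
    then show ?thesis using m1 by (simp add: t_def field_simps)
  qed
  have t2: "t \<le> 1" using ymu m1 by (simp add: t_def field_simps)
  define \<omega> where "\<omega> = Complex t (- sgn y)"
  have n\<omega>: "norm \<omega> \<le> 2"
  proof -
    have "norm \<omega> \<le> \<bar>t\<bar> + \<bar>sgn y\<bar>" using cmod_le[of \<omega>] by (simp add: \<omega>_def)
    moreover have "\<bar>sgn y\<bar> = 1" using y0 by (simp add: abs_sgn_eq)
    ultimately show ?thesis using t t2 by simp
  qed
  have good: "t \<le> Re (cnj \<omega> * p s)" if s: "s \<ge> 0" for s
  proof -
    have "Re (cnj \<omega> * p s) = t * (s powr \<alpha> - Re (unrotate \<alpha> \<mu>)) + sgn y * y"
      unfolding p_def \<zeta>_def pot_selfadjoint[OF s] by (simp add: \<omega>_def y_def algebra_simps)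
    also have "sgn y * y = \<bar>y\<bar>" by (simp add: mult.commute abs_sgn)
    finally have "Re (cnj \<omega> * p s) = t * s powr \<alpha> - t * Re (unrotate \<alpha> \<mu>) + \<bar>y\<bar>" by (simp add: algebra_simps)
    moreover have "t * Re (unrotate \<alpha> \<mu>) \<le> t * norm \<mu>"
      using t complex_Re_le_cmod[of "unrotate \<alpha> \<mu>"] by (intro mult_left_mono) auto
    moreover have "t * s powr \<alpha> \<ge> 0" using t by simp
    ultimately show ?thesis using tmu t1 by linarith
  qed
  have Q: "norm (p s) \<le> 1 + norm \<mu>" if "0 \<le> s" "s \<le> 1" for s
  proof -
    have "s powr \<alpha> \<le> 1" using that \<alpha> by (simp add: powr_le1)
    then have "norm (complex_of_real (s powr \<alpha>)) \<le> 1" by simp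
    then show ?thesis unfolding p_def \<zeta>_def pot_selfadjoint[OF that(1)]
      using norm_triangle_ineq4[of "complex_of_real (s powr \<alpha>)" "unrotate \<alpha> \<mu>"] by simp
  qed
  have v0: "v 0 = a" "w 0 = exp \<zeta> * b" by (simp_all add: v_def w_def sol_0'[OF q])
  note B = decaying_slope_bound[OF sol dec q t _ good Q]
  have "Re \<omega> = t" by (simp add: \<omega>_def)
  show "norm b \<le> 32 * (1 + norm \<mu>) ^ 3 / \<bar>Im (unrotate \<alpha> \<mu>)\<bar>" if "norm a = 1"
  proof -
    have "norm b = norm (w 0)" by (simp only: v0 norm_mult n\<zeta> mult_1)
    also have "\<dots> \<le> 2 * (1 + (1 + norm \<mu>))\<^sup>2 * (norm \<omega> / t)" using B(1) that \<open>Re \<omega> = t\<close> by (simp add: v0)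
    also have "\<dots> \<le> 2 * (2 * (1 + norm \<mu>))\<^sup>2 * (2 / t)"
      using n\<omega> t by (intro mult_mono power_mono divide_right_mono) auto
    also have "\<dots> = 32 * (1 + norm \<mu>) ^ 3 / \<bar>y\<bar>"     proof -
      define M where "M = 1 + norm \<mu>"
      have "M > 0" using m1 by (simp add: M_def)
      then show ?thesis using y0 unfolding t_def M_def[symmetric] by (simp add: power2_eq_square power3_eq_cube)
    qed
    finally show ?thesis by (simp add: y_def)
  qed
  show "b = 0" if "a = 0" using B(2) that \<open>Re \<omega> = t\<close> by (simp add: v0)
qed

lemma regularI:
  assumes "\<And>b. dec_data \<alpha> 0 \<mu> 0 0 b \<Longrightarrow> b = 0"
  shows "regular \<alpha> \<mu>"
proof -
  obtain r y0 y1 where r: "r > 0" and nz: "\<And>\<zeta>. \<zeta> \<in> ball 0 r \<Longrightarrow> y0 \<zeta> \<noteq> 0 \<or> y1 \<zeta> \<noteq> (0::complex)"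
    and dd: "\<And>\<zeta>. \<zeta> \<in> ball 0 r \<Longrightarrow> dec_data \<alpha> 0 \<mu> \<zeta> (y0 \<zeta>) (y1 \<zeta>)"
    using dec_data_near_zeta[OF \<alpha> order_refl zero_strip] by metis
  have z: "0 \<in> ball (0::complex) r" using r by simp
  have "y0 0 \<noteq> 0" using assms dd[OF z] nz[OF z] by metis
  then have "dec_data \<alpha> 0 \<mu> 0 1 (y1 0 / y0 0)"
    by (intro dec_data_prop[OF \<alpha> order_refl zero_strip dd[OF z] nz[OF z]]) simp
  then show ?thesis unfolding regular_def by blast
qed

lemma weyl_exists: "regular \<alpha> \<mu> \<Longrightarrow> dec_data \<alpha> 0 \<mu> 0 1 (weyl_m \<alpha> \<mu>)"
  unfolding regular_def weyl_m_def by (rule someI_ex)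

lemma regular_off_ray: "Im (unrotate \<alpha> \<mu>) \<noteq> 0 \<Longrightarrow> regular \<alpha> \<mu>"
  using dec_data_bound(2) by (intro regularI) blast

lemma weyl_is_sol: "is_sol (pot \<alpha> 0 \<mu> 0) (weyl_u \<alpha> \<mu>) (weyl_u' \<alpha> \<mu>)"
  unfolding weyl_u_def weyl_u'_def by (rule is_sol_sol[OF pot_zero_continuous]) simp

lemma weyl_initial [simp]: "weyl_u \<alpha> \<mu> 0 = 1" "weyl_u' \<alpha> \<mu> 0 = weyl_m \<alpha> \<mu>"
  by (simp_all add: weyl_u_def weyl_u'_def sol_0'[OF pot_zero_continuous])

lemma weyl_decaying:
  assumes "regular \<alpha> \<mu>"
  shows "decaying (weyl_u \<alpha> \<mu>) (weyl_u' \<alpha> \<mu>)"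
  using weyl_exists[OF assms] by (simp add: dec_data_def[OF \<alpha>] weyl_u_def weyl_u'_def)

lemma weyl_m_bound:
  assumes "Im (unrotate \<alpha> \<mu>) \<noteq> 0"
  shows "norm (weyl_m \<alpha> \<mu>) \<le> 32 * (1 + norm \<mu>) ^ 3 / \<bar>Im (unrotate \<alpha> \<mu>)\<bar>"
  by (rule dec_data_bound(1)[OF assms weyl_exists[OF regular_off_ray[OF assms]]]) simp

lemma weyl_norm2_le:
  assumes "\<And>N. N \<ge> 0 \<Longrightarrow> integral {0..N} (\<lambda>s. (norm (weyl_u \<alpha> \<mu> s))\<^sup>2) \<le> B"
  shows "weyl_norm2 \<alpha> \<mu> \<le> B" "integrable half_line (\<lambda>s. (norm (weyl_u \<alpha> \<mu> s))\<^sup>2)"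
  unfolding weyl_norm2_def
  by (rule integrable_half_lineI; use assms in \<open>auto intro!: continuous_intros is_sol_continuous(1)[OF weyl_is_sol]\<close>)+

text \<open>On rays on which the numerical range is avoided, the slope at \<open>0\<close> grows like the square root
  of the spectral parameter, so that the solution becomes small in \<open>L\<^sub>2\<close>.\<close>

lemma weyl_norm2_on_ray:
  assumes e: "norm e = 1" and \<omega>: "Re \<omega> > 0" "Im \<omega> \<ge> 0" "Re (cnj \<omega> * (- e)) > 0"
  obtains K where "\<And>r. r \<ge> 1 \<Longrightarrow> regular \<alpha> (of_real r * e)" "\<And>r. r \<ge> 1 \<Longrightarrow> weyl_norm2 \<alpha> (of_real r * e) \<le> K / sqrt r"
proof -
  define p where "p = Re \<omega>"
  define \<kappa> where "\<kappa> = Re (cnj \<omega> * (- e))"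
  define K where "K = 2 * (norm \<omega> / (2 * p) + 2 * norm \<omega> / \<kappa>)"
  have pos: "p > 0" "\<kappa> > 0" using \<omega> by (auto simp: p_def \<kappa>_def)
  have n\<omega>: "norm \<omega> > 0" using \<omega> by auto
  have good: "\<kappa> * r \<le> Re (cnj \<omega> * pot \<alpha> 0 (of_real r * e) 0 s)" if s: "s \<ge> 0" for s r
  proof -
    have "cnj \<omega> * pot \<alpha> 0 (of_real r * e) 0 s = cnj \<omega> * \<i> * of_real (s powr \<alpha>) + of_real r * (cnj \<omega> * (- e))"
      by (simp add: pot_zero[OF s] algebra_simps)
    then have "Re (cnj \<omega> * pot \<alpha> 0 (of_real r * e) 0 s) = Re (cnj \<omega> * \<i> * of_real (s powr \<alpha>)) + r * \<kappa>"
      by (simp only: plus_complex.simps \<kappa>_def Re_complex_of_real Im_complex_of_real times_complex.simps)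
    moreover have "Re (cnj \<omega> * \<i> * of_real (s powr \<alpha>)) = Im \<omega> * s powr \<alpha>" by simp
    moreover have "Im \<omega> * s powr \<alpha> \<ge> 0" using \<omega> by simp
    ultimately show ?thesis by (simp add: mult.commute)
  qed
  have reg: "regular \<alpha> (of_real r * e)" if r: "r \<ge> 1" for r
  proof (rule regularI)
    fix b assume d: "dec_data \<alpha> 0 (of_real r * e) 0 0 b"
    note q = pot_zero_continuous[OF order_refl, of "of_real r * e"]
    obtain Q where Q: "\<And>s. 0 \<le> s \<Longrightarrow> s \<le> 1 \<Longrightarrow> norm (pot \<alpha> 0 (of_real r * e) 0 s) \<le> Q"
      using picard_bounded_on[OF q] by blast
    have "min p (\<kappa> * r) \<le> Re (cnj \<omega> * pot \<alpha> 0 (of_real r * e) 0 s)" if "s \<ge> 0" for s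
      using good[OF that, of r] by linarith
    from decaying_slope_bound(2)[OF is_sol_sol[OF q] d[unfolded dec_data_def[OF \<alpha>]] q _ _ this Q]
    show "b = 0" using pos r by (simp add: p_def sol_0'[OF q])
  qed
  have "weyl_norm2 \<alpha> (of_real r * e) \<le> (norm \<omega> * K / \<kappa>) / sqrt r" if r: "r \<ge> 1" for r
  proof -
    define \<mu> where "\<mu> = of_real r * e"
    have n\<mu>: "norm \<mu> = r" using r e by (simp add: \<mu>_def norm_mult)
    define u where "u = weyl_u \<alpha> \<mu>"
    define u' where "u' = weyl_u' \<alpha> \<mu>"
    have sol: "is_sol (pot \<alpha> 0 \<mu> 0) u u'" unfolding u_def u'_def by (rule weyl_is_sol)
    have dec: "decaying u u'" unfolding u_def u'_def \<mu>_def by (rule weyl_decaying[OF reg[OF r]])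
    have en: "integral {0..b} (\<lambda>s. p * (norm (u' s))\<^sup>2 + (\<kappa> * r) * (norm (u s))\<^sup>2) \<le> norm \<omega> * norm (weyl_m \<alpha> \<mu>)"
      if "b \<ge> 0" for b
    proof -
      have "integral {0..b} (\<lambda>s. p * (norm (u' s))\<^sup>2 + (\<kappa> * r) * (norm (u s))\<^sup>2) \<le> - energy_flux \<omega> u u' 0"
        by (rule decaying_energy_bound[OF sol dec]) (use pos r good that in \<open>auto simp: p_def \<mu>_def\<close>)
      also have "\<dots> \<le> norm \<omega> * norm (weyl_m \<alpha> \<mu>)"
        using abs_energy_flux_le[of \<omega> u u' 0] by (simp add: u_def u'_def)
      finally show ?thesis .
    qed
    have m: "norm (weyl_m \<alpha> \<mu>) \<le> K * sqrt r"
    proof -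
      \<comment> \<open>The natural length for a potential of size r: on [0, r^(-1/2)] the two parts
        |u'|/l and r |u| of the tested equation are balanced.\<close>
      define l where "l = 1 / sqrt r"
      have sr: "sqrt r \<ge> 1" using r by simp
      have l: "l > 0" "l \<le> 1" using sr by (auto simp: l_def)
      define h where "h s = p * (norm (u' s))\<^sup>2 + (\<kappa> * r) * (norm (u s))\<^sup>2" for s
      define A where "A = r * (norm \<omega> / (2 * p) + 2 * norm \<omega> / \<kappa>)"
      have conth: "continuous_on {0..} h" unfolding h_def by (rule weighted_energy_continuous[OF sol])
      have "norm (u' 0) \<le> integral {0..l} (\<lambda>s. norm (u' s) / l + (2 * r) * norm (u s))"
      proof (rule initial_slope_le[OF sol pot_zero_continuous l(1)])
        fix s assume s: "0 \<le> s" "s \<le> l"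
        then have "s powr \<alpha> \<le> 1" using l \<alpha> by (simp add: powr_le1)
        then show "norm (pot \<alpha> 0 \<mu> 0 s) \<le> 2 * r" using norm_pot_zero_le[OF s(1), of \<mu>] n\<mu> r by linarith
      qed auto
      also have "\<dots> \<le> integral {0..l} (\<lambda>s. 1 / (2 * norm \<omega>) * h s + A)"
      proof (rule integral_le)
        show "(\<lambda>s. norm (u' s) / l + (2 * r) * norm (u s)) integrable_on {0..l}"
          using l by (intro continuous_integrable_half_line continuous_intros is_sol_continuous[OF sol]) auto
        show "(\<lambda>s. 1 / (2 * norm \<omega>) * h s + A) integrable_on {0..l}"
          by (intro continuous_integrable_half_line continuous_intros conth) auto
        fix s
        have 1: "x * y \<le> (\<epsilon> * x\<^sup>2 + y\<^sup>2 / \<epsilon>) / 2" if "\<epsilon> > 0" for x y \<epsilon> :: real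
        proof -
          have "0 \<le> (\<epsilon> * x - y)\<^sup>2" by simp
          then have "2 * (x * y) * \<epsilon> \<le> \<epsilon>\<^sup>2 * x\<^sup>2 + y\<^sup>2" by (simp add: power2_eq_square algebra_simps)
          then show ?thesis using that by (simp add: field_simps power2_eq_square)
        qed
        have "norm (u' s) / l = norm (u' s) * sqrt r" by (simp add: l_def)
        also have "\<dots> \<le> (p / norm \<omega> * (norm (u' s))\<^sup>2 + (sqrt r)\<^sup>2 / (p / norm \<omega>)) / 2"
          using pos n\<omega> by (intro 1) simp
        also have "\<dots> = 1 / (2 * norm \<omega>) * (p * (norm (u' s))\<^sup>2) + r * (norm \<omega> / (2 * p))"
          using r pos n\<omega> by (simp add: field_simps)
        finally have a: "norm (u' s) / l \<le> 1 / (2 * norm \<omega>) * (p * (norm (u' s))\<^sup>2) + r * (norm \<omega> / (2 * p))" .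
        have "(2 * r) * norm (u s) = (sqrt r * norm (u s)) * (2 * sqrt r)" using r by simp
        also have "\<dots> \<le> (\<kappa> / norm \<omega> * (sqrt r * norm (u s))\<^sup>2 + (2 * sqrt r)\<^sup>2 / (\<kappa> / norm \<omega>)) / 2"
          using pos n\<omega> by (intro 1) simp
        also have "\<dots> = 1 / (2 * norm \<omega>) * (\<kappa> * r * (norm (u s))\<^sup>2) + r * (2 * norm \<omega> / \<kappa>)"
          using r pos n\<omega> by (simp add: power_mult_distrib field_simps)
        finally show "norm (u' s) / l + (2 * r) * norm (u s) \<le> 1 / (2 * norm \<omega>) * h s + A"
          using a unfolding h_def A_def distrib_left by linarith
      qed
      also have "\<dots> = 1 / (2 * norm \<omega>) * integral {0..l} h + A * l"
      proof -
        have "integral {0..l} (\<lambda>s. 1 / (2 * norm \<omega>) * h s + A) = integral {0..l} (\<lambda>s. 1 / (2 * norm \<omega>) * h s) + integral {0..l} (\<lambda>s. A)"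
          by (intro Henstock_Kurzweil_Integration.integral_add integrable_on_mult_right continuous_integrable_half_line[OF conth] integrable_const_ivl) auto
        moreover have "integral {0..l} (\<lambda>s. 1 / (2 * norm \<omega>) * h s) = 1 / (2 * norm \<omega>) * integral {0..l} h"
          by (rule integral_mult_right)
        moreover have "integral {0..l} (\<lambda>s. A) = A * l" using l by simp
        ultimately show ?thesis by (simp only:)
      qed
      also have "\<dots> \<le> 1 / (2 * norm \<omega>) * (norm \<omega> * norm (weyl_m \<alpha> \<mu>)) + A * l"
        using en[of l] l n\<omega> unfolding h_def by (intro add_right_mono mult_left_mono) auto
      also have "\<dots> = norm (weyl_m \<alpha> \<mu>) / 2 + A * l" using n\<omega> by simp
      also have "A * l = K / 2 * sqrt r"
      proof -
        define B where "B = norm \<omega> / (2 * p) + 2 * norm \<omega> / \<kappa>"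
        have "A * l = B * (r / sqrt r)" by (simp add: A_def l_def B_def)
        also have "r / sqrt r = sqrt r" using r by (simp add: real_div_sqrt)
        finally show ?thesis by (simp add: K_def B_def)
      qed
      finally show ?thesis by (simp add: u'_def)
    qed
    have "weyl_norm2 \<alpha> \<mu> \<le> (norm \<omega> * K / \<kappa>) / sqrt r"
    proof (rule weyl_norm2_le)
      fix N :: real assume N: "N \<ge> 0"
      have "(\<kappa> * r) * integral {0..N} (\<lambda>s. (norm (u s))\<^sup>2) = integral {0..N} (\<lambda>s. (\<kappa> * r) * (norm (u s))\<^sup>2)"
        by (rule integral_mult_right[symmetric])
      also have "\<dots> \<le> integral {0..N} (\<lambda>s. p * (norm (u' s))\<^sup>2 + (\<kappa> * r) * (norm (u s))\<^sup>2)"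
        using pos by (intro integral_le continuous_integrable_half_line continuous_intros is_sol_continuous[OF sol]) auto
      also have "\<dots> \<le> norm \<omega> * (K * sqrt r)"
        using en[OF N] m n\<omega> by (meson mult_left_mono norm_ge_zero order_trans)
      finally have "integral {0..N} (\<lambda>s. (norm (u s))\<^sup>2) \<le> norm \<omega> * (K * sqrt r) / (\<kappa> * r)"
        using pos r by (simp add: field_simps)
      also have "\<dots> = (norm \<omega> * K / \<kappa>) * (sqrt r / r)" by simp
      also have "sqrt r / r = 1 / sqrt r" using r by (simp add: field_simps flip: real_sqrt_mult)
      finally show "integral {0..N} (\<lambda>s. (norm (weyl_u \<alpha> \<mu> s))\<^sup>2) \<le> (norm \<omega> * K / \<kappa>) / sqrt r"
        by (simp add: u_def)
    qed
    then show ?thesis by (simp add: \<mu>_def)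
  qed
  with reg show thesis by (rule that)
qed

text \<open>Up to a point X of size |\<mu>|^(1/\<alpha>) the solution grows at a rate of size
  |\<mu>|^(1/2), whence the order 1/2 + 1/\<alpha>. Beyond X the multiplier 1 + \<i> bounds the tail
  by the energy at X.\<close>

lemma weyl_norm2_growth:
  assumes Im: "Im (unrotate \<alpha> \<mu>) \<noteq> 0" and \<mu>: "norm \<mu> \<ge> 1"
  shows "weyl_norm2 \<alpha> \<mu> \<le> ((norm (weyl_m \<alpha> \<mu>))\<^sup>2 + 4) * exp ((5 * 3 powr (1 / \<alpha>) + 2) * norm \<mu> powr (1 / 2 + 1 / \<alpha>))"
proof -
  define n where "n = norm \<mu>"
  have n: "n \<ge> 1" using \<mu> by (simp add: n_def)
  \<comment> \<open>With the factor 3, s^\<alpha> - (Re \<mu> + Im \<mu>) \<ge> 3n - 2n \<ge> 1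
    holds beyond X.\<close>
  define X where "X = (3 * n) powr (1 / \<alpha>)"
  have X: "X \<ge> 0" by (simp add: X_def)
  define u where "u = weyl_u \<alpha> \<mu>"
  define u' where "u' = weyl_u' \<alpha> \<mu>"
  define m where "m = norm (weyl_m \<alpha> \<mu>)"
  have sol: "is_sol (pot \<alpha> 0 \<mu> 0) u u'" unfolding u_def u'_def by (rule weyl_is_sol)
  have dec: "decaying u u'" unfolding u_def u'_def by (rule weyl_decaying[OF regular_off_ray[OF Im]])
  have XA: "X powr \<alpha> = 3 * n" using \<alpha> n by (simp add: X_def powr_powr)
  \<comment> \<open>On [0, X] the potential is at most s^\<alpha> + |\<mu>| \<le> 3n + n = k^2, so
    this is the optimal weight in \<open>is_sol_growth\<close>.\<close>
  define k where "k = 2 * sqrt n"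
  have k: "k > 0" "k\<^sup>2 = 4 * n" using n by (auto simp: k_def power_mult_distrib)
  define E where "E = (m\<^sup>2 + 4 * n) * exp (2 * k * X)"
  have grow: "(norm (u' s))\<^sup>2 + (norm (u s))\<^sup>2 \<le> E" if s: "0 \<le> s" "s \<le> X" for s
  proof -
    have "(norm (u' s))\<^sup>2 + k\<^sup>2 * (norm (u s))\<^sup>2 \<le> ((norm (u' 0))\<^sup>2 + k\<^sup>2 * (norm (u 0))\<^sup>2) * exp ((k\<^sup>2 + 4 * n) / k * (s - 0))"
    proof (rule is_sol_growth[OF sol order_refl s(1) k(1)])
      fix t assume t: "0 \<le> t" "t \<le> s"
      then have "t powr \<alpha> \<le> X powr \<alpha>" using s \<alpha> by (intro powr_mono2) auto
      then show "norm (pot \<alpha> 0 \<mu> 0 t) \<le> 4 * n" using norm_pot_zero_le[OF t(1), of \<mu>] by (simp add: XA n_def)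
    qed
    also have "(k\<^sup>2 + 4 * n) / k = 2 * k" unfolding k(2)[symmetric] using k(1) by (simp add: power2_eq_square)
    also have "((norm (u' 0))\<^sup>2 + k\<^sup>2 * (norm (u 0))\<^sup>2) = m\<^sup>2 + 4 * n" by (simp add: u_def u'_def m_def k(2))
    also have "(m\<^sup>2 + 4 * n) * exp (2 * k * (s - 0)) \<le> E"
      unfolding E_def using s k n by (intro mult_left_mono) auto
    finally have "(norm (u' s))\<^sup>2 + k\<^sup>2 * (norm (u s))\<^sup>2 \<le> E" .
    moreover have "1 * (norm (u s))\<^sup>2 \<le> k\<^sup>2 * (norm (u s))\<^sup>2" using k n by (intro mult_right_mono) auto
    ultimately show ?thesis by simp
  qed
  have E0: "E \<ge> 0" using n by (simp add: E_def)
  have cont: "continuous_on {0..} (\<lambda>s. (norm (u s))\<^sup>2)" by (intro continuous_intros is_sol_continuous[OF sol])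
  have first: "integral {0..X} (\<lambda>s. (norm (u s))\<^sup>2) \<le> X * E"
  proof -
    have "integral {0..X} (\<lambda>s. (norm (u s))\<^sup>2) \<le> integral {0..X} (\<lambda>s. E)"
    proof (rule integral_le[OF continuous_integrable_half_line[OF cont order_refl] integrable_const_ivl])
      fix s assume "s \<in> {0..X}"
      then have "(norm (u' s))\<^sup>2 + (norm (u s))\<^sup>2 \<le> E" using grow by simp
      then show "(norm (u s))\<^sup>2 \<le> E" using zero_le_power2[of "norm (u' s)"] by linarith
    qed
    then show ?thesis using X by (simp add: mult.commute)
  qed
  have second: "integral {X..b} (\<lambda>s. (norm (u s))\<^sup>2) \<le> E" if b: "b \<ge> X" for b
  proof -
    have "integral {X..b} (\<lambda>s. (norm (u s))\<^sup>2) \<le> integral {X..b} (\<lambda>s. 1 * (norm (u' s))\<^sup>2 + 1 * (norm (u s))\<^sup>2)"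
      using X by (intro integral_le continuous_integrable_half_line continuous_intros is_sol_continuous[OF sol]) auto
    also have "\<dots> \<le> - energy_flux (1 + \<i>) u u' X"
    proof (rule decaying_energy_bound[OF sol dec])
      fix s assume s: "X \<le> s"
      have "X powr \<alpha> \<le> s powr \<alpha>" using s X \<alpha> by (intro powr_mono2) auto
      moreover have "Re (cnj (1 + \<i>) * pot \<alpha> 0 \<mu> 0 s) = s powr \<alpha> - (Re \<mu> + Im \<mu>)"
        using s X by (simp add: pot_zero algebra_simps)
      moreover have "Re \<mu> + Im \<mu> \<le> 2 * n"
        using complex_Re_le_cmod[of \<mu>] abs_Im_le_cmod[of \<mu>] by (simp add: n_def)
      ultimately show "1 \<le> Re (cnj (1 + \<i>) * pot \<alpha> 0 \<mu> 0 s)" using XA n by linarith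
    qed (use X b in auto)
    also have "\<dots> \<le> norm (1 + \<i>) * ((norm (u X))\<^sup>2 + (norm (u' X))\<^sup>2) / 2"
      using abs_energy_flux_le'[of "1 + \<i>" u u' X] by linarith
    also have "\<dots> \<le> 2 * E / 2"
    proof (intro divide_right_mono mult_mono)
      show "norm (1 + \<i>) \<le> 2" using norm_triangle_ineq[of 1 \<i>] by simp
      show "(norm (u X))\<^sup>2 + (norm (u' X))\<^sup>2 \<le> E" using grow[of X] X by simp
    qed auto
    finally show ?thesis by simp
  qed
  define p where "p = 1 / 2 + 1 / \<alpha>"
  have p: "p \<ge> 1/2" using \<alpha> by (simp add: p_def)
  define T where "T = 3 powr (1 / \<alpha>)"
  have T: "T \<ge> 0" by (simp add: T_def)
  have Xeq: "X = T * n powr (1 / \<alpha>)" using n by (simp add: X_def T_def powr_mult)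
  have "weyl_norm2 \<alpha> \<mu> \<le> (X + 1) * E"
  proof (rule weyl_norm2_le)
    fix N :: real assume N: "N \<ge> 0"
    define b where "b = max N X"
    have "integral {0..N} (\<lambda>s. (norm (u s))\<^sup>2) \<le> integral {0..b} (\<lambda>s. (norm (u s))\<^sup>2)"
      by (intro integral_subset_le continuous_integrable_half_line[OF cont]) (auto simp: b_def)
    also have "\<dots> = integral {0..X} (\<lambda>s. (norm (u s))\<^sup>2) + integral {X..b} (\<lambda>s. (norm (u s))\<^sup>2)"
      by (rule Henstock_Kurzweil_Integration.integral_combine[symmetric])
         (use X in \<open>auto simp: b_def intro: continuous_integrable_half_line[OF cont]\<close>)
    also have "\<dots> \<le> X * E + E" using first second[of b] by (intro add_mono) (auto simp: b_def)
    finally show "integral {0..N} (\<lambda>s. (norm (weyl_u \<alpha> \<mu> s))\<^sup>2) \<le> (X + 1) * E"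
      by (simp add: u_def algebra_simps)
  qed
  also have "\<dots> \<le> exp (T * n powr p) * ((m\<^sup>2 + 4) * exp (2 * n powr p) * exp (4 * T * n powr p))"
  proof (rule mult_mono)
    have "n powr (1 / \<alpha>) \<le> n powr p" using n \<alpha> by (intro powr_mono) (auto simp: p_def)
    then have "X \<le> T * n powr p" using T by (simp add: Xeq mult_left_mono)
    then show "X + 1 \<le> exp (T * n powr p)"
      using exp_ge_add_one_self[of "T * n powr p"] by linarith
    have "n \<le> exp (2 * n powr p)"
    proof -
      have "p * ln n \<le> exp (p * ln n)" using exp_ge_add_one_self[of "p * ln n"] by linarith
      also have "\<dots> = n powr p" using n by (simp add: powr_def)
      finally have "p * ln n \<le> n powr p" .
      moreover have "1/2 * ln n \<le> p * ln n" using p n by (intro mult_right_mono) auto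
      ultimately have "ln n \<le> 2 * n powr p" by simp
      then show ?thesis using n by (metis exp_le_cancel_iff exp_ln less_le_trans zero_less_one)
    qed
    moreover have "1 \<le> exp (2 * n powr p)" by simp
    ultimately have "m\<^sup>2 * 1 + 4 * n \<le> m\<^sup>2 * exp (2 * n powr p) + 4 * exp (2 * n powr p)"
      by (intro add_mono mult_left_mono) auto
    then have 1: "m\<^sup>2 + 4 * n \<le> (m\<^sup>2 + 4) * exp (2 * n powr p)" by (simp add: algebra_simps)
    have "2 * k * X = 4 * T * (sqrt n * n powr (1 / \<alpha>))" by (simp add: k_def Xeq)
    also have "sqrt n * n powr (1 / \<alpha>) = n powr p" using n by (simp add: p_def powr_half_sqrt[symmetric] powr_add)
    finally have 2: "exp (2 * k * X) = exp (4 * T * n powr p)" by simp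
    show "E \<le> (m\<^sup>2 + 4) * exp (2 * n powr p) * exp (4 * T * n powr p)"
      unfolding E_def 2 using 1 by (intro mult_right_mono) auto
  qed (use X E0 in auto)
  also have "\<dots> = (m\<^sup>2 + 4) * exp ((5 * T + 2) * n powr p)"
    by (simp add: mult_exp_exp algebra_simps)
  finally show ?thesis by (simp add: m_def T_def n_def p_def)
qed

end

section \<open>A ray inside the numerical range\<close>

text \<open>The crude value 1/4 is matched to the constants of the inner ray: 1/256 is a quarter of
  1/64, so (1/256) cos(pi/12) \<le> (1/64) sin(pi/12).\<close>

lemma sin_pi12: "sin (pi / 12) \<ge> 1 / 4"
proof -
  have c: "cos (pi / 12) > 0" by (intro cos_gt_zero) auto
  have s: "sin (pi / 12) > 0" by (intro sin_gt_zero) auto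
  have "2 * sin (pi / 12) * cos (pi / 12) = sin (2 * (pi / 12))" by (rule sin_double[symmetric])
  also have "\<dots> = 1 / 2" by (simp add: sin_30)
  finally have "sin (pi / 12) * cos (pi / 12) = 1 / 4" by simp
  moreover have "sin (pi / 12) * cos (pi / 12) \<le> sin (pi / 12) * 1" using s by (intro mult_left_mono) auto
  ultimately show ?thesis by simp
qed

text \<open>Along the ray the derivative has argument -pi/12 + (\<alpha> - 1) \<theta> with \<theta>
  in [-pi/6, 0]. For \<alpha> between 1/2 and 1 this stays in [-pi/12, 0], so the imaginary part
  never rises above its value at s = 0.\<close>

lemma Im_rotated_power_le:
  fixes \<alpha> x s :: real
  assumes \<alpha>: "1 / 2 \<le> \<alpha>" "\<alpha> \<le> 1" and x: "x > 0" and s: "s \<ge> 0"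
  shows "Im (cis (pi / 12) * (of_real x + cis (- (pi / 6)) * of_real s) powr of_real \<alpha>) \<le> x powr \<alpha> * sin (pi / 12)"
proof -
  define w where "w s = of_real x + cis (- (pi / 6)) * of_real s" for s
  define g' where "g' s = cis (pi / 12) * (cis (- (pi / 6)) * (of_real \<alpha> * w s powr (of_real \<alpha> - 1)))" for s
  have pos: "Re (w s) > 0" if "s \<ge> 0" for s
  proof -
    have "cos (pi / 6) > 0" by (intro cos_gt_zero) auto
    then show ?thesis using x that by (simp add: w_def add_pos_nonneg)
  qed
  have der: "((\<lambda>s. cis (pi / 12) * w s powr of_real \<alpha>) has_vector_derivative g' s) (at s within {0..})" if s: "s \<ge> 0" for s
  proof -
    have "w s \<notin> \<real>\<^sub>\<le>\<^sub>0" using pos[OF s] by (auto simp: complex_nonpos_Reals_iff)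
    from has_field_derivative_powr[OF this, of "of_real \<alpha>"]
    have p: "((\<lambda>z. z powr of_real \<alpha>) has_field_derivative of_real \<alpha> * w s powr (of_real \<alpha> - 1)) (at (w s) within w ` {0..})"
      by (rule DERIV_subset) simp
    have "(w has_vector_derivative 0 + cis (- (pi / 6)) * 1) (at s within {0..})"
      unfolding w_def by (intro has_vector_derivative_add has_vector_derivative_mult_right) (auto intro!: derivative_eq_intros)
    then have "((\<lambda>z. z powr of_real \<alpha>) \<circ> w has_vector_derivative (0 + cis (- (pi / 6)) * 1) * (of_real \<alpha> * w s powr (of_real \<alpha> - 1))) (at s within {0..})"
      by (rule field_vector_diff_chain_within[OF _ p])
    from has_vector_derivative_mult_right[OF this, of "cis (pi / 12)"]
    show ?thesis by (simp add: g'_def o_def)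
  qed
  have neg: "Im (g' s) \<le> 0" if s: "s \<ge> 0" for s
  proof (cases "s = 0")
    case True
    have "g' s = of_real (\<alpha> * x powr (\<alpha> - 1)) * cis (- (pi / 12))"
      using x by (simp add: True g'_def w_def cis_mult mult_ac powr_of_real[of x "\<alpha> - 1", simplified])
    moreover have "sin (pi / 12) \<ge> 0" using sin_pi12 by linarith
    ultimately show ?thesis using \<alpha> by simp
  next
    case False
    define \<theta> where "\<theta> = Im (Ln (w s))"
    have weq: "w s = of_real x + of_real s * cis (- (pi / 6))" by (simp add: w_def)
    have \<theta>: "- (pi / 6) \<le> \<theta>" "\<theta> \<le> 0"
      using Arg_of_shifted_ray(4)[of x s "- (pi / 6)"] x s False unfolding \<theta>_def weq by auto
    have nz: "w s \<noteq> 0" using pos[OF s] by auto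
    define N where "N = norm (w s) powr (\<alpha> - 1)"
    have "w s powr of_real (\<alpha> - 1) = exp (of_real (\<alpha> - 1) * Ln (w s))" using nz by (simp add: powr_def)
    also have "\<dots> = of_real (exp ((\<alpha> - 1) * Re (Ln (w s)))) * cis ((\<alpha> - 1) * \<theta>)" by (simp add: exp_eq_polar \<theta>_def)
    also have "exp ((\<alpha> - 1) * Re (Ln (w s))) = N" using nz by (simp add: N_def powr_def Re_Ln)
    finally have "w s powr (of_real \<alpha> - 1) = of_real N * cis ((\<alpha> - 1) * \<theta>)" by simp
    then have "g' s = of_real (\<alpha> * N) * (cis (pi / 12) * cis (- (pi / 6)) * cis ((\<alpha> - 1) * \<theta>))"
      by (simp add: g'_def mult_ac)
    also have "cis (pi / 12) * cis (- (pi / 6)) * cis ((\<alpha> - 1) * \<theta>) = cis (- (pi / 12) + (\<alpha> - 1) * \<theta>)"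
      by (simp add: cis_mult)
    finally have eq: "Im (g' s) = \<alpha> * N * sin (- (pi / 12) + (\<alpha> - 1) * \<theta>)" by simp
    have "(1 - \<alpha>) * (- \<theta>) \<le> (1 / 2) * (pi / 6)" using \<alpha> \<theta> by (intro mult_mono) auto
    moreover have "(1 - \<alpha>) * (- \<theta>) \<ge> 0" using \<alpha> \<theta> by (intro mult_nonneg_nonneg) auto
    moreover have "(\<alpha> - 1) * \<theta> = (1 - \<alpha>) * (- \<theta>)" by (simp add: algebra_simps)
    ultimately have "sin (- (- (pi / 12) + (\<alpha> - 1) * \<theta>)) \<ge> 0" by (intro sin_ge_zero) auto
    then have "sin (- (pi / 12) + (\<alpha> - 1) * \<theta>) \<le> 0" by (simp only: sin_minus)
    moreover have "\<alpha> * N \<ge> 0" using \<alpha> by (simp add: N_def)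
    ultimately show ?thesis unfolding eq by (simp add: mult_nonneg_nonpos)
  qed
  have "- Im (cis (pi / 12) * w 0 powr of_real \<alpha>) \<le> - Im (cis (pi / 12) * w s powr of_real \<alpha>)"
  proof (rule nondecreasing_on_half_line[of "\<lambda>s. - Im (cis (pi / 12) * w s powr of_real \<alpha>)" "\<lambda>s. - Im (g' s)"])
    show "((\<lambda>s. - Im (cis (pi / 12) * w s powr of_real \<alpha>)) has_real_derivative - Im (g' s)) (at s within {0..})" if "s \<ge> 0" for s
    proof (rule DERIV_minus)
      show "((\<lambda>s. Im (cis (pi / 12) * w s powr of_real \<alpha>)) has_real_derivative Im (g' s)) (at s within {0..})"
        using bounded_linear.has_vector_derivative[OF bounded_linear_Im der[OF that]]
        by (simp only: has_real_derivative_iff_has_vector_derivative)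
    qed
  qed (use s neg in auto)
  moreover have "Im (cis (pi / 12) * w 0 powr of_real \<alpha>) = x powr \<alpha> * sin (pi / 12)"
    using x by (simp add: w_def powr_of_real)
  ultimately show ?thesis by (simp add: w_def)
qed

text \<open>On the ray \<open>\<mu> = b (1/256 + \<i>)\<close>, close to the boundary of the numerical range, the resolvent is
  exponentially large, but the normalized decaying solution is not: rotating the ray of integration
  about a point \<open>x\<^sub>1\<close> slightly to the left of the turning point shows that the solution decays
  exponentially on \<open>[0, x\<^sub>1]\<close>, and it can grow only by a much smaller factor near the turning point.\<close>

context
  fixes \<alpha> :: real
  assumes \<alpha>: "1 / 2 \<le> \<alpha>" "\<alpha> \<le> 1"
begin

lemma alpha_pos: "\<alpha> > 0" using \<alpha> by simp

lemma unrotate_inner_ray: "Im (unrotate \<alpha> (of_real b * Complex (1 / 256) 1)) = b * (cos (pi / (2 + \<alpha>)) - 1 / 256 * sin (pi / (2 + \<alpha>)))"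
  by (simp add: unrotate_def algebra_simps)

text \<open>The eigenvalue ray has argument at most 5 pi/12, so it is at least pi/12 away from the
  imaginary axis, much further than the inner ray.\<close>

lemma unrotate_inner_ray_pos: "cos (pi / (2 + \<alpha>)) - 1 / 256 * sin (pi / (2 + \<alpha>)) > 0"
proof -
  have "pi / (2 + \<alpha>) \<le> pi / 2 - pi / 12"
  proof -
    have "pi / (2 + \<alpha>) \<le> pi / (12 / 5)" using \<alpha> by (intro divide_left_mono) auto
    then show ?thesis by simp
  qed
  then have "cos (pi / 2 - pi / 12) \<le> cos (pi / (2 + \<alpha>))"
    using alpha_pos by (intro cos_monotone_0_pi_le) auto
  moreover have "cos (pi / 2 - pi / 12) = sin (pi / 12)" by (simp only: cos_diff cos_pi_half sin_pi_half mult_zero_left mult_1 add_0)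
  ultimately have "sin (pi / 12) \<le> cos (pi / (2 + \<alpha>))" by simp
  moreover have "sin (pi / (2 + \<alpha>)) \<le> 1" by simp
  ultimately show ?thesis using sin_pi12 by linarith
qed

text \<open>The angles serve two ends. Along the ray turned by -pi/6 the multiplier cis(-5 pi/12)
  contributes the total rotation 5 pi/12 - 2 pi/6 = pi/12 of \<open>Im_rotated_power_le\<close>, and
  the potential is accretive from s = 0 on. At s = 0 it combines with the factor exp \<zeta> of the
  slope to 5 pi/12 - pi/6 = pi/4, which is the multiplier 1 - \<i> on the original
  half-line.\<close>

lemma inner_ray_flux:
  assumes b: "b > 0" and x: "x > 0" "x powr \<alpha> \<le> b * (63 / 64)"
    and d: "dec_data \<alpha> 0 (of_real b * Complex (1 / 256) 1) 0 a m"
  defines "\<mu> \<equiv> of_real b * Complex (1 / 256) 1"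
  shows "energy_flux (1 - \<i>) (sol (pot \<alpha> 0 \<mu> 0) a m) (dsol (pot \<alpha> 0 \<mu> 0) a m) x \<le> 0"
proof -
  define u where "u = sol (pot \<alpha> 0 \<mu> 0) a m x"
  define u' where "u' = dsol (pot \<alpha> 0 \<mu> 0) a m x"
  define \<zeta> where "\<zeta> = - \<i> * complex_of_real (pi / 6)"
  have e\<zeta>: "exp \<zeta> = cis (- (pi / 6))" by (simp add: \<zeta>_def cis_conv_exp)
  have \<zeta>: "\<zeta> \<in> strip \<alpha>"
  proof -
    have "(2 + \<alpha>) * (pi / 6) \<le> 3 * (pi / 6)" using \<alpha> by (intro mult_right_mono) auto
    moreover have "0 \<le> (2 + \<alpha>) * (pi / 6)" using \<alpha> by simp
    moreover have "(2 + \<alpha>) * Im \<zeta> = - ((2 + \<alpha>) * (pi / 6))" by (simp add: \<zeta>_def)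
    ultimately show ?thesis using pi_gt_zero unfolding strip_def mem_Collect_eq by linarith
  qed
  have "dec_data \<alpha> x \<mu> 0 u u'"
    unfolding u_def u'_def using dec_data_shift[OF alpha_pos _ d[folded \<mu>_def]] x by simp
  then have dd: "dec_data \<alpha> x \<mu> \<zeta> u (exp \<zeta> * u')"
    using x by (intro dec_data_rotate[OF alpha_pos _ \<zeta>]) auto
  define p where "p = pot \<alpha> x \<mu> \<zeta>"
  have q: "continuous_on {0..} p" unfolding p_def using x by (intro pot_continuous[OF alpha_pos] strip_imp[OF alpha_pos \<zeta>]) auto
  define \<omega> where "\<omega> = cis (- (5 * pi / 12))"
  have cw: "cnj \<omega> = cis (5 * pi / 12)" by (simp add: \<omega>_def cis_cnj)
  have "Re \<omega> \<ge> 0" by (simp add: \<omega>_def) (intro cos_ge_zero; simp)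
  have good: "0 \<le> Re (cnj \<omega> * p s)" if s: "s \<ge> 0" for s
  proof -
    define W where "W = (of_real x + cis (- (pi / 6)) * of_real s) powr (of_real \<alpha> :: complex)"
    have "cnj \<omega> * p s = (cis (5 * pi / 12) * cis (- (pi / 6)) * cis (- (pi / 6))) * (\<i> * W - \<mu>)"
      by (simp add: cw p_def pot_def e\<zeta> W_def power2_eq_square mult_ac)
    also have "cis (5 * pi / 12) * cis (- (pi / 6)) * cis (- (pi / 6)) = cis (pi / 12)"
      by (simp add: cis_mult)
    also have "cis (pi / 12) * (\<i> * W - \<mu>) = \<i> * (cis (pi / 12) * W) - cis (pi / 12) * \<mu>"
      by (simp add: algebra_simps)
    finally have "Re (cnj \<omega> * p s) = - Im (cis (pi / 12) * W) - Re (cis (pi / 12) * \<mu>)"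
      by (simp only: minus_complex.simps Re_i_times)
    moreover have "Im (cis (pi / 12) * W) \<le> x powr \<alpha> * sin (pi / 12)"
      unfolding W_def by (rule Im_rotated_power_le[OF \<alpha> x(1) s])
    moreover have "x powr \<alpha> * sin (pi / 12) \<le> b * (63 / 64) * sin (pi / 12)"
      using x sin_pi12 by (intro mult_right_mono) auto
    moreover have "Re (cis (pi / 12) * \<mu>) = b * (1 / 256 * cos (pi / 12) - sin (pi / 12))"
      by (simp add: \<mu>_def algebra_simps)
    moreover have "b * (1 / 256 * cos (pi / 12) - sin (pi / 12)) + b * (63 / 64) * sin (pi / 12)
        = b * (1 / 256 * cos (pi / 12) - 1 / 64 * sin (pi / 12))" by (simp add: algebra_simps)
    \<comment> \<open>The margin 1/64 to the left of the turning point pays for the real part b/256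
      of \<mu>, since sin(pi/12) \<ge> 1/4.\<close>
    moreover have "b * (1 / 256 * cos (pi / 12) - 1 / 64 * sin (pi / 12)) \<le> 0"
    proof -
      have "1 / 256 * cos (pi / 12) - 1 / 64 * sin (pi / 12) \<le> 0"
        using sin_pi12 cos_le_one[of "pi / 12"] by linarith
      then show ?thesis using b by (simp add: mult_nonneg_nonpos)
    qed
    ultimately show ?thesis by linarith
  qed
  have "energy_flux \<omega> (sol p u (exp \<zeta> * u')) (dsol p u (exp \<zeta> * u')) 0 \<le> 0"
    by (rule decaying_flux_nonpos[OF is_sol_sol[OF q] _ \<open>Re \<omega> \<ge> 0\<close> good order_refl order_refl])
       (use dd in \<open>simp_all add: dec_data_def[OF alpha_pos] p_def\<close>)
  then have "Re (cnj \<omega> * (exp \<zeta> * u') * cnj u) \<le> 0" by (simp add: energy_flux_def sol_0'[OF q])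
  moreover have "cnj \<omega> * (exp \<zeta> * u') * cnj u = of_real (1 / sqrt 2) * ((1 + \<i>) * u' * cnj u)"
  proof -
    have "cnj \<omega> * exp \<zeta> = cis (pi / 4)" by (simp add: cw e\<zeta> cis_mult)
    also have "\<dots> = of_real (1 / sqrt 2) * (1 + \<i>)" by (simp add: complex_eq_iff cos_45 sin_45 real_div_sqrt field_simps)
    finally have "cnj \<omega> * exp \<zeta> * u' * cnj u = of_real (1 / sqrt 2) * (1 + \<i>) * u' * cnj u" by simp
    then show ?thesis by (simp only: mult.assoc)
  qed
  ultimately have "1 / sqrt 2 * Re ((1 + \<i>) * u' * cnj u) \<le> 0"
    by (simp only: times_complex.simps Re_complex_of_real Im_complex_of_real mult_zero_left diff_zero)
  then have "Re ((1 + \<i>) * u' * cnj u) \<le> 0"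
  proof -
    define X where "X = Re ((1 + \<i>) * u' * cnj u)"
    have "1 / sqrt 2 * X \<le> 0" using \<open>1 / sqrt 2 * Re ((1 + \<i>) * u' * cnj u) \<le> 0\<close> unfolding X_def .
    then have "X \<le> 0" by (simp add: divide_le_0_iff)
    then show ?thesis unfolding X_def .
  qed
  then show ?thesis by (simp add: energy_flux_def u_def u'_def)
qed

text \<open>The half-line is cut where s^\<alpha> equals b/4, 63 b/64 and 65 b/64. On [0, xh] the
  flux for 1 - \<i> decays exponentially at rate sqrt b. Around the turning point |q| \<le> 3 b/64
  allows growth only at rate 2k \<le> sqrt b/2 over a length of at most B/16 + 1. Beyond x2 the
  multiplier 1 + \<i> controls the tail. The decay wins because xh \<ge> B/16.\<close>

lemma weyl_norm2_inner_ray: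
  assumes b: "b \<ge> 1024"
  defines "\<mu> \<equiv> of_real b * Complex (1 / 256) 1"
  shows "weyl_norm2 \<alpha> \<mu> \<le> 8 * b ^ 3 * norm (weyl_m \<alpha> \<mu>)"
proof -
  define y where "y = 1 / \<alpha>"
  have y: "1 \<le> y" "y \<le> 2" using \<alpha> by (auto simp: y_def field_simps)
  have pw: "(t powr y) powr \<alpha> = t" if "t \<ge> 0" for t using that alpha_pos by (simp add: y_def powr_powr)
  define x1 where "x1 = (b * (63 / 64)) powr y"
  define x2 where "x2 = (b * (65 / 64)) powr y"
  define xh where "xh = (b / 4) powr y"
  define B where "B = b powr y"
  have Bb: "B \<ge> b" "B \<le> b ^ 2"
  proof -
    have "b powr 1 \<le> b powr y" using b y by (intro powr_mono) auto
    then show "B \<ge> b" using b by (simp add: B_def)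
    have "b powr y \<le> b powr 2" using b y by (intro powr_mono) auto
    then show "B \<le> b ^ 2" using b by (simp add: B_def)
  qed
  have xh: "xh \<ge> B / 16"
  proof -
    have "(1 / 4 :: real) powr 2 \<le> (1 / 4) powr y" using y by (intro powr_mono') auto
    then have "1 / 16 \<le> (1 / 4 :: real) powr y" by (simp add: power2_eq_square)
    then have "B * (1 / 16) \<le> B * (1 / 4) powr y" using Bb b by (intro mult_left_mono) auto
    also have "\<dots> = xh" using b powr_mult[of b "1 / 4" y] by (simp add: B_def xh_def)
    finally show ?thesis by simp
  qed
  have x21: "x2 - x1 \<le> B / 16"
  proof -
    have "(65 / 64 :: real) powr y \<le> (65 / 64) powr 2" using y by (intro powr_mono) auto
    moreover have "(63 / 64 :: real) powr 2 \<le> (63 / 64) powr y" using y by (intro powr_mono') auto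
    ultimately have "(65 / 64 :: real) powr y - (63 / 64) powr y \<le> 1 / 16" by (simp add: power2_eq_square)
    then have "B * ((65 / 64) powr y - (63 / 64) powr y) \<le> B * (1 / 16)" using Bb b by (intro mult_left_mono) auto
    moreover have "x2 = B * (65 / 64) powr y" "x1 = B * (63 / 64) powr y"
      using b powr_mult[of b "65 / 64" y] powr_mult[of b "63 / 64" y] by (auto simp: x1_def x2_def B_def)
    ultimately show ?thesis by (simp add: algebra_simps)
  qed
  have x1: "x1 \<ge> 1" "x1 powr \<alpha> = b * (63 / 64)" "x1 > 0"
  proof -
    show "x1 powr \<alpha> = b * (63 / 64)" unfolding x1_def using b by (intro pw) auto
    show "x1 \<ge> 1" unfolding x1_def using b y by (intro ge_one_powr_ge_zero) auto
    then show "x1 > 0" by simp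
  qed
  have x12: "x1 \<le> x2" unfolding x1_def x2_def using b y by (intro powr_mono2) auto
  have x2: "x2 powr \<alpha> = b * (65 / 64)" unfolding x2_def using b by (intro pw) auto
  have xhp: "xh powr \<alpha> = b / 4" unfolding xh_def using b by (intro pw) auto
  \<comment> \<open>One unit to the left of x1 the power s^\<alpha> is lower by at most 1, as
    \<alpha> \<le> 1, and hence by less than b/64.\<close>
  have x1m: "(x1 - 1) powr \<alpha> \<ge> b * (62 / 64)"
  proof -
    define t where "t = (x1 - 1) / x1"
    have t: "0 \<le> t" "t \<le> 1" using x1 by (auto simp: t_def field_simps)
    have "t \<le> t powr \<alpha>" using t \<alpha> powr_mono'[of \<alpha> 1 t] by (cases "t = 0") auto
    then have "x1 powr \<alpha> * t \<le> x1 powr \<alpha> * t powr \<alpha>" by (intro mult_left_mono) auto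
    also have "\<dots> = (x1 - 1) powr \<alpha>" using x1 t powr_mult[of x1 t \<alpha>] by (simp add: t_def)
    finally have 1: "x1 powr \<alpha> * t \<le> (x1 - 1) powr \<alpha>" .
    have "x1 powr \<alpha> * t = x1 powr \<alpha> - x1 powr \<alpha> / x1" using x1 by (simp add: t_def field_simps)
    moreover have "x1 powr \<alpha> / x1 \<le> 1" using x1 \<alpha> powr_mono[of \<alpha> 1 x1] by (simp add: field_simps)
    ultimately show ?thesis using 1 x1(2) b by linarith
  qed
  have xh1: "xh \<le> x1 - 1"
  proof (rule ccontr)
    assume "\<not> xh \<le> x1 - 1"
    then have "(x1 - 1) powr \<alpha> \<le> xh powr \<alpha>" using x1 \<alpha> by (intro powr_mono2) auto
    then show False using x1m xhp b by linarith
  qed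
  have xh0: "xh \<ge> 0" by (simp add: xh_def)
  define u where "u = weyl_u \<alpha> \<mu>"
  define u' where "u' = weyl_u' \<alpha> \<mu>"
  define m where "m = norm (weyl_m \<alpha> \<mu>)"
  define q where "q = pot \<alpha> 0 \<mu> 0"
  have Im: "Im (unrotate \<alpha> \<mu>) \<noteq> 0"
    unfolding \<mu>_def unrotate_inner_ray using unrotate_inner_ray_pos b by simp
  have sol: "is_sol q u u'" unfolding u_def u'_def q_def by (rule weyl_is_sol[OF alpha_pos])
  have dec: "decaying u u'" unfolding u_def u'_def by (rule weyl_decaying[OF alpha_pos regular_off_ray[OF alpha_pos Im]])
  have q: "q s = Complex (- b / 256) (s powr \<alpha> - b)" if "s \<ge> 0" for s
    unfolding q_def pot_zero[OF alpha_pos that] \<mu>_def by (simp add: complex_eq_iff)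
  define F where "F = energy_flux (1 - \<i>) u u'"
  have Req: "Re (cnj (1 - \<i>) * q s) = b * (255 / 256) - s powr \<alpha>" if "s \<ge> 0" for s
    by (simp add: q[OF that])
  have Fx1: "F x1 \<le> 0"
    unfolding F_def u_def u'_def weyl_u_def weyl_u'_def \<mu>_def
    by (rule inner_ray_flux) (use b x1 weyl_exists[OF alpha_pos regular_off_ray[OF alpha_pos Im]] in \<open>auto simp: \<mu>_def\<close>)
  have low: "Re (cnj (1 - \<i>) * q s) \<ge> 1" if "0 \<le> s" "s \<le> x1" for s
  proof -
    have "s powr \<alpha> \<le> x1 powr \<alpha>" using that \<alpha> by (intro powr_mono2) auto
    then show ?thesis using Req[OF that(1)] x1 b by linarith
  qed
  have Fneg: "F s \<le> 0" if "0 \<le> s" "s \<le> x1" for s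
  proof -
    have "F s \<le> F x1" unfolding F_def
    proof (rule energy_flux_mono[OF sol _ that])
      show "0 \<le> Re (cnj (1 - \<i>) * q t)" if "s \<le> t" "t \<le> x1" for t
        using low[of t] that \<open>0 \<le> s\<close> by linarith
    qed simp
    then show ?thesis using Fx1 by simp
  qed
  have F0: "- F 0 \<le> 2 * m"
  proof -
    have "- F 0 \<le> norm (1 - \<i>) * norm (u 0) * norm (u' 0)" unfolding F_def using abs_energy_flux_le[of "1 - \<i>" u u' 0] by linarith
    also have "\<dots> = norm (1 - \<i>) * m" by (simp add: u_def u'_def m_def weyl_initial[OF alpha_pos])
    also have "\<dots> \<le> 2 * m" using norm_triangle_ineq4[of 1 \<i>] by (intro mult_right_mono) (auto simp: m_def)
    finally show ?thesis .
  qed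
  \<comment> \<open>Up to xh the potential coefficient is at least b/2, so the derivative of F
    dominates sqrt b |F| and F exp(sqrt b s) is nondecreasing.\<close>
  have decay: "- F xh \<le> 2 * m * exp (- (sqrt b * xh))"
  proof -
    have "F 0 * exp (sqrt b * 0) \<le> F xh * exp (sqrt b * xh)"
    proof (rule nondecreasing_on_half_line[of "\<lambda>s. F s * exp (sqrt b * s)"
        "\<lambda>s. (Re (1 - \<i>) * (norm (u' s))\<^sup>2 + Re (cnj (1 - \<i>) * q s) * (norm (u s))\<^sup>2 + sqrt b * F s) * exp (sqrt b * s)"])
      show "((\<lambda>s. F s * exp (sqrt b * s)) has_real_derivative
          (Re (1 - \<i>) * (norm (u' s))\<^sup>2 + Re (cnj (1 - \<i>) * q s) * (norm (u s))\<^sup>2 + sqrt b * F s) * exp (sqrt b * s)) (at s within {0..})"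
        if "s \<ge> 0" for s
        using energy_flux_has_derivative[OF sol that, of "1 - \<i>"] unfolding F_def[symmetric]
        by (auto intro!: derivative_eq_intros simp: algebra_simps)
      fix s assume s: "0 \<le> s" "s \<le> xh"
      have "s powr \<alpha> \<le> xh powr \<alpha>" using s \<alpha> by (intro powr_mono2) auto
      then have c: "Re (cnj (1 - \<i>) * q s) \<ge> b / 2" using Req[OF s(1)] xhp b by linarith
      have "sqrt b * (- F s) \<le> sqrt b * (sqrt 2 * norm (u s) * norm (u' s))"
      proof (rule mult_left_mono)
        have "norm (1 - \<i>) = sqrt 2" by (simp add: cmod_def)
        then show "- F s \<le> sqrt 2 * norm (u s) * norm (u' s)"
          unfolding F_def using abs_energy_flux_le[of "1 - \<i>" u u' s] by simp
      qed (use b in simp)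
      also have "\<dots> = 2 * (norm (u' s) * (sqrt (b / 2) * norm (u s)))"
        using b by (simp add: real_sqrt_divide real_sqrt_mult field_simps)
      also have "\<dots> \<le> (norm (u' s))\<^sup>2 + (sqrt (b / 2) * norm (u s))\<^sup>2"
        using sum_squares_bound[of "norm (u' s)" "sqrt (b / 2) * norm (u s)"] by (simp add: mult.assoc)
      also have "\<dots> = (norm (u' s))\<^sup>2 + b / 2 * (norm (u s))\<^sup>2" using b by (simp add: power_mult_distrib)
      also have "\<dots> \<le> (norm (u' s))\<^sup>2 + Re (cnj (1 - \<i>) * q s) * (norm (u s))\<^sup>2"
        using c by (intro add_left_mono mult_right_mono) auto
      finally have "sqrt b * (- F s) \<le> (norm (u' s))\<^sup>2 + Re (cnj (1 - \<i>) * q s) * (norm (u s))\<^sup>2" .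
      then have "0 \<le> Re (1 - \<i>) * (norm (u' s))\<^sup>2 + Re (cnj (1 - \<i>) * q s) * (norm (u s))\<^sup>2 + sqrt b * F s"
        by (simp only: minus_complex.simps one_complex.simps imaginary_unit.simps) simp
      then show "0 \<le> (Re (1 - \<i>) * (norm (u' s))\<^sup>2 + Re (cnj (1 - \<i>) * q s) * (norm (u s))\<^sup>2 + sqrt b * F s) * exp (sqrt b * s)"
        by (rule mult_nonneg_nonneg) simp
    qed (use xh0 in auto)
    then have "- F xh * exp (sqrt b * xh) \<le> 2 * m" using F0 by simp
    then have "- F xh * exp (sqrt b * xh) * exp (- (sqrt b * xh)) \<le> 2 * m * exp (- (sqrt b * xh))"
      by (rule mult_right_mono) simp
    then show ?thesis by (simp add: mult.assoc mult_exp_exp)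
  qed
  define h where "h s = (norm (u' s))\<^sup>2 + (norm (u s))\<^sup>2" for s
  have h0: "h s \<ge> 0" for s by (simp add: h_def)
  have conth: "continuous_on {0..} h" unfolding h_def by (intro continuous_intros is_sol_continuous[OF sol])
  have segF: "integral {c..d} h \<le> - F c" if "0 \<le> c" "c \<le> d" "d \<le> x1" for c d
  proof -
    have "integral {c..d} (\<lambda>s. 1 * (norm (u' s))\<^sup>2 + 1 * (norm (u s))\<^sup>2) \<le> F d - F c"
      unfolding F_def by (rule energy_inequality[OF sol that(1,2)]) (use low that in auto)
    then show ?thesis using Fneg[of d] that by (simp add: h_def[abs_def])
  qed
  \<comment> \<open>Passage from an integral bound to a pointwise one: the minimum of h over an
    interval of length 1 is at most its integral.\<close>
  obtain s0 where s0: "x1 - 1 \<le> s0" "s0 \<le> x1" "h s0 \<le> - F xh"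
  proof -
    have "continuous_on {x1 - 1..x1} h" using x1 by (intro continuous_on_subset[OF conth]) auto
    then obtain s0 where s0: "s0 \<in> {x1 - 1..x1}" "\<And>s. s \<in> {x1 - 1..x1} \<Longrightarrow> h s0 \<le> h s"
      using continuous_attains_inf[of "{x1 - 1..x1}" h] by auto
    have "h s0 = integral {x1 - 1..x1} (\<lambda>_. h s0)" by simp
    also have "\<dots> \<le> integral {x1 - 1..x1} h"
      using s0 x1 by (intro integral_le continuous_integrable_half_line[OF conth]) auto
    also have "\<dots> \<le> integral {xh..x1} h"
      using xh1 xh0 x1 h0 by (intro integral_subset_le continuous_integrable_half_line[OF conth]) auto
    also have "\<dots> \<le> - F xh" by (rule segF) (use xh0 xh1 in auto)
    finally show thesis using s0 that by auto
  qed
  \<comment> \<open>The factor 3/64 covers the deviation 2/64 of s^\<alpha>/b from 1 in the turning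
    zone together with the real part 1/256 of \<mu>/b.\<close>
  define k where "k = sqrt (3 / 64 * b)"
  have k: "k > 0" "k\<^sup>2 = 3 / 64 * b" "k\<^sup>2 \<ge> 1" using b by (auto simp: k_def)
  have turn: "h x \<le> b * m" if x: "x1 \<le> x" "x \<le> x2" for x
  proof -
    have s0p: "s0 \<ge> 0" using s0 x1 by linarith
    have "(norm (u' x))\<^sup>2 + k\<^sup>2 * (norm (u x))\<^sup>2 \<le> ((norm (u' s0))\<^sup>2 + k\<^sup>2 * (norm (u s0))\<^sup>2) * exp ((k\<^sup>2 + k\<^sup>2) / k * (x - s0))"
    proof (rule is_sol_growth[OF sol s0p _ k(1)])
      show "s0 \<le> x" using s0 x by simp
      fix s assume s: "s0 \<le> s" "s \<le> x"
      have sp: "s \<ge> 0" using s s0p by simp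
      have "(x1 - 1) powr \<alpha> \<le> s powr \<alpha>" using s s0 x1 \<alpha> by (intro powr_mono2) auto
      moreover have "s powr \<alpha> \<le> x2 powr \<alpha>" using s x sp \<alpha> by (intro powr_mono2) auto
      ultimately have "\<bar>s powr \<alpha> - b\<bar> \<le> 2 / 64 * b" using x1m x2 b unfolding abs_le_iff by linarith
      moreover have "norm (q s) \<le> \<bar>- b / 256\<bar> + \<bar>s powr \<alpha> - b\<bar>" using cmod_le[of "q s"] by (simp add: q[OF sp])
      ultimately show "norm (q s) \<le> k\<^sup>2" using k(2) b by simp
    qed
    also have "(k\<^sup>2 + k\<^sup>2) / k = 2 * k" using k(1) by (simp add: power2_eq_square)
    also have "((norm (u' s0))\<^sup>2 + k\<^sup>2 * (norm (u s0))\<^sup>2) * exp (2 * k * (x - s0)) \<le> (k\<^sup>2 * (- F xh)) * exp (2 * k * (x2 - x1 + 1))"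
    proof (rule mult_mono)
      have "1 * (norm (u' s0))\<^sup>2 \<le> k\<^sup>2 * (norm (u' s0))\<^sup>2" using k(3) by (intro mult_right_mono) auto
      then have "(norm (u' s0))\<^sup>2 + k\<^sup>2 * (norm (u s0))\<^sup>2 \<le> k\<^sup>2 * h s0" by (simp add: h_def distrib_left)
      also have "\<dots> \<le> k\<^sup>2 * (- F xh)" using s0 by (intro mult_left_mono) auto
      finally show "(norm (u' s0))\<^sup>2 + k\<^sup>2 * (norm (u s0))\<^sup>2 \<le> k\<^sup>2 * (- F xh)" .
      then show "0 \<le> k\<^sup>2 * (- F xh)" by (rule order_trans[rotated]) simp
      show "exp (2 * k * (x - s0)) \<le> exp (2 * k * (x2 - x1 + 1))" using k s0 x by simp
    qed simp
    also have "\<dots> \<le> (k\<^sup>2 * (2 * m * exp (- (sqrt b * xh)))) * exp (2 * k * (x2 - x1 + 1))"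
      using decay k by (intro mult_right_mono mult_left_mono) auto
    also have "\<dots> = 2 * k\<^sup>2 * m * exp (2 * k * (x2 - x1 + 1) - sqrt b * xh)"
      by (simp add: mult_exp_exp)
    also have "\<dots> \<le> 2 * k\<^sup>2 * m * 1"
    proof (rule mult_left_mono)
      have "k \<le> sqrt (1 / 16 * b)" unfolding k_def using b by (intro real_sqrt_le_mono) auto
      also have "\<dots> = sqrt b / 4" by (simp add: real_sqrt_mult real_sqrt_divide)
      finally have "2 * k \<le> sqrt b / 2" by simp
      then have "2 * k * (x2 - x1 + 1) \<le> sqrt b / 2 * (B / 16 + 1)"
        using x21 x12 k b by (intro mult_mono) auto
      also have "\<dots> \<le> sqrt b * (B / 16)"
      proof -
        have "1 / 2 * (B / 16 + 1) \<le> B / 16" using Bb b by simp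
        then have "sqrt b * (1 / 2 * (B / 16 + 1)) \<le> sqrt b * (B / 16)" using b by (intro mult_left_mono) auto
        then show ?thesis by simp
      qed
      also have "\<dots> \<le> sqrt b * xh" using xh b by (intro mult_left_mono) auto
      finally show "exp (2 * k * (x2 - x1 + 1) - sqrt b * xh) \<le> 1" by simp
    qed (simp add: m_def)
    also have "\<dots> \<le> b * m" unfolding k(2) using b by (simp add: m_def mult_right_mono)
    finally have "(norm (u' x))\<^sup>2 + k\<^sup>2 * (norm (u x))\<^sup>2 \<le> b * m" .
    moreover have "1 * (norm (u x))\<^sup>2 \<le> k\<^sup>2 * (norm (u x))\<^sup>2" using k by (intro mult_right_mono) auto
    ultimately show ?thesis by (simp add: h_def)
  qed
  have tail: "integral {x2..d} h \<le> b * m" if d: "x2 \<le> d" for d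
  proof -
    have "integral {x2..d} (\<lambda>s. 1 * (norm (u' s))\<^sup>2 + 1 * (norm (u s))\<^sup>2) \<le> - energy_flux (1 + \<i>) u u' x2"
    proof (rule decaying_energy_bound[OF sol dec])
      fix s assume s: "x2 \<le> s"
      have s0: "s \<ge> 0" using s x1 x12 by linarith
      have "x2 powr \<alpha> \<le> s powr \<alpha>" using s x1 x12 \<alpha> by (intro powr_mono2) auto
      then show "1 \<le> Re (cnj (1 + \<i>) * q s)" using x2 b by (simp add: q[OF s0])
    qed (use x1 x12 d in auto)
    also have "\<dots> \<le> norm (1 + \<i>) * ((norm (u x2))\<^sup>2 + (norm (u' x2))\<^sup>2) / 2"
      using abs_energy_flux_le'[of "1 + \<i>" u u' x2] by linarith
    also have "\<dots> \<le> 2 * (b * m) / 2"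
    proof (intro divide_right_mono mult_mono)
      show "norm (1 + \<i>) \<le> 2" using norm_triangle_ineq[of 1 \<i>] by simp
      show "(norm (u x2))\<^sup>2 + (norm (u' x2))\<^sup>2 \<le> b * m" using turn[of x2] x12 by (simp add: h_def)
    qed auto
    finally show ?thesis by (simp add: h_def[abs_def])
  qed
  show ?thesis
  proof (rule weyl_norm2_le[OF alpha_pos])
    fix N :: real assume N: "N \<ge> 0"
    define d where "d = max N x2"
    have ci: "h integrable_on {c..e}" if "c \<ge> 0" for c e by (rule continuous_integrable_half_line[OF conth that])
    have ord: "0 \<le> x1" "x1 \<le> x2" "x2 \<le> d" "0 \<le> x2" using x1 x12 by (auto simp: d_def)
    have "integral {0..N} (\<lambda>s. (norm (u s))\<^sup>2) \<le> integral {0..N} h"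
      by (intro integral_le ci continuous_integrable_half_line continuous_intros is_sol_continuous[OF sol]) (auto simp: h_def)
    also have "\<dots> \<le> integral {0..d} h"
      by (intro integral_subset_le ci) (auto simp: h0 d_def)
    also have "\<dots> = integral {0..x1} h + integral {x1..x2} h + integral {x2..d} h"
    proof -
      have "integral {0..x1} h + integral {x1..x2} h = integral {0..x2} h"
        by (rule Henstock_Kurzweil_Integration.integral_combine) (use ord in \<open>auto intro: ci\<close>)
      moreover have "integral {0..x2} h + integral {x2..d} h = integral {0..d} h"
        by (rule Henstock_Kurzweil_Integration.integral_combine) (use ord in \<open>auto intro: ci\<close>)
      ultimately show ?thesis by simp
    qed
    also have "integral {0..x1} h \<le> 2 * m" using segF[of 0 x1] F0 ord by simp
    also have "integral {x1..x2} h \<le> (x2 - x1) * (b * m)"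
    proof -
      have "integral {x1..x2} h \<le> integral {x1..x2} (\<lambda>_. b * m)"
        by (rule integral_le[OF ci[OF ord(1)] integrable_const_ivl]) (use turn in auto)
      then show ?thesis using ord by (simp add: mult_ac)
    qed
    also have "integral {x2..d} h \<le> b * m" by (rule tail[OF ord(3)])
    also have "2 * m + (x2 - x1) * (b * m) + b * m \<le> 2 * (b ^ 3 * m) + b ^ 3 * m + b ^ 3 * m"
    proof (intro add_mono)
      have m0: "m \<ge> 0" by (simp add: m_def)
      have b3: "1 \<le> b ^ 3" using b by (intro one_le_power) auto
      then show "2 * m \<le> 2 * (b ^ 3 * m)" using m0 by (simp add: mult_le_cancel_right1)
      have "x2 - x1 \<le> b ^ 2" using x21 Bb b by linarith
      then have "(x2 - x1) * (b * m) \<le> b ^ 2 * (b * m)" using b m0 by (intro mult_right_mono) auto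
      then show "(x2 - x1) * (b * m) \<le> b ^ 3 * m" by (simp add: power3_eq_cube power2_eq_square mult.assoc)
      have "b ^ 1 \<le> b ^ 3" using b by (intro power_increasing) auto
      then show "b * m \<le> b ^ 3 * m" using m0 by (intro mult_right_mono) auto
    qed
    also have "\<dots> \<le> 8 * b ^ 3 * norm (weyl_m \<alpha> \<mu>)" using b by (simp add: m_def)
    finally show "integral {0..N} (\<lambda>s. (norm (weyl_u \<alpha> \<mu> s))\<^sup>2) \<le> 8 * b ^ 3 * norm (weyl_m \<alpha> \<mu>)"
      by (simp add: u_def)
  qed
qed

text \<open>One factor b^3 comes from \<open>weyl_norm2_inner_ray\<close>, the other from the cubic
  bound on the Weyl coefficient, in which the distance b c to the line of the eigenvalue ray is
  bounded below by c.\<close>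

lemma weyl_norm2_inner_ray_polynomial:
  obtains C where "\<And>b. b \<ge> 1024 \<Longrightarrow> weyl_norm2 \<alpha> (of_real b * Complex (1 / 256) 1) \<le> C * b ^ 6"
proof -
  define c where "c = cos (pi / (2 + \<alpha>)) - 1 / 256 * sin (pi / (2 + \<alpha>))"
  have c: "c > 0" using unrotate_inner_ray_pos by (simp add: c_def)
  have "weyl_norm2 \<alpha> (of_real b * Complex (1 / 256) 1) \<le> (8 * (32 * 27 / c)) * b ^ 6" if b: "b \<ge> 1024" for b
  proof -
    define \<mu> where "\<mu> = of_real b * Complex (1 / 256) 1"
    have Im: "Im (unrotate \<alpha> \<mu>) = b * c" unfolding \<mu>_def unrotate_inner_ray c_def ..
    have n: "norm \<mu> \<le> 2 * b"
    proof -
      have "norm (Complex (1 / 256) 1) \<le> 2" using cmod_le[of "Complex (1 / 256) 1"] by simp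
      then show ?thesis using b by (simp add: \<mu>_def norm_mult)
    qed
    have "norm (weyl_m \<alpha> \<mu>) \<le> 32 * (1 + norm \<mu>) ^ 3 / \<bar>Im (unrotate \<alpha> \<mu>)\<bar>"
      by (rule weyl_m_bound[OF alpha_pos]) (use Im b c in auto)
    also have "\<dots> \<le> 32 * (3 * b) ^ 3 / c"
    proof (rule frac_le)
      show "32 * (1 + norm \<mu>) ^ 3 \<le> 32 * (3 * b) ^ 3" using n b by (intro mult_left_mono power_mono) auto
      have "1 * c \<le> b * c" using b c by (intro mult_right_mono) auto
      then show "c \<le> \<bar>Im (unrotate \<alpha> \<mu>)\<bar>" using Im b c by simp
    qed (use b c in auto)
    also have "\<dots> = (32 * 27 / c) * b ^ 3" by (simp add: power_mult_distrib)
    finally have "8 * b ^ 3 * norm (weyl_m \<alpha> \<mu>) \<le> 8 * b ^ 3 * ((32 * 27 / c) * b ^ 3)"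
      using b by (intro mult_left_mono) auto
    also have "\<dots> = (8 * (32 * 27 / c)) * b ^ 6" by (simp add: power_add[symmetric] mult.left_commute)
    finally show ?thesis using weyl_norm2_inner_ray[OF b] by (simp add: \<mu>_def)
  qed
  then show thesis by (rule that)
qed

end

section \<open>Square integrable functions\<close>

lemma L2_D:
  assumes "f \<in> L2 M"
  shows "f \<in> borel_measurable M" "integrable M (\<lambda>x. (norm (f x))\<^sup>2)"
  using assms by (auto simp: L2_def)

text \<open>Cauchy-Schwarz in Young's form; the free weight \<eta> is tuned in each application to
  balance the two norms.\<close>

lemma L2_pairing:
  assumes f: "f \<in> L2 M" and g: "g \<in> L2 M"
  shows "integrable M (\<lambda>x. f x * g x)"
    and "\<eta> > 0 \<Longrightarrow> norm (\<integral>x. f x * g x \<partial>M) \<le> (\<eta> * (\<integral>x. (norm (f x))\<^sup>2 \<partial>M) + (\<integral>x. (norm (g x))\<^sup>2 \<partial>M) / \<eta>) / 2"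
proof -
  note fm = L2_D[OF f] and gm = L2_D[OF g]
  have 1: "a * b \<le> (\<eta> * a\<^sup>2 + b\<^sup>2 / \<eta>) / 2" if "\<eta> > 0" for a b \<eta> :: real
  proof -
    have "0 \<le> (\<eta> * a - b)\<^sup>2" by simp
    then have "2 * (a * b) * \<eta> \<le> \<eta>\<^sup>2 * a\<^sup>2 + b\<^sup>2" by (simp add: power2_eq_square algebra_simps)
    then show ?thesis using that by (simp add: field_simps power2_eq_square)
  qed
  have dom: "integrable M (\<lambda>x. (\<eta> * (norm (f x))\<^sup>2 + (norm (g x))\<^sup>2 / \<eta>) / 2)" for \<eta>
    using fm gm by (intro integrable_divide Bochner_Integration.integrable_add integrable_mult_right)
  have bd: "norm (f x * g x) \<le> (\<eta> * (norm (f x))\<^sup>2 + (norm (g x))\<^sup>2 / \<eta>) / 2" if "\<eta> > 0" for x \<eta>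
    unfolding norm_mult by (rule 1[OF that])
  show int: "integrable M (\<lambda>x. f x * g x)"
    by (rule Bochner_Integration.integrable_bound[OF dom[of 1]])
       (use fm gm bd[of 1] in \<open>auto intro!: AE_I2 order_trans[OF _ abs_ge_self]\<close>)
  show "norm (\<integral>x. f x * g x \<partial>M) \<le> (\<eta> * (\<integral>x. (norm (f x))\<^sup>2 \<partial>M) + (\<integral>x. (norm (g x))\<^sup>2 \<partial>M) / \<eta>) / 2"
    if \<eta>: "\<eta> > 0"
  proof -
    have "norm (\<integral>x. f x * g x \<partial>M) \<le> (\<integral>x. norm (f x * g x) \<partial>M)" by (rule integral_norm_bound)
    also have "\<dots> \<le> (\<integral>x. (\<eta> * (norm (f x))\<^sup>2 + (norm (g x))\<^sup>2 / \<eta>) / 2 \<partial>M)"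
      by (intro integral_mono integrable_norm int dom bd \<eta>)
    also have "\<dots> = (\<eta> * (\<integral>x. (norm (f x))\<^sup>2 \<partial>M) + (\<integral>x. (norm (g x))\<^sup>2 \<partial>M) / \<eta>) / 2"
      using fm gm by simp
    finally show ?thesis .
  qed
qed

lemma L2_half_lineI:
  assumes "continuous_on {0..} v" "\<And>N. N \<ge> 0 \<Longrightarrow> integral {0..N} (\<lambda>s. (norm (v s))\<^sup>2) \<le> B"
  shows "v \<in> L2 half_line" "(\<integral>s. (norm (v s))\<^sup>2 \<partial>half_line) \<le> B"
proof -
  have c: "continuous_on {0..} (\<lambda>s. (norm (v s))\<^sup>2)" by (intro continuous_intros assms)
  note I = integrable_half_lineI[OF c _ assms(2)]
  show "(\<integral>s. (norm (v s))\<^sup>2 \<partial>half_line) \<le> B" by (rule I(2)) auto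
  have "integrable half_line (\<lambda>s. (norm (v s))\<^sup>2)" by (rule I(1)) auto
  moreover have "v \<in> borel_measurable half_line"
    by (intro continuous_imp_measurable_on_sets_lebesgue assms) auto
  ultimately show "v \<in> L2 half_line" by (simp add: L2_def)
qed

lemma decaying_L2:
  assumes sol: "is_sol q v w" and dec: "decaying v w"
  shows "v \<in> L2 half_line"
proof (rule L2_half_lineI(1)[OF is_sol_continuous(1)[OF sol]])
  fix N :: real
  have c: "continuous_on {0..} (\<lambda>s. (norm (v s))\<^sup>2 + (norm (w s))\<^sup>2)"
    by (intro continuous_intros is_sol_continuous[OF sol])
  have "integral {0..N} (\<lambda>s. (norm (v s))\<^sup>2) \<le> integral {0..N} (\<lambda>s. (norm (v s))\<^sup>2 + (norm (w s))\<^sup>2)"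
    by (intro integral_le continuous_integrable_half_line continuous_intros is_sol_continuous[OF sol]) auto
  also have "\<dots> \<le> (\<integral>s. (norm (v s))\<^sup>2 + (norm (w s))\<^sup>2 \<partial>half_line)"
    by (rule integral_segment_le_half_line[OF c]) (use dec in \<open>auto simp: decaying_def\<close>)
  finally show "integral {0..N} (\<lambda>s. (norm (v s))\<^sup>2) \<le> (\<integral>s. (norm (v s))\<^sup>2 + (norm (w s))\<^sup>2 \<partial>half_line)" .
qed

section \<open>Eigenfunctions\<close>

lemma D_eq:
  assumes "(y has_vector_derivative y') (at x within {0..})" "x \<ge> 0"
  shows "D y x = y'"
proof -
  have "x islimpt {0..}"
    unfolding islimpt_approachable
  proof (intro allI impI)
    fix e :: real assume "e > 0"
    then show "\<exists>x'\<in>{0..}. x' \<noteq> x \<and> dist x' x < e"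
      using assms(2) by (intro bexI[of _ "x + e / 2"]) (auto simp: dist_real_def)
  qed
  then have "at x within {0..} \<noteq> bot" by (simp add: trivial_limit_within)
  then show ?thesis unfolding D_def using assms(1) by (simp add: vector_derivative_within)
qed

lemma is_sol_D:
  assumes "is_sol q v w" "x \<ge> 0"
  shows "D v x = w x" "D (D v) x = q x * v x"
proof -
  have Dv: "D v x = w x" if "x \<ge> 0" for x using is_solD(1)[OF assms(1) that] that by (rule D_eq)
  then show "D v x = w x" using assms(2) .
  have "(D v has_vector_derivative q x * v x) (at x within {0..})"
    by (rule has_vector_derivative_transform[OF _ _ is_solD(2)[OF assms]]) (use assms(2) Dv in auto)
  then show "D (D v) x = q x * v x" using assms(2) by (rule D_eq)
qed

lemma lipschitz_absolutely_continuous: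
  assumes lip: "\<And>x y. r \<le> x \<Longrightarrow> x \<le> y \<Longrightarrow> y \<le> s \<Longrightarrow> norm (f y - f x) \<le> K * (y - x)" and K: "K \<ge> 0"
  shows "absolutely_continuous_between r s f"
  unfolding absolutely_continuous_between_def
proof (intro allI impI)
  fix \<epsilon> :: real assume e: "\<epsilon> > 0"
  show "\<exists>\<delta>>0. \<forall>(n::nat) a b. (\<forall>i<n. r \<le> a i \<and> a i \<le> b i \<and> b i \<le> s) \<longrightarrow>
      (\<forall>i<n. \<forall>j<n. i \<noteq> j \<longrightarrow> {a i<..<b i} \<inter> {a j<..<b j} = {}) \<longrightarrow>
      (\<Sum>i<n. b i - a i) < \<delta> \<longrightarrow> (\<Sum>i<n. norm (f (b i) - f (a i))) < \<epsilon>"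
  proof (intro exI[of _ "\<epsilon> / (K + 1)"] conjI allI impI)
    show "\<epsilon> / (K + 1) > 0" using e K by simp
    fix n and a b :: "nat \<Rightarrow> real"
    assume ab: "\<forall>i<n. r \<le> a i \<and> a i \<le> b i \<and> b i \<le> s" and sm: "(\<Sum>i<n. b i - a i) < \<epsilon> / (K + 1)"
    have s0: "(\<Sum>i<n. b i - a i) \<ge> 0" using ab by (intro sum_nonneg) auto
    have "(\<Sum>i<n. norm (f (b i) - f (a i))) \<le> (\<Sum>i<n. K * (b i - a i))"
      using ab by (intro sum_mono lip) auto
    also have "\<dots> = K * (\<Sum>i<n. b i - a i)" by (simp add: sum_distrib_left)
    also have "\<dots> \<le> (K + 1) * (\<Sum>i<n. b i - a i)" using s0 by (intro mult_right_mono) auto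
    also have "\<dots> < \<epsilon>" using sm K by (simp add: field_simps)
    finally show "(\<Sum>i<n. norm (f (b i) - f (a i))) < \<epsilon>" .
  qed
qed

lemma is_sol_W22_loc:
  assumes sol: "is_sol q v w" and q: "continuous_on {0..} q"
  shows "v \<in> W22_loc"
  unfolding W22_loc_def
proof (intro CollectI conjI allI impI)
  fix x :: real assume x: "x \<ge> 0"
  then show "v differentiable at x within {0..}"
    using is_solD(1)[OF sol x] unfolding has_vector_derivative_def differentiable_def by blast
next
  fix R :: real assume R: "R > 0"
  have cqv: "continuous_on {0..} (\<lambda>s. q s * v s)" by (intro continuous_intros q is_sol_continuous[OF sol])
  obtain K where K: "\<And>s. 0 \<le> s \<Longrightarrow> s \<le> R \<Longrightarrow> norm (q s * v s) \<le> K" using picard_bounded_on[OF cqv] by blast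
  have K0: "K \<ge> 0" using K[of 0] R order_trans[OF norm_ge_zero] by auto
  show "absolutely_continuous_between 0 R (D v)"
  proof (rule lipschitz_absolutely_continuous[OF _ K0])
    fix x y assume xy: "0 \<le> x" "x \<le> y" "y \<le> R"
    have "((\<lambda>s. q s * v s) has_integral w y - w x) {x..y}"
      by (rule fundamental_theorem_of_calculus[OF xy(2)])
         (use xy in \<open>auto intro!: has_vector_derivative_within_subset[OF is_solD(2)[OF sol]]\<close>)
    then have I: "w y - w x = integral {x..y} (\<lambda>s. q s * v s)" by (simp add: integral_unique)
    have "norm (integral {x..y} (\<lambda>s. q s * v s)) \<le> integral {x..y} (\<lambda>s. K)"
      by (rule integral_norm_bound_integral[OF continuous_integrable_half_line[OF cqv xy(1)] integrable_const_ivl])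
         (use K xy in auto)
    then have "norm (w y - w x) \<le> K * (y - x)" using xy by (simp add: I mult.commute)
    then show "norm (D v y - D v x) \<le> K * (y - x)" using xy by (simp add: is_sol_D(1)[OF sol])
  qed
  have m: "(\<lambda>s. q s * v s) \<in> borel_measurable (lebesgue_on {0..R})"
    by (rule continuous_borel_measurable_segment[OF cqv])
  have eq: "D (D v) s = q s * v s" if "s \<in> space (lebesgue_on {0..R})" for s
    using is_sol_D(2)[OF sol] that by simp
  have "D (D v) \<in> borel_measurable (lebesgue_on {0..R}) \<longleftrightarrow> (\<lambda>s. q s * v s) \<in> borel_measurable (lebesgue_on {0..R})"
    by (rule measurable_cong) (rule eq)
  moreover have "integrable (lebesgue_on {0..R}) (\<lambda>s. (norm (q s * v s))\<^sup>2)"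
  proof (rule Bochner_Integration.integrable_bound[where f = "\<lambda>_. K\<^sup>2"])
    show "integrable (lebesgue_on {0..R}) (\<lambda>_. K\<^sup>2)"
      by (intro finite_measure.integrable_const finite_measure_lebesgue_on) auto
    show "(\<lambda>s. (norm (q s * v s))\<^sup>2) \<in> borel_measurable (lebesgue_on {0..R})" using m by measurable
    show "AE s in lebesgue_on {0..R}. norm ((norm (q s * v s))\<^sup>2) \<le> norm (K\<^sup>2)"
      using K K0 by (intro AE_I2) (auto intro!: power_mono)
  qed
  moreover have "integrable (lebesgue_on {0..R}) (\<lambda>s. (norm (D (D v) s))\<^sup>2) \<longleftrightarrow> integrable (lebesgue_on {0..R}) (\<lambda>s. (norm (q s * v s))\<^sup>2)"
    by (rule Bochner_Integration.integrable_cong[OF refl]) (simp only: eq)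
  ultimately show "D (D v) \<in> L2 (lebesgue_on {0..R})" using m unfolding L2_def by blast
qed

text \<open>The equation v'' = q v holds at every point with continuous right side, so membership in
  the domain reduces to square integrability. The solution is not null: a continuous null function
  would have slope 0 at the origin, not 1.\<close>

lemma eigenfunctionI:
  assumes \<alpha>: "\<alpha> > 0" and d: "dec_data \<alpha> 0 \<mu> 0 0 1"
  shows "sol (pot \<alpha> 0 \<mu> 0) 0 1 \<in> eigenfunctions \<i> \<alpha>"
proof -
  define q where "q = pot \<alpha> 0 \<mu> 0"
  define v where "v = sol q 0 1"
  define w where "w = dsol q 0 1"
  have qc: "continuous_on {0..} q" unfolding q_def by (rule pot_zero_continuous[OF \<alpha>]) simp
  have sol: "is_sol q v w" unfolding v_def w_def by (rule is_sol_sol[OF qc])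
  have dec: "decaying v w" using d by (simp add: dec_data_def[OF \<alpha>] q_def v_def w_def)
  have vL2: "v \<in> L2 half_line" by (rule decaying_L2[OF sol dec])
  have de: "diff_expr \<i> \<alpha> v x = \<mu> * v x" if "x \<ge> 0" for x
    unfolding diff_expr_def is_sol_D(2)[OF sol that] by (simp add: q_def pot_zero[OF \<alpha> that] algebra_simps)
  have "(\<lambda>x. \<mu> * v x) \<in> L2 half_line"
    using L2_D[OF vL2] by (auto simp: L2_def norm_mult power_mult_distrib)
  then have deL2: "diff_expr \<i> \<alpha> v \<in> L2 half_line"
  proof -
    have "diff_expr \<i> \<alpha> v \<in> borel_measurable half_line \<longleftrightarrow> (\<lambda>x. \<mu> * v x) \<in> borel_measurable half_line"
      by (rule measurable_cong) (simp add: de)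
    moreover have "integrable half_line (\<lambda>x. (norm (diff_expr \<i> \<alpha> v x))\<^sup>2) \<longleftrightarrow> integrable half_line (\<lambda>x. (norm (\<mu> * v x))\<^sup>2)"
      by (rule Bochner_Integration.integrable_cong) (simp_all add: de)
    ultimately show ?thesis using \<open>(\<lambda>x. \<mu> * v x) \<in> L2 half_line\<close> by (simp add: L2_def)
  qed
  have v0: "v 0 = 0" "w 0 = 1" by (simp_all add: v_def w_def sol_0'[OF qc])
  have "\<not> (AE x in half_line. v x = 0)"
  proof
    assume "AE x in half_line. v x = 0"
    then have "AE x in half_line. (norm (v x))\<^sup>2 = 0" by eventually_elim simp
    then have "(\<integral>x. (norm (v x))\<^sup>2 \<partial>half_line) = 0"
      by (intro integral_eq_zero_AE)
    moreover have "integral {0..1} (\<lambda>x. (norm (v x))\<^sup>2) \<le> (\<integral>x. (norm (v x))\<^sup>2 \<partial>half_line)"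
      by (rule integral_segment_le_half_line)
         (use L2_D(2)[OF vL2] in \<open>auto intro!: continuous_intros is_sol_continuous[OF sol]\<close>)
    moreover have "integral {0..1} (\<lambda>x. (norm (v x))\<^sup>2) \<ge> 0"
      by (intro integral_nonneg continuous_integrable_half_line continuous_intros is_sol_continuous[OF sol]) auto
    ultimately have "integral {0..1} (\<lambda>x. (norm (v x))\<^sup>2) = 0" by linarith
    moreover have "continuous_on {0..1} (\<lambda>x. (norm (v x))\<^sup>2)"
      by (intro continuous_intros continuous_on_subset[OF is_sol_continuous(1)[OF sol]]) auto
    ultimately have z: "\<forall>x\<in>{0..1}. (norm (v x))\<^sup>2 = 0" by (subst (asm) integral_eq_0_iff) auto
    have "(v has_vector_derivative w 0) (at 0 within {0..1})"
      by (rule has_vector_derivative_within_subset[OF is_solD(1)[OF sol]]) auto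
    then have "((\<lambda>_. 0) has_vector_derivative w 0) (at 0 within {0..1})"
      by (rule has_vector_derivative_transform[rotated 2]) (use z in auto)
    then have "w 0 = 0"
      using vector_derivative_unique_within_closed_interval[of 0 1 0 "\<lambda>_. 0" "w 0" 0] by simp
    then show False using v0 by simp
  qed
  moreover have "AE x in half_line. diff_expr \<i> \<alpha> v x = \<mu> * v x" by (intro AE_I2) (simp add: de)
  moreover have "v \<in> op_domain \<i> \<alpha>"
    unfolding op_domain_def using vL2 is_sol_W22_loc[OF sol qc] deL2 v0 by simp
  ultimately show ?thesis unfolding eigenfunctions_def by (auto simp: v_def q_def)
qed

section \<open>The entire function of an annihilator of the eigenfunctions\<close>

text \<open>At a zero z0 of y both F and y are divided by z - z0; simplicity makes the reduced
  denominator nonzero, and at z0 the reduced quotient is the ratio of the derivatives.\<close>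

lemma holomorphic_quotient_simple_zeros:
  fixes F y :: "complex \<Rightarrow> complex"
  assumes S: "open S" and F: "F holomorphic_on S" and y: "y holomorphic_on S"
    and zero: "\<And>z. z \<in> S \<Longrightarrow> y z = 0 \<Longrightarrow> F z = 0 \<and> deriv y z \<noteq> 0"
  shows "(\<lambda>z. if y z = 0 then deriv F z / deriv y z else F z / y z) holomorphic_on S"
    (is "?g holomorphic_on S")
proof -
  have "\<exists>T. open T \<and> z0 \<in> T \<and> T \<subseteq> S \<and> ?g holomorphic_on T" if z0: "z0 \<in> S" for z0
  proof (cases "y z0 = 0")
    case False
    define T where "T = S \<inter> y -` (- {0})"
    have T: "open T" unfolding T_def
      by (rule continuous_open_preimage[OF holomorphic_on_imp_continuous_on[OF y] S]) auto
    have "(\<lambda>z. F z / y z) holomorphic_on T"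
      by (intro holomorphic_intros holomorphic_on_subset[OF F] holomorphic_on_subset[OF y]) (auto simp: T_def)
    then have "?g holomorphic_on T" by (rule holomorphic_transform) (auto simp: T_def)
    then show ?thesis using T False z0 by (auto simp: T_def)
  next
    case True
    define Y where "Y z = (if z = z0 then deriv y z0 else (y z - y z0) / (z - z0))" for z
    define \<Phi> where "\<Phi> z = (if z = z0 then deriv F z0 else (F z - F z0) / (z - z0))" for z
    have hY: "Y holomorphic_on S" unfolding Y_def by (rule pole_lemma_open[OF y S])
    have h\<Phi>: "\<Phi> holomorphic_on S" unfolding \<Phi>_def by (rule pole_lemma_open[OF F S])
    define T where "T = S \<inter> Y -` (- {0})"
    have T: "open T" unfolding T_def
      by (rule continuous_open_preimage[OF holomorphic_on_imp_continuous_on[OF hY] S]) auto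
    have z0T: "z0 \<in> T" using z0 zero[OF z0 True] by (simp add: T_def Y_def)
    have "(\<lambda>z. \<Phi> z / Y z) holomorphic_on T"
      by (intro holomorphic_intros holomorphic_on_subset[OF h\<Phi>] holomorphic_on_subset[OF hY]) (auto simp: T_def)
    then have "?g holomorphic_on T"
    proof (rule holomorphic_transform)
      fix z assume z: "z \<in> T"
      then have Yz: "Y z \<noteq> 0" by (simp add: T_def)
      show "\<Phi> z / Y z = ?g z"
        using True zero[OF z0 True] Yz by (cases "z = z0") (auto simp: \<Phi>_def Y_def)
    qed
    then show ?thesis using T z0T by (auto simp: T_def)
  qed
  then have "?g field_differentiable at z0 within S" if "z0 \<in> S" for z0
    using that by (meson field_differentiable_at_within holomorphic_on_imp_differentiable_at)
  then show ?thesis by (simp add: holomorphic_on_def)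
qed

context
  fixes \<alpha> :: real
  assumes \<alpha>: "\<alpha> > 0"
begin

definition fam :: "complex \<Rightarrow> complex \<Rightarrow> complex \<Rightarrow> real \<Rightarrow> complex" where
  "fam \<mu> a b = sol (pot \<alpha> 0 \<mu> 0) a b"

lemma fam_lincomb: "s \<ge> 0 \<Longrightarrow> fam \<mu> a b s = a * fam \<mu> 1 0 s + b * fam \<mu> 0 1 s"
  unfolding fam_def by (rule sol_lincomb(1)[OF pot_zero_continuous[OF \<alpha> order_refl]])

lemma fam_continuous: "continuous_on {0..} (fam \<mu> a b)"
  unfolding fam_def by (rule continuous_on_sol[OF pot_zero_continuous[OF \<alpha> order_refl]])

lemma fam_holomorphic:
  assumes "s \<ge> 0"
  shows "(\<lambda>\<mu>. fam \<mu> a b s) holomorphic_on ball 0 L"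
    "\<exists>B. \<forall>\<mu>\<in>ball 0 L. \<forall>t. 0 \<le> t \<longrightarrow> t \<le> s \<longrightarrow> norm (fam \<mu> a b t) \<le> B"
proof -
  have b: "\<exists>Q. \<forall>\<mu>\<in>ball 0 L. \<forall>s. 0 \<le> s \<longrightarrow> s \<le> N \<longrightarrow> norm (pot \<alpha> 0 \<mu> 0 s) \<le> Q" for N
  proof (intro exI ballI allI impI)
    fix \<mu> s assume "\<mu> \<in> ball (0::complex) L" "0 \<le> s" "s \<le> N"
    then have "norm (pot \<alpha> 0 \<mu> 0 s) \<le> s powr \<alpha> + norm \<mu>" "s powr \<alpha> \<le> N powr \<alpha>" "norm \<mu> \<le> L"
      using norm_pot_zero_le[OF \<alpha>] \<alpha> by (auto intro: powr_mono2)
    then show "norm (pot \<alpha> 0 \<mu> 0 s) \<le> N powr \<alpha> + L" by linarith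
  qed
  note sh = sol_holomorphic[OF open_ball pot_zero_continuous[OF \<alpha> order_refl] pot_holomorphic(2)[OF \<alpha> order_refl] b assms, of a b]
  show "(\<lambda>\<mu>. fam \<mu> a b s) holomorphic_on ball 0 L" unfolding fam_def by (rule sh(1))
  show "\<exists>B. \<forall>\<mu>\<in>ball 0 L. \<forall>t. 0 \<le> t \<longrightarrow> t \<le> s \<longrightarrow> norm (fam \<mu> a b t) \<le> B" unfolding fam_def by (rule sh(3))
qed

text \<open>On a bounded set of \<mu> one R serves all parameters, so data normalized at R rather
  than at 0 are holomorphic without poles. Their L2 norms are uniformly bounded: directly on [0, R],
  and through the flux at R beyond it.\<close>

lemma dec_data_family:
  assumes L: "L > 0"
  obtains y0 y1 B where "y0 holomorphic_on ball 0 L" "y1 holomorphic_on ball 0 L"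
    "\<And>\<mu>. \<mu> \<in> ball 0 L \<Longrightarrow> y0 \<mu> \<noteq> 0 \<or> y1 \<mu> \<noteq> 0"
    "\<And>\<mu>. \<mu> \<in> ball 0 L \<Longrightarrow> dec_data \<alpha> 0 \<mu> 0 (y0 \<mu>) (y1 \<mu>)"
    "\<And>N. \<exists>B. \<forall>\<mu>\<in>ball 0 L. \<forall>t. 0 \<le> t \<longrightarrow> t \<le> N \<longrightarrow> norm (fam \<mu> (y0 \<mu>) (y1 \<mu>) t) \<le> B"
    "\<And>\<mu> N. \<mu> \<in> ball 0 L \<Longrightarrow> N \<ge> 0 \<Longrightarrow> integral {0..N} (\<lambda>s. (norm (fam \<mu> (y0 \<mu>) (y1 \<mu>) s))\<^sup>2) \<le> B"
proof -
  \<comment> \<open>The larger ball contains the closed ball of radius L as a compact subset, on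
    which the data are bounded.\<close>
  define U where "U = ball (0::complex) (L + 1)"
  obtain R c where R: "R \<ge> 0" "c > 0" "c \<le> 1" and good0: "\<And>\<zeta> l s. - 3 * pi / 4 + pi / 4 \<le> (2 + \<alpha>) * Im \<zeta> \<Longrightarrow> (2 + \<alpha>) * Im \<zeta> \<le> pi / 4 - pi / 4 \<Longrightarrow> 0 \<le> Re \<zeta> \<Longrightarrow>
      norm l \<le> L + 1 \<Longrightarrow> s \<ge> R \<Longrightarrow> c \<le> Re (cnj (1 + \<i>) * pot \<alpha> 0 l \<zeta> s)"
    using pot_good_eventually[OF \<alpha> order_refl, of "pi / 4" 0 "L + 1"] pi_gt_zero by auto
  have good: "c \<le> Re (cnj (1 + \<i>) * pot \<alpha> 0 \<mu> 0 s)" if "\<mu> \<in> U" "s \<ge> R" for \<mu> s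
    by (rule good0) (use that in \<open>auto simp: U_def\<close>)
  have b: "\<exists>Q. \<forall>\<mu>\<in>U. \<forall>s. 0 \<le> s \<longrightarrow> s \<le> N \<longrightarrow> norm (pot \<alpha> 0 \<mu> 0 s) \<le> Q" for N
  proof (intro exI ballI allI impI)
    fix \<mu> s assume "\<mu> \<in> U" "0 \<le> s" "s \<le> N"
    then have "norm (pot \<alpha> 0 \<mu> 0 s) \<le> s powr \<alpha> + norm \<mu>" "s powr \<alpha> \<le> N powr \<alpha>" "norm \<mu> \<le> L + 1"
      using norm_pot_zero_le[OF \<alpha>] \<alpha> by (auto simp: U_def intro: powr_mono2)
    then show "norm (pot \<alpha> 0 \<mu> 0 s) \<le> N powr \<alpha> + (L + 1)" by linarith
  qed
  obtain y0 y1 where y: "y0 holomorphic_on U" "y1 holomorphic_on U"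
      and nz: "\<And>\<mu>. \<mu> \<in> U \<Longrightarrow> y0 \<mu> \<noteq> 0 \<or> y1 \<mu> \<noteq> 0"
      and dd: "\<And>\<mu>. \<mu> \<in> U \<Longrightarrow> decaying (sol (pot \<alpha> 0 \<mu> 0) (y0 \<mu>) (y1 \<mu>)) (dsol (pot \<alpha> 0 \<mu> 0) (y0 \<mu>) (y1 \<mu>))"
      and YR: "\<And>\<mu>. \<mu> \<in> U \<Longrightarrow> sol (pot \<alpha> 0 \<mu> 0) (y0 \<mu>) (y1 \<mu>) R = 1"
      and Y'R: "(\<lambda>\<mu>. dsol (pot \<alpha> 0 \<mu> 0) (y0 \<mu>) (y1 \<mu>) R) holomorphic_on U"
    by (rule decaying_data_holomorphic[of U "\<lambda>\<mu>. pot \<alpha> 0 \<mu> 0" c "1 + \<i>" R])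
       (use R good b pot_zero_continuous[OF \<alpha> order_refl] pot_holomorphic(2)[OF \<alpha> order_refl] in \<open>auto simp: U_def\<close>)
  have bdd: "\<exists>B. \<forall>\<mu>\<in>cball 0 L. norm (h \<mu>) \<le> B" if "h holomorphic_on U" for h :: "complex \<Rightarrow> complex"
  proof -
    have "compact (h ` cball 0 L)"
      by (intro compact_continuous_image continuous_on_subset[OF holomorphic_on_imp_continuous_on[OF that]]) (auto simp: U_def)
    then show ?thesis using compact_imp_bounded bounded_iff by (metis imageI)
  qed
  obtain B0 B1 B2 where B: "\<And>\<mu>. \<mu> \<in> cball 0 L \<Longrightarrow> norm (y0 \<mu>) \<le> B0" "\<And>\<mu>. \<mu> \<in> cball 0 L \<Longrightarrow> norm (y1 \<mu>) \<le> B1"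
      "\<And>\<mu>. \<mu> \<in> cball 0 L \<Longrightarrow> norm (dsol (pot \<alpha> 0 \<mu> 0) (y0 \<mu>) (y1 \<mu>) R) \<le> B2"
    using bdd[OF y(1)] bdd[OF y(2)] bdd[OF Y'R] by metis
  have LU: "ball 0 L \<subseteq> U" by (auto simp: U_def)
  have Ybd: "\<exists>B. \<forall>\<mu>\<in>ball 0 L. \<forall>t. 0 \<le> t \<longrightarrow> t \<le> N \<longrightarrow> norm (fam \<mu> (y0 \<mu>) (y1 \<mu>) t) \<le> B" for N
  proof (cases "N \<ge> 0")
    case True
    obtain C0 where C0: "\<forall>\<mu>\<in>ball 0 L. \<forall>t. 0 \<le> t \<longrightarrow> t \<le> N \<longrightarrow> norm (fam \<mu> 1 0 t) \<le> C0" using fam_holomorphic(2)[OF True] by blast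
    obtain C1 where C1: "\<forall>\<mu>\<in>ball 0 L. \<forall>t. 0 \<le> t \<longrightarrow> t \<le> N \<longrightarrow> norm (fam \<mu> 0 1 t) \<le> C1" using fam_holomorphic(2)[OF True] by blast
    have "norm (fam \<mu> (y0 \<mu>) (y1 \<mu>) t) \<le> B0 * C0 + B1 * C1" if "\<mu> \<in> ball 0 L" "0 \<le> t" "t \<le> N" for \<mu> t
    proof -
      have m: "\<mu> \<in> cball 0 L" using that by auto
      have "norm (fam \<mu> (y0 \<mu>) (y1 \<mu>) t) \<le> norm (y0 \<mu>) * norm (fam \<mu> 1 0 t) + norm (y1 \<mu>) * norm (fam \<mu> 0 1 t)"
        unfolding fam_lincomb[OF that(2), of \<mu> "y0 \<mu>" "y1 \<mu>"] by (metis norm_mult norm_triangle_ineq)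
      also have "\<dots> \<le> B0 * C0 + B1 * C1"
        using B(1)[OF m] B(2)[OF m] C0 C1 that
        by (intro add_mono mult_mono) (auto intro: order_trans[OF norm_ge_zero])
      finally show ?thesis .
    qed
    then show ?thesis by blast
  next
    case False
    then show ?thesis by (intro exI[of _ 0]) auto
  qed
  obtain B3 where B3: "\<forall>\<mu>\<in>ball 0 L. \<forall>t. 0 \<le> t \<longrightarrow> t \<le> R \<longrightarrow> norm (fam \<mu> (y0 \<mu>) (y1 \<mu>) t) \<le> B3" using Ybd by blast
  define B where "B = R * B3\<^sup>2 + 2 * B2 / c"
  have tot: "integral {0..N} (\<lambda>s. (norm (fam \<mu> (y0 \<mu>) (y1 \<mu>) s))\<^sup>2) \<le> B" if \<mu>: "\<mu> \<in> ball 0 L" and N: "N \<ge> 0" for \<mu> N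
  proof -
    have \<mu>U: "\<mu> \<in> U" using \<mu> LU by blast
    define v where "v = fam \<mu> (y0 \<mu>) (y1 \<mu>)"
    define w where "w = dsol (pot \<alpha> 0 \<mu> 0) (y0 \<mu>) (y1 \<mu>)"
    have sol: "is_sol (pot \<alpha> 0 \<mu> 0) v w" unfolding v_def w_def fam_def by (rule is_sol_sol[OF pot_zero_continuous[OF \<alpha> order_refl]])
    have dec: "decaying v w" using dd[OF \<mu>U] by (simp add: v_def w_def fam_def)
    have cont: "continuous_on {0..} (\<lambda>s. (norm (v s))\<^sup>2)" by (intro continuous_intros is_sol_continuous[OF sol])
    define d where "d = max N R"
    have "integral {0..N} (\<lambda>s. (norm (v s))\<^sup>2) \<le> integral {0..d} (\<lambda>s. (norm (v s))\<^sup>2)"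
      by (intro integral_subset_le continuous_integrable_half_line[OF cont]) (auto simp: d_def)
    also have "\<dots> = integral {0..R} (\<lambda>s. (norm (v s))\<^sup>2) + integral {R..d} (\<lambda>s. (norm (v s))\<^sup>2)"
      by (rule Henstock_Kurzweil_Integration.integral_combine[symmetric])
         (use R in \<open>auto simp: d_def intro: continuous_integrable_half_line[OF cont]\<close>)
    also have "integral {0..R} (\<lambda>s. (norm (v s))\<^sup>2) \<le> R * B3\<^sup>2"
    proof -
      have "integral {0..R} (\<lambda>s. (norm (v s))\<^sup>2) \<le> integral {0..R} (\<lambda>s. B3\<^sup>2)"
        by (rule integral_le[OF continuous_integrable_half_line[OF cont order_refl] integrable_const_ivl])
           (use B3 \<mu> in \<open>auto simp: v_def intro!: power_mono\<close>)
      then show ?thesis using R by (simp add: mult.commute)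
    qed
    also have "integral {R..d} (\<lambda>s. (norm (v s))\<^sup>2) \<le> 2 * B2 / c"
    proof -
      have "c * integral {R..d} (\<lambda>s. (norm (v s))\<^sup>2) = integral {R..d} (\<lambda>s. 0 * (norm (w s))\<^sup>2 + c * (norm (v s))\<^sup>2)"
        by simp
      also have "\<dots> \<le> - energy_flux (1 + \<i>) v w R"
        by (rule decaying_energy_bound[OF sol dec]) (use R good[OF \<mu>U] in \<open>auto simp: d_def\<close>)
      also have "\<dots> \<le> norm (1 + \<i>) * norm (v R) * norm (w R)" using abs_energy_flux_le[of "1 + \<i>" v w R] by linarith
      also have "\<dots> \<le> 2 * 1 * B2"
        using norm_triangle_ineq[of 1 \<i>] YR[OF \<mu>U] B(3)[of \<mu>] \<mu>
        by (intro mult_mono) (auto simp: v_def w_def fam_def)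
      finally show ?thesis using R by (simp add: field_simps)
    qed
    finally show ?thesis by (simp add: v_def B_def)
  qed
  show thesis
    by (rule that[OF holomorphic_on_subset[OF y(1) LU] holomorphic_on_subset[OF y(2) LU]])
       (use nz dd LU Ybd tot in \<open>auto simp: dec_data_def[OF \<alpha>]\<close>)
qed

lemma fam_dec_L2:
  assumes "dec_data \<alpha> 0 \<mu> 0 a b"
  shows "fam \<mu> a b \<in> L2 half_line"
  using decaying_L2[OF is_sol_sol[OF pot_zero_continuous[OF \<alpha> order_refl]]] assms
  by (simp add: dec_data_def[OF \<alpha>] fam_def)

lemma weyl_u_L2: "regular \<alpha> \<mu> \<Longrightarrow> weyl_u \<alpha> \<mu> \<in> L2 half_line"
  using fam_dec_L2[OF weyl_exists[OF \<alpha>]] by (simp add: fam_def weyl_u_def)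

text \<open>Uniform control in \<mu> on the whole half-line is available for the L2 norm only, which
  is not an integrable majorant. The integral is therefore truncated at N, and the limit is taken
  with a bound independent of N and \<mu>.\<close>

lemma pairing_family_holomorphic:
  assumes f: "f \<in> L2 half_line" and y: "y0 holomorphic_on ball 0 L" "y1 holomorphic_on ball 0 L"
    and dd: "\<And>\<mu>. \<mu> \<in> ball 0 L \<Longrightarrow> dec_data \<alpha> 0 \<mu> 0 (y0 \<mu>) (y1 \<mu>)"
    and Yb: "\<And>N. \<exists>B. \<forall>\<mu>\<in>ball 0 L. \<forall>t. 0 \<le> t \<longrightarrow> t \<le> N \<longrightarrow> norm (fam \<mu> (y0 \<mu>) (y1 \<mu>) t) \<le> B"
    and YB: "\<And>\<mu> N. \<mu> \<in> ball 0 L \<Longrightarrow> N \<ge> 0 \<Longrightarrow> integral {0..N} (\<lambda>s. (norm (fam \<mu> (y0 \<mu>) (y1 \<mu>) s))\<^sup>2) \<le> B"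
  shows "(\<lambda>\<mu>. \<integral>t. f t * fam \<mu> (y0 \<mu>) (y1 \<mu>) t \<partial>half_line) holomorphic_on ball 0 L"
proof (rule holomorphic_pointwise_limit[OF open_ball])
  note fm = L2_D[OF f]
  define K where "K N t \<mu> = indicator {0..real N} t *\<^sub>R (f t * fam \<mu> (y0 \<mu>) (y1 \<mu>) t)" for N t \<mu>
  have ind: "(indicator {0..real N} :: real \<Rightarrow> real) \<in> borel_measurable half_line" for N
    by (intro borel_measurable_indicator) (auto simp: sets_restrict_space_iff)
  have fint: "integrable half_line (\<lambda>t. f t * fam \<mu> (y0 \<mu>) (y1 \<mu>) t)" if "\<mu> \<in> ball 0 L" for \<mu>
    by (rule L2_pairing(1)[OF f fam_dec_L2[OF dd[OF that]]])
  have Kmeas: "(\<lambda>t. K N t \<mu>) \<in> borel_measurable half_line" if "\<mu> \<in> ball 0 L" for N \<mu>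
    unfolding K_def by (intro borel_measurable_scaleR ind borel_measurable_integrable fint that)
  show "(\<lambda>\<mu>. \<integral>t. K N t \<mu> \<partial>half_line) holomorphic_on ball 0 L" for N
  proof -
    obtain C where C: "\<And>\<mu> t. \<mu> \<in> ball 0 L \<Longrightarrow> 0 \<le> t \<Longrightarrow> t \<le> real N \<Longrightarrow> norm (fam \<mu> (y0 \<mu>) (y1 \<mu>) t) \<le> C"
      using Yb[of "real N"] by blast
    define g where "g t = \<bar>C\<bar> * (indicator {0..real N} t + (norm (f t))\<^sup>2)" for t
    have gi: "integrable half_line g" unfolding g_def
    proof (intro integrable_mult_right Bochner_Integration.integrable_add fm)
      show "integrable half_line (indicator {0..real N} :: real \<Rightarrow> real)"
        by (rule integrable_real_indicator) (auto simp: sets_restrict_space_iff emeasure_restrict_space)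
    qed
    show ?thesis
    proof (rule holomorphic_on_integral[OF open_ball Kmeas _ gi])
      show "K N t holomorphic_on ball 0 L" if "t \<in> space half_line" for t
      proof -
        have t: "t \<ge> 0" using that by simp
        show ?thesis unfolding K_def fam_lincomb[OF t, of _ "y0 _" "y1 _"]
          by (simp only: scaleR_conv_of_real) (intro holomorphic_intros y fam_holomorphic(1)[OF t])
      qed
      show "norm (K N t \<mu>) \<le> g t" if "t \<in> space half_line" "\<mu> \<in> ball 0 L" for t \<mu>
      proof (cases "t \<le> real N")
        case True
        have t: "t \<ge> 0" using that by simp
        have "norm (f t) \<le> 1 + (norm (f t))\<^sup>2"
        proof -
          have "norm (f t) \<le> (1 * (norm (f t))\<^sup>2 + 1 / 1) / 2" by (rule le_weighted_square) simp
          also have "\<dots> \<le> 1 + (norm (f t))\<^sup>2" by simp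
          finally show ?thesis .
        qed
        then have "norm (f t) * norm (fam \<mu> (y0 \<mu>) (y1 \<mu>) t) \<le> (1 + (norm (f t))\<^sup>2) * \<bar>C\<bar>"
          using C[OF that(2) t True] by (intro mult_mono) auto
        then show ?thesis using True t by (simp add: K_def g_def norm_mult mult.commute)
      next
        case False
        then show ?thesis by (simp add: K_def g_def)
      qed
    qed
  qed
  fix \<mu> :: complex assume \<mu>: "\<mu> \<in> ball 0 L"
  note fi = fint[OF \<mu>]
  have n2: "(\<integral>t. (norm (fam \<mu> (y0 \<mu>) (y1 \<mu>) t))\<^sup>2 \<partial>half_line) \<le> B"
    by (rule L2_half_lineI(2)[OF fam_continuous YB[OF \<mu>]])
  have Ki: "integrable half_line (\<lambda>t. K N t \<mu>)" for N
    by (rule Bochner_Integration.integrable_bound[OF fi Kmeas[OF \<mu>]])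
       (auto simp: K_def indicator_def intro!: AE_I2)
  show "norm (\<integral>t. K N t \<mu> \<partial>half_line) \<le> ((\<integral>t. (norm (f t))\<^sup>2 \<partial>half_line) + B) / 2" for N
  proof -
    note Y2 = L2_D[OF fam_dec_L2[OF dd[OF \<mu>]]]
    have "norm (\<integral>t. K N t \<mu> \<partial>half_line) \<le> (\<integral>t. norm (K N t \<mu>) \<partial>half_line)" by (rule integral_norm_bound)
    also have "\<dots> \<le> (\<integral>t. ((norm (f t))\<^sup>2 + (norm (fam \<mu> (y0 \<mu>) (y1 \<mu>) t))\<^sup>2) / 2 \<partial>half_line)"
    proof (intro integral_mono integrable_norm Ki integrable_divide Bochner_Integration.integrable_add fm Y2)
      fix t
      have "2 * (norm (f t) * norm (fam \<mu> (y0 \<mu>) (y1 \<mu>) t)) \<le> (norm (f t))\<^sup>2 + (norm (fam \<mu> (y0 \<mu>) (y1 \<mu>) t))\<^sup>2"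
        using sum_squares_bound[of "norm (f t)"] by (simp add: mult.assoc)
      then show "norm (K N t \<mu>) \<le> ((norm (f t))\<^sup>2 + (norm (fam \<mu> (y0 \<mu>) (y1 \<mu>) t))\<^sup>2) / 2"
        by (simp add: K_def norm_mult indicator_def)
    qed
    also have "\<dots> = ((\<integral>t. (norm (f t))\<^sup>2 \<partial>half_line) + (\<integral>t. (norm (fam \<mu> (y0 \<mu>) (y1 \<mu>) t))\<^sup>2 \<partial>half_line)) / 2"
      using fm Y2 by simp
    also have "\<dots> \<le> ((\<integral>t. (norm (f t))\<^sup>2 \<partial>half_line) + B) / 2" using n2 by simp
    finally show ?thesis .
  qed
  show "(\<lambda>N. \<integral>t. K N t \<mu> \<partial>half_line) \<longlonglongrightarrow> (\<integral>t. f t * fam \<mu> (y0 \<mu>) (y1 \<mu>) t \<partial>half_line)"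
  proof (rule integral_dominated_convergence[where w = "\<lambda>t. norm (f t * fam \<mu> (y0 \<mu>) (y1 \<mu>) t)"])
    show "AE t in half_line. (\<lambda>N. K N t \<mu>) \<longlonglongrightarrow> f t * fam \<mu> (y0 \<mu>) (y1 \<mu>) t"
    proof (intro AE_I2)
      fix t assume "t \<in> space half_line"
      then have t: "t \<ge> 0" by simp
      obtain n where "t \<le> real n" using real_arch_simple by blast
      then have "\<forall>N\<ge>n. K N t \<mu> = f t * fam \<mu> (y0 \<mu>) (y1 \<mu>) t" using t by (auto simp: K_def)
      then show "(\<lambda>N. K N t \<mu>) \<longlonglongrightarrow> f t * fam \<mu> (y0 \<mu>) (y1 \<mu>) t"
        by (intro tendsto_eventually) (auto simp: eventually_sequentially)
    qed
    show "AE t in half_line. norm (K N t \<mu>) \<le> norm (f t * fam \<mu> (y0 \<mu>) (y1 \<mu>) t)" for N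
      by (auto simp: K_def indicator_def intro!: AE_I2)
  qed (use fi Kmeas[OF \<mu>] in auto)
qed

text \<open>The bound on the Weyl coefficient has a simple pole only, so the zeros of \<open>y0\<close> are simple.\<close>

lemma dec_data_zero_simple:
  assumes y: "y0 holomorphic_on ball 0 L" "y1 holomorphic_on ball 0 L"
    and nz: "\<And>\<mu>. \<mu> \<in> ball 0 L \<Longrightarrow> y0 \<mu> \<noteq> 0 \<or> y1 \<mu> \<noteq> 0"
    and dd: "\<And>\<mu>. \<mu> \<in> ball 0 L \<Longrightarrow> dec_data \<alpha> 0 \<mu> 0 (y0 \<mu>) (y1 \<mu>)"
    and z: "z \<in> ball 0 L" "y0 z = 0"
  shows "deriv y0 z \<noteq> 0"
proof
  assume d0: "deriv y0 z = 0"
  have L: "L > 0" using z by (auto intro: le_less_trans[OF norm_ge_zero])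
  have zray: "Im (unrotate \<alpha> z) = 0"
  proof (rule ccontr)
    assume "Im (unrotate \<alpha> z) \<noteq> 0"
    then show False using dec_data_bound(2)[OF \<alpha> _ dd[OF z(1)] z(2)] nz[OF z(1)] z(2) by blast
  qed
  \<comment> \<open>Unit vector orthogonal to the eigenvalue ray: the points z + h n approach z at
    distance exactly 1/(n + 1) from the line of that ray.\<close>
  define d where "d = \<i> * cis (pi / (2 + \<alpha>))"
  have nd: "norm d = 1" "d \<noteq> 0" by (auto simp: d_def norm_mult)
  define h where "h n = of_real (1 / real (Suc n)) * d" for n
  have hlim: "h \<longlonglongrightarrow> 0"
  proof -
    have "(\<lambda>n. complex_of_real (1 / real (Suc n)) * d) \<longlonglongrightarrow> complex_of_real 0 * d"
      by (intro tendsto_intros lim_inverse_n'[THEN LIMSEQ_Suc, unfolded inverse_eq_divide] | simp)+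
    then show ?thesis by (simp add: h_def[abs_def])
  qed
  have hnz: "h n \<noteq> 0" for n using nd by (simp add: h_def del: of_nat_Suc)
  have unr: "Im (unrotate \<alpha> (z + h n)) = 1 / real (Suc n)" for n
  proof -
    have "unrotate \<alpha> (z + h n) = unrotate \<alpha> z + of_real (1 / real (Suc n)) * \<i>"
      by (simp add: unrotate_def h_def d_def distrib_right mult.assoc cis_mult)
    then show ?thesis using zray by (simp del: of_nat_Suc)
  qed
  have ev: "\<forall>\<^sub>F n in sequentially. z + h n \<in> ball 0 L"
  proof -
    have "(\<lambda>n. z + h n) \<longlonglongrightarrow> z + 0" by (intro tendsto_intros hlim)
    then show ?thesis using z(1) by (intro topological_tendstoD[of _ z]) auto
  qed
  define C where "C = 32 * (1 + L) ^ 3"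
  \<comment> \<open>Here y1 = y0 m with |m| at most of size 1/|h n|. A multiple zero of y0 would
    send the right side to 0 and force y1 z = 0, which \<open>nz\<close> forbids.\<close>
  have bound: "norm (y1 (z + h n)) \<le> C * norm (y0 (z + h n) / h n)" if U: "z + h n \<in> ball 0 L" for n
  proof -
    have Im: "Im (unrotate \<alpha> (z + h n)) \<noteq> 0" unfolding unr by simp
    have "y0 (z + h n) * weyl_m \<alpha> (z + h n) = y1 (z + h n) * 1"
      by (rule dec_data_unique[OF \<alpha> order_refl zero_strip[OF \<alpha>] dd[OF U] weyl_exists[OF \<alpha> regular_off_ray[OF \<alpha> Im]]])
    then have "norm (y1 (z + h n)) = norm (y0 (z + h n)) * norm (weyl_m \<alpha> (z + h n))"
      by (metis mult.right_neutral norm_mult)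
    also have "\<dots> \<le> norm (y0 (z + h n)) * (C * real (Suc n))"
    proof (rule mult_left_mono)
      have "norm (weyl_m \<alpha> (z + h n)) \<le> 32 * (1 + norm (z + h n)) ^ 3 / \<bar>Im (unrotate \<alpha> (z + h n))\<bar>"
        by (rule weyl_m_bound[OF \<alpha> Im])
      also have "\<dots> = 32 * (1 + norm (z + h n)) ^ 3 * real (Suc n)" unfolding unr by simp
      also have "\<dots> \<le> C * real (Suc n)"
        unfolding C_def using U by (intro mult_right_mono mult_left_mono power_mono) auto
      finally show "norm (weyl_m \<alpha> (z + h n)) \<le> C * real (Suc n)" .
    qed simp
    also have "\<dots> = C * norm (y0 (z + h n) / h n)"
      using nd by (simp add: norm_divide h_def norm_mult del: of_nat_Suc)
    finally show ?thesis .
  qed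
  have "(y0 has_field_derivative deriv y0 z) (at z)"
    using y(1) z(1) holomorphic_derivI open_ball by blast
  then have "((\<lambda>k. (y0 (z + k) - y0 z) / k) \<longlongrightarrow> 0) (at 0)" by (simp add: DERIV_def d0)
  then have "((\<lambda>k. y0 (z + k) / k) \<longlongrightarrow> 0) (at 0)" by (simp add: z(2))
  then have "((\<lambda>k. y0 (z + k) / k) \<circ> h) \<longlonglongrightarrow> 0"
    using hlim hnz by (subst (asm) tendsto_at_iff_sequentially) auto
  then have "(\<lambda>n. C * norm (y0 (z + h n) / h n)) \<longlonglongrightarrow> C * norm (0::complex)"
    by (intro tendsto_intros) (simp add: o_def)
  then have lim0: "(\<lambda>n. C * norm (y0 (z + h n) / h n)) \<longlonglongrightarrow> 0" by simp
  have "isCont y1 z"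
    using holomorphic_on_imp_continuous_on[OF y(2)] z(1) by (simp add: continuous_on_eq_continuous_at)
  then have "(\<lambda>n. y1 (z + h n)) \<longlonglongrightarrow> y1 z"
    using isCont_tendsto_compose[of z y1 "\<lambda>n. z + h n"] tendsto_add[OF tendsto_const hlim, of z] by simp
  then have lim1: "(\<lambda>n. norm (y1 (z + h n))) \<longlonglongrightarrow> norm (y1 z)" by (rule tendsto_norm)
  have "norm (y1 z) \<le> 0"
    by (rule tendsto_le[OF _ lim0 lim1]) (use ev bound in \<open>auto elim!: eventually_mono\<close>)
  then show False using nz[OF z(1)] z(2) by simp
qed

text \<open>The pairing with the pole-free data, divided by y0, is the pairing with the normalized
  solution. Where y0 vanishes the decaying solution is an eigenfunction, so the numerator vanishes
  as well, and simplicity of the zero makes the singularity removable.\<close>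

theorem annihilator_entire:
  assumes f: "f \<in> L2 half_line" and orth: "\<And>g. g \<in> eigenfunctions \<i> \<alpha> \<Longrightarrow> (\<integral>t. f t * g t \<partial>half_line) = 0"
  obtains \<Gamma> where "\<Gamma> holomorphic_on UNIV"
    "\<And>\<mu>. regular \<alpha> \<mu> \<Longrightarrow> \<Gamma> \<mu> = (\<integral>t. f t * weyl_u \<alpha> \<mu> t \<partial>half_line)"
proof -
  define G where "G \<mu> = (\<integral>t. f t * weyl_u \<alpha> \<mu> t \<partial>half_line)" for \<mu>
  define W where "W = {\<mu>. Im (unrotate \<alpha> \<mu>) \<noteq> 0}"
  \<comment> \<open>W is dense and consists of regular parameters, so this limit agrees with the
    local quotient on every ball and glues them independently of L.\<close>
  define \<Gamma> where "\<Gamma> \<mu> = Lim (at \<mu> within W) G" for \<mu>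
  have Wlim: "\<mu> islimpt W" for \<mu>
    unfolding islimpt_approachable
  proof (intro allI impI)
    fix e :: real assume e: "e > 0"
    define d where "d = \<i> * cis (pi / (2 + \<alpha>))"
    define x where "x = Im (unrotate \<alpha> \<mu>)"
    have unr: "Im (unrotate \<alpha> (\<mu> + of_real t * d)) = x + t" for t
    proof -
      have "unrotate \<alpha> (\<mu> + of_real t * d) = unrotate \<alpha> \<mu> + of_real t * \<i>"
        by (simp add: unrotate_def d_def distrib_right mult.assoc cis_mult)
      then show ?thesis by (simp add: x_def)
    qed
    have nd: "norm d = 1" by (simp add: d_def norm_mult)
    define t where "t = (if x + e / 2 = 0 then e / 3 else e / 2)"
    have "t \<noteq> 0" "\<bar>t\<bar> < e" "x + t \<noteq> 0" using e by (auto simp: t_def)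
    moreover have "d \<noteq> 0" using nd by auto
    ultimately show "\<exists>x'\<in>W. x' \<noteq> \<mu> \<and> dist x' \<mu> < e"
      by (intro bexI[of _ "\<mu> + of_real t * d"]) (auto simp: W_def unr dist_norm norm_mult nd)
  qed
  have local: "\<exists>g. g holomorphic_on ball 0 L \<and> (\<forall>\<mu>\<in>ball 0 L. regular \<alpha> \<mu> \<longrightarrow> g \<mu> = G \<mu>)" if L: "L > 0" for L
  proof -
    obtain y0 y1 B where y: "y0 holomorphic_on ball 0 L" "y1 holomorphic_on ball 0 L"
      and nz: "\<And>\<mu>. \<mu> \<in> ball 0 L \<Longrightarrow> y0 \<mu> \<noteq> 0 \<or> y1 \<mu> \<noteq> 0"
      and dd: "\<And>\<mu>. \<mu> \<in> ball 0 L \<Longrightarrow> dec_data \<alpha> 0 \<mu> 0 (y0 \<mu>) (y1 \<mu>)"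
      and Yb: "\<And>N. \<exists>B. \<forall>\<mu>\<in>ball 0 L. \<forall>t. 0 \<le> t \<longrightarrow> t \<le> N \<longrightarrow> norm (fam \<mu> (y0 \<mu>) (y1 \<mu>) t) \<le> B"
      and YB: "\<And>\<mu> N. \<mu> \<in> ball 0 L \<Longrightarrow> N \<ge> 0 \<Longrightarrow> integral {0..N} (\<lambda>s. (norm (fam \<mu> (y0 \<mu>) (y1 \<mu>) s))\<^sup>2) \<le> B"
      using dec_data_family[OF L] by blast
    define F where "F \<mu> = (\<integral>t. f t * fam \<mu> (y0 \<mu>) (y1 \<mu>) t \<partial>half_line)" for \<mu>
    have hF: "F holomorphic_on ball 0 L" unfolding F_def by (rule pairing_family_holomorphic[OF f y dd Yb YB])
    have F0: "F z = 0" if z: "z \<in> ball 0 L" "y0 z = 0" for z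
    proof -
      have "y1 z \<noteq> 0" using nz[OF z(1)] z(2) by simp
      then have "dec_data \<alpha> 0 z 0 0 1"
        using dec_data_prop[OF \<alpha> order_refl zero_strip[OF \<alpha>] dd[OF z(1)] nz[OF z(1)], of 1 0] z(2) by simp
      then have "(\<integral>t. f t * fam z 0 1 t \<partial>half_line) = 0"
        unfolding fam_def by (intro orth eigenfunctionI[OF \<alpha>])
      moreover have "F z = (\<integral>t. y1 z * (f t * fam z 0 1 t) \<partial>half_line)"
        unfolding F_def by (rule Bochner_Integration.integral_cong) (use fam_lincomb[of _ z "y0 z" "y1 z"] z(2) in auto)
      ultimately show ?thesis by simp
    qed
    define g where "g z = (if y0 z = 0 then deriv F z / deriv y0 z else F z / y0 z)" for z
    have "g holomorphic_on ball 0 L"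
      unfolding g_def using F0 dec_data_zero_simple[OF y nz dd]
      by (intro holomorphic_quotient_simple_zeros[OF open_ball hF y(1)]) auto
    moreover have "g \<mu> = G \<mu>" if \<mu>: "\<mu> \<in> ball 0 L" "regular \<alpha> \<mu>" for \<mu>
    proof -
      have eq: "y0 \<mu> * weyl_m \<alpha> \<mu> = y1 \<mu> * 1"
        by (rule dec_data_unique[OF \<alpha> order_refl zero_strip[OF \<alpha>] dd[OF \<mu>(1)] weyl_exists[OF \<alpha> \<mu>(2)]])
      then have "y0 \<mu> \<noteq> 0" using nz[OF \<mu>(1)] by auto
      moreover have "F \<mu> = y0 \<mu> * G \<mu>"
      proof -
        have "F \<mu> = (\<integral>t. y0 \<mu> * (f t * weyl_u \<alpha> \<mu> t) \<partial>half_line)"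
          unfolding F_def
        proof (rule Bochner_Integration.integral_cong[OF refl])
          fix t assume "t \<in> space half_line"
          then have t: "t \<ge> 0" by simp
          show "f t * fam \<mu> (y0 \<mu>) (y1 \<mu>) t = y0 \<mu> * (f t * weyl_u \<alpha> \<mu> t)"
            using eq unfolding weyl_u_def fam_def[symmetric] fam_lincomb[OF t, of \<mu> "y0 \<mu>" "y1 \<mu>"] fam_lincomb[OF t, of \<mu> 1 "weyl_m \<alpha> \<mu>"]
            by (simp add: algebra_simps)
        qed
        also have "\<dots> = y0 \<mu> * G \<mu>" unfolding G_def by simp
        finally show ?thesis .
      qed
      ultimately show ?thesis by (simp add: g_def)
    qed
    ultimately show ?thesis by blast
  qed
  have \<Gamma>eq: "\<Gamma> \<mu> = g \<mu>" if g: "g holomorphic_on ball 0 L" "\<forall>\<mu>\<in>ball 0 L. regular \<alpha> \<mu> \<longrightarrow> g \<mu> = G \<mu>" and \<mu>: "\<mu> \<in> ball 0 L" for g L \<mu>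
  proof -
    have "isCont g \<mu>"
      using holomorphic_on_imp_continuous_on[OF g(1)] \<mu> by (simp add: continuous_on_eq_continuous_at)
    then have "(g \<longlongrightarrow> g \<mu>) (at \<mu>)" by (simp add: isCont_def)
    then have "(g \<longlongrightarrow> g \<mu>) (at \<mu> within W)" by (rule tendsto_mono[rotated]) (simp add: at_le)
    moreover have "\<forall>\<^sub>F z in at \<mu> within W. g z = G z"
    proof -
      have "\<forall>\<^sub>F z in at \<mu> within W. z \<in> ball 0 L"
        using \<mu> by (intro eventually_at_topological[THEN iffD2] exI[of _ "ball 0 L"]) auto
      moreover have "\<forall>\<^sub>F z in at \<mu> within W. z \<in> W" by (simp add: eventually_at_filter)
      ultimately show ?thesis
        by eventually_elim (use g(2) regular_off_ray[OF \<alpha>] in \<open>auto simp: W_def\<close>)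
    qed
    ultimately have "(G \<longlongrightarrow> g \<mu>) (at \<mu> within W)" using tendsto_cong by metis
    then show ?thesis unfolding \<Gamma>_def using Wlim by (intro tendsto_Lim) (auto simp: trivial_limit_within)
  qed
  show thesis
  proof (rule that)
    show "\<Gamma> holomorphic_on UNIV"
    proof -
      have "\<Gamma> field_differentiable at \<mu>" for \<mu>
      proof -
        define L where "L = norm \<mu> + 1"
        have L: "L > 0" "\<mu> \<in> ball 0 L" by (auto simp: L_def add_nonneg_pos)
        obtain g where g: "g holomorphic_on ball 0 L" "\<forall>\<mu>\<in>ball 0 L. regular \<alpha> \<mu> \<longrightarrow> g \<mu> = G \<mu>"
          using local[OF L(1)] by blast
        have "\<Gamma> holomorphic_on ball 0 L" by (rule holomorphic_transform[OF g(1)]) (use \<Gamma>eq[OF g] in auto)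
        then show ?thesis using L(2) by (auto simp: holomorphic_on_open field_differentiable_def)
      qed
      then show ?thesis by (simp add: holomorphic_on_def)
    qed
    fix \<mu> assume reg: "regular \<alpha> \<mu>"
    define L where "L = norm \<mu> + 1"
    have L: "L > 0" "\<mu> \<in> ball 0 L" by (auto simp: L_def add_nonneg_pos)
    obtain g where g: "g holomorphic_on ball 0 L" "\<forall>\<mu>\<in>ball 0 L. regular \<alpha> \<mu> \<longrightarrow> g \<mu> = G \<mu>"
      using local[OF L(1)] by blast
    show "\<Gamma> \<mu> = (\<integral>t. f t * weyl_u \<alpha> \<mu> t \<partial>half_line)"
      using \<Gamma>eq[OF g L(2)] g(2) L(2) reg by (simp add: G_def)
  qed
qed

end

section \<open>Vanishing of the entire function\<close>

lemma phragmen_lindelof_between: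
  fixes G :: "complex \<Rightarrow> complex"
  assumes hol: "G holomorphic_on UNIV" and ab: "a < b" "b - a < pi" "p * (b - a) < pi" and p: "p > 0"
    and gr: "C \<ge> 0" "\<And>z. norm z \<ge> 1 \<Longrightarrow> norm (G z) \<le> K * exp (C * norm z powr p)"
    and ra: "\<And>r. r \<ge> 1 \<Longrightarrow> norm (G (of_real r * cis a)) \<le> B * r ^ n"
    and rb: "\<And>r. r \<ge> 1 \<Longrightarrow> norm (G (of_real r * cis b)) \<le> B * r ^ n"
  obtains B' where "\<And>r \<theta>. r \<ge> 1 \<Longrightarrow> a \<le> \<theta> \<Longrightarrow> \<theta> \<le> b \<Longrightarrow> norm (G (of_real r * cis \<theta>)) \<le> B' * r ^ n"
proof -
  define e where "e = cis ((a + b) / 2)"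
  define \<psi> where "\<psi> = (b - a) / 2"
  have eq: "e * cis \<theta> = cis ((a + b) / 2 + \<theta>)" for \<theta> by (simp add: e_def cis_mult)
  have ends: "(a + b) / 2 + \<psi> = b" "(a + b) / 2 + - \<psi> = a" by (auto simp: \<psi>_def field_simps)
  obtain B' where B': "\<And>r \<theta>. r \<ge> 1 \<Longrightarrow> \<bar>\<theta>\<bar> \<le> \<psi> \<Longrightarrow> norm (G (of_real r * (e * cis \<theta>))) \<le> B' * r ^ n"
  proof (rule phragmen_lindelof_sector[OF hol, of e \<psi> p C K B n])
    show "norm (G (of_real r * (e * cis \<psi>))) \<le> B * r ^ n" if "r \<ge> 1" for r
      using rb[OF that] by (simp only: eq ends)
    show "norm (G (of_real r * (e * cis (- \<psi>)))) \<le> B * r ^ n" if "r \<ge> 1" for r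
      using ra[OF that] by (simp only: eq ends)
  qed (use ab p gr in \<open>auto simp: e_def \<psi>_def\<close>)
  have "norm (G (of_real r * cis \<theta>)) \<le> B' * r ^ n" if "r \<ge> 1" "a \<le> \<theta>" "\<theta> \<le> b" for r \<theta>
  proof -
    have "\<bar>\<theta> - (a + b) / 2\<bar> \<le> \<psi>" using that by (auto simp: \<psi>_def abs_le_iff field_simps)
    from B'[OF that(1) this] show ?thesis by (simp add: eq)
  qed
  then show thesis by (rule that)
qed

text \<open>The sectors between consecutive rays are narrow enough for the order, so the polynomial
  bounds spread from the rays to the plane and G is a polynomial by Liouville. A nonconstant
  polynomial is unbounded along the ray of e, hence G is constant, and its limit there is 0.\<close>

lemma phragmen_lindelof_rays:
  fixes G :: "complex \<Rightarrow> complex" and ray :: "nat \<Rightarrow> real"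
  assumes hol: "G holomorphic_on UNIV" and p: "p > 0"
    and gr: "C \<ge> 0" "\<And>z. norm z \<ge> 1 \<Longrightarrow> norm (G z) \<le> K * exp (C * norm z powr p)"
    and rays: "\<And>i. i < N \<Longrightarrow> ray i < ray (Suc i) \<and> ray (Suc i) - ray i < pi \<and> p * (ray (Suc i) - ray i) < pi"
    and full: "ray N = ray 0 + 2 * pi"
    and bnd: "\<And>i. i \<le> N \<Longrightarrow> \<exists>B. \<forall>r\<ge>1. norm (G (of_real r * cis (ray i))) \<le> B * r ^ n"
    and lim: "(\<lambda>k. G (of_real (real (Suc k)) * e)) \<longlonglongrightarrow> 0" and e: "norm e = 1"
  shows "G z = 0"
proof -
  obtain Bi where Bi: "\<And>i r. i \<le> N \<Longrightarrow> r \<ge> 1 \<Longrightarrow> norm (G (of_real r * cis (ray i))) \<le> Bi i * r ^ n"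
    using bnd by metis
  define B where "B = (\<Sum>i\<le>N. \<bar>Bi i\<bar>)"
  have B: "norm (G (of_real r * cis (ray i))) \<le> B * r ^ n" if i: "i \<le> N" and r: "r \<ge> 1" for i r
  proof -
    have "Bi i \<le> \<bar>Bi i\<bar>" by simp
    also have "\<dots> \<le> B" unfolding B_def using i by (intro member_le_sum) auto
    finally have "Bi i * r ^ n \<le> B * r ^ n" using r by (intro mult_right_mono) auto
    then show ?thesis using Bi[OF i r] by simp
  qed
  have "\<exists>B'. \<forall>r\<ge>1. \<forall>\<theta>. ray i \<le> \<theta> \<longrightarrow> \<theta> \<le> ray (Suc i) \<longrightarrow> norm (G (of_real r * cis \<theta>)) \<le> B' * r ^ n" if i: "i < N" for i
  proof (rule phragmen_lindelof_between[OF hol, of "ray i" "ray (Suc i)" p C K B n])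
    show "norm (G (of_real r * cis (ray i))) \<le> B * r ^ n" "norm (G (of_real r * cis (ray (Suc i)))) \<le> B * r ^ n" if "r \<ge> 1" for r
      using B[of i r] B[of "Suc i" r] i that by auto
  qed (use rays[OF i] p gr in auto)
  then obtain Ci where Ci: "\<And>i r \<theta>. i < N \<Longrightarrow> r \<ge> 1 \<Longrightarrow> ray i \<le> \<theta> \<Longrightarrow> \<theta> \<le> ray (Suc i) \<Longrightarrow> norm (G (of_real r * cis \<theta>)) \<le> Ci i * r ^ n"
    by metis
  define M where "M = (\<Sum>i<N. \<bar>Ci i\<bar>)"
  have sector: "\<exists>i<N. ray i \<le> \<theta> \<and> \<theta> \<le> ray (Suc i)" if "ray 0 \<le> \<theta>" "\<theta> < ray N" for \<theta>
  proof -
    have "\<exists>i<k. ray i \<le> \<theta> \<and> \<theta> \<le> ray (Suc i)" if "\<theta> < ray k" for k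
      using that
    proof (induction k)
      case 0 then show ?case using \<open>ray 0 \<le> \<theta>\<close> by simp
    next
      case (Suc k)
      show ?case
      proof (cases "\<theta> < ray k")
        case True then show ?thesis using Suc.IH by (auto intro: less_SucI)
      next
        case False then show ?thesis using Suc.prems by (intro exI[of _ k]) auto
      qed
    qed
    then show ?thesis using that(2) by blast
  qed
  have poly: "norm (G w) \<le> M * norm w ^ n" if w: "norm w \<ge> 1" for w
  proof -
    \<comment> \<open>The representative of the argument of w in the interval from
      \<open>ray 0\<close> to \<open>ray 0\<close> + 2 pi, right end excluded.\<close>
    define \<theta> where "\<theta> = Arg w + 2 * pi * of_int \<lceil>(ray 0 - Arg w) / (2 * pi)\<rceil>"
    have c: "cis \<theta> = cis (Arg w)"
    proof -
      have "cis (2 * pi * of_int k) = 1" for k :: int by (simp add: cis.ctr complex_eq_iff)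
      then show ?thesis by (simp add: \<theta>_def cis_mult[symmetric])
    qed
    have "(ray 0 - Arg w) / (2 * pi) \<le> of_int \<lceil>(ray 0 - Arg w) / (2 * pi)\<rceil>" by simp
    then have "ray 0 - Arg w \<le> of_int \<lceil>(ray 0 - Arg w) / (2 * pi)\<rceil> * (2 * pi)"
      by (subst (asm) pos_divide_le_eq) auto
    then have lo: "ray 0 \<le> \<theta>" unfolding \<theta>_def mult.commute[of "2 * pi"] by linarith
    have "of_int \<lceil>(ray 0 - Arg w) / (2 * pi)\<rceil> - 1 < (ray 0 - Arg w) / (2 * pi)" by linarith
    then have "(of_int \<lceil>(ray 0 - Arg w) / (2 * pi)\<rceil> - 1) * (2 * pi) < ray 0 - Arg w"
      by (subst (asm) pos_less_divide_eq) auto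
    then have "\<theta> < ray 0 + 2 * pi"
      unfolding \<theta>_def left_diff_distrib mult.commute[of "2 * pi"] by linarith
    then obtain i where i: "i < N" "ray i \<le> \<theta>" "\<theta> \<le> ray (Suc i)" using sector[OF lo] full by auto
    have wn: "w \<noteq> 0" using w by auto
    have "w = of_real (norm w) * cis \<theta>"
      unfolding c using Arg_eq[OF wn] by (simp add: cis_conv_exp)
    then have "norm (G w) \<le> Ci i * norm w ^ n" using Ci[OF i(1) w i(2,3)] by simp
    also have "Ci i \<le> M"
    proof -
      have "Ci i \<le> \<bar>Ci i\<bar>" by simp
      also have "\<dots> \<le> M" unfolding M_def using i by (intro member_le_sum) auto
      finally show ?thesis .
    qed
    finally show ?thesis using w by (simp add: mult_right_mono)
  qed
  define P where "P = (\<Sum>k\<le>n. monom ((deriv ^^ k) G 0 / fact k) k)"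
  have GP: "G w = poly P w" for w
    using Liouville_polynomial[OF hol, of 1 M n w] poly by (simp add: P_def poly_sum poly_monom)
  obtain a Q where PQ: "P = pCons a Q" by (metis pCons_cases)
  have "Q = 0"
  proof (rule ccontr)
    assume "Q \<noteq> 0"
    then obtain r where r: "\<forall>w. r \<le> norm w \<longrightarrow> 1 \<le> norm (poly (pCons a Q) w)" using poly_infinity[of Q 1 a] by blast
    have "\<forall>\<^sub>F k in sequentially. norm (G (of_real (real (Suc k)) * e)) < 1"
      using order_tendstoD(2)[OF tendsto_norm[OF lim], of 1] by simp
    moreover have "\<forall>\<^sub>F k in sequentially. r \<le> real (Suc k)"
      using eventually_ge_at_top[of "nat \<lceil>r\<rceil>"] by eventually_elim linarith
    ultimately have "\<forall>\<^sub>F k in sequentially. False"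
    proof eventually_elim
      case (elim k)
      have "norm (of_real (real (Suc k)) * e) = real (Suc k)" using e by (simp add: norm_mult del: of_nat_Suc)
      then have "1 \<le> norm (poly (pCons a Q) (of_real (real (Suc k)) * e))" using r elim(2) by metis
      then show False using elim(1) unfolding GP PQ by linarith
    qed
    then show False by simp
  qed
  then have Ga: "G w = a" for w by (simp add: GP PQ)
  then have "a = 0" using lim by (simp add: LIMSEQ_const_iff)
  then show ?thesis by (simp add: Ga)
qed

text \<open>A ray outside the closed first quadrant is separated from it by a line through 0. In the
  flux derivative Re \<omega> > 0 handles the kinetic term, Im \<omega> \<ge> 0 the term \<i>
  x^\<alpha>, and the last inequality the term with \<mu>.\<close>

lemma outer_ray_multiplier:
  assumes a: "cos a < 0 \<or> sin a < 0"
  shows "\<exists>\<omega>. Re \<omega> > 0 \<and> Im \<omega> \<ge> 0 \<and> Re (cnj \<omega> * (- cis a)) > 0"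
proof (cases "cos a < 0")
  case True
  then show ?thesis by (intro exI[of _ 1]) auto
next
  case False
  then have s: "sin a < 0" using a by simp
  \<comment> \<open>The multiplier \<i> alone would give -sin a > 0; the added real part -sin a/2
    costs at most half of it.\<close>
  have "(- sin a / 2) * cos a \<le> (- sin a / 2) * 1" using s by (intro mult_left_mono) auto
  moreover have "Re (cnj (Complex (- sin a / 2) 1) * (- cis a)) = - ((- sin a / 2) * cos a) - sin a" by simp
  ultimately have "Re (cnj (Complex (- sin a / 2) 1) * (- cis a)) > 0" using s by linarith
  then show ?thesis using s by (intro exI[of _ "Complex (- sin a / 2) 1"]) simp
qed

context
  fixes \<alpha> :: real
  assumes \<alpha>: "\<alpha> > 0"
begin

lemma unrotate_inverse: "unrotate \<alpha> (z * cis (pi / (2 + \<alpha>))) = z"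
  by (simp add: unrotate_def mult.assoc cis_mult)

text \<open>Off the eigenvalue ray the pairing grows with order 1/2 + 1/\<alpha> up to one factor of
  the inverse distance to the line of the ray, which \<open>entire_growth_across_real_line\<close>
  removes in the unrotated variable.\<close>

lemma annihilator_growth:
  assumes f: "f \<in> L2 half_line" and hol: "\<Gamma> holomorphic_on UNIV"
    and \<Gamma>: "\<And>\<mu>. regular \<alpha> \<mu> \<Longrightarrow> \<Gamma> \<mu> = (\<integral>t. f t * weyl_u \<alpha> \<mu> t \<partial>half_line)"
  obtains K C where "C \<ge> 0" "\<And>z. norm z \<ge> 1 \<Longrightarrow> norm (\<Gamma> z) \<le> K * exp (C * norm z powr (1 / 2 + 1 / \<alpha>))"
proof -
  define p where "p = 1 / 2 + 1 / \<alpha>"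
  have p: "p > 0" "p \<ge> 1/2" using \<alpha> by (auto simp: p_def add_pos_pos)
  define F2 where "F2 = (\<integral>t. (norm (f t))\<^sup>2 \<partial>half_line)"
  have F2: "F2 \<ge> 0" by (simp add: F2_def)
  define c where "c = 5 * 3 powr (1 / \<alpha>) + 2"
  have c: "c \<ge> 0" by (simp add: c_def)
  define H where "H z = \<Gamma> (z * cis (pi / (2 + \<alpha>)))" for z
  have holH: "H holomorphic_on UNIV"
  proof -
    have "(\<lambda>z. z * cis (pi / (2 + \<alpha>))) holomorphic_on UNIV" by (intro holomorphic_intros)
    then have "\<Gamma> \<circ> (\<lambda>z. z * cis (pi / (2 + \<alpha>))) holomorphic_on UNIV" using hol by (rule holomorphic_on_compose_gen) auto
    then show ?thesis by (simp add: o_def H_def[abs_def])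
  qed
  have bound: "norm (H z) \<le> (32 * 8 * (F2 + 4)) * exp ((c + 6) * norm z powr p) * (1 + 1 / \<bar>Im z\<bar>)"
    if z: "norm z \<ge> 1" "Im z \<noteq> 0" for z
  proof -
    define \<mu> where "\<mu> = z * cis (pi / (2 + \<alpha>))"
    define n where "n = norm z"
    have n: "n \<ge> 1" "norm \<mu> = n" using z by (auto simp: \<mu>_def n_def norm_mult)
    have unr: "unrotate \<alpha> \<mu> = z" unfolding \<mu>_def by (rule unrotate_inverse)
    then have Im: "Im (unrotate \<alpha> \<mu>) \<noteq> 0" using z by simp
    note reg = regular_off_ray[OF \<alpha> Im]
    define m where "m = norm (weyl_m \<alpha> \<mu>)"
    have m0: "m \<ge> 0" by (simp add: m_def)
    define E where "E = exp (c * n powr p)"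
    have E: "E \<ge> 1" using c by (simp add: E_def)
    have N2: "weyl_norm2 \<alpha> \<mu> \<le> (m\<^sup>2 + 4) * E"
      using weyl_norm2_growth[OF \<alpha> Im] n by (simp add: m_def E_def c_def p_def)
    \<comment> \<open>The weight 1 + m matters: the squared norm of u contains m^2, and this choice
      leaves the first power of m only, hence the first power of 1/|Im z|.\<close>
    have "norm (\<Gamma> \<mu>) \<le> ((1 + m) * F2 + weyl_norm2 \<alpha> \<mu> / (1 + m)) / 2"
      unfolding \<Gamma>[OF reg] F2_def weyl_norm2_def using m0 by (intro L2_pairing(2)[OF f weyl_u_L2[OF \<alpha> reg]]) auto
    also have "\<dots> \<le> ((1 + m) * F2 + (1 + m) * 4 * E) / 2"
    proof -
      have "(m\<^sup>2 + 4) * E \<le> (1 + m) * 4 * E * (1 + m)"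
      proof -
        have "m\<^sup>2 + 4 \<le> 4 * (1 + m)\<^sup>2" using m0 by (simp add: power2_sum)
        then have "(m\<^sup>2 + 4) * E \<le> 4 * (1 + m)\<^sup>2 * E" using E by (intro mult_right_mono) auto
        then show ?thesis by (simp add: power2_eq_square mult_ac)
      qed
      then have "weyl_norm2 \<alpha> \<mu> \<le> (1 + m) * 4 * E * (1 + m)" using N2 by linarith
      then have "weyl_norm2 \<alpha> \<mu> / (1 + m) \<le> (1 + m) * 4 * E" using m0 by (subst pos_divide_le_eq) auto
      then show ?thesis by (intro divide_right_mono add_left_mono) auto
    qed
    also have "\<dots> \<le> (1 + m) * ((F2 + 4) * E)"
    proof -
      have "F2 * 1 \<le> F2 * E" using F2 E by (intro mult_left_mono) auto
      then have "F2 + 4 * E \<le> (F2 + 4) * E" by (simp add: algebra_simps)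
      then have "(1 + m) * (F2 + 4 * E) \<le> (1 + m) * ((F2 + 4) * E)" using m0 by (intro mult_left_mono) auto
      moreover have "0 \<le> (1 + m) * (F2 + 4 * E)" using m0 F2 E by (intro mult_nonneg_nonneg) auto
      moreover have "(1 + m) * F2 + (1 + m) * 4 * E = (1 + m) * (F2 + 4 * E)" by (simp add: algebra_simps)
      moreover have "x / 2 \<le> y" if "x \<le> y" "0 \<le> x" for x y :: real using that by simp
      ultimately show ?thesis by metis
    qed
    also have "\<dots> \<le> (32 * 8 * exp (6 * n powr p) * (1 + 1 / \<bar>Im z\<bar>)) * ((F2 + 4) * E)"
    proof (rule mult_right_mono)
      have "m \<le> 32 * (1 + n) ^ 3 / \<bar>Im z\<bar>" using weyl_m_bound[OF \<alpha> Im] n unr by (simp add: m_def)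
      moreover have "1 \<le> 32 * (1 + n) ^ 3"
      proof -
        have "1 \<le> (1 + n) ^ 3" using n by (intro one_le_power) auto
        then show ?thesis by linarith
      qed
      ultimately have "1 + m \<le> 32 * (1 + n) ^ 3 * (1 + 1 / \<bar>Im z\<bar>)" by (simp add: distrib_left)
      also have "\<dots> \<le> 32 * (8 * exp (6 * n powr p)) * (1 + 1 / \<bar>Im z\<bar>)"
      proof (intro mult_right_mono mult_left_mono)
        have "n \<le> exp (2 * n powr p)"
        proof -
          have "p * ln n \<le> exp (p * ln n)" using exp_ge_add_one_self[of "p * ln n"] by linarith
          also have "\<dots> = n powr p" using n by (simp add: powr_def)
          finally have "p * ln n \<le> n powr p" .
          moreover have "1/2 * ln n \<le> p * ln n" using p n by (intro mult_right_mono) auto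
          ultimately have "ln n \<le> 2 * n powr p" by simp
          then show ?thesis using n by (metis exp_le_cancel_iff exp_ln less_le_trans zero_less_one)
        qed
        then have "n ^ 3 \<le> exp (2 * n powr p) ^ 3" using n by (intro power_mono) auto
        also have "\<dots> = exp (6 * n powr p)" by (simp flip: exp_of_nat_mult)
        finally have "n ^ 3 \<le> exp (6 * n powr p)" .
        moreover have "(1 + n) ^ 3 \<le> (2 * n) ^ 3" using n by (intro power_mono) auto
        ultimately show "(1 + n) ^ 3 \<le> 8 * exp (6 * n powr p)" by (simp add: power_mult_distrib)
      qed auto
      finally show "1 + m \<le> 32 * 8 * exp (6 * n powr p) * (1 + 1 / \<bar>Im z\<bar>)" by simp
    qed (use F2 E in auto)
    also have "\<dots> = (32 * 8 * (F2 + 4)) * (exp (6 * n powr p) * E) * (1 + 1 / \<bar>Im z\<bar>)" by (simp only: mult_ac)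
    also have "exp (6 * n powr p) * E = exp ((c + 6) * n powr p)" by (simp add: E_def mult_exp_exp algebra_simps)
    finally show ?thesis by (simp only: H_def \<mu>_def n_def)
  qed
  obtain K' C' where KC: "K' \<ge> 0" "C' \<ge> 0" "\<And>z. norm z \<ge> 1 \<Longrightarrow> norm (H z) \<le> K' * exp (C' * norm z powr p)"
    by (rule entire_growth_across_real_line[OF holH p(1) _ _ bound]) (use c F2 in auto)
  have main: "norm (\<Gamma> z) \<le> K' * exp (C' * norm z powr p)" if "norm z \<ge> 1" for z
  proof -
    have "\<Gamma> z = H (z * cis (- (pi / (2 + \<alpha>))))" by (simp add: H_def mult.assoc cis_mult)
    then show ?thesis using KC(3)[of "z * cis (- (pi / (2 + \<alpha>)))"] that by (simp add: norm_mult)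
  qed
  show thesis by (rule that[OF KC(2) main[unfolded p_def]])
qed

lemma outer_ray:
  assumes a: "cos a < 0 \<or> sin a < 0"
  obtains K where "\<And>r. r \<ge> 1 \<Longrightarrow> regular \<alpha> (of_real r * cis a)" "\<And>r. r \<ge> 1 \<Longrightarrow> weyl_norm2 \<alpha> (of_real r * cis a) \<le> K / sqrt r"
proof -
  obtain \<omega> where "Re \<omega> > 0" "Im \<omega> \<ge> 0" "Re (cnj \<omega> * (- cis a)) > 0"
    using outer_ray_multiplier[OF a] by blast
  from weyl_norm2_on_ray[OF \<alpha> _ this] that show thesis by (metis norm_cis)
qed

text \<open>The conditions on \<phi> cover two situations: a ray just outside the quadrant, bounded
  through the numerical range, and a ray just inside, bounded by
  \<open>weyl_norm2_inner_ray_polynomial\<close>, whence the exponent 6.\<close>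

theorem annihilator_vanishes:
  assumes f: "f \<in> L2 half_line" and orth: "\<And>g. g \<in> eigenfunctions \<i> \<alpha> \<Longrightarrow> (\<integral>t. f t * g t \<partial>half_line) = 0"
    and \<delta>: "0 < \<delta>" "\<delta> < pi / 8" and \<phi>: "3 * pi / 8 < \<phi>" "\<phi> < 5 * pi / 8"
    and p: "(1 / 2 + 1 / \<alpha>) * (\<phi> + \<delta>) < pi" "1 / 2 + 1 / \<alpha> < 8 / 3"
    and ray: "\<And>r. r \<ge> r0 \<Longrightarrow> regular \<alpha> (of_real r * cis \<phi>)" "\<And>r. r \<ge> r0 \<Longrightarrow> weyl_norm2 \<alpha> (of_real r * cis \<phi>) \<le> C0 * r ^ 6"
    and reg: "regular \<alpha> \<mu>"
  shows "(\<integral>t. f t * weyl_u \<alpha> \<mu> t \<partial>half_line) = 0"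
proof -
  define q where "q = 1 / 2 + 1 / \<alpha>"
  have q: "q > 0" "q < 8 / 3" "q * (\<phi> + \<delta>) < pi"
    unfolding q_def by (intro add_pos_pos; use \<alpha> in simp) (rule p(2), rule p(1))
  define F2 where "F2 = (\<integral>t. (norm (f t))\<^sup>2 \<partial>half_line)"
  have F2: "F2 \<ge> 0" by (simp add: F2_def)
  obtain \<Gamma> where hol: "\<Gamma> holomorphic_on UNIV"
    and \<Gamma>: "\<And>\<mu>. regular \<alpha> \<mu> \<Longrightarrow> \<Gamma> \<mu> = (\<integral>t. f t * weyl_u \<alpha> \<mu> t \<partial>half_line)"
    using annihilator_entire[OF \<alpha> f orth] by blast
  have \<Gamma>le: "norm (\<Gamma> \<mu>) \<le> (\<eta> * F2 + weyl_norm2 \<alpha> \<mu> / \<eta>) / 2" if "regular \<alpha> \<mu>" "\<eta> > 0" for \<mu> \<eta>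
    unfolding \<Gamma>[OF that(1)] F2_def weyl_norm2_def by (intro L2_pairing(2)[OF f weyl_u_L2[OF \<alpha> that(1)] that(2)])
  have "\<exists>K C. C \<ge> 0 \<and> (\<forall>z. norm z \<ge> 1 \<longrightarrow> norm (\<Gamma> z) \<le> K * exp (C * norm z powr q))"
    by (rule annihilator_growth[OF f hol \<Gamma>]) (auto simp: q_def)
  then obtain K C where gr: "C \<ge> 0" "\<And>z. norm z \<ge> 1 \<Longrightarrow> norm (\<Gamma> z) \<le> K * exp (C * norm z powr q)"
    by metis
  \<comment> \<open>The critical gap is \<phi> + \<delta>; all others are at most 3 pi/8, which an
    order below 8/3 tolerates. Apart from \<phi>, every ray lies outside the closed first
    quadrant.\<close>
  define ray :: "nat \<Rightarrow> real" where "ray i = [-\<delta>, \<phi>, 3 * pi / 4, 9 * pi / 8, 3 * pi / 2, 15 * pi / 8, 2 * pi - \<delta>] ! i" for i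
  have rayv: "ray 0 = - \<delta>" "ray (Suc 0) = \<phi>" "ray (Suc (Suc 0)) = 3 * pi / 4" "ray (Suc (Suc (Suc 0))) = 9 * pi / 8"
    "ray (Suc (Suc (Suc (Suc 0)))) = 3 * pi / 2" "ray (Suc (Suc (Suc (Suc (Suc 0))))) = 15 * pi / 8"
    "ray (Suc (Suc (Suc (Suc (Suc (Suc 0)))))) = 2 * pi - \<delta>"
    by (simp_all add: ray_def)
  have outer: "\<exists>B. \<forall>r\<ge>1. norm (\<Gamma> (of_real r * cis a)) \<le> B * r ^ 6" if a: "cos a < 0 \<or> sin a < 0" for a
  proof -
    obtain K where K: "\<And>r. r \<ge> 1 \<Longrightarrow> regular \<alpha> (of_real r * cis a)" "\<And>r. r \<ge> 1 \<Longrightarrow> weyl_norm2 \<alpha> (of_real r * cis a) \<le> K / sqrt r"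
      using outer_ray[OF a] by blast
    have "norm (\<Gamma> (of_real r * cis a)) \<le> ((F2 + \<bar>K\<bar>) / 2) * r ^ 6" if r: "r \<ge> 1" for r
    proof -
      have "norm (\<Gamma> (of_real r * cis a)) \<le> (1 * F2 + weyl_norm2 \<alpha> (of_real r * cis a) / 1) / 2"
        by (rule \<Gamma>le[OF K(1)[OF r]]) simp
      also have "\<dots> \<le> (F2 + \<bar>K\<bar>) / 2"
      proof -
        have "K / sqrt r \<le> \<bar>K\<bar> / 1" using r by (intro frac_le) auto
        then show ?thesis using K(2)[OF r] by simp
      qed
      also have "\<dots> \<le> ((F2 + \<bar>K\<bar>) / 2) * r ^ 6" using mult_left_mono[OF one_le_power[OF r, of 6], of "(F2 + \<bar>K\<bar>) / 2"] F2 by simp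
      finally show ?thesis .
    qed
    then show ?thesis by blast
  qed
  have inner: "\<exists>B. \<forall>r\<ge>1. norm (\<Gamma> (of_real r * cis \<phi>)) \<le> B * r ^ 6"
  proof -
    define R where "R = max 1 r0"
    have "compact (\<Gamma> ` cball 0 R)"
      by (intro compact_continuous_image continuous_on_subset[OF holomorphic_on_imp_continuous_on[OF hol]]) auto
    then obtain b where b: "\<forall>y\<in>\<Gamma> ` cball 0 R. norm y \<le> b" using compact_imp_bounded bounded_iff by metis
    have "norm (\<Gamma> (of_real r * cis \<phi>)) \<le> (\<bar>b\<bar> + (F2 + \<bar>C0\<bar>) / 2) * r ^ 6" if r: "r \<ge> 1" for r
    proof (cases "r \<le> R")
      case True
      have r6: "1 \<le> r ^ 6" using one_le_power[OF r] .
      have "of_real r * cis \<phi> \<in> cball 0 R" using True r by (simp add: norm_mult)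
      then have "norm (\<Gamma> (of_real r * cis \<phi>)) \<le> b" using b by blast
      also have "b \<le> (\<bar>b\<bar> + (F2 + \<bar>C0\<bar>) / 2) * 1"
      proof -
        have "0 \<le> (F2 + \<bar>C0\<bar>) / 2" using F2 by simp
        then show ?thesis using abs_ge_self[of b] unfolding mult_1_right by linarith
      qed
      also have "\<dots> \<le> (\<bar>b\<bar> + (F2 + \<bar>C0\<bar>) / 2) * r ^ 6" using r6 F2 by (intro mult_left_mono) auto
      finally show ?thesis .
    next
      case False
      then have rr: "r \<ge> r0" by (simp add: R_def)
      have r6: "1 \<le> r ^ 6" using one_le_power[OF r] .
      have "norm (\<Gamma> (of_real r * cis \<phi>)) \<le> (1 * F2 + weyl_norm2 \<alpha> (of_real r * cis \<phi>) / 1) / 2"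
        by (rule \<Gamma>le[OF ray(1)[OF rr]]) simp
      also have "\<dots> \<le> (F2 * r ^ 6 + \<bar>C0\<bar> * r ^ 6) / 2"
      proof -
        have "C0 * r ^ 6 \<le> \<bar>C0\<bar> * r ^ 6" using r by (intro mult_right_mono) auto
        moreover have "F2 * 1 \<le> F2 * r ^ 6" using r6 F2 by (intro mult_left_mono) auto
        ultimately show ?thesis using ray(2)[OF rr] by simp
      qed
      also have "\<dots> \<le> (\<bar>b\<bar> + (F2 + \<bar>C0\<bar>) / 2) * r ^ 6" using r by (simp add: algebra_simps add_divide_distrib)
      finally show ?thesis .
    qed
    then show ?thesis by blast
  qed
  have vanish: "\<Gamma> z = 0" for z
  proof (rule phragmen_lindelof_rays[OF hol q(1) gr, of 6 ray 6 "-1"])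
    fix i :: nat assume "i < 6"
    then have i: "i = 0 \<or> i = Suc 0 \<or> i = Suc (Suc 0) \<or> i = Suc (Suc (Suc 0)) \<or> i = Suc (Suc (Suc (Suc 0))) \<or> i = Suc (Suc (Suc (Suc (Suc 0))))" by auto
    have step: "ray (Suc i) - ray i \<le> 3 * pi / 8 \<or> ray (Suc i) - ray i = \<phi> + \<delta>"
      using i \<delta> \<phi> by (elim disjE) (simp_all add: rayv)
    have pos: "ray i < ray (Suc i)" using i \<delta> \<phi> by (elim disjE) (simp_all add: rayv)
    have "q * (ray (Suc i) - ray i) < pi"
    proof (cases "ray (Suc i) - ray i = \<phi> + \<delta>")
      case False
      then have "q * (ray (Suc i) - ray i) \<le> q * (3 * pi / 8)" using step q by (intro mult_left_mono) auto
      also have "\<dots> < 8 / 3 * (3 * pi / 8)" using q by (intro mult_strict_right_mono) auto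
      finally show ?thesis by simp
    qed (use q in simp)
    then show "ray i < ray (Suc i) \<and> ray (Suc i) - ray i < pi \<and> q * (ray (Suc i) - ray i) < pi"
      using pos step \<delta> \<phi> by auto
  next
    show "ray 6 = ray 0 + 2 * pi" by (simp add: ray_def)
  next
    fix i :: nat assume "i \<le> 6"
    then have i: "i = 0 \<or> i = Suc 0 \<or> i = Suc (Suc 0) \<or> i = Suc (Suc (Suc 0)) \<or> i = Suc (Suc (Suc (Suc 0))) \<or> i = Suc (Suc (Suc (Suc (Suc 0))))
      \<or> i = Suc (Suc (Suc (Suc (Suc (Suc 0)))))" by auto
    have neg: "sin x < 0" if "pi < x" "x < 2 * pi" for x :: real
      using that sin_lt_zero by blast
    have c34: "cos (3 * pi / 4) < 0" using cos_monotone_0_pi[of "pi / 2" "3 * pi / 4"] by simp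
    show "\<exists>B. \<forall>r\<ge>1. norm (\<Gamma> (of_real r * cis (ray i))) \<le> B * r ^ 6"
      using i
    proof (elim disjE)
      assume "i = Suc 0" then show ?thesis using inner by (simp add: rayv)
    next
      assume "i = 0" then show ?thesis using outer[of "- \<delta>"] \<delta> sin_gt_zero[of \<delta>] by (simp add: rayv)
    next
      assume "i = Suc (Suc 0)" then show ?thesis using outer[of "3 * pi / 4"] c34 by (simp add: rayv)
    next
      assume "i = Suc (Suc (Suc 0))" then show ?thesis using outer[of "9 * pi / 8"] neg[of "9 * pi / 8"] by (simp add: rayv)
    next
      assume "i = Suc (Suc (Suc (Suc 0)))" then show ?thesis using outer[of "3 * pi / 2"] neg[of "3 * pi / 2"] by (simp add: rayv)
    next
      assume "i = Suc (Suc (Suc (Suc (Suc 0))))" then show ?thesis using outer[of "15 * pi / 8"] neg[of "15 * pi / 8"] by (simp add: rayv)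
    next
      assume "i = Suc (Suc (Suc (Suc (Suc (Suc 0)))))"
      then show ?thesis using outer[of "2 * pi - \<delta>"] neg[of "2 * pi - \<delta>"] \<delta> by (simp add: rayv)
    qed
  next
    obtain K where K: "\<And>r. r \<ge> 1 \<Longrightarrow> regular \<alpha> (of_real r * cis pi)" "\<And>r. r \<ge> 1 \<Longrightarrow> weyl_norm2 \<alpha> (of_real r * cis pi) \<le> K / sqrt r"
      using outer_ray[of pi] by auto
    \<comment> \<open>With s = r^(1/4) the squared norm on the negative axis is at most of size
      1/s^2, and the weight 1/s makes both terms of the pairing bound of size 1/s.\<close>
    define s where "s k = sqrt (sqrt (real (Suc k)))" for k
    have s: "s k > 0" "sqrt (real (Suc k)) = s k * s k" for k by (auto simp: s_def)
    have "norm (\<Gamma> (of_real (real (Suc k)) * - 1)) \<le> ((F2 + K) / 2) * (1 / s k)" for k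
    proof -
      define r where "r = real (Suc k)"
      have r: "r \<ge> 1" by (simp add: r_def)
      have "norm (\<Gamma> (of_real r * cis pi)) \<le> (1 / s k * F2 + weyl_norm2 \<alpha> (of_real r * cis pi) / (1 / s k)) / 2"
        using s by (intro \<Gamma>le[OF K(1)[OF r]]) simp
      also have "\<dots> \<le> (1 / s k * F2 + K / (s k * s k) / (1 / s k)) / 2"
        using K(2)[OF r] s(1)[of k] unfolding s(2)[of k, folded r_def] by (intro divide_right_mono add_left_mono) auto
      also have "K / (s k * s k) / (1 / s k) = K * (1 / s k)" using s(1)[of k] by (simp add: field_simps)
      also have "(1 / s k * F2 + K * (1 / s k)) / 2 = ((F2 + K) / 2) * (1 / s k)"
      proof -
        have "(i * F2 + K * i) / 2 = ((F2 + K) / 2) * i" for i by (simp add: field_simps)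
        then show ?thesis .
      qed
      also have "of_real r * cis pi = of_real (real (Suc k)) * - 1" by (simp add: r_def)
      finally show ?thesis .
    qed
    moreover have "(\<lambda>k. ((F2 + K) / 2) * (1 / s k)) \<longlonglongrightarrow> 0"
    proof -
      have "filterlim s at_top sequentially"
        unfolding s_def by (intro filterlim_compose[OF sqrt_at_top] filterlim_compose[OF filterlim_real_sequentially filterlim_Suc])
      then have "(\<lambda>k. inverse (s k)) \<longlonglongrightarrow> 0" by (rule tendsto_inverse_0_at_top)
      then have "(\<lambda>k. ((F2 + K) / 2) * inverse (s k)) \<longlonglongrightarrow> ((F2 + K) / 2) * 0" by (intro tendsto_intros)
      then show ?thesis by (simp add: inverse_eq_divide)
    qed
    ultimately show "(\<lambda>k. \<Gamma> (of_real (real (Suc k)) * - 1)) \<longlonglongrightarrow> 0"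
      by (rule Lim_null_comparison[OF always_eventually[OF allI]])
  qed auto
  show ?thesis using \<Gamma>[OF reg] vanish by simp
qed

end

section \<open>The normalized decaying solutions are complete\<close>

text \<open>The sets {..a} are closed under intersection and generate the Borel sets, so the
  integral over every Borel subset of [0, N] vanishes; a Lebesgue set differs from a Borel set by a
  null set.\<close>

lemma AE_zero_of_interval_integrals:
  fixes h :: "real \<Rightarrow> complex"
  assumes h: "\<And>N. N \<ge> 0 \<Longrightarrow> integrable (lebesgue_on {0..N}) h"
    and zero: "\<And>x. x \<ge> 0 \<Longrightarrow> (\<integral>t. h t \<partial>lebesgue_on {0..x}) = 0"
  shows "AE t in half_line. h t = 0"
proof -
  have seg: "AE t in lebesgue_on {0..N}. h t = 0" if N: "N \<ge> 0" for N
  proof (rule sigma_finite_measure.density_zero[OF _ h[OF N]])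
    interpret finite_measure "lebesgue_on {0..N}" by (rule finite_measure_lebesgue_on) simp
    show "sigma_finite_measure (lebesgue_on {0..N})" ..
  next
    define M where "M = lebesgue_on {0..N}"
    have hM: "integrable M h" unfolding M_def by (rule h[OF N])
    have spM: "space M = {0..N}" by (simp add: M_def)
    have intA: "integrable M (\<lambda>t. indicator B t *\<^sub>R h t)" if "B \<in> sets borel" for B
    proof -
      have "(\<lambda>t. indicator B t *\<^sub>R h t) \<in> borel_measurable M"
      proof (intro borel_measurable_scaleR borel_measurable_integrable[OF hM] borel_measurable_indicator')
        show "{x \<in> space M. x \<in> B} \<in> sets M"
          unfolding spM using that by (auto simp: M_def sets_restrict_space intro!: image_eqI[of _ _ B])
      qed
      then show ?thesis
        by (rule Bochner_Integration.integrable_bound[OF hM]) (auto simp: indicator_def)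
    qed
    have borelM: "B \<inter> {0..N} \<in> sets M" if "B \<in> sets borel" for B
      using that by (auto simp: M_def sets_restrict_space intro!: image_eqI[of _ _ B])
    have borel: "(\<integral>t. indicator B t *\<^sub>R h t \<partial>M) = 0" if "B \<in> sets borel" for B
    proof -
      have B: "B \<in> sigma_sets UNIV (range (\<lambda>a::real. {..a}))" using that by (simp add: borel_eq_atMost)
      have sg: "sigma_sets UNIV (range (\<lambda>a::real. {..a})) = sets borel" by (simp add: borel_eq_atMost)
      show ?thesis
      proof (rule sigma_sets_induct_disjoint[OF _ _ B])
        show "Int_stable (range (\<lambda>a::real. {..a}))" by (auto simp: Int_stable_def)
        show "range (\<lambda>a::real. {..a}) \<subseteq> Pow UNIV" by simp
      next
        fix A assume "A \<in> range (\<lambda>a::real. {..a})"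
        then obtain a where A: "A = {..a}" by blast
        show "(\<integral>t. indicator A t *\<^sub>R h t \<partial>M) = 0"
        proof (cases "a < 0")
          case True
          then have "(\<integral>t. indicator A t *\<^sub>R h t \<partial>M) = (\<integral>t. 0 \<partial>M)"
            by (intro Bochner_Integration.integral_cong) (auto simp: A spM)
          then show ?thesis by simp
        next
          case False
          have "(\<integral>t. indicator A t *\<^sub>R h t \<partial>M) = (\<integral>t. indicator {0..N} t *\<^sub>R (indicator A t *\<^sub>R h t) \<partial>lebesgue)"
            unfolding M_def by (rule integral_restrict_space) simp
          also have "\<dots> = (\<integral>t. indicator {0..min a N} t *\<^sub>R h t \<partial>lebesgue)"
            by (rule Bochner_Integration.integral_cong) (auto simp: A indicator_def)
          also have "\<dots> = (\<integral>t. h t \<partial>lebesgue_on {0..min a N})"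
            by (rule integral_restrict_space[symmetric]) simp
          also have "\<dots> = 0" using zero[of "min a N"] False N by simp
          finally show ?thesis .
        qed
      next
        show "(\<integral>t. indicator {} t *\<^sub>R h t \<partial>M) = 0" by simp
      next
        fix A assume A: "A \<in> sigma_sets UNIV (range (\<lambda>a::real. {..a}))" "(\<integral>t. indicator A t *\<^sub>R h t \<partial>M) = 0"
        have "(\<integral>t. indicator (UNIV - A) t *\<^sub>R h t \<partial>M) = (\<integral>t. h t - indicator A t *\<^sub>R h t \<partial>M)"
          by (rule Bochner_Integration.integral_cong) (auto simp: indicator_def)
        also have "\<dots> = (\<integral>t. h t \<partial>M) - (\<integral>t. indicator A t *\<^sub>R h t \<partial>M)"
          by (rule Bochner_Integration.integral_diff[OF hM intA]) (use A(1) sg in simp)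
        also have "\<dots> = 0" using A(2) zero[OF N] by (simp add: M_def)
        finally show "(\<integral>t. indicator (UNIV - A) t *\<^sub>R h t \<partial>M) = 0" .
      next
        fix A :: "nat \<Rightarrow> real set"
        assume A4: "disjoint_family A" "range A \<subseteq> sigma_sets UNIV (range (\<lambda>a::real. {..a}))" "\<And>i. (\<integral>t. indicator (A i) t *\<^sub>R h t \<partial>M) = 0"
        have A: "A i \<in> sets borel" for i using A4(2) sg by auto
        define A' where "A' i = A i \<inter> {0..N}" for i
        have ind: "indicator (\<Union>i. A' i) t *\<^sub>R h t = indicator (\<Union>i. A i) t *\<^sub>R h t" "indicator (A' i) t *\<^sub>R h t = indicator (A i) t *\<^sub>R h t"
          if "t \<in> space M" for t i
          using that by (auto simp: A'_def indicator_def spM)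
        have "(LINT t:(\<Union>i. A' i)|M. h t) = (\<Sum>i. (LINT t:(A' i)|M. h t))"
        proof (rule lebesgue_integral_countable_add)
          show "A' i \<in> sets M" for i unfolding A'_def by (rule borelM[OF A])
          show "A' i \<inter> A' j = {}" if "i \<noteq> j" for i j using A4(1) that by (auto simp: A'_def disjoint_family_on_def)
          have "integrable M (\<lambda>t. indicator (\<Union>i. A i) t *\<^sub>R h t)" using A by (intro intA sets.countable_UN) auto
          then show "set_integrable M (\<Union>i. A' i) h"
            unfolding set_integrable_def using ind(1) by (subst Bochner_Integration.integrable_cong[OF refl, of M _ "\<lambda>t. indicator (\<Union>i. A i) t *\<^sub>R h t"]) auto
        qed
        moreover have "(LINT t:(A' i)|M. h t) = 0" for i
          unfolding set_lebesgue_integral_def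
          by (rule trans[OF Bochner_Integration.integral_cong[OF refl ind(2)] A4(3)])
        ultimately have "(LINT t:(\<Union>i. A' i)|M. h t) = 0" by simp
        moreover have "(LINT t:(\<Union>i. A' i)|M. h t) = (\<integral>t. indicator (\<Union>i. A i) t *\<^sub>R h t \<partial>M)"
          unfolding set_lebesgue_integral_def by (rule Bochner_Integration.integral_cong[OF refl ind(1)])
        ultimately show "(\<integral>t. indicator (\<Union>i. A i) t *\<^sub>R h t \<partial>M) = 0" by simp
      qed
    qed
    fix A assume "A \<in> sets (lebesgue_on {0..N})"
    then have A: "A \<in> sets lebesgue" "A \<subseteq> {0..N}" by (auto simp: sets_restrict_space_iff)
    obtain S Z Z' where Z: "A = S \<union> Z" "Z \<subseteq> Z'" "Z' \<in> null_sets lborel" "S \<in> sets lborel"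
      using A(1) by (rule sets_completionE)
    have "AE t in lebesgue. t \<notin> Z'" by (intro AE_not_in null_sets_completionI Z(3))
    then have "AE t in M. t \<notin> Z'" unfolding M_def by (subst AE_restrict_space_iff) auto
    then have eq: "AE t in M. indicator A t *\<^sub>R h t = indicator S t *\<^sub>R h t"
      by eventually_elim (use Z in \<open>auto simp: indicator_def\<close>)
    have "(\<integral>t. indicator A t *\<^sub>R h t \<partial>M) = (\<integral>t. indicator S t *\<^sub>R h t \<partial>M)"
    proof (rule integral_cong_AE[OF _ _ eq])
      have "A \<in> sets M" using \<open>A \<in> sets (lebesgue_on {0..N})\<close> by (simp add: M_def)
      then show "(\<lambda>t. indicator A t *\<^sub>R h t) \<in> borel_measurable M"
        by (intro borel_measurable_scaleR borel_measurable_integrable[OF hM] borel_measurable_indicator)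
      show "(\<lambda>t. indicator S t *\<^sub>R h t) \<in> borel_measurable M"
        using Z(4) by (intro borel_measurable_integrable intA) simp
    qed
    also have "\<dots> = 0" using Z(4) by (intro borel) simp
    finally show "set_lebesgue_integral (lebesgue_on {0..N}) A h = 0"
      by (simp add: set_lebesgue_integral_def M_def)
  qed
  have "AE t in lebesgue. \<forall>N::nat. t \<in> {0..real N} \<longrightarrow> h t = 0"
    unfolding AE_all_countable using seg by (auto simp: AE_restrict_space_iff)
  then have "AE t in lebesgue. t \<in> {0..} \<longrightarrow> h t = 0"
  proof eventually_elim
    case (elim t)
    then show ?case using real_arch_simple[of t] by auto
  qed
  then show ?thesis by (simp add: AE_restrict_space_iff)
qed

section \<open>Green function and Cauchy kernel\<close>

context
  fixes \<alpha> :: real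
  assumes \<alpha>: "\<alpha> > 0"
begin

abbreviation (input) "cosol \<mu> \<equiv> fam \<alpha> \<mu> 1 0"
abbreviation (input) "sisol \<mu> \<equiv> fam \<alpha> \<mu> 0 1"

lemma fam_is_sol: "is_sol (pot \<alpha> 0 \<mu> 0) (fam \<alpha> \<mu> a b) (dsol (pot \<alpha> 0 \<mu> 0) a b)"
  unfolding fam_def[OF \<alpha>] by (rule is_sol_sol[OF pot_zero_continuous[OF \<alpha> order_refl]])

lemma fam_0: "fam \<alpha> \<mu> a b 0 = a"
  unfolding fam_def[OF \<alpha>] by (rule sol_0'[OF pot_zero_continuous[OF \<alpha> order_refl]])

text \<open>The resolvent kernel of the Dirichlet operator. The Wronskian of u and S is 1 by their
  initial values, so no denominator appears.\<close>

definition green :: "complex \<Rightarrow> real \<Rightarrow> real \<Rightarrow> complex" where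
  "green \<mu> x t = (if t \<le> x then weyl_u \<alpha> \<mu> x * sisol \<mu> t else sisol \<mu> x * weyl_u \<alpha> \<mu> t)"

text \<open>As a function of x it is the solution with value 0 and slope 1 at x = t. It is entire in
  \<mu>, being built from the solutions with fixed initial data.\<close>

definition cauchy_kernel :: "complex \<Rightarrow> real \<Rightarrow> real \<Rightarrow> complex" where
  "cauchy_kernel \<mu> x t = (if t \<le> x then sisol \<mu> x * cosol \<mu> t - cosol \<mu> x * sisol \<mu> t else 0)"

lemma weyl_u_fam: "s \<ge> 0 \<Longrightarrow> weyl_u \<alpha> \<mu> s = cosol \<mu> s + weyl_m \<alpha> \<mu> * sisol \<mu> s"
  unfolding weyl_u_def using fam_lincomb[OF \<alpha>, of s \<mu> 1 "weyl_m \<alpha> \<mu>"] by (simp add: fam_def[OF \<alpha>])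

lemma weyl_u_continuous: "continuous_on {0..} (weyl_u \<alpha> \<mu>)"
  by (rule is_sol_continuous(1)[OF weyl_is_sol[OF \<alpha>]])

lemma green_continuous: "continuous_on {0..} (green \<mu> x)"
  unfolding green_def
  by (rule continuous_on_cases_le)
     (auto intro!: continuous_intros continuous_on_subset[OF fam_continuous[OF \<alpha>]] continuous_on_subset[OF weyl_u_continuous])

lemma cauchy_kernel_continuous: "continuous_on {0..} (cauchy_kernel \<mu> x)"
  unfolding cauchy_kernel_def
  by (rule continuous_on_cases_le)
     (auto intro!: continuous_intros continuous_on_subset[OF fam_continuous[OF \<alpha>]])

lemma cauchy_kernel_green:
  assumes "x \<ge> 0" "t \<ge> 0"
  shows "cauchy_kernel \<mu> x t = sisol \<mu> x * weyl_u \<alpha> \<mu> t - green \<mu> x t"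
  by (simp add: cauchy_kernel_def green_def weyl_u_fam[OF assms(1)] weyl_u_fam[OF assms(2)] algebra_simps)

text \<open>The two fluxes at \<open>x\<close> combine, through the Wronskian, to the diagonal of the Green function.\<close>

lemma green_norm:
  assumes reg: "regular \<alpha> \<mu>" and c: "c > 0" "c \<le> Re \<omega>" and r: "r > 0"
    and good: "\<And>s. s \<ge> 0 \<Longrightarrow> c * r \<le> Re (cnj \<omega> * pot \<alpha> 0 \<mu> 0 s)" and x: "x \<ge> 0" and N: "N \<ge> 0"
  shows "integral {0..N} (\<lambda>t. (norm (green \<mu> x t))\<^sup>2) \<le> (norm \<omega>)\<^sup>2 / (c\<^sup>2 * (r * sqrt r))"
proof -
  define q where "q = pot \<alpha> 0 \<mu> 0"
  define S where "S = sisol \<mu>"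
  define S' where "S' = dsol q 0 1"
  define u where "u = weyl_u \<alpha> \<mu>"
  define u' where "u' = weyl_u' \<alpha> \<mu>"
  have sS: "is_sol q S S'" unfolding S_def S'_def q_def by (rule fam_is_sol)
  have su: "is_sol q u u'" unfolding u_def u'_def q_def by (rule weyl_is_sol[OF \<alpha>])
  have dec: "decaying u u'" unfolding u_def u'_def by (rule weyl_decaying[OF \<alpha> reg])
  define W where "W = energy_flux \<omega> S S' x"
  define V where "V = - energy_flux \<omega> u u' x"
  define P where "P = norm (S x) * norm (u x)"
  have sr: "sqrt r > 0" using r by simp
  have S0: "S 0 = 0" "S' 0 = 1" by (simp_all add: S_def S'_def fam_0)
  have cont: "continuous_on {0..} (\<lambda>s. c * (norm (S' s))\<^sup>2 + c * r * (norm (S s))\<^sup>2)" by (rule weighted_energy_continuous[OF sS])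
  have W: "integral {0..x} (\<lambda>s. c * (norm (S' s))\<^sup>2 + c * r * (norm (S s))\<^sup>2) \<le> W"
    using energy_inequality[OF sS order_refl x c(2), of "c * r"] good by (simp add: W_def q_def energy_flux_def S0)
  have V: "integral {x..b} (\<lambda>s. c * (norm (u' s))\<^sup>2 + c * r * (norm (u s))\<^sup>2) \<le> V" if "b \<ge> x" for b
    unfolding V_def by (rule decaying_energy_bound[OF su dec]) (use c r x good that in \<open>auto simp: q_def\<close>)
  have comb: "W * (norm (u x))\<^sup>2 + V * (norm (S x))\<^sup>2 \<le> norm \<omega> * P"
  proof -
    have wr: "u x * S' x - u' x * S x = 1"
      using wronskian_constant[OF su sS x] by (simp add: S0 u_def u'_def weyl_initial[OF \<alpha>])
    have 1: "W * (norm (u x))\<^sup>2 = Re (cnj \<omega> * S' x * cnj (S x) * (u x * cnj (u x)))"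
      by (simp only: W_def energy_flux_def complex_norm_square[symmetric] Re_times_of_real)
    have 2: "V * (norm (S x))\<^sup>2 = - Re (cnj \<omega> * u' x * cnj (u x) * (S x * cnj (S x)))"
      by (simp only: V_def energy_flux_def complex_norm_square[symmetric] Re_times_of_real minus_mult_left)
    have "W * (norm (u x))\<^sup>2 + V * (norm (S x))\<^sup>2 = Re (cnj \<omega> * cnj (S x) * cnj (u x) * (u x * S' x - u' x * S x))"
      unfolding 1 2 minus_complex.simps(1)[symmetric] add_uminus_conv_diff by (simp add: algebra_simps del: minus_complex.simps)
    also have "\<dots> = Re (cnj \<omega> * cnj (S x) * cnj (u x))" unfolding wr by simp
    also have "\<dots> \<le> norm (cnj \<omega> * cnj (S x) * cnj (u x))" by (rule complex_Re_le_cmod)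
    also have "\<dots> = norm \<omega> * P" by (simp add: norm_mult P_def)
    finally show ?thesis .
  qed
  have V0: "V \<ge> 0"
  proof -
    have "0 \<le> integral {x..x} (\<lambda>s. c * (norm (u' s))\<^sup>2 + c * r * (norm (u s))\<^sup>2)" by simp
    then show ?thesis using V[of x] by linarith
  qed
  \<comment> \<open>The derivative of |S|^2 is at most the energy density over c sqrt r and S
    vanishes at 0, so the value at x is controlled by the flux there.\<close>
  have Ssq: "(norm (S x))\<^sup>2 \<le> W / (c * sqrt r)"
  proof -
    have I: "((\<lambda>s. 2 * Re (S' s * cnj (S s))) has_integral (norm (S x))\<^sup>2 - (norm (S 0))\<^sup>2) {0..x}"
    proof (rule fundamental_theorem_of_calculus[OF x])
      fix s assume "s \<in> {0..x}"
      then have "((\<lambda>s. (norm (S s))\<^sup>2) has_real_derivative 2 * Re (S' s * cnj (S s))) (at s within {0..})"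
        by (intro norm_square_has_derivative is_solD(1)[OF sS]) auto
      then show "((\<lambda>s. (norm (S s))\<^sup>2) has_vector_derivative 2 * Re (S' s * cnj (S s))) (at s within {0..x})"
        unfolding has_real_derivative_iff_has_vector_derivative by (rule has_vector_derivative_within_subset) auto
    qed
    have "(norm (S x))\<^sup>2 \<le> integral {0..x} (\<lambda>s. 1 / (c * sqrt r) * (c * (norm (S' s))\<^sup>2 + c * r * (norm (S s))\<^sup>2))"
    proof (rule has_integral_le[OF _ integrable_integral])
      show "((\<lambda>s. 2 * Re (S' s * cnj (S s))) has_integral (norm (S x))\<^sup>2) {0..x}" using I by (simp add: S0)
      show "(\<lambda>s. 1 / (c * sqrt r) * (c * (norm (S' s))\<^sup>2 + c * r * (norm (S s))\<^sup>2)) integrable_on {0..x}"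
        by (rule integrable_on_mult_right[OF continuous_integrable_half_line[OF cont order_refl]])
      fix s
      have "2 * Re (S' s * cnj (S s)) \<le> 2 * (norm (S' s) * norm (S s))"
        using complex_Re_le_cmod[of "S' s * cnj (S s)"] by (simp add: norm_mult)
      also have "\<dots> \<le> ((norm (S' s))\<^sup>2 + (sqrt r)\<^sup>2 * (norm (S s))\<^sup>2) / sqrt r" by (rule two_mult_le_weighted[OF sr])
      also have "\<dots> = 1 / (c * sqrt r) * (c * (norm (S' s))\<^sup>2 + c * r * (norm (S s))\<^sup>2)" using c r by (simp add: field_simps)
      finally show "2 * Re (S' s * cnj (S s)) \<le> 1 / (c * sqrt r) * (c * (norm (S' s))\<^sup>2 + c * r * (norm (S s))\<^sup>2)" .
    qed
    also have "\<dots> = 1 / (c * sqrt r) * integral {0..x} (\<lambda>s. c * (norm (S' s))\<^sup>2 + c * r * (norm (S s))\<^sup>2)" by (rule integral_mult_right)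
    also have "\<dots> \<le> 1 / (c * sqrt r) * W" using W c sr by (intro mult_left_mono) auto
    finally show ?thesis by simp
  qed
  \<comment> \<open>A self-improving bound: P^2 = |S|^2 |u|^2 \<le> W |u|^2 / (c sqrt r), while W
    |u|^2 is at most |\<omega>| P; one factor P cancels.\<close>
  have P: "P \<le> norm \<omega> / (c * sqrt r)"
  proof (cases "P = 0")
    case True then show ?thesis using c sr by simp
  next
    case False
    have P0: "P > 0" using False by (simp add: P_def zero_less_mult_iff)
    have "P * P = (norm (S x))\<^sup>2 * (norm (u x))\<^sup>2" by (simp add: P_def power2_eq_square mult_ac)
    also have "\<dots> \<le> W / (c * sqrt r) * (norm (u x))\<^sup>2" using Ssq by (intro mult_right_mono) auto
    also have "\<dots> = (W * (norm (u x))\<^sup>2) / (c * sqrt r)" by simp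
    also have "\<dots> \<le> (norm \<omega> * P) / (c * sqrt r)"
    proof (rule divide_right_mono)
      have "0 \<le> V * (norm (S x))\<^sup>2" using V0 by simp
      then show "W * (norm (u x))\<^sup>2 \<le> norm \<omega> * P" using comb by linarith
    qed (use c sr in simp)
    finally have "P * P \<le> norm \<omega> / (c * sqrt r) * P" by simp
    then show ?thesis using P0 by (simp only: mult_le_cancel_right_pos)
  qed
  have A1: "integral {0..x} (\<lambda>s. (norm (S s))\<^sup>2) \<le> W / (c * r)"
  proof -
    have "c * r * integral {0..x} (\<lambda>s. (norm (S s))\<^sup>2) = integral {0..x} (\<lambda>s. c * r * (norm (S s))\<^sup>2)" by (rule integral_mult_right[symmetric])
    also have "\<dots> \<le> integral {0..x} (\<lambda>s. c * (norm (S' s))\<^sup>2 + c * r * (norm (S s))\<^sup>2)"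
      using c by (intro integral_le continuous_integrable_half_line continuous_intros is_sol_continuous[OF sS]) auto
    also have "\<dots> \<le> W" by (rule W)
    finally show ?thesis using c r by (simp add: pos_le_divide_eq mult.commute)
  qed
  have A2: "integral {x..b} (\<lambda>s. (norm (u s))\<^sup>2) \<le> V / (c * r)" if b: "b \<ge> x" for b
  proof -
    have "c * r * integral {x..b} (\<lambda>s. (norm (u s))\<^sup>2) = integral {x..b} (\<lambda>s. c * r * (norm (u s))\<^sup>2)" by (rule integral_mult_right[symmetric])
    also have "\<dots> \<le> integral {x..b} (\<lambda>s. c * (norm (u' s))\<^sup>2 + c * r * (norm (u s))\<^sup>2)"
      using c x by (intro integral_le continuous_integrable_half_line continuous_intros is_sol_continuous[OF su]) auto
    also have "\<dots> \<le> V" by (rule V[OF b])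
    finally show ?thesis using c r by (simp add: pos_le_divide_eq mult.commute)
  qed
  define b where "b = max N x"
  have contg: "continuous_on {0..} (\<lambda>t. (norm (green \<mu> x t))\<^sup>2)" by (intro continuous_intros green_continuous)
  have ci: "(\<lambda>t. (norm (green \<mu> x t))\<^sup>2) integrable_on {d..e}" if "d \<ge> 0" for d e by (rule continuous_integrable_half_line[OF contg that])
  have "integral {0..N} (\<lambda>t. (norm (green \<mu> x t))\<^sup>2) \<le> integral {0..b} (\<lambda>t. (norm (green \<mu> x t))\<^sup>2)"
    by (intro integral_subset_le ci) (auto simp: b_def)
  also have "\<dots> = integral {0..x} (\<lambda>t. (norm (green \<mu> x t))\<^sup>2) + integral {x..b} (\<lambda>t. (norm (green \<mu> x t))\<^sup>2)"
    by (rule Henstock_Kurzweil_Integration.integral_combine[symmetric]) (use x in \<open>auto simp: b_def intro: ci\<close>)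
  also have "integral {0..x} (\<lambda>t. (norm (green \<mu> x t))\<^sup>2) = integral {0..x} (\<lambda>t. (norm (u x))\<^sup>2 * (norm (S t))\<^sup>2)"
    by (rule Henstock_Kurzweil_Integration.integral_cong) (simp add: green_def S_def u_def norm_mult power_mult_distrib)
  also have "\<dots> = (norm (u x))\<^sup>2 * integral {0..x} (\<lambda>t. (norm (S t))\<^sup>2)" by (rule integral_mult_right)
  also have "integral {x..b} (\<lambda>t. (norm (green \<mu> x t))\<^sup>2) = integral {x..b} (\<lambda>t. (norm (S x))\<^sup>2 * (norm (u t))\<^sup>2)"
    by (rule Henstock_Kurzweil_Integration.integral_cong) (auto simp: green_def S_def u_def norm_mult power_mult_distrib)
  also have "\<dots> = (norm (S x))\<^sup>2 * integral {x..b} (\<lambda>t. (norm (u t))\<^sup>2)" by (rule integral_mult_right)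
  also have "(norm (u x))\<^sup>2 * integral {0..x} (\<lambda>t. (norm (S t))\<^sup>2) + (norm (S x))\<^sup>2 * integral {x..b} (\<lambda>t. (norm (u t))\<^sup>2)
      \<le> (norm (u x))\<^sup>2 * (W / (c * r)) + (norm (S x))\<^sup>2 * (V / (c * r))"
    using A1 A2[of b] by (intro add_mono mult_left_mono) (auto simp: b_def)
  also have "\<dots> = (W * (norm (u x))\<^sup>2 + V * (norm (S x))\<^sup>2) / (c * r)" by (simp add: add_divide_distrib mult.commute)
  also have "\<dots> \<le> (norm \<omega> * (norm \<omega> / (c * sqrt r))) / (c * r)"
  proof (rule divide_right_mono)
    have "norm \<omega> * P \<le> norm \<omega> * (norm \<omega> / (c * sqrt r))" using P by (rule mult_left_mono) simp
    then show "W * (norm (u x))\<^sup>2 + V * (norm (S x))\<^sup>2 \<le> norm \<omega> * (norm \<omega> / (c * sqrt r))" using comb by linarith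
  qed (use c r in simp)
  also have "\<dots> = (norm \<omega>)\<^sup>2 / (c\<^sup>2 * (r * sqrt r))" by (simp add: power2_eq_square mult_ac)
  finally show ?thesis .
qed

text \<open>On a fixed interval the weight k = |\<mu>|^(1/2) gives growth of order 1/2; the factor
  |\<mu>| in the initial energy cancels against the weight of |v|^2.\<close>

lemma fam_growth:
  assumes \<mu>: "norm \<mu> \<ge> 1" and t: "0 \<le> t" "t \<le> x" and ab: "norm a \<le> 1" "norm b \<le> 1"
  shows "(norm (fam \<alpha> \<mu> a b t))\<^sup>2 \<le> 2 * exp ((2 + x powr \<alpha>) * x * sqrt (norm \<mu>))"
proof -
  define n where "n = norm \<mu>"
  have n: "n \<ge> 1" using \<mu> by (simp add: n_def)
  define v where "v = fam \<alpha> \<mu> a b"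
  define w where "w = dsol (pot \<alpha> 0 \<mu> 0) a b"
  define Q where "Q = x powr \<alpha> + n"
  have sol: "is_sol (pot \<alpha> 0 \<mu> 0) v w" unfolding v_def w_def by (rule fam_is_sol)
  have sn: "sqrt n \<ge> 1" using n by simp
  have "(norm (w t))\<^sup>2 + (sqrt n)\<^sup>2 * (norm (v t))\<^sup>2 \<le>
      ((norm (w 0))\<^sup>2 + (sqrt n)\<^sup>2 * (norm (v 0))\<^sup>2) * exp (((sqrt n)\<^sup>2 + Q) / sqrt n * (t - 0))"
  proof (rule is_sol_growth[OF sol order_refl t(1)])
    fix s assume s: "0 \<le> s" "s \<le> t"
    then have "s powr \<alpha> \<le> x powr \<alpha>" using t \<alpha> by (intro powr_mono2) auto
    then show "norm (pot \<alpha> 0 \<mu> 0 s) \<le> Q" using norm_pot_zero_le[OF \<alpha> s(1), of \<mu>] by (simp add: Q_def n_def)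
  qed (use n in auto)
  also have "\<dots> \<le> (2 * n) * exp ((2 + x powr \<alpha>) * x * sqrt n)"
  proof (rule mult_mono)
    have "(norm b)\<^sup>2 \<le> 1" "(norm a)\<^sup>2 \<le> 1" using ab by (auto simp: power_le_one)
    then have "(norm b)\<^sup>2 + n * (norm a)\<^sup>2 \<le> n + n * 1" using n by (intro add_mono mult_left_mono) auto
    then show "(norm (w 0))\<^sup>2 + (sqrt n)\<^sup>2 * (norm (v 0))\<^sup>2 \<le> 2 * n"
      using n by (simp add: v_def w_def fam_0)
    have "Q \<le> (x powr \<alpha> + 1) * n" using mult_right_mono[of 1 n "x powr \<alpha>"] n by (simp add: Q_def algebra_simps)
    then have "((sqrt n)\<^sup>2 + Q) / sqrt n \<le> ((2 + x powr \<alpha>) * n) / sqrt n"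
      using n by (intro divide_right_mono) (auto simp: algebra_simps)
    also have "\<dots> = (2 + x powr \<alpha>) * sqrt n" using n by (simp add: real_div_sqrt flip: times_divide_eq_right)
    finally have "((sqrt n)\<^sup>2 + Q) / sqrt n * (t - 0) \<le> (2 + x powr \<alpha>) * sqrt n * x"
      using t n by (intro mult_mono) auto
    then show "exp (((sqrt n)\<^sup>2 + Q) / sqrt n * (t - 0)) \<le> exp ((2 + x powr \<alpha>) * x * sqrt n)"
      by (simp add: mult_ac)
  qed (use n in auto)
  finally have "(norm (w t))\<^sup>2 + (sqrt n)\<^sup>2 * (norm (v t))\<^sup>2 \<le> n * (2 * exp ((2 + x powr \<alpha>) * x * sqrt n))"
    by (simp only: mult_ac)
  then have "n * (norm (v t))\<^sup>2 \<le> n * (2 * exp ((2 + x powr \<alpha>) * x * sqrt n))"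
    by (rule order_trans[rotated]) (use n in simp)
  then have "(norm (v t))\<^sup>2 \<le> 2 * exp ((2 + x powr \<alpha>) * x * sqrt n)"
    by (rule mult_left_le_imp_le) (use n in simp)
  then show ?thesis by (simp add: v_def n_def)
qed

text \<open>Order 1/2 is so low that a sector of opening 7 pi/8 enclosing the first quadrant is
  harmless; bounds on rays outside the quadrant therefore suffice for every \<alpha> > 0.\<close>

theorem cauchy_kernel_orthogonal:
  assumes f: "f \<in> L2 half_line" and orth: "\<And>\<mu>. regular \<alpha> \<mu> \<Longrightarrow> (\<integral>t. f t * weyl_u \<alpha> \<mu> t \<partial>half_line) = 0"
    and x: "x \<ge> 0"
  shows "cauchy_kernel \<mu> x \<in> L2 half_line" "(\<integral>t. f t * cauchy_kernel \<mu> x t \<partial>half_line) = 0"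
proof -
  define F2 where "F2 = (\<integral>t. (norm (f t))\<^sup>2 \<partial>half_line)"
  have F2: "F2 \<ge> 0" by (simp add: F2_def)
  note fm = L2_D[OF f]
  define w where "w \<mu> = (\<integral>t. f t * cauchy_kernel \<mu> x t \<partial>half_line)" for \<mu>
  have kseg: "integral {0..N} (\<lambda>t. (norm (cauchy_kernel \<mu> x t))\<^sup>2) \<le> x * B"
    if B: "\<And>t. 0 \<le> t \<Longrightarrow> t \<le> x \<Longrightarrow> (norm (cauchy_kernel \<mu> x t))\<^sup>2 \<le> B" and N: "N \<ge> 0" for \<mu> N B
  proof -
    have cont: "continuous_on {0..} (\<lambda>t. (norm (cauchy_kernel \<mu> x t))\<^sup>2)" by (intro continuous_intros cauchy_kernel_continuous)
    define b where "b = max N x"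
    have "integral {0..N} (\<lambda>t. (norm (cauchy_kernel \<mu> x t))\<^sup>2) \<le> integral {0..b} (\<lambda>t. (norm (cauchy_kernel \<mu> x t))\<^sup>2)"
      by (intro integral_subset_le continuous_integrable_half_line[OF cont]) (auto simp: b_def)
    also have "\<dots> = integral {0..x} (\<lambda>t. (norm (cauchy_kernel \<mu> x t))\<^sup>2) + integral {x..b} (\<lambda>t. (norm (cauchy_kernel \<mu> x t))\<^sup>2)"
      by (rule Henstock_Kurzweil_Integration.integral_combine[symmetric])
         (use x in \<open>auto simp: b_def intro: continuous_integrable_half_line[OF cont]\<close>)
    also have "integral {x..b} (\<lambda>t. (norm (cauchy_kernel \<mu> x t))\<^sup>2) = integral {x..b} (\<lambda>t. 0)"
      by (rule Henstock_Kurzweil_Integration.integral_cong) (auto simp: cauchy_kernel_def)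
    also have "integral {0..x} (\<lambda>t. (norm (cauchy_kernel \<mu> x t))\<^sup>2) \<le> integral {0..x} (\<lambda>t. B)"
      by (rule integral_le[OF continuous_integrable_half_line[OF cont order_refl] integrable_const_ivl]) (use B in auto)
    finally show ?thesis using x by (simp add: mult.commute)
  qed
  have kbd: "\<exists>B. \<forall>\<mu>\<in>ball 0 L. \<forall>t. 0 \<le> t \<longrightarrow> t \<le> x \<longrightarrow> norm (cauchy_kernel \<mu> x t) \<le> B" for L
  proof -
    obtain C0 where C0: "\<forall>\<mu>\<in>ball 0 L. \<forall>t. 0 \<le> t \<longrightarrow> t \<le> x \<longrightarrow> norm (cosol \<mu> t) \<le> C0" using fam_holomorphic(2)[OF \<alpha> x] by blast
    obtain C1 where C1: "\<forall>\<mu>\<in>ball 0 L. \<forall>t. 0 \<le> t \<longrightarrow> t \<le> x \<longrightarrow> norm (sisol \<mu> t) \<le> C1" using fam_holomorphic(2)[OF \<alpha> x] by blast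
    have "norm (cauchy_kernel \<mu> x t) \<le> C1 * C0 + C0 * C1" if \<mu>: "\<mu> \<in> ball 0 L" and t: "0 \<le> t" "t \<le> x" for \<mu> t
    proof -
      have "norm (cauchy_kernel \<mu> x t) \<le> norm (sisol \<mu> x) * norm (cosol \<mu> t) + norm (cosol \<mu> x) * norm (sisol \<mu> t)"
        using t norm_triangle_ineq4[of "sisol \<mu> x * cosol \<mu> t" "cosol \<mu> x * sisol \<mu> t"] by (simp add: cauchy_kernel_def norm_mult)
      also have "\<dots> \<le> C1 * C0 + C0 * C1"
        using C0 C1 \<mu> t x order_trans[OF norm_ge_zero, of "cosol \<mu> t" C0] order_trans[OF norm_ge_zero, of "sisol \<mu> t" C1]
        by (intro add_mono mult_mono) auto
      finally show ?thesis .
    qed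
    then show ?thesis by blast
  qed
  have kL2: "cauchy_kernel \<mu> x \<in> L2 half_line" for \<mu>
  proof -
    obtain B where B: "\<forall>t. 0 \<le> t \<longrightarrow> t \<le> x \<longrightarrow> norm (cauchy_kernel \<mu> x t) \<le> B" using kbd[of "norm \<mu> + 1"] by force
    show ?thesis
    proof (rule L2_half_lineI(1)[OF cauchy_kernel_continuous kseg])
      show "(norm (cauchy_kernel \<mu> x t))\<^sup>2 \<le> B\<^sup>2" if "0 \<le> t" "t \<le> x" for t
        using B that by (intro power_mono) auto
    qed
  qed
  then show "cauchy_kernel \<mu> x \<in> L2 half_line" .
  have fk: "integrable half_line (\<lambda>t. f t * cauchy_kernel \<mu> x t)" for \<mu> by (rule L2_pairing(1)[OF f kL2])
  have hol: "w holomorphic_on UNIV"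
  proof -
    have "w holomorphic_on ball 0 L" for L
    proof -
      obtain B where B: "\<And>\<mu> t. \<mu> \<in> ball 0 L \<Longrightarrow> 0 \<le> t \<Longrightarrow> t \<le> x \<Longrightarrow> norm (cauchy_kernel \<mu> x t) \<le> B" using kbd[of L] by blast
      define g where "g t = \<bar>B\<bar> * (indicator {0..x} t + (norm (f t))\<^sup>2)" for t
      have gi: "integrable half_line g" unfolding g_def
      proof (intro integrable_mult_right Bochner_Integration.integrable_add fm)
        show "integrable half_line (indicator {0..x} :: real \<Rightarrow> real)"
          by (rule integrable_real_indicator) (use x in \<open>auto simp: sets_restrict_space_iff emeasure_restrict_space\<close>)
      qed
      show ?thesis unfolding w_def
      proof (rule holomorphic_on_integral[OF open_ball borel_measurable_integrable[OF fk] _ gi])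
        show "(\<lambda>\<mu>. f t * cauchy_kernel \<mu> x t) holomorphic_on ball 0 L" if "t \<in> space half_line" for t
        proof (cases "t \<le> x")
          case True
          have t: "t \<ge> 0" using that by simp
          show ?thesis using True unfolding cauchy_kernel_def
            by (simp only: if_True) (intro holomorphic_intros fam_holomorphic(1)[OF \<alpha> t] fam_holomorphic(1)[OF \<alpha> x])
        next
          case False
          then show ?thesis by (simp add: cauchy_kernel_def)
        qed
        show "norm (f t * cauchy_kernel \<mu> x t) \<le> g t" if "t \<in> space half_line" "\<mu> \<in> ball 0 L" for t \<mu>
        proof (cases "t \<le> x")
          case True
          have t: "t \<ge> 0" using that by simp
          have "norm (f t) \<le> (1 * (norm (f t))\<^sup>2 + 1 / 1) / 2" by (rule le_weighted_square) simp
          also have "\<dots> \<le> 1 + (norm (f t))\<^sup>2" by simp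
          finally have "norm (f t) * norm (cauchy_kernel \<mu> x t) \<le> (1 + (norm (f t))\<^sup>2) * \<bar>B\<bar>"
            using B[OF that(2) t True] by (intro mult_mono) auto
          then show ?thesis using True t by (simp add: g_def norm_mult mult.commute)
        next
          case False
          then show ?thesis by (simp add: cauchy_kernel_def g_def)
        qed
      qed
    qed
    then have "w field_differentiable at \<mu>" for \<mu>
      using holomorphic_on_imp_differentiable_at[of w "ball 0 (norm \<mu> + 1)" \<mu>] by simp
    then show ?thesis by (simp add: holomorphic_on_def)
  qed
  have growth: "norm (w \<mu>) \<le> (F2 + 8 * x) * exp ((2 * ((2 + x powr \<alpha>) * x)) * norm \<mu> powr (1 / 2))" if \<mu>: "norm \<mu> \<ge> 1" for \<mu>
  proof -
    define E where "E = exp ((2 + x powr \<alpha>) * x * sqrt (norm \<mu>))"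
    have E: "E \<ge> 1" using x by (simp add: E_def)
    have B: "(norm (cauchy_kernel \<mu> x t))\<^sup>2 \<le> 16 * E\<^sup>2" if t: "0 \<le> t" "t \<le> x" for t
    proof -
      have a: "(norm (cosol \<mu> t))\<^sup>2 \<le> 2 * E" "(norm (sisol \<mu> t))\<^sup>2 \<le> 2 * E" "(norm (cosol \<mu> x))\<^sup>2 \<le> 2 * E" "(norm (sisol \<mu> x))\<^sup>2 \<le> 2 * E"
        unfolding E_def using fam_growth[OF \<mu>] t x by auto
      have "norm (cauchy_kernel \<mu> x t) = norm (sisol \<mu> x * cosol \<mu> t - cosol \<mu> x * sisol \<mu> t)" using t by (simp add: cauchy_kernel_def)
      then have "(norm (cauchy_kernel \<mu> x t))\<^sup>2 \<le> 2 * (norm (sisol \<mu> x * cosol \<mu> t))\<^sup>2 + 2 * (norm (cosol \<mu> x * sisol \<mu> t))\<^sup>2"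
        using power_mono[OF norm_triangle_ineq4[of "sisol \<mu> x * cosol \<mu> t" "cosol \<mu> x * sisol \<mu> t"] norm_ge_zero, of 2]
          sum_squares_bound[of "norm (sisol \<mu> x * cosol \<mu> t)" "norm (cosol \<mu> x * sisol \<mu> t)"]
        by (simp only: power2_sum)
      also have "\<dots> = 2 * ((norm (sisol \<mu> x))\<^sup>2 * (norm (cosol \<mu> t))\<^sup>2) + 2 * ((norm (cosol \<mu> x))\<^sup>2 * (norm (sisol \<mu> t))\<^sup>2)"
        by (simp add: norm_mult power_mult_distrib)
      also have "\<dots> \<le> 2 * ((2 * E) * (2 * E)) + 2 * ((2 * E) * (2 * E))"
        using a E by (intro add_mono mult_left_mono mult_mono) auto
      finally show ?thesis by (simp add: power2_eq_square)
    qed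
    have "norm (w \<mu>) \<le> (1 * F2 + (\<integral>t. (norm (cauchy_kernel \<mu> x t))\<^sup>2 \<partial>half_line) / 1) / 2"
      unfolding w_def F2_def by (rule L2_pairing(2)[OF f kL2]) simp
    also have "\<dots> \<le> (F2 + x * (16 * E\<^sup>2)) / 2"
      using L2_half_lineI(2)[OF cauchy_kernel_continuous kseg[OF B]] by simp
    also have "\<dots> \<le> (F2 + 8 * x) * E\<^sup>2"
    proof -
      have "1 \<le> E\<^sup>2" using E by (simp add: one_le_power)
      then have "F2 * 1 \<le> F2 * E\<^sup>2" using F2 by (intro mult_left_mono) auto
      moreover have "(F2 + x * (16 * E\<^sup>2)) / 2 = F2 / 2 + 8 * x * E\<^sup>2" by simp
      moreover have "(F2 + 8 * x) * E\<^sup>2 = F2 * E\<^sup>2 + 8 * x * E\<^sup>2" by (simp add: distrib_right)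
      ultimately show ?thesis using F2 by linarith
    qed
    also have "E\<^sup>2 = exp ((2 * ((2 + x powr \<alpha>) * x)) * norm \<mu> powr (1 / 2))"
      by (simp add: E_def powr_half_sqrt flip: exp_of_nat_mult)
    finally show ?thesis .
  qed
  have outer: "\<exists>K. \<forall>r\<ge>1. norm (w (of_real r * cis a)) \<le> K / sqrt r" if a: "cos a < 0 \<or> sin a < 0" for a
  proof -
    have "\<exists>\<omega>. Re \<omega> > 0 \<and> Im \<omega> \<ge> 0 \<and> Re (cnj \<omega> * (- cis a)) > 0"
      by (rule outer_ray_multiplier[OF a])
    then obtain \<omega> where \<omega>: "Re \<omega> > 0" "Im \<omega> \<ge> 0" "Re (cnj \<omega> * (- cis a)) > 0" by blast
    obtain K0 where reg: "\<And>r. r \<ge> 1 \<Longrightarrow> regular \<alpha> (of_real r * cis a)"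
      using outer_ray[OF \<alpha> a] by metis
    define c where "c = min (Re \<omega>) (Re (cnj \<omega> * (- cis a)))"
    have c: "c > 0" "c \<le> Re \<omega>" "c \<le> Re (cnj \<omega> * (- cis a))" unfolding c_def using \<omega> by linarith+
    define A where "A = (norm \<omega>)\<^sup>2 / c\<^sup>2"
    have "norm (w (of_real r * cis a)) \<le> ((F2 + A) / 2) / sqrt r" if r: "r \<ge> 1" for r
    proof -
      define \<mu> where "\<mu> = of_real r * cis a"
      have sr: "sqrt r > 0" using r by simp
      have good: "c * r \<le> Re (cnj \<omega> * pot \<alpha> 0 \<mu> 0 s)" if s: "s \<ge> 0" for s
      proof -
        have "cnj \<omega> * pot \<alpha> 0 \<mu> 0 s = cnj \<omega> * \<i> * of_real (s powr \<alpha>) + of_real r * (cnj \<omega> * (- cis a))"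
          by (simp add: pot_zero[OF \<alpha> s] \<mu>_def algebra_simps)
        then have "Re (cnj \<omega> * pot \<alpha> 0 \<mu> 0 s) = Re (cnj \<omega> * \<i> * of_real (s powr \<alpha>)) + r * Re (cnj \<omega> * (- cis a))"
          by (simp only: plus_complex.simps Re_complex_of_real Im_complex_of_real times_complex.simps mult_zero_left diff_zero)
        moreover have "Re (cnj \<omega> * \<i> * of_real (s powr \<alpha>)) = Im \<omega> * s powr \<alpha>" by simp
        moreover have "Im \<omega> * s powr \<alpha> \<ge> 0" using \<omega> by simp
        moreover have "r * c \<le> r * Re (cnj \<omega> * (- cis a))" using c r by (intro mult_left_mono) auto
        ultimately show ?thesis by (simp only: mult.commute[of c r])
      qed
      have regm: "regular \<alpha> \<mu>" unfolding \<mu>_def by (rule reg[OF r])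
      have gn: "integral {0..N} (\<lambda>t. (norm (green \<mu> x t))\<^sup>2) \<le> A / (r * sqrt r)" if "N \<ge> 0" for N
        using green_norm[OF regm c(1,2) _ good x that] r by (simp add: A_def)
      note g = L2_half_lineI[OF green_continuous gn]
      have "w \<mu> = (\<integral>t. sisol \<mu> x * (f t * weyl_u \<alpha> \<mu> t) - f t * green \<mu> x t \<partial>half_line)"
        unfolding w_def
        by (rule Bochner_Integration.integral_cong) (simp_all add: cauchy_kernel_green[OF x] algebra_simps)
      also have "\<dots> = sisol \<mu> x * (\<integral>t. f t * weyl_u \<alpha> \<mu> t \<partial>half_line) - (\<integral>t. f t * green \<mu> x t \<partial>half_line)"
        using L2_pairing(1)[OF f weyl_u_L2[OF \<alpha> regm]] L2_pairing(1)[OF f g(1)] by simp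
      also have "\<dots> = - (\<integral>t. f t * green \<mu> x t \<partial>half_line)" using orth[OF regm] by simp
      finally have "norm (w \<mu>) = norm (\<integral>t. f t * green \<mu> x t \<partial>half_line)" by simp
      \<comment> \<open>The squared norm of the Green function is of size r^(-3/2); the weight
        r^(-1/2) leaves terms of size r^(-1/2) and r^(-1).\<close>
      also have "\<dots> \<le> (1 / sqrt r * F2 + (\<integral>t. (norm (green \<mu> x t))\<^sup>2 \<partial>half_line) / (1 / sqrt r)) / 2"
        unfolding F2_def by (rule L2_pairing(2)[OF f g(1) divide_pos_pos[OF zero_less_one sr]])
      also have "\<dots> \<le> (1 / sqrt r * F2 + (A / (r * sqrt r)) / (1 / sqrt r)) / 2"
        using g(2) sr by (intro divide_right_mono add_left_mono) auto
      also have "(A / (r * sqrt r)) / (1 / sqrt r) = A / r" using sr by simp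
      also have "(1 / sqrt r * F2 + A / r) / 2 \<le> (1 / sqrt r * F2 + A / sqrt r) / 2"
      proof (intro divide_right_mono add_left_mono divide_left_mono)
        have "sqrt r * 1 \<le> sqrt r * sqrt r" using r by (intro mult_left_mono) auto
        then show "sqrt r \<le> r" using r by simp
      qed (use r in \<open>auto simp: A_def\<close>)
      also have "\<dots> = ((F2 + A) / 2) / sqrt r" by (simp add: add_divide_distrib)
      finally show ?thesis by (simp add: \<mu>_def)
    qed
    then show ?thesis by blast
  qed
  have outer0: "\<exists>B. \<forall>r\<ge>1. norm (w (of_real r * cis a)) \<le> B * r ^ 0" if a: "cos a < 0 \<or> sin a < 0" for a
  proof -
    obtain K where K: "\<forall>r\<ge>1. norm (w (of_real r * cis a)) \<le> K / sqrt r" using outer[OF a] by blast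
    have "norm (w (of_real r * cis a)) \<le> \<bar>K\<bar> * r ^ 0" if r: "r \<ge> 1" for r
    proof -
      have "K / sqrt r \<le> \<bar>K\<bar> / 1" using r by (intro frac_le) auto
      then show ?thesis using K r by (auto intro: order_trans)
    qed
    then show ?thesis by blast
  qed
  define ray :: "nat \<Rightarrow> real" where "ray i = [- pi / 8, 3 * pi / 4, 5 * pi / 4, 15 * pi / 8] ! i" for i
  have rayv: "ray 0 = - pi / 8" "ray (Suc 0) = 3 * pi / 4" "ray (Suc (Suc 0)) = 5 * pi / 4" "ray (Suc (Suc (Suc 0))) = 15 * pi / 8"
    by (simp_all add: ray_def)
  show "(\<integral>t. f t * cauchy_kernel \<mu> x t \<partial>half_line) = 0"
    unfolding w_def[symmetric]
  proof (rule phragmen_lindelof_rays[OF hol, of "1 / 2" "2 * ((2 + x powr \<alpha>) * x)" "F2 + 8 * x" 3 ray 0 "-1"])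
    show "0 \<le> 2 * ((2 + x powr \<alpha>) * x)" using x by simp
    show "norm (w z) \<le> (F2 + 8 * x) * exp (2 * ((2 + x powr \<alpha>) * x) * norm z powr (1 / 2))" if "1 \<le> norm z" for z
      using growth[OF that] .
    fix i :: nat assume "i < 3"
    then have "i = 0 \<or> i = Suc 0 \<or> i = Suc (Suc 0)" by auto
    then show "ray i < ray (Suc i) \<and> ray (Suc i) - ray i < pi \<and> 1 / 2 * (ray (Suc i) - ray i) < pi"
      by (elim disjE) (simp_all add: rayv, (use pi_gt_zero in linarith))
  next
    show "ray 3 = ray 0 + 2 * pi" by (simp add: ray_def)
  next
    fix i :: nat assume "i \<le> 3"
    then have i: "i = 0 \<or> i = Suc 0 \<or> i = Suc (Suc 0) \<or> i = Suc (Suc (Suc 0))" by auto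
    have neg: "sin t < 0" if "pi < t" "t < 2 * pi" for t :: real
      using that sin_lt_zero by blast
    have c34: "cos (3 * pi / 4) < 0" using cos_monotone_0_pi[of "pi / 2" "3 * pi / 4"] by simp
    have s8: "sin (pi / 8) > 0" by (intro sin_gt_zero) auto
    show "\<exists>B. \<forall>r\<ge>1. norm (w (of_real r * cis (ray i))) \<le> B * r ^ 0"
      using i
    proof (elim disjE)
      assume "i = 0" then show ?thesis using outer0[of "- (pi / 8)"] s8 by (simp add: rayv)
    next
      assume "i = Suc 0" then show ?thesis using outer0[of "3 * pi / 4"] c34 by (simp add: rayv)
    next
      assume "i = Suc (Suc 0)" then show ?thesis using outer0[of "5 * pi / 4"] neg[of "5 * pi / 4"] by (simp add: rayv)
    next
      assume "i = Suc (Suc (Suc 0))" then show ?thesis using outer0[of "15 * pi / 8"] neg[of "15 * pi / 8"] by (simp add: rayv)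
    qed
  next
    obtain K where K: "\<forall>r\<ge>1. norm (w (of_real r * cis pi)) \<le> K / sqrt r" using outer[of pi] by auto
    have "norm (w (of_real (real (Suc k)) * - 1)) \<le> K / sqrt (real (Suc k))" for k
      using K[rule_format, of "real (Suc k)"] by simp
    moreover have "(\<lambda>k. K / sqrt (real (Suc k))) \<longlonglongrightarrow> 0"
      by (intro tendsto_divide_0[OF tendsto_const] filterlim_at_top_imp_at_infinity
          filterlim_compose[OF sqrt_at_top] filterlim_compose[OF filterlim_real_sequentially filterlim_Suc])
    ultimately show "(\<lambda>k. w (of_real (real (Suc k)) * - 1)) \<longlonglongrightarrow> 0"
      by (rule Lim_null_comparison[OF always_eventually[OF allI]])
  qed auto
qed

end

section \<open>Vanishing of a function orthogonal to the Cauchy kernel\<close>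

lemma is_sol_lipschitz:
  assumes sol: "is_sol q v w"
  obtains L where "L \<ge> 0" "\<And>s t. 0 \<le> s \<Longrightarrow> s \<le> t \<Longrightarrow> t \<le> N \<Longrightarrow> norm (v t - v s) \<le> L * (t - s)"
proof -
  obtain L where L: "\<And>s. 0 \<le> s \<Longrightarrow> s \<le> N \<Longrightarrow> norm (w s) \<le> L"
    using picard_bounded_on[OF is_sol_continuous(2)[OF sol]] by blast
  have "norm (v t - v s) \<le> \<bar>L\<bar> * (t - s)" if st: "0 \<le> s" "s \<le> t" "t \<le> N" for s t
  proof -
    have "(w has_integral v t - v s) {s..t}"
      by (rule fundamental_theorem_of_calculus[OF st(2)])
         (use st in \<open>auto intro!: has_vector_derivative_within_subset[OF is_solD(1)[OF sol]]\<close>)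
    then have "v t - v s = integral {s..t} w" by (simp add: integral_unique)
    also have "norm (integral {s..t} w) \<le> \<bar>L\<bar> * (t - s)"
      by (rule integral_bound[OF st(2)])
         (use st L in \<open>auto intro!: continuous_on_subset[OF is_sol_continuous(2)[OF sol]] order_trans[OF L]\<close>)
    finally show ?thesis .
  qed
  then show thesis using that[of "\<bar>L\<bar>"] by simp
qed

lemma L2_half_line_segment:
  assumes f: "f \<in> L2 half_line" and g: "continuous_on {0..} g" and N: "N \<ge> 0"
  shows "integrable (lebesgue_on {0..N}) (\<lambda>t. f t * g t)"
proof -
  have fm: "f \<in> borel_measurable (lebesgue_on {0..N})"
    by (rule measurable_restrict_mono[OF L2_D(1)[OF f]]) auto
  have "set_integrable lebesgue {0..} (\<lambda>t. (norm (f t))\<^sup>2)"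
    using L2_D(2)[OF f] by (simp add: integrable_restrict_space set_integrable_def)
  then have "set_integrable lebesgue {0..N} (\<lambda>t. (norm (f t))\<^sup>2)"
    by (rule set_integrable_subset) auto
  then have f2: "integrable (lebesgue_on {0..N}) (\<lambda>t. (norm (f t))\<^sup>2)"
    by (simp add: integrable_restrict_space set_integrable_def)
  obtain B where B: "\<And>s. 0 \<le> s \<Longrightarrow> s \<le> N \<Longrightarrow> norm (g s) \<le> B" using picard_bounded_on[OF g] by blast
  have "finite_measure (lebesgue_on {0..N})" by (rule finite_measure_lebesgue_on) simp
  then have c: "integrable (lebesgue_on {0..N}) (\<lambda>t. 1 + (norm (f t))\<^sup>2)"
    by (intro Bochner_Integration.integrable_add f2 finite_measure.integrable_const)
  show ?thesis
  proof (rule Bochner_Integration.integrable_bound[OF integrable_mult_right[OF c, of "\<bar>B\<bar>"]])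
    show "(\<lambda>t. f t * g t) \<in> borel_measurable (lebesgue_on {0..N})"
      by (intro borel_measurable_times fm continuous_borel_measurable_segment[OF g])
    show "AE t in lebesgue_on {0..N}. norm (f t * g t) \<le> norm (\<bar>B\<bar> * (1 + (norm (f t))\<^sup>2))"
    proof (rule AE_I2)
      fix t assume "t \<in> space (lebesgue_on {0..N})"
      then have t: "0 \<le> t" "t \<le> N" by auto
      have "norm (f t) \<le> (1 * (norm (f t))\<^sup>2 + 1 / 1) / 2" by (rule le_weighted_square) simp
      also have "\<dots> \<le> 1 + (norm (f t))\<^sup>2" by simp
      finally have "norm (f t) * norm (g t) \<le> (1 + (norm (f t))\<^sup>2) * \<bar>B\<bar>"
        using B[OF t] by (intro mult_mono) auto
      also have "\<dots> \<le> norm (\<bar>B\<bar> * (1 + (norm (f t))\<^sup>2))" by (simp add: mult.commute)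
      finally show "norm (f t * g t) \<le> norm (\<bar>B\<bar> * (1 + (norm (f t))\<^sup>2))" by (simp only: norm_mult)
    qed
  qed
qed

context
  fixes \<alpha> :: real
  assumes \<alpha>: "\<alpha> > 0"
begin

text \<open>The functions \<open>a\<close> and \<open>b\<close> are proportional to the two solutions with the same factor \<open>\<rho>\<close>; as
  the Cauchy kernel vanishes on the diagonal to first order only, \<open>\<rho>\<close> must be zero.\<close>

theorem cauchy_kernel_complete:
  assumes f: "f \<in> L2 half_line"
    and orth: "\<And>x. x \<ge> 0 \<Longrightarrow> (\<integral>t. f t * cauchy_kernel \<alpha> \<mu> x t \<partial>half_line) = 0"
  shows "AE t in half_line. f t = 0"
proof -
  define q where "q = pot \<alpha> 0 \<mu> 0"
  define C where "C = fam \<alpha> \<mu> 1 0"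
  define S where "S = fam \<alpha> \<mu> 0 1"
  define C' where "C' = dsol q 1 0"
  define S' where "S' = dsol q 0 1"
  have sC: "is_sol q C C'" unfolding C_def C'_def q_def by (rule fam_is_sol[OF \<alpha>])
  have sS: "is_sol q S S'" unfolding S_def S'_def q_def by (rule fam_is_sol[OF \<alpha>])
  have init: "C 0 = 1" "S 0 = 0" by (simp_all add: C_def S_def fam_0[OF \<alpha>])
  have init': "C' 0 = 0" "S' 0 = 1"
    using pot_zero_continuous[OF \<alpha> order_refl] by (simp_all add: C'_def S'_def q_def)
  have wr: "C s * S' s - C' s * S s = 1" if "s \<ge> 0" for s
    using wronskian_constant[OF sC sS that] by (simp add: init init')
  note cC = is_sol_continuous(1)[OF sC] and cS = is_sol_continuous(1)[OF sS]
  note iC = L2_half_line_segment[OF f cC] and iS = L2_half_line_segment[OF f cS]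
  define a where "a x = integral {0..x} (\<lambda>t. f t * C t)" for x
  define b where "b x = integral {0..x} (\<lambda>t. f t * S t)" for x
  have aL: "a x = (\<integral>t. f t * C t \<partial>lebesgue_on {0..x})" if "x \<ge> 0" for x
    unfolding a_def by (rule lebesgue_integral_eq_integral[OF iC[OF that], symmetric]) simp
  have bL: "b x = (\<integral>t. f t * S t \<partial>lebesgue_on {0..x})" if "x \<ge> 0" for x
    unfolding b_def by (rule lebesgue_integral_eq_integral[OF iS[OF that], symmetric]) simp
  have intC: "(\<lambda>t. f t * C t) integrable_on {y..x}" if "0 \<le> y" for x y
    proof (cases "y \<le> x")
    case True
    have "(\<lambda>t. f t * C t) integrable_on {0..x}"
      by (rule integrable_on_lebesgue_on[OF iC]) (use True that in auto)
    then show ?thesis by (rule integrable_on_subinterval) (use that in auto)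
  qed (simp add: integrable_on_empty)
  have intS: "(\<lambda>t. f t * S t) integrable_on {y..x}" if "0 \<le> y" for x y
    proof (cases "y \<le> x")
    case True
    have "(\<lambda>t. f t * S t) integrable_on {0..x}"
      by (rule integrable_on_lebesgue_on[OF iS]) (use True that in auto)
    then show ?thesis by (rule integrable_on_subinterval) (use that in auto)
  qed (simp add: integrable_on_empty)
  have rel: "S x * a x = C x * b x" if x: "x \<ge> 0" for x
  proof -
    have "0 = (\<integral>t. f t * cauchy_kernel \<alpha> \<mu> x t \<partial>half_line)" by (simp add: orth[OF x])
    also have "\<dots> = (\<integral>t. indicator {0..} t *\<^sub>R (f t * cauchy_kernel \<alpha> \<mu> x t) \<partial>lebesgue)"
      by (rule integral_restrict_space) simp
    also have "\<dots> = (\<integral>t. indicator {0..x} t *\<^sub>R (S x * (f t * C t) - C x * (f t * S t)) \<partial>lebesgue)"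
      by (rule Bochner_Integration.integral_cong)
         (auto simp: indicator_def cauchy_kernel_def[OF \<alpha>] S_def C_def algebra_simps)
    also have "\<dots> = (\<integral>t. S x * (f t * C t) - C x * (f t * S t) \<partial>lebesgue_on {0..x})"
      by (rule integral_restrict_space[symmetric]) simp
    also have "\<dots> = S x * a x - C x * b x"
      using iC[OF x] iS[OF x] by (simp add: aL[OF x] bL[OF x])
    finally show ?thesis by simp
  qed
  have ab0: "a y = 0 \<and> b y = 0" if y: "y \<ge> 0" for y
  proof -
    \<comment> \<open>The Wronskian identity C S' - C' S = 1 solves the relation S a = C b as (a, b)
      = \<rho> (C, S) at y.\<close>
    define \<rho> where "\<rho> = S' y * a y - C' y * b y"
    have "a y = (C y * S' y - C' y * S y) * a y" by (simp add: wr[OF y])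
    also have "\<dots> = C y * S' y * a y - C' y * (S y * a y)" by (simp add: algebra_simps)
    also have "\<dots> = C y * \<rho>" unfolding rel[OF y] \<rho>_def by (simp add: algebra_simps)
    finally have a: "a y = C y * \<rho>" .
    have "b y = (C y * S' y - C' y * S y) * b y" by (simp add: wr[OF y])
    also have "\<dots> = S' y * (C y * b y) - C' y * S y * b y" by (simp add: algebra_simps)
    also have "\<dots> = S y * \<rho>" unfolding rel[OF y, symmetric] \<rho>_def by (simp add: algebra_simps)
    finally have b: "b y = S y * \<rho>" .
    define \<kappa> where "\<kappa> x = S x * C y - C x * S y" for x
    have d\<kappa>: "(\<kappa> has_vector_derivative 1) (at y within {0..})"
    proof -
      have "(\<kappa> has_vector_derivative (S' y * C y - C' y * S y)) (at y within {0..})"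
        unfolding \<kappa>_def by (intro derivative_intros is_solD(1)[OF sS y] is_solD(1)[OF sC y])
      then show ?thesis using wr[OF y] by (simp add: mult.commute)
    qed
    obtain LC where LC: "LC \<ge> 0" "\<And>s t. 0 \<le> s \<Longrightarrow> s \<le> t \<Longrightarrow> t \<le> y + 1 \<Longrightarrow> norm (C t - C s) \<le> LC * (t - s)"
      using is_sol_lipschitz[OF sC] by blast
    obtain LS where LS: "LS \<ge> 0" "\<And>s t. 0 \<le> s \<Longrightarrow> s \<le> t \<Longrightarrow> t \<le> y + 1 \<Longrightarrow> norm (S t - S s) \<le> LS * (t - s)"
      using is_sol_lipschitz[OF sS] by blast
    obtain BC where BC: "\<And>s. 0 \<le> s \<Longrightarrow> s \<le> y + 1 \<Longrightarrow> norm (C s) \<le> BC" using picard_bounded_on[OF cC] by blast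
    obtain BS where BS: "\<And>s. 0 \<le> s \<Longrightarrow> s \<le> y + 1 \<Longrightarrow> norm (S s) \<le> BS" using picard_bounded_on[OF cS] by blast
    have BC0: "BC \<ge> 0" and BS0: "BS \<ge> 0" using y BC[of y] BS[of y] by (auto intro: order_trans[OF norm_ge_zero])
    define M where "M = LS * BC + LC * BS"
    have M0: "M \<ge> 0" using LS(1) LC(1) BC0 BS0 by (simp add: M_def)
    define G where "G x = integral {y..x} (\<lambda>t. norm (f t))" for x
    have f1: "integrable (lebesgue_on {0..N}) f" if "N \<ge> 0" for N
      using L2_half_line_segment[OF f continuous_on_const that, of 1] by simp
    have fn: "(\<lambda>t. norm (f t)) integrable_on {0..y + 1}"
      by (rule integrable_on_lebesgue_on[OF integrable_norm[OF f1]]) (use y in auto)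
    have fny: "(\<lambda>t. norm (f t)) integrable_on {y..x}" if "x \<le> y + 1" for x
      by (rule integrable_on_subinterval[OF fn]) (use that y in auto)
    have cG: "continuous_on {y..y + 1} G" unfolding G_def
      by (rule indefinite_integral_continuous_1[OF fny[OF order_refl]])
    \<comment> \<open>Splitting the relation at x into the parts over [0, y] and [y, x] expresses
      \<rho> \<kappa>(x) by the Cauchy kernel integrated against f over [y, x]. There the kernel is
      at most M (x - y), and \<kappa>(x) is of size x - y itself, so |\<rho>| is bounded by a
      multiple of G(x), which tends to 0 as x tends to y.\<close>
    have bound: "norm \<rho> * norm (\<kappa> x) \<le> M * (x - y) * G x" if x: "y < x" "x \<le> y + 1" for x
    proof -
      have x0: "x \<ge> 0" using x y by simp
      have ax: "a x = a y + integral {y..x} (\<lambda>t. f t * C t)" unfolding a_def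
        by (rule Henstock_Kurzweil_Integration.integral_combine[symmetric]) (use x y in \<open>auto intro!: intC\<close>)
      have bx: "b x = b y + integral {y..x} (\<lambda>t. f t * S t)" unfolding b_def
        by (rule Henstock_Kurzweil_Integration.integral_combine[symmetric]) (use x y in \<open>auto intro!: intS\<close>)
      have "\<rho> * \<kappa> x = S x * a y - C x * b y" by (simp add: a b \<kappa>_def algebra_simps)
      also have "\<dots> = - (S x * integral {y..x} (\<lambda>t. f t * C t) - C x * integral {y..x} (\<lambda>t. f t * S t))"
        using rel[OF x0] unfolding ax bx by (simp add: algebra_simps)
      also have "S x * integral {y..x} (\<lambda>t. f t * C t) - C x * integral {y..x} (\<lambda>t. f t * S t)
          = integral {y..x} (\<lambda>t. S x * (f t * C t) - C x * (f t * S t))"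
        by (simp add: Henstock_Kurzweil_Integration.integral_diff integrable_on_mult_right intC intS y)
      finally have "norm \<rho> * norm (\<kappa> x) = norm (integral {y..x} (\<lambda>t. S x * (f t * C t) - C x * (f t * S t)))"
        by (metis norm_minus_cancel norm_mult)
      also have "\<dots> \<le> integral {y..x} (\<lambda>t. M * (x - y) * norm (f t))"
      proof (rule integral_norm_bound_integral)
        show "(\<lambda>t. S x * (f t * C t) - C x * (f t * S t)) integrable_on {y..x}"
          by (intro integrable_diff integrable_on_mult_right intC intS y)
        show "(\<lambda>t. M * (x - y) * norm (f t)) integrable_on {y..x}"
          by (intro integrable_on_mult_right fny x)
        fix t assume t: "t \<in> {y..x}"
        have t0: "0 \<le> t" "t \<le> x" "t \<le> y + 1" using t x y by auto
        have "norm ((S x - S t) * C t - (C x - C t) * S t) \<le> norm (S x - S t) * norm (C t) + norm (C x - C t) * norm (S t)"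
          using norm_triangle_ineq4[of "(S x - S t) * C t" "(C x - C t) * S t"] by (simp only: norm_mult)
        also have "\<dots> \<le> (LS * (x - t)) * BC + (LC * (x - t)) * BS"
          using LS LC x t0 BC0 BS0 by (intro add_mono mult_mono BC BS) auto
        also have "\<dots> = M * (x - t)" by (simp add: M_def algebra_simps)
        also have "\<dots> \<le> M * (x - y)" using t M0 by (intro mult_left_mono) auto
        finally have k: "norm ((S x - S t) * C t - (C x - C t) * S t) \<le> M * (x - y)" .
        have "S x * (f t * C t) - C x * (f t * S t) = ((S x - S t) * C t - (C x - C t) * S t) * f t"
          by (simp add: algebra_simps)
        then show "norm (S x * (f t * C t) - C x * (f t * S t)) \<le> M * (x - y) * norm (f t)"
          using mult_right_mono[OF k norm_ge_zero] by (simp only: norm_mult)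
      qed
      also have "\<dots> = M * (x - y) * G x" by (simp add: G_def)
      finally show ?thesis .
    qed
    have "\<rho> = 0"
    proof (rule ccontr)
      assume "\<rho> \<noteq> 0"
      then have r: "norm \<rho> > 0" by simp
      obtain d where d: "d > 0" "\<And>x. x \<in> {0..} \<Longrightarrow> norm (x - y) < d \<Longrightarrow> norm (\<kappa> x - \<kappa> y - (x - y) *\<^sub>R 1) \<le> 1 / 2 * norm (x - y)"
        using d\<kappa> half_gt_zero[OF zero_less_one] unfolding has_vector_derivative_def has_derivative_within_alt by blast
      have "norm \<rho> / (2 * M + 1) > 0" using r M0 by simp
      then obtain d' where d': "d' > 0" "\<And>x. x \<in> {y..y + 1} \<Longrightarrow> dist x y < d' \<Longrightarrow> dist (G x) (G y) < norm \<rho> / (2 * M + 1)"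
        using cG unfolding continuous_on_iff by (meson atLeastAtMost_iff le_add_same_cancel1 order_refl zero_le_one)
      define x where "x = y + min 1 (min d d') / 2"
      have x: "y < x" "x \<le> y + 1" "x - y < d" "x - y < d'" using d(1) d'(1) by (auto simp: x_def)
      have "norm (\<kappa> x - of_real (x - y)) \<le> (x - y) / 2"
        using d(2)[of x] x y by (simp add: \<kappa>_def scaleR_conv_of_real)
      then have "(x - y) / 2 \<le> norm (\<kappa> x)"
        using norm_triangle_ineq2[of "of_real (x - y)" "of_real (x - y) - \<kappa> x"] x(1)
        by (simp add: norm_minus_commute del: of_real_diff)
      then have "norm \<rho> * ((x - y) / 2) \<le> norm \<rho> * norm (\<kappa> x)" by (intro mult_left_mono) auto
      also have "\<dots> \<le> M * (x - y) * G x" by (rule bound[OF x(1,2)])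
      finally have "norm \<rho> * (x - y) \<le> (2 * M * G x) * (x - y)" by (simp add: mult_ac)
      then have 1: "norm \<rho> \<le> 2 * M * G x" using x(1) by simp
      have "G y = 0" by (simp add: G_def)
      then have 2: "G x < norm \<rho> / (2 * M + 1)" using d'(2)[of x] x by (simp add: dist_real_def)
      have "2 * M * G x \<le> 2 * M * (norm \<rho> / (2 * M + 1))" using 2 M0 by (intro mult_left_mono) auto
      also have "\<dots> = norm \<rho> * (2 * M / (2 * M + 1))" by simp
      also have "\<dots> < norm \<rho> * 1" using r M0 by (intro mult_strict_left_mono) auto
      finally show False using 1 by simp
    qed
    then show ?thesis using a b by simp
  qed
  have "AE t in half_line. f t * C t = 0"
    by (rule AE_zero_of_interval_integrals[OF iC]) (use ab0 aL in auto)
  moreover have "AE t in half_line. f t * S t = 0"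
    by (rule AE_zero_of_interval_integrals[OF iS]) (use ab0 bL in auto)
  moreover have "AE t in half_line. t \<ge> 0" by (rule AE_I2) simp
  ultimately show ?thesis
  proof eventually_elim
    case (elim t)
    then show ?case using wr[of t] by auto
  qed
qed

end

section \<open>Completeness by duality\<close>

lemma L2_lincomb:
  assumes f: "f \<in> L2 M" and g: "g \<in> L2 M"
  shows "(\<lambda>x. c * f x + d * g x) \<in> L2 M"
proof -
  note fm = L2_D[OF f] and gm = L2_D[OF g]
  have m: "(\<lambda>x. c * f x + d * g x) \<in> borel_measurable M" using fm gm by (intro borel_measurable_add borel_measurable_times) auto
  have "integrable M (\<lambda>x. 2 * (norm c)\<^sup>2 * (norm (f x))\<^sup>2 + 2 * (norm d)\<^sup>2 * (norm (g x))\<^sup>2)"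
    using fm gm by (intro Bochner_Integration.integrable_add integrable_mult_right)
  then have "integrable M (\<lambda>x. (norm (c * f x + d * g x))\<^sup>2)"
  proof (rule Bochner_Integration.integrable_bound)
    show "(\<lambda>x. (norm (c * f x + d * g x))\<^sup>2) \<in> borel_measurable M" using m by (intro borel_measurable_power measurable_compose[OF _ borel_measurable_norm])
    have "(norm (c * f x + d * g x))\<^sup>2 \<le> 2 * (norm c)\<^sup>2 * (norm (f x))\<^sup>2 + 2 * (norm d)\<^sup>2 * (norm (g x))\<^sup>2" for x
    proof -
      have "(norm (c * f x + d * g x))\<^sup>2 \<le> (norm (c * f x) + norm (d * g x))\<^sup>2" by (intro power_mono norm_triangle_ineq) auto
      also have "\<dots> \<le> 2 * (norm (c * f x))\<^sup>2 + 2 * (norm (d * g x))\<^sup>2"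
        using sum_squares_bound[of "norm (c * f x)" "norm (d * g x)"] by (simp only: power2_sum)
      finally show ?thesis by (simp add: norm_mult power_mult_distrib)
    qed
    then show "AE x in M. norm ((norm (c * f x + d * g x))\<^sup>2) \<le> norm (2 * (norm c)\<^sup>2 * (norm (f x))\<^sup>2 + 2 * (norm d)\<^sup>2 * (norm (g x))\<^sup>2)"
      by (intro AE_I2) (auto intro: order_trans[OF _ abs_ge_self])
  qed
  then show ?thesis using m by (simp add: L2_def)
qed

lemma L2_diff: "f \<in> L2 M \<Longrightarrow> g \<in> L2 M \<Longrightarrow> (\<lambda>x. f x - g x) \<in> L2 M"
  using L2_lincomb[of f M g 1 "-1"] by simp

lemma L2_cnj: "f \<in> L2 M \<Longrightarrow> (\<lambda>x. cnj (f x)) \<in> L2 M"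
  by (simp add: L2_def borel_measurable_complex_iff)

text \<open>The Riesz-Fischer argument. Weighting the squared increments by 2^n keeps the sum of
  their integrals finite, because 2^n / 4^n is summable; almost everywhere the increments are then
  at most a multiple of 2^(-n/2), so the sequence converges. Fatou's lemma preserves the
  rate.\<close>

lemma L2_sequence_limit:
  assumes h: "\<And>n. h n \<in> L2 M"
    and close: "\<And>m n. n \<le> m \<Longrightarrow> (\<integral>x. (norm (h m x - h n x))\<^sup>2 \<partial>M) \<le> K * (1 / 4) ^ n"
  obtains H where "H \<in> L2 M" "\<And>n. (\<integral>x. (norm (H x - h n x))\<^sup>2 \<partial>M) \<le> K * (1 / 4) ^ n"
proof -
  have "0 \<le> (\<integral>x. (norm (h 0 x - h 0 x))\<^sup>2 \<partial>M)" by simp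
  also have "\<dots> \<le> K * (1 / 4) ^ 0" by (rule close) simp
  finally have K: "K \<ge> 0" by simp
  have hm: "h n \<in> borel_measurable M" for n by (rule L2_D(1)[OF h])
  have dm: "(\<lambda>x. (norm (h m x - h n x))\<^sup>2) \<in> borel_measurable M" for m n
    using hm by (intro borel_measurable_power measurable_compose[OF _ borel_measurable_norm] borel_measurable_diff)
  have di: "integrable M (\<lambda>x. (norm (h m x - h n x))\<^sup>2)" for m n by (rule L2_D(2)[OF L2_diff[OF h h]])
  define F where "F x = (\<Sum>n. ennreal (2 ^ n * (norm (h (Suc n) x - h n x))\<^sup>2))" for x
  have Fm: "(\<lambda>x. ennreal (2 ^ n * (norm (h (Suc n) x - h n x))\<^sup>2)) \<in> borel_measurable M" for n
    using dm by (intro measurable_compose[OF _ measurable_ennreal] borel_measurable_times) auto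
  have "(\<integral>\<^sup>+x. F x \<partial>M) = (\<Sum>n. \<integral>\<^sup>+x. ennreal (2 ^ n * (norm (h (Suc n) x - h n x))\<^sup>2) \<partial>M)"
    unfolding F_def by (rule nn_integral_suminf[OF Fm])
  also have "\<dots> = (\<Sum>n. ennreal (2 ^ n * (\<integral>x. (norm (h (Suc n) x - h n x))\<^sup>2 \<partial>M)))"
    using di by (subst nn_integral_eq_integral) (auto intro: integrable_mult_right)
  also have "\<dots> \<le> (\<Sum>n. ennreal (K * (1 / 2) ^ n))"
  proof (intro suminf_le ennreal_leI)
    fix n
    have "(2::real) ^ n * (\<integral>x. (norm (h (Suc n) x - h n x))\<^sup>2 \<partial>M) \<le> 2 ^ n * (K * (1 / 4) ^ n)"
      by (intro mult_left_mono close) auto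
    also have "\<dots> = K * ((2 * (1 / 4)) ^ n)" unfolding power_mult_distrib by simp
    finally show "2 ^ n * (\<integral>x. (norm (h (Suc n) x - h n x))\<^sup>2 \<partial>M) \<le> K * (1 / 2) ^ n" by simp
  qed auto
  also have "\<dots> < \<infinity>"
  proof -
    have "summable (\<lambda>n. K * (1 / 2 :: real) ^ n)" by (intro summable_mult summable_geometric) simp
    then have "(\<Sum>n. ennreal (K * (1 / 2) ^ n)) \<noteq> top" using K by (intro ennreal_suminf_neq_top) auto
    then show ?thesis by (simp add: less_top)
  qed
  finally have "(\<integral>\<^sup>+x. F x \<partial>M) \<noteq> \<infinity>" by simp
  moreover have "F \<in> borel_measurable M" unfolding F_def by (rule borel_measurable_suminf_order[OF Fm])
  ultimately have AEF: "AE x in M. F x \<noteq> \<infinity>" by (intro nn_integral_noteq_infinite)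
  define H where "H x = lim (\<lambda>n. h n x)" for x
  have Hm: "H \<in> borel_measurable M" unfolding H_def by (rule borel_measurable_lim_metric[OF hm])
  have conv: "(\<lambda>n. h n x) \<longlonglongrightarrow> H x" if fin: "F x \<noteq> \<infinity>" for x
  proof -
    define \<Delta> where "\<Delta> n = h (Suc n) x - h n x" for n
    obtain c where c: "F x = ennreal c" "c \<ge> 0" using fin by (cases "F x") auto
    have "norm (\<Delta> n) \<le> sqrt c * sqrt (1 / 2) ^ n" for n
    proof -
      have "ennreal (2 ^ n * (norm (\<Delta> n))\<^sup>2) \<le> ennreal c"
      proof -
        define T where "T n = ennreal (2 ^ n * (norm (h (Suc n) x - h n x))\<^sup>2)" for n
        have "sum T {n} \<le> suminf T" by (rule sum_le_suminf) auto
        moreover have "suminf T = ennreal c" unfolding c(1)[symmetric] F_def T_def ..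
        ultimately show ?thesis by (simp add: T_def \<Delta>_def)
      qed
      then have "2 ^ n * (norm (\<Delta> n))\<^sup>2 \<le> c" by (simp only: ennreal_le_iff[OF c(2)])
      then have "(norm (\<Delta> n))\<^sup>2 \<le> c * (1 / 2) ^ n" by (simp add: field_simps power_divide)
      then have "norm (\<Delta> n) \<le> sqrt (c * (1 / 2) ^ n)" by (rule real_le_rsqrt)
      then show ?thesis by (simp add: real_sqrt_mult real_sqrt_power)
    qed
    moreover have "summable (\<lambda>n. sqrt c * sqrt (1 / 2) ^ n)" by (intro summable_mult summable_geometric) simp
    ultimately have "summable \<Delta>" by (rule summable_comparison_test'[rotated])
    then have "convergent (\<lambda>n. \<Sum>i<n. \<Delta> i)" by (simp add: summable_iff_convergent)
    moreover have "(\<Sum>i<n. \<Delta> i) = h n x - h 0 x" for n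
      unfolding \<Delta>_def by (rule sum_lessThan_telescope)
    ultimately have "convergent (\<lambda>n. h n x)" by (simp only: convergent_diff_const_right_iff)
    then show ?thesis by (simp add: H_def convergent_LIMSEQ_iff)
  qed
  have nn: "(\<integral>\<^sup>+x. ennreal ((norm (H x - h n x))\<^sup>2) \<partial>M) \<le> ennreal (K * (1 / 4) ^ n)" for n
  proof -
    have "(\<integral>\<^sup>+x. ennreal ((norm (H x - h n x))\<^sup>2) \<partial>M) = (\<integral>\<^sup>+x. liminf (\<lambda>m. ennreal ((norm (h m x - h n x))\<^sup>2)) \<partial>M)"
    proof (rule nn_integral_cong_AE)
      show "AE x in M. ennreal ((norm (H x - h n x))\<^sup>2) = liminf (\<lambda>m. ennreal ((norm (h m x - h n x))\<^sup>2))"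
        using AEF
      proof eventually_elim
        case (elim x)
        have "(\<lambda>m. ennreal ((norm (h m x - h n x))\<^sup>2)) \<longlonglongrightarrow> ennreal ((norm (H x - h n x))\<^sup>2)"
          by (intro tendsto_ennrealI tendsto_intros conv[OF elim])
        from lim_imp_Liminf[OF sequentially_bot this] show ?case by (rule sym)
      qed
    qed
    also have "\<dots> \<le> liminf (\<lambda>m. \<integral>\<^sup>+x. ennreal ((norm (h m x - h n x))\<^sup>2) \<partial>M)"
      using dm by (intro nn_integral_liminf) auto
    also have "\<dots> \<le> ennreal (K * (1 / 4) ^ n)"
    proof (rule Liminf_le[OF sequentially_bot eventually_sequentiallyI])
      fix m assume "n \<le> m"
      then show "(\<integral>\<^sup>+x. ennreal ((norm (h m x - h n x))\<^sup>2) \<partial>M) \<le> ennreal (K * (1 / 4) ^ n)"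
        using di close by (subst nn_integral_eq_integral) (auto intro: ennreal_leI)
    qed
    finally show ?thesis .
  qed
  have m2: "(\<lambda>x. (norm (H x - h n x))\<^sup>2) \<in> borel_measurable M" for n
    using hm Hm by (intro borel_measurable_power measurable_compose[OF _ borel_measurable_norm] borel_measurable_diff)
  have i2: "integrable M (\<lambda>x. (norm (H x - h n x))\<^sup>2)" for n
    using m2 le_less_trans[OF nn ennreal_less_top] by (intro integrableI_nonneg) auto
  show thesis
  proof (rule that)
    have "(\<lambda>x. H x - h 0 x) \<in> L2 M" using i2[of 0] Hm hm[of 0] by (simp add: L2_def)
    from L2_lincomb[OF this h[of 0], of 1 1] show "H \<in> L2 M" by simp
    fix n
    have "0 \<le> K * (1 / 4) ^ n" using K by simp
    then show "(\<integral>x. (norm (H x - h n x))\<^sup>2 \<partial>M) \<le> K * (1 / 4) ^ n"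
      using nn[of n] by (simp add: nn_integral_eq_integral[OF i2])
  qed
qed

section \<open>Linear spans and density in L2\<close>

lemma complex_span_lincomb:
  assumes "g \<in> complex_span E" "g' \<in> complex_span E"
  shows "(\<lambda>x. c * g x + d * g' x) \<in> complex_span E"
proof -
  obtain F a where F: "finite F" "F \<subseteq> E" "g = (\<lambda>x. \<Sum>u\<in>F. a u * u x)" using assms(1) by (auto simp: complex_span_def)
  obtain F' a' where F': "finite F'" "F' \<subseteq> E" "g' = (\<lambda>x. \<Sum>u\<in>F'. a' u * u x)" using assms(2) by (auto simp: complex_span_def)
  define A where "A u = (if u \<in> F then c * a u else 0) + (if u \<in> F' then d * a' u else 0)" for u
  have "c * g x + d * g' x = (\<Sum>u\<in>F \<union> F'. A u * u x)" for x
  proof -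
    have "(\<Sum>u\<in>F \<union> F'. A u * u x) = (\<Sum>u\<in>F \<union> F'. if u \<in> F then c * a u * u x else 0) + (\<Sum>u\<in>F \<union> F'. if u \<in> F' then d * a' u * u x else 0)"
      unfolding sum.distrib[symmetric] by (rule sum.cong) (auto simp: A_def algebra_simps)
    also have "(\<Sum>u\<in>F \<union> F'. if u \<in> F then c * a u * u x else 0) = (\<Sum>u\<in>F. c * a u * u x)"
      using F(1) F'(1) by (intro sum.mono_neutral_cong_right) auto
    also have "(\<Sum>u\<in>F \<union> F'. if u \<in> F' then d * a' u * u x else 0) = (\<Sum>u\<in>F'. d * a' u * u x)"
      using F(1) F'(1) by (intro sum.mono_neutral_cong_right) auto
    finally show ?thesis by (simp add: F(3) F'(3) sum_distrib_left mult.assoc)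
  qed
  then show ?thesis using F F' by (auto simp: complex_span_def intro!: exI[of _ "F \<union> F'"] exI[of _ A])
qed

lemma complex_span_superset: "E \<subseteq> complex_span E"
proof
  fix g assume "g \<in> E"
  then show "g \<in> complex_span E"
    unfolding complex_span_def by (intro CollectI exI[of _ "{g}"] exI[of _ "\<lambda>_. 1"]) auto
qed

lemma complex_span_zero: "(\<lambda>x. 0) \<in> complex_span E"
  by (auto simp: complex_span_def intro!: exI[of _ "{}"])

lemma complex_span_L2:
  assumes "E \<subseteq> L2 M"
  shows "complex_span E \<subseteq> L2 M"
proof
  fix g assume "g \<in> complex_span E"
  then obtain F a where F: "finite F" "F \<subseteq> E" "g = (\<lambda>x. \<Sum>u\<in>F. a u * u x)" by (auto simp: complex_span_def)
  have "(\<lambda>x. \<Sum>u\<in>F. a u * u x) \<in> L2 M" using F(1,2)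
  proof (induction F)
    case empty
    then show ?case by (simp add: L2_def)
  next
    case (insert u F)
    then show ?case using L2_lincomb[of u M "\<lambda>x. \<Sum>u\<in>F. a u * u x" "a u" 1] assms by auto
  qed
  then show "g \<in> L2 M" using F(3) by simp
qed

text \<open>A minimizing sequence for the distance to the span converges to the component orthogonal to it.\<close>

theorem complete_system_in_L2I:
  assumes E: "E \<subseteq> L2 M"
    and ann: "\<And>h. h \<in> L2 M \<Longrightarrow> (\<And>g. g \<in> E \<Longrightarrow> (\<integral>x. h x * g x \<partial>M) = 0) \<Longrightarrow> AE x in M. h x = 0"
  shows "complete_system_in_L2 M E"
proof (rule ccontr)
  define N where "N u = (\<integral>x. (norm (u x :: complex))\<^sup>2 \<partial>M)" for u
  have N0: "N u \<ge> 0" for u by (simp add: N_def)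
  define V where "V = complex_span E"
  have V2: "g \<in> L2 M" if "g \<in> V" for g using complex_span_L2[OF E] that by (auto simp: V_def)
  have Vl: "(\<lambda>x. c * g x + d * g' x) \<in> V" if "g \<in> V" "g' \<in> V" for c d g g'
    using complex_span_lincomb that by (simp add: V_def)
  assume "\<not> complete_system_in_L2 M E"
  then obtain f \<epsilon> where f: "f \<in> L2 M" and e: "\<epsilon> > 0" and far: "\<And>g. g \<in> V \<Longrightarrow> \<not> L2_norm M (\<lambda>x. f x - g x) < \<epsilon>"
    using E by (auto simp: complete_system_in_L2_def V_def)
  have far': "\<epsilon>\<^sup>2 \<le> N (\<lambda>x. f x - g x)" if "g \<in> V" for g
  proof -
    have "\<epsilon> \<le> sqrt (N (\<lambda>x. f x - g x))" using far[OF that] by (simp add: L2_norm_def N_def)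
    then have "\<epsilon>\<^sup>2 \<le> (sqrt (N (\<lambda>x. f x - g x)))\<^sup>2" using e by (intro power_mono) auto
    then show ?thesis using N0 by simp
  qed
  define D2 where "D2 = (INF g\<in>V. N (\<lambda>x. f x - g x))"
  have V0: "V \<noteq> {}" using complex_span_zero by (auto simp: V_def)
  have low: "D2 \<le> N (\<lambda>x. f x - g x)" if "g \<in> V" for g
    unfolding D2_def by (rule cINF_lower[OF bdd_belowI2[of _ 0] that]) (rule N0)
  have De: "\<epsilon>\<^sup>2 \<le> D2" unfolding D2_def by (rule cINF_greatest[OF V0 far'])
  have "\<exists>g\<in>V. N (\<lambda>x. f x - g x) < D2 + (1 / 4) ^ n" for n :: nat
  proof -
    have "bdd_below ((\<lambda>g. N (\<lambda>x. f x - g x)) ` V)" by (rule bdd_belowI2[of _ 0]) (rule N0)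
    from cINF_less_iff[OF V0 this, of "D2 + (1 / 4) ^ n"] show ?thesis by (simp flip: D2_def)
  qed
  then obtain g where g: "\<And>n. g n \<in> V" "\<And>n. N (\<lambda>x. f x - g n x) < D2 + (1 / 4) ^ n" by metis
  define h where "h n x = f x - g n x" for n x
  have h_eq: "h n = (\<lambda>x. f x - g n x)" for n by (rule ext) (rule h_def)
  have hL: "h n \<in> L2 M" for n unfolding h_eq by (intro L2_diff f V2 g)
  have Nh: "N (h n) < D2 + (1 / 4) ^ n" for n unfolding h_eq by (rule g(2))
  have close: "N (\<lambda>x. h m x - h n x) \<le> 4 * (1 / 4) ^ n" if nm: "n \<le> m" for m n
  proof -
    \<comment> \<open>The midpoint of \<open>g m\<close> and \<open>g n\<close> lies in the span, so
      its squared distance to f is at least \<open>D2\<close>, and the parallelogram law bounds the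
      distance between \<open>h m\<close> and \<open>h n\<close>.\<close>
    define p where "p x = 1 / 2 * g m x + 1 / 2 * g n x" for x
    have pV: "p \<in> V" unfolding p_def by (intro Vl g)
    have par: "(norm (u - v))\<^sup>2 = 2 * (norm u)\<^sup>2 + 2 * (norm v)\<^sup>2 - 4 * (norm (1 / 2 * (u + v)))\<^sup>2" for u v :: complex
      by (simp only: cmod_power2) (simp add: field_simps power2_eq_square)
    have pt: "(norm (h m x - h n x))\<^sup>2 = 2 * (norm (h m x))\<^sup>2 + 2 * (norm (h n x))\<^sup>2 - 4 * (norm (f x - p x))\<^sup>2" for x
    proof -
      have "f x - p x = 1 / 2 * (h m x + h n x)" by (simp add: h_def p_def field_simps)
      then show ?thesis by (simp only: par)
    qed
    have "N (\<lambda>x. h m x - h n x) = 2 * N (h m) + 2 * N (h n) - 4 * N (\<lambda>x. f x - p x)"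
      unfolding N_def pt using L2_D(2)[OF hL] L2_D(2)[OF L2_diff[OF f V2[OF pV]]] by simp
    also have "\<dots> \<le> 2 * (1 / 4) ^ m + 2 * (1 / 4) ^ n" using Nh[of m] Nh[of n] low[OF pV] by linarith
    also have "\<dots> \<le> 4 * (1 / 4) ^ n"
      using power_decreasing[OF nm, of "1 / 4 :: real"] by simp
    finally show ?thesis .
  qed
  obtain H where H: "H \<in> L2 M" "\<And>n. N (\<lambda>x. H x - h n x) \<le> 4 * (1 / 4) ^ n"
    using L2_sequence_limit[OF hL close[unfolded N_def]] unfolding N_def by blast
  have orth: "(\<integral>x. H x * cnj (u x) \<partial>M) = 0" if uE: "u \<in> E" for u
  proof -
    have uV: "u \<in> V" using uE complex_span_superset by (auto simp: V_def)
    note uL = V2[OF uV]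
    note cL = L2_cnj[OF uL]
    have Nc: "(\<integral>x. (norm (cnj (u x)))\<^sup>2 \<partial>M) = N u" by (simp add: N_def)
    have b1: "(norm (\<integral>x. h n x * cnj (u x) \<partial>M))\<^sup>2 \<le> (N u + 1) * (1 / 4) ^ n" for n
    proof -
      define z where "z = (\<integral>x. h n x * cnj (u x) \<partial>M)"
      \<comment> \<open>Taking 1/(N u + 1) in place of the optimal 1/N u keeps the step meaningful
        for a null u, and s N u \<le> 1 still holds.\<close>
      define s where "s = 1 / (N u + 1)"
      have s: "s > 0" "s * (N u + 1) = 1" using N0[of u] by (auto simp: s_def)
      have iz: "integrable M (\<lambda>x. h n x * cnj (u x))" by (rule L2_pairing(1)[OF hL cL])
      define t where "t = of_real s * z"
      have tV: "(\<lambda>x. 1 * g n x + t * u x) \<in> V" by (intro Vl g uV)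
      have ex: "(norm (a - t * b))\<^sup>2 = (norm a)\<^sup>2 - 2 * Re (cnj t * (a * cnj b)) + (norm t)\<^sup>2 * (norm b)\<^sup>2" for a b
        by (simp only: cmod_power2) (simp add: algebra_simps power2_eq_square)
      have "D2 \<le> N (\<lambda>x. f x - (1 * g n x + t * u x))" by (rule low[OF tV])
      also have "\<dots> = N (\<lambda>x. h n x - t * u x)" by (simp add: h_def diff_diff_eq)
      also have "\<dots> = N (h n) - 2 * (\<integral>x. Re (cnj t * (h n x * cnj (u x))) \<partial>M) + (norm t)\<^sup>2 * N u"
        unfolding N_def ex using L2_D(2)[OF hL] L2_D(2)[OF uL] integrable_Re[OF integrable_mult_right[OF iz, of "cnj t"]]
        by (simp del: times_complex.simps)
      also have "(\<integral>x. Re (cnj t * (h n x * cnj (u x))) \<partial>M) = Re (cnj t * z)"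
        using integral_Re[OF integrable_mult_right[OF iz, of "cnj t"]] by (simp add: z_def del: times_complex.simps)
      also have "Re (cnj t * z) = s * (norm z)\<^sup>2"
        unfolding t_def by (simp only: cmod_power2) (simp add: power2_eq_square algebra_simps)
      also have "(norm t)\<^sup>2 * N u = s * (norm z)\<^sup>2 * (s * N u)"
        unfolding t_def by (simp add: norm_mult power_mult_distrib power2_eq_square)
      also have "\<dots> \<le> s * (norm z)\<^sup>2 * 1"
        using s by (intro mult_left_mono) (auto simp: distrib_left)
      finally have "s * (norm z)\<^sup>2 \<le> (1 / 4) ^ n" using Nh[of n] by simp
      then have "(N u + 1) * (s * (norm z)\<^sup>2) \<le> (N u + 1) * (1 / 4) ^ n" using N0[of u] by (intro mult_left_mono) auto
      moreover have "(N u + 1) * (s * (norm z)\<^sup>2) = (norm z)\<^sup>2" using s(2) by (simp add: mult.assoc[symmetric] mult.commute)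
      ultimately show ?thesis by (simp only: z_def)
    qed
    define B where "B = sqrt (N u + 1) + (4 + N u) / 2"
    have b2: "norm (\<integral>x. H x * cnj (u x) \<partial>M) \<le> B * (1 / 2) ^ n" for n
    proof -
      have four: "(1 / 4 :: real) ^ n = (1 / 2) ^ n * (1 / 2) ^ n" by (simp flip: power_mult_distrib)
      have "(norm (\<integral>x. h n x * cnj (u x) \<partial>M)) \<le> sqrt ((N u + 1) * (1 / 4) ^ n)" by (rule real_le_rsqrt[OF b1])
      also have "\<dots> = sqrt (N u + 1) * (1 / 2) ^ n" by (simp add: four real_sqrt_mult)
      finally have 1: "norm (\<integral>x. h n x * cnj (u x) \<partial>M) \<le> sqrt (N u + 1) * (1 / 2) ^ n" .
      have "norm (\<integral>x. (H x - h n x) * cnj (u x) \<partial>M) \<le> (2 ^ n * N (\<lambda>x. H x - h n x) + N u / 2 ^ n) / 2"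
        using L2_pairing(2)[OF L2_diff[OF H(1) hL] cL, of "2 ^ n" n] by (simp add: Nc N_def)
      also have "\<dots> \<le> (2 ^ n * (4 * (1 / 4) ^ n) + N u / 2 ^ n) / 2"
        using H(2)[of n] by (intro divide_right_mono add_right_mono mult_left_mono) auto
      also have "\<dots> = (4 + N u) / 2 * (1 / 2) ^ n"
      proof -
        have gen: "a * (4 * (b * b)) = 4 * b" if "a * b = 1" for a b :: real using that by algebra
        have "(2::real) ^ n * (1 / 2) ^ n = 1" by (simp flip: power_mult_distrib)
        then have "(2::real) ^ n * (4 * (1 / 4) ^ n) = 4 * (1 / 2) ^ n" unfolding four by (rule gen)
        moreover have "N u / 2 ^ n = N u * (1 / 2) ^ n" by (simp add: power_one_over)
        ultimately show ?thesis by (simp add: distrib_right add_divide_distrib)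
      qed
      finally have 2: "norm (\<integral>x. (H x - h n x) * cnj (u x) \<partial>M) \<le> (4 + N u) / 2 * (1 / 2) ^ n" .
      have "(\<integral>x. H x * cnj (u x) \<partial>M) = (\<integral>x. h n x * cnj (u x) + (H x - h n x) * cnj (u x) \<partial>M)"
        by (rule Bochner_Integration.integral_cong) (auto simp: algebra_simps)
      also have "\<dots> = (\<integral>x. h n x * cnj (u x) \<partial>M) + (\<integral>x. (H x - h n x) * cnj (u x) \<partial>M)"
        by (rule Bochner_Integration.integral_add[OF L2_pairing(1)[OF hL cL] L2_pairing(1)[OF L2_diff[OF H(1) hL] cL]])
      finally have "norm (\<integral>x. H x * cnj (u x) \<partial>M) \<le> norm (\<integral>x. h n x * cnj (u x) \<partial>M) + norm (\<integral>x. (H x - h n x) * cnj (u x) \<partial>M)"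
        by (simp only: norm_triangle_ineq)
      then show ?thesis using 1 2 unfolding B_def distrib_right by linarith
    qed
    have "(\<lambda>n. B * (1 / 2) ^ n) \<longlonglongrightarrow> B * 0" by (intro tendsto_intros LIMSEQ_power_zero) simp
    then have "norm (\<integral>x. H x * cnj (u x) \<partial>M) \<le> B * 0" by (rule LIMSEQ_le_const) (use b2 in auto)
    then show ?thesis by simp
  qed
  \<comment> \<open>H is orthogonal to the system in the Hermitian sense, while the annihilator
    condition is bilinear; hence the conjugate of H.\<close>
  have "AE x in M. cnj (H x) = 0"
  proof (rule ann[OF L2_cnj[OF H(1)]])
    fix u assume "u \<in> E"
    have "(\<integral>x. cnj (H x) * u x \<partial>M) = (\<integral>x. cnj (H x * cnj (u x)) \<partial>M)" by simp
    also have "\<dots> = cnj (\<integral>x. H x * cnj (u x) \<partial>M)" by (rule Bochner_Integration.integral_cnj)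
    finally show "(\<integral>x. cnj (H x) * u x \<partial>M) = 0" using orth[OF \<open>u \<in> E\<close>] by simp
  qed
  then have H0: "AE x in M. H x = 0" by simp
  have small: "\<epsilon>\<^sup>2 \<le> 4 * (1 / 4) ^ n" for n
  proof -
    have "N (h n) = N (\<lambda>x. H x - h n x)" unfolding N_def
    proof (rule integral_cong_AE)
      show "AE x in M. (norm (h n x))\<^sup>2 = (norm (H x - h n x))\<^sup>2" using H0 by eventually_elim simp
    qed (use L2_D(2)[OF hL] L2_D(2)[OF L2_diff[OF H(1) hL]] in auto)
    then show ?thesis using De low[OF g(1)[of n]] H(2)[of n] by (simp flip: h_eq)
  qed
  have "(\<lambda>n. 4 * (1 / 4 :: real) ^ n) \<longlonglongrightarrow> 4 * 0" by (intro tendsto_intros LIMSEQ_power_zero) simp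
  then have "\<epsilon>\<^sup>2 \<le> 4 * 0" by (rule LIMSEQ_le_const) (use small in blast)
  then show False using e by simp
qed

section \<open>The theorem\<close>

text \<open>Orthogonality to all normalized solutions is needed to reach the Cauchy kernel; after
  that the single spectral parameter 0 is enough.\<close>

lemma eigenfunctions_complete:
  assumes \<alpha>: "\<alpha> > 0"
    and \<delta>: "0 < \<delta>" "\<delta> < pi / 8" and \<phi>: "3 * pi / 8 < \<phi>" "\<phi> < 5 * pi / 8"
    and p: "(1 / 2 + 1 / \<alpha>) * (\<phi> + \<delta>) < pi" "1 / 2 + 1 / \<alpha> < 8 / 3"
    and ray: "\<And>r. r \<ge> r0 \<Longrightarrow> regular \<alpha> (of_real r * cis \<phi>)" "\<And>r. r \<ge> r0 \<Longrightarrow> weyl_norm2 \<alpha> (of_real r * cis \<phi>) \<le> C0 * r ^ 6"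
  shows "complete_system_in_L2 half_line (eigenfunctions \<i> \<alpha>)"
proof (rule complete_system_in_L2I)
  show "eigenfunctions \<i> \<alpha> \<subseteq> L2 half_line" by (auto simp: eigenfunctions_def op_domain_def)
  fix f assume f: "f \<in> L2 half_line" and orth: "\<And>g. g \<in> eigenfunctions \<i> \<alpha> \<Longrightarrow> (\<integral>t. f t * g t \<partial>half_line) = 0"
  have "(\<integral>t. f t * weyl_u \<alpha> \<mu> t \<partial>half_line) = 0" if "regular \<alpha> \<mu>" for \<mu>
    by (rule annihilator_vanishes[OF \<alpha> f orth \<delta> \<phi> p ray that])
  then have "(\<integral>t. f t * cauchy_kernel \<alpha> 0 x t \<partial>half_line) = 0" if "x \<ge> 0" for x
    by (rule cauchy_kernel_orthogonal(2)[OF \<alpha> f _ that])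
  then show "AE t in half_line. f t = 0" by (rule cauchy_kernel_complete[OF \<alpha> f])
qed

lemma eigenfunctions_complete_large:
  assumes \<alpha>: "\<alpha> > 2 / 3"
  shows "complete_system_in_L2 half_line (eigenfunctions \<i> \<alpha>)"
proof -
  define p where "p = 1 / 2 + 1 / \<alpha>"
  have \<alpha>0: "\<alpha> > 0" using \<alpha> by simp
  have "1 / \<alpha> < 3 / 2" using \<alpha> by (simp add: field_simps)
  moreover have "1 / \<alpha> > 0" using \<alpha>0 by simp
  ultimately have p: "1 / 2 < p" "p < 2" unfolding p_def by linarith+
  \<comment> \<open>Both boundary rays lie \<delta> outside the quadrant, which widens the sector to
    pi/2 + 2 \<delta>. Taking \<delta> proportional to the gap 2 - p keeps p (pi/2 + 2 \<delta>)
    below pi.\<close>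
  define \<delta> where "\<delta> = pi * (2 - p) / 16"
  have \<delta>: "0 < \<delta>" using p by (simp add: \<delta>_def)
  have "pi * (2 - p) < pi * 2" using p by (intro mult_strict_left_mono) auto
  then have \<delta>8: "\<delta> < pi / 8" by (simp add: \<delta>_def)
  define \<phi> where "\<phi> = pi / 2 + \<delta>"
  have \<phi>: "3 * pi / 8 < \<phi>" "\<phi> < 5 * pi / 8" using \<delta> \<delta>8 pi_gt_zero unfolding \<phi>_def by linarith+
  have "cos \<phi> < cos (pi / 2)" using \<delta> \<delta>8 unfolding \<phi>_def by (intro cos_monotone_0_pi) auto
  then have "cos \<phi> < 0 \<or> sin \<phi> < 0" by simp
  then obtain K where K: "\<And>r. r \<ge> 1 \<Longrightarrow> regular \<alpha> (of_real r * cis \<phi>)" "\<And>r. r \<ge> 1 \<Longrightarrow> weyl_norm2 \<alpha> (of_real r * cis \<phi>) \<le> K / sqrt r"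
    using outer_ray[OF \<alpha>0] by metis
  show ?thesis
  proof (rule eigenfunctions_complete[OF \<alpha>0 \<delta> \<delta>8 \<phi> _ _ K(1)])
    have "p * (2 * \<delta>) < 2 * (2 * \<delta>)" using p \<delta> by (intro mult_strict_right_mono) auto
    then have "p * (\<phi> + \<delta>) < p * pi / 2 + 4 * \<delta>" by (simp add: \<phi>_def algebra_simps)
    also have "4 * \<delta> = pi / 2 - p * pi / 4" by (simp add: \<delta>_def field_simps)
    also have "p * pi / 2 + (pi / 2 - p * pi / 4) = pi / 2 + p * pi / 4" by simp
    also have "\<dots> < pi / 2 + 2 * pi / 4" using p by (intro add_strict_left_mono divide_strict_right_mono mult_strict_right_mono) auto
    finally show "(1 / 2 + 1 / \<alpha>) * (\<phi> + \<delta>) < pi" by (simp add: p_def)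
    show "1 / 2 + 1 / \<alpha> < 8 / 3" using p by (simp add: p_def)
    show "weyl_norm2 \<alpha> (of_real r * cis \<phi>) \<le> \<bar>K\<bar> * r ^ 6" if r: "r \<ge> 1" for r
    proof -
      have "K / sqrt r \<le> \<bar>K\<bar> / 1" using r by (intro frac_le) auto
      also have "\<dots> \<le> \<bar>K\<bar> * r ^ 6" using mult_left_mono[OF one_le_power[OF r, of 6], of "\<bar>K\<bar>"] by simp
      finally show ?thesis using K(2)[OF r] by linarith
    qed
  qed
qed

text \<open>The upper boundary ray passes through 1/256 + \<i>, at the angle \<theta> =
  arctan(1/256) inside the quadrant. The lower one lies \<theta>/2 below the real axis, so the
  opening is pi/2 - \<theta>/2.\<close>

lemma eigenfunctions_complete_small:
  assumes \<alpha>: "1 / 2 < \<alpha>" "\<alpha> \<le> 1" and p: "(1 / 2 + 1 / \<alpha>) * (pi / 2 - arctan (1 / 256) / 2) < pi"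
  shows "complete_system_in_L2 half_line (eigenfunctions \<i> \<alpha>)"
proof -
  have \<alpha>0: "\<alpha> > 0" and \<alpha>1: "1 / 2 \<le> \<alpha>" using \<alpha> by simp_all
  define \<theta> where "\<theta> = arctan (1 / 256)"
  \<comment> \<open>The modulus of 1/256 + \<i>, converting the radius r into the height b = r/n.
    The bound n \<le> 2 turns the condition b \<ge> 1024 into r \<ge> 2048.\<close>
  define n where "n = sqrt (1 + (1 / 256)\<^sup>2)"
  have "sqrt 1 \<le> n" "n \<le> sqrt (2\<^sup>2)" unfolding n_def by (intro real_sqrt_le_mono, simp add: power2_eq_square)+
  then have n: "1 \<le> n" "n \<le> 2" by simp_all
  have \<theta>: "0 < \<theta>" "\<theta> < pi / 8"
  proof -
    show "0 < \<theta>" by (simp add: \<theta>_def)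
    show "\<theta> < pi / 8"
    proof (rule ccontr)
      assume "\<not> \<theta> < pi / 8"
      then have "sin (pi / 8) \<le> sin \<theta>"
        using arctan_ubound[of "1 / 256"] pi_gt_zero by (intro sin_monotone_2pi_le) (auto simp: \<theta>_def)
      also have "\<dots> \<le> 1 / 256"
        using n by (simp add: \<theta>_def sin_arctan n_def[symmetric] field_simps)
      finally have "2 * (sin (pi / 8) * cos (pi / 8)) \<le> 2 * (1 / 256 * 1)"
        by (intro mult_left_mono mult_mono) (auto intro!: cos_ge_zero)
      also have "2 * (sin (pi / 8) * cos (pi / 8)) = sqrt 2 / 2"
        using sin_double[of "pi / 8"] by (simp add: sin_45)
      finally show False using real_sqrt_ge_one[of 2] by linarith
    qed
  qed
  define \<phi> where "\<phi> = pi / 2 - \<theta>"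
  have cis: "of_real r * cis \<phi> = of_real (r / n) * Complex (1 / 256) 1" for r
    by (rule complex_eqI) (simp_all add: \<phi>_def \<theta>_def n_def cos_diff sin_diff cos_arctan sin_arctan)
  obtain C where C: "\<And>b. b \<ge> 1024 \<Longrightarrow> weyl_norm2 \<alpha> (of_real b * Complex (1 / 256) 1) \<le> C * b ^ 6"
    using weyl_norm2_inner_ray_polynomial[OF \<alpha>1 \<alpha>(2)] by blast
  have b: "r / n \<ge> 1024" "r / n \<le> r" if "r \<ge> 2048" for r
  proof -
    have "1024 * n \<le> r" using n that by linarith
    then show "r / n \<ge> 1024" using n by (simp add: pos_le_divide_eq)
    have "r / n \<le> r / 1" using n that by (intro divide_left_mono) auto
    then show "r / n \<le> r" by simp
  qed
  show ?thesis
  proof (rule eigenfunctions_complete[OF \<alpha>0, of "\<theta> / 2" \<phi> 2048])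
    show "0 < \<theta> / 2" "\<theta> / 2 < pi / 8" "3 * pi / 8 < \<phi>" "\<phi> < 5 * pi / 8"
      using \<theta> pi_gt_zero unfolding \<phi>_def by linarith+
    have "\<phi> + \<theta> / 2 = pi / 2 - \<theta> / 2" by (simp add: \<phi>_def)
    then show "(1 / 2 + 1 / \<alpha>) * (\<phi> + \<theta> / 2) < pi" using p by (simp only: \<theta>_def)
    have "1 / \<alpha> < 2" using \<alpha> by (simp add: field_simps)
    then show "1 / 2 + 1 / \<alpha> < 8 / 3" by linarith
    fix r :: real assume r: "r \<ge> 2048"
    have "Im (unrotate \<alpha> (of_real (r / n) * Complex (1 / 256) 1)) > 0"
      unfolding unrotate_inner_ray[OF \<alpha>1 \<alpha>(2)] using unrotate_inner_ray_pos[OF \<alpha>1 \<alpha>(2)] b(1)[OF r] by (intro mult_pos_pos) auto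
    then show "regular \<alpha> (of_real r * cis \<phi>)" unfolding cis by (intro regular_off_ray[OF \<alpha>0]) simp
    have "weyl_norm2 \<alpha> (of_real r * cis \<phi>) \<le> C * (r / n) ^ 6" unfolding cis by (rule C[OF b(1)[OF r]])
    also have "\<dots> \<le> \<bar>C\<bar> * r ^ 6"
    proof (rule mult_mono)
      show "(r / n) ^ 6 \<le> r ^ 6" by (rule power_mono[OF b(2)[OF r]]) (use r n in auto)
    qed (use r n in auto)
    finally show "weyl_norm2 \<alpha> (of_real r * cis \<phi>) \<le> \<bar>C\<bar> * r ^ 6" .
  qed
qed

theorem mainTheorem2:
  shows "\<exists>\<alpha>\<^sub>0::real. \<alpha>\<^sub>0 < 2 / 3 \<and>
           (\<forall>\<alpha>::real. \<alpha> > 0 \<longrightarrow> \<alpha> > \<alpha>\<^sub>0 \<longrightarrow>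
              complete_system_in_L2 half_line (eigenfunctions \<i> \<alpha>))"
proof -
  define \<beta> where "\<beta> = pi / 2 - arctan (1 / 256) / 2"
  have "arctan (1 / 256) < pi / 2" by (rule arctan_ubound)
  moreover have "arctan (1 / 256) > (0::real)" by simp
  ultimately have \<beta>: "0 < \<beta>" "\<beta> < pi / 2" unfolding \<beta>_def by linarith+
  \<comment> \<open>With order 1/2 + 1/\<alpha> and opening \<beta>, the requirement that their
    product be less than pi reads 1/\<alpha> < c. As \<beta> < pi/2, c exceeds 3/2 and 1/c drops
    below 2/3. The other bound, 1/2, comes from the estimate on the inner ray.\<close>
  define c where "c = pi / \<beta> - 1 / 2"
  have c: "c > 3 / 2" using \<beta> by (simp add: c_def field_simps)
  show ?thesis
  proof (intro exI[of _ "max (1 / 2) (1 / c)"] conjI allI impI)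
    have "1 / c < 2 / 3" using c by (simp add: field_simps)
    then show "max (1 / 2) (1 / c) < 2 / 3" by simp
    fix \<alpha> :: real assume \<alpha>: "\<alpha> > 0" "\<alpha> > max (1 / 2) (1 / c)"
    show "complete_system_in_L2 half_line (eigenfunctions \<i> \<alpha>)"
    proof (cases "\<alpha> > 2 / 3")
      case True
      then show ?thesis by (rule eigenfunctions_complete_large)
    next
      case False
      have "1 / \<alpha> < c" using \<alpha> c by (simp add: field_simps)
      then have "1 / 2 + 1 / \<alpha> < pi / \<beta>" by (simp add: c_def)
      then have "(1 / 2 + 1 / \<alpha>) * \<beta> < pi" using \<beta> by (simp add: pos_less_divide_eq)
      then show ?thesis
        by (intro eigenfunctions_complete_small) (use \<alpha> False in \<open>auto simp: \<beta>_def\<close>)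
    qed
  qed
qed

end
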